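(* Let $\mathbb{K}$ be an algebraically closed field of characteristic zero, let $n_1,\dots,n_s$ be positive integers, set $n:=n_1+\cdots+n_s$, and let $X\subset\mathbb{P}^r$, $r+1=\prod_{i=1}^s(n_i+1)$, be the Segre embedding of the multiprojective space $\mathbb{P}^{n_1}\times\cdots\times\mathbb{P}^{n_s}$ over $\mathbb{K}$. Fix an integer $b\ge 2$ and assume the existence of a decomposition $E\sqcup F=\{1,\dots,s\}$ such that $$\prod_{i\in E}(n_i+1)>b+3+\sum_{i\in E}n_i\quad\text{and}\quad \prod_{i\in F}(n_i+1)>b+3+\sum_{i\in F}n_i.$$ Then $\dim\sigma_b(X)=b(n+1)-1$, $\dim\tau(X,b)=b(n+1)-2$, and $r_X(q)>b$ for a general $q\in\tau(X,b)$.
   Context: For an integral and non-degenerate variety $X\subset\mathbb{P}^r$, $\langle\ \rangle$ denotes linear span and $X_{\mathrm{reg}}$ is the smooth locus of $X$. The $X$-rank $r_X(q)$ of $q\in\mathbb{P}^r$ is the minimal cardinality of a finite set $S\subset X$ with $q\in\langle S\rangle$. The $s$-secant variety $\sigma_s(X)\subseteq\mathbb{P}^r$ is the closure of the union of all linear spaces $\langle S\rangle$ with $S\subset X$ and $\sharp(S)=s$. The tangential variety $\tau(X)\subseteq\mathbb{P}^r$ is the closure of the union of all (embedded projective) tangent spaces $T_pX$, $p\in X_{\mathrm{reg}}$. For $b\ge 2$, $\tau(X,b)$ is the join of one copy of $\tau(X)$ and $b-2$ copies of $X$ (the closure of the union of the linear spans of $b-1$ points, one in $\tau(X)$ and $b-2$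 in $X$); so $\tau(X,2)=\tau(X)$. "A general $q$" means all $q$ in some non-empty Zariski open subset. *)

theory Defs
  imports
    "HOL-Analysis.Analysis"
    "HOL-Computational_Algebra.Polynomial"
    "HOL-Library.Function_Algebras"
    "HOL-Library.Poly_Mapping"
    "HOL-Library.Extended_Nat"
begin

section \<open>Multivariate polynomials\<close>

text \<open>
  A polynomial in variables of type \<open>'i\<close> with coefficients in \<open>'k\<close> is an element of
  \<open>('i \<Rightarrow>\<^sub>0 nat) \<Rightarrow>\<^sub>0 'k\<close>: a finitely supported map from monomials (exponent vectors) to
  coefficients.  The ring structure is the convolution product of \<^theory>\<open>HOL-Library.Poly_Mapping\<close>.
\<close>

type_synonym ('i, 'k) mpoly = "('i \<Rightarrow>\<^sub>0 nat) \<Rightarrow>\<^sub>0 'k"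

definition eval_monom :: "('i \<Rightarrow> 'k) \<Rightarrow> ('i \<Rightarrow>\<^sub>0 nat) \<Rightarrow> 'k::comm_semiring_1" where
  "eval_monom v m = (\<Prod>i\<in>Poly_Mapping.keys m. v i ^ Poly_Mapping.lookup m i)"

definition eval_mpoly :: "('i, 'k) mpoly \<Rightarrow> ('i \<Rightarrow> 'k) \<Rightarrow> 'k::comm_semiring_1" where
  "eval_mpoly f v =
     (\<Sum>m\<in>Poly_Mapping.keys f. Poly_Mapping.lookup f m * eval_monom v m)"

definition monom_degree :: "('i \<Rightarrow>\<^sub>0 nat) \<Rightarrow> nat" where
  "monom_degree m = (\<Sum>i\<in>Poly_Mapping.keys m. Poly_Mapping.lookup m i)"

text \<open>Homogeneous polynomials of degree \<open>d\<close> in the variables indexed by \<open>I\<close> (including \<open>0\<close>).\<close>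

definition forms :: "'i set \<Rightarrow> nat \<Rightarrow> ('i, 'k::zero) mpoly set" where
  "forms I d = {f. \<forall>m\<in>Poly_Mapping.keys f. Poly_Mapping.keys m \<subseteq> I \<and> monom_degree m = d}"

definition homogeneous_polys :: "'i set \<Rightarrow> ('i, 'k::zero) mpoly set" where
  "homogeneous_polys I = (\<Union>d. forms I d)"

text \<open>
  The formal partial derivative with respect to the variable \<open>i\<close>.  A monomial not involving \<open>i\<close>
  contributes \<open>0\<close>, so the truncated subtraction of exponents does no harm.
\<close>

definition partial_deriv :: "'i \<Rightarrow> ('i, 'k) mpoly \<Rightarrow> ('i, 'k::comm_semiring_1) mpoly" where
  "partial_deriv i f =
     (\<Sum>m\<in>Poly_Mapping.keys f.
        Poly_Mapping.single (m - Poly_Mapping.single i 1)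
          (of_nat (Poly_Mapping.lookup m i) * Poly_Mapping.lookup f m))"

lemma eval_monom_superset:
  assumes "finite A" "Poly_Mapping.keys m \<subseteq> A"
  shows "eval_monom v m = (\<Prod>i\<in>A. v i ^ Poly_Mapping.lookup m i)"
  unfolding eval_monom_def
  by (rule prod.mono_neutral_left) (use assms in \<open>auto simp: in_keys_iff\<close>)

lemma eval_monom_add: "eval_monom v (m + m') = eval_monom v m * eval_monom v m'"
proof -
  let ?A = "Poly_Mapping.keys m \<union> Poly_Mapping.keys m'"
  have "eval_monom v (m + m') = (\<Prod>i\<in>?A. v i ^ Poly_Mapping.lookup (m + m') i)"
    using Poly_Mapping.keys_add[of m m'] by (intro eval_monom_superset) auto
  also have "\<dots> = (\<Prod>i\<in>?A. v i ^ Poly_Mapping.lookup m i) * (\<Prod>i\<in>?A. v i ^ Poly_Mapping.lookup m' i)"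
    by (simp add: lookup_add power_add prod.distrib)
  also have "\<dots> = eval_monom v m * eval_monom v m'"
    by (simp add: eval_monom_superset[of ?A])
  finally show ?thesis .
qed

lemma eval_mpoly_superset:
  assumes "finite A" "Poly_Mapping.keys f \<subseteq> A"
  shows "eval_mpoly f v = (\<Sum>m\<in>A. Poly_Mapping.lookup f m * eval_monom v m)"
  unfolding eval_mpoly_def
  by (rule sum.mono_neutral_left) (use assms in \<open>auto simp: in_keys_iff\<close>)

lemma eval_mpoly_0 [simp]: "eval_mpoly 0 v = 0"
  by (simp add: eval_mpoly_def)

lemma eval_mpoly_single [simp]:
  "eval_mpoly (Poly_Mapping.single m c) v = c * eval_monom v m"
  by (subst eval_mpoly_superset[of "{m}"]) auto

lemma eval_mpoly_1 [simp]: "eval_mpoly 1 v = 1"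
  using eval_mpoly_single[of 0 1 v] by (simp add: eval_monom_def)

lemma eval_mpoly_add: "eval_mpoly (f + g) v = eval_mpoly f v + eval_mpoly g v"
proof -
  let ?A = "Poly_Mapping.keys f \<union> Poly_Mapping.keys g"
  have "eval_mpoly (f + g) v = (\<Sum>m\<in>?A. Poly_Mapping.lookup (f + g) m * eval_monom v m)"
    using Poly_Mapping.keys_add[of f g] by (intro eval_mpoly_superset) auto
  also have "\<dots> = eval_mpoly f v + eval_mpoly g v"
    by (simp add: eval_mpoly_superset[of ?A] lookup_add algebra_simps sum.distrib)
  finally show ?thesis .
qed

lemma eval_mpoly_sum: "eval_mpoly (\<Sum>x\<in>A. f x) v = (\<Sum>x\<in>A. eval_mpoly (f x) v)"
  by (induction A rule: infinite_finite_induct) (auto simp: eval_mpoly_add)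

lemma mpoly_expansion:
  "f = (\<Sum>m\<in>Poly_Mapping.keys f. Poly_Mapping.single m (Poly_Mapping.lookup f m))"
  by (rule poly_mapping_eqI)
     (simp add: lookup_sum lookup_single when_def in_keys_iff)

lemma eval_mpoly_mult: "eval_mpoly (f * g) v = eval_mpoly f v * eval_mpoly g v"
proof -
  let ?s = "\<lambda>f m. Poly_Mapping.single m (Poly_Mapping.lookup f m)"
  have "f * g = (\<Sum>m\<in>Poly_Mapping.keys f. ?s f m) * (\<Sum>m\<in>Poly_Mapping.keys g. ?s g m)"
    by (rule arg_cong2[of _ _ _ _ "(*)"]; rule mpoly_expansion)
  also have "\<dots> = (\<Sum>m\<in>Poly_Mapping.keys f. \<Sum>m'\<in>Poly_Mapping.keys g. ?s f m * ?s g m')"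
    by (simp add: sum_product)
  finally have "eval_mpoly (f * g) v =
      (\<Sum>m\<in>Poly_Mapping.keys f. \<Sum>m'\<in>Poly_Mapping.keys g.
         Poly_Mapping.lookup f m * eval_monom v m * (Poly_Mapping.lookup g m' * eval_monom v m'))"
    by (simp add: eval_mpoly_sum mult_single eval_monom_add ac_simps)
  then show ?thesis
    by (simp add: eval_mpoly_def sum_product)
qed

lemma monom_degree_superset:
  assumes "finite A" "Poly_Mapping.keys m \<subseteq> A"
  shows "monom_degree m = (\<Sum>i\<in>A. Poly_Mapping.lookup m i)"
  unfolding monom_degree_def
  by (rule sum.mono_neutral_left) (use assms in \<open>auto simp: in_keys_iff\<close>)

lemma monom_degree_add: "monom_degree (m + m') = monom_degree m + monom_degree m'"
proof -
  let ?A = "Poly_Mapping.keys m \<union> Poly_Mapping.keys m'"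
  have "monom_degree (m + m') = (\<Sum>i\<in>?A. Poly_Mapping.lookup (m + m') i)"
    using Poly_Mapping.keys_add[of m m'] by (intro monom_degree_superset) auto
  then show ?thesis
    by (simp add: lookup_add sum.distrib monom_degree_superset[of ?A])
qed

lemma homogeneous_polys_mult:
  assumes "f \<in> homogeneous_polys I" "g \<in> homogeneous_polys I"
  shows "f * g \<in> homogeneous_polys I"
proof -
  obtain d e where d: "f \<in> forms I d" and e: "g \<in> forms I e"
    using assms by (auto simp: homogeneous_polys_def)
  have "f * g \<in> forms I (d + e)"
    unfolding forms_def
  proof safe
    fix m assume "m \<in> Poly_Mapping.keys (f * g)"
    then obtain a b where ab: "m = a + b" "a \<in> Poly_Mapping.keys f" "b \<in> Poly_Mapping.keys g"
      using keys_mult[of f g] by auto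
    show "monom_degree m = d + e"
      using ab d e by (auto simp: forms_def monom_degree_add)
    show "x \<in> I" if "x \<in> Poly_Mapping.keys m" for x
      using that ab d e Poly_Mapping.keys_add[of a b] unfolding forms_def by blast
  qed
  then show ?thesis
    by (auto simp: homogeneous_polys_def)
qed

section \<open>Projective space\<close>

definition fun_scale :: "'k \<Rightarrow> ('i \<Rightarrow> 'k) \<Rightarrow> 'i \<Rightarrow> 'k::times" where
  "fun_scale c v = (\<lambda>i. c * v i)"

global_interpretation fun_vec: vector_space "fun_scale :: 'k::field \<Rightarrow> ('i \<Rightarrow> 'k) \<Rightarrow> 'i \<Rightarrow> 'k"
  by standard (auto simp: fun_scale_def fun_eq_iff algebra_simps)

text \<open>
  The vector space \<open>K\<^sup>I\<close> consists of the functions that vanish outside \<open>I\<close>.  The points of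
  \<open>\<P>(K\<^sup>I)\<close>, a projective space of dimension \<open>card I - 1\<close>, are the lines through the origin.
\<close>

definition coord_space :: "'i set \<Rightarrow> ('i \<Rightarrow> 'k::zero) set" where
  "coord_space I = {v. \<forall>i. i \<notin> I \<longrightarrow> v i = 0}"

definition proj_space :: "'i set \<Rightarrow> ('i \<Rightarrow> 'k::field) set set" where
  "proj_space I = {fun_vec.span {v} | v. v \<in> coord_space I \<and> v \<noteq> 0}"

text \<open>
  As the polynomials in question are homogeneous, vanishing at one non-zero vector of the line
  \<open>p\<close> amounts to vanishing on all of \<open>p\<close>.
\<close>

definition zero_locus :: "'i set \<Rightarrow> ('i, 'k) mpoly set \<Rightarrow> ('i \<Rightarrow> 'k::field) set set" where
  "zero_locus I G = {p \<in> proj_space I. \<forall>f\<in>G. \<forall>v\<in>p. eval_mpoly f v = 0}"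

definition zariski :: "'i set \<Rightarrow> ('i \<Rightarrow> 'k::field) set topology" where
  "zariski I =
     topology (\<lambda>U. \<exists>G. G \<subseteq> homogeneous_polys I \<and> U = proj_space I - zero_locus I G)"

lemma eval_mpoly_scale:
  assumes "f \<in> forms I d"
  shows "eval_mpoly f (fun_scale c v) = c ^ d * eval_mpoly f v"
proof -
  have 1: "eval_monom (fun_scale c v) m = c ^ monom_degree m * eval_monom v m" for m
    unfolding eval_monom_def monom_degree_def fun_scale_def power_mult_distrib prod.distrib
      power_sum ..
  show ?thesis
    unfolding eval_mpoly_def sum_distrib_left
  proof (rule sum.cong)
    fix m assume "m \<in> Poly_Mapping.keys f"
    then have "monom_degree m = d"
      using assms by (simp add: forms_def)
    then show "Poly_Mapping.lookup f m * eval_monom (fun_scale c v) m =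
        c ^ d * (Poly_Mapping.lookup f m * eval_monom v m)"
      unfolding 1 by (simp only: mult.left_commute)
  qed simp
qed

lemma mem_zero_locus_span:
  assumes "G \<subseteq> homogeneous_polys I" "v \<in> coord_space I" "v \<noteq> 0"
  shows "fun_vec.span {v} \<in> zero_locus I G \<longleftrightarrow> (\<forall>f\<in>G. eval_mpoly f v = 0)"
proof -
  have "fun_vec.span {v} \<in> proj_space I"
    using assms(2,3) by (auto simp: proj_space_def)
  moreover have "eval_mpoly f w = 0"
    if "f \<in> G" "eval_mpoly f v = 0" "w \<in> fun_vec.span {v}" for f w
  proof -
    obtain c where "w = fun_scale c v"
      using \<open>w \<in> _\<close> by (auto simp: fun_vec.span_singleton)
    moreover obtain d where "f \<in> forms I d"
      using assms(1) \<open>f \<in> G\<close> by (auto simp: homogeneous_polys_def)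
    ultimately show ?thesis
      using \<open>eval_mpoly f v = 0\<close> by (simp add: eval_mpoly_scale)
  qed
  ultimately show ?thesis
    using fun_vec.span_base[of v "{v}"] by (auto simp: zero_locus_def)
qed

lemma zero_locus_Un_eq:
  fixes G H :: "('i, 'k::field) mpoly set"
  assumes G: "G \<subseteq> homogeneous_polys I" and H: "H \<subseteq> homogeneous_polys I"
  shows "zero_locus I G \<union> zero_locus I H = zero_locus I {f * g | f g. f \<in> G \<and> g \<in> H}"
    (is "_ = zero_locus I ?GH")
proof -
  have GH: "?GH \<subseteq> homogeneous_polys I"
    using G H homogeneous_polys_mult by blast
  have "p \<in> zero_locus I G \<union> zero_locus I H \<longleftrightarrow> p \<in> zero_locus I ?GH"
    if p: "p \<in> proj_space I" for p
  proof -
    obtain v where v: "p = fun_vec.span {v}" "v \<in> coord_space I" "v \<noteq> 0"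
      using p by (auto simp: proj_space_def)
    show ?thesis
      unfolding v(1) Un_iff mem_zero_locus_span[OF G v(2,3)] mem_zero_locus_span[OF H v(2,3)]
        mem_zero_locus_span[OF GH v(2,3)]
    proof (intro iffI)
      assume "(\<forall>f\<in>G. eval_mpoly f v = 0) \<or> (\<forall>f\<in>H. eval_mpoly f v = 0)"
      then show "\<forall>f\<in>?GH. eval_mpoly f v = 0"
        by (auto simp: eval_mpoly_mult)
    next
      assume *: "\<forall>f\<in>?GH. eval_mpoly f v = 0"
      have "eval_mpoly f v = 0 \<or> eval_mpoly g v = 0" if "f \<in> G" "g \<in> H" for f g
      proof -
        have "f * g \<in> ?GH"
          using that by blast
        then show ?thesis
          using * eval_mpoly_mult[of f g v] by auto
      qed
      then show "(\<forall>f\<in>G. eval_mpoly f v = 0) \<or> (\<forall>f\<in>H. eval_mpoly f v = 0)"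
        by blast
    qed
  qed
  moreover have "zero_locus I K \<subseteq> proj_space I" for K :: "('i, 'k) mpoly set"
    by (auto simp: zero_locus_def)
  ultimately show ?thesis
    by blast
qed

lemma istopology_zariski:
  "istopology (\<lambda>U. \<exists>G. G \<subseteq> homogeneous_polys I \<and> U = proj_space I - zero_locus I G)"
    (is "istopology ?P")
  unfolding istopology_def
proof (intro conjI allI impI)
  fix S T assume "?P S" "?P T"
  then obtain G H where GH: "G \<subseteq> homogeneous_polys I" "S = proj_space I - zero_locus I G"
    "H \<subseteq> homogeneous_polys I" "T = proj_space I - zero_locus I H"
    by blast
  have "{f * g | f g. f \<in> G \<and> g \<in> H} \<subseteq> homogeneous_polys I"
    using GH(1,3) homogeneous_polys_mult by blast
  moreover have "S \<inter> T = proj_space I - zero_locus I {f * g | f g. f \<in> G \<and> g \<in> H}"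
    using GH zero_locus_Un_eq[OF GH(1,3)] by blast
  ultimately show "?P (S \<inter> T)" by blast
next
  fix \<K> assume "\<forall>K\<in>\<K>. ?P K"
  then have "\<exists>G. \<forall>K\<in>\<K>. G K \<subseteq> homogeneous_polys I \<and> K = proj_space I - zero_locus I (G K)"
    by (rule bchoice)
  then obtain G where G: "\<And>K. K \<in> \<K> \<Longrightarrow> G K \<subseteq> homogeneous_polys I"
    "\<And>K. K \<in> \<K> \<Longrightarrow> K = proj_space I - zero_locus I (G K)"
    by blast
  have "\<Union>\<K> = (\<Union>K\<in>\<K>. proj_space I - zero_locus I (G K))"
  proof -
    have "(\<Union>K\<in>\<K>. proj_space I - zero_locus I (G K)) = (\<Union>K\<in>\<K>. K)"
      by (rule SUP_cong) (simp_all flip: G(2))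
    then show ?thesis
      by simp
  qed
  also have "\<dots> = proj_space I - zero_locus I (\<Union>K\<in>\<K>. G K)"
    by (auto simp: zero_locus_def)
  finally have "\<Union>\<K> = proj_space I - zero_locus I (\<Union>K\<in>\<K>. G K)" .
  moreover have "(\<Union>K\<in>\<K>. G K) \<subseteq> homogeneous_polys I"
    using G(1) by (rule UN_least)
  ultimately show "?P (\<Union>\<K>)"
    by (intro exI conjI)
qed

lemma openin_zariski:
  "openin (zariski I) U \<longleftrightarrow>
     (\<exists>G. G \<subseteq> homogeneous_polys I \<and> U = proj_space I - zero_locus I G)"
  by (simp add: zariski_def istopology_zariski)

lemma topspace_zariski [simp]:
  "topspace (zariski I) = (proj_space I :: ('i \<Rightarrow> 'k::field) set set)"
proof -
  have "openin (zariski I) (proj_space I :: ('i \<Rightarrow> 'k) set set)"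
    unfolding openin_zariski
  proof (intro exI conjI)
    have "(1 :: ('i, 'k) mpoly) \<in> forms I 0"
      by (auto simp: forms_def monom_degree_def)
    then show "{1 :: ('i, 'k) mpoly} \<subseteq> homogeneous_polys I"
      by (auto simp: homogeneous_polys_def)
    have "zero_locus I {1 :: ('i, 'k) mpoly} = {}"
      using fun_vec.span_zero by (auto simp: zero_locus_def proj_space_def)
    then show "(proj_space I :: ('i \<Rightarrow> 'k) set set) = proj_space I - zero_locus I {1 :: ('i, 'k) mpoly}"
      by simp
  qed
  then have "proj_space I \<subseteq> topspace (zariski I :: ('i \<Rightarrow> 'k) set topology)"
    by (rule openin_subset)
  moreover have "topspace (zariski I) \<subseteq> (proj_space I :: ('i \<Rightarrow> 'k) set set)"
    using openin_topspace[of "zariski I"] unfolding openin_zariski by blast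
  ultimately show ?thesis
    by (rule subset_antisym[rotated])
qed

lemma closedin_zariski:
  fixes Z :: "('i \<Rightarrow> 'k::field) set set"
  shows "closedin (zariski I) Z \<longleftrightarrow> (\<exists>G. G \<subseteq> homogeneous_polys I \<and> Z = zero_locus I G)"
proof -
  have sub: "zero_locus I G \<subseteq> proj_space I" for G :: "('i, 'k) mpoly set"
    by (auto simp: zero_locus_def)
  have eq: "Z \<subseteq> proj_space I \<and> proj_space I - Z = proj_space I - zero_locus I G \<longleftrightarrow>
      Z = zero_locus I G" for G
    using sub[of G] by auto
  have "closedin (zariski I) Z \<longleftrightarrow> (\<exists>G. G \<subseteq> homogeneous_polys I \<and>
      (Z \<subseteq> proj_space I \<and> proj_space I - Z = proj_space I - zero_locus I G))"
    unfolding closedin_def openin_zariski topspace_zariski by blast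
  then show ?thesis
    unfolding eq .
qed

section \<open>Dimension\<close>

definition irreducible_in :: "'a topology \<Rightarrow> 'a set \<Rightarrow> bool" where
  "irreducible_in T Z \<longleftrightarrow> Z \<subseteq> topspace T \<and> Z \<noteq> {} \<and>
     (\<forall>A B. closedin T A \<longrightarrow> closedin T B \<longrightarrow> Z \<subseteq> A \<union> B \<longrightarrow> Z \<subseteq> A \<or> Z \<subseteq> B)"

text \<open>
  Krull dimension: the supremum of the lengths \<open>d\<close> of chains \<open>Z\<^sub>0 \<subset> Z\<^sub>1 \<subset> \<dots> \<subset> Z\<^sub>d\<close> of irreducible
  closed subsets.  By this convention the empty space has dimension \<open>0\<close>, not \<open>-1\<close>.
\<close>

definition krull_dim :: "'a topology \<Rightarrow> enat" where
  "krull_dim T = Sup {enat d | d. \<exists>Z :: nat \<Rightarrow> 'a set.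
     (\<forall>i\<le>d. closedin T (Z i) \<and> irreducible_in T (Z i)) \<and> (\<forall>i<d. Z i \<subset> Z (Suc i))}"

definition zariski_dim :: "'i set \<Rightarrow> ('i \<Rightarrow> 'k::field) set set \<Rightarrow> enat" where
  "zariski_dim I Y = krull_dim (subtopology (zariski I) Y)"

section \<open>Linear spans, rank, secant and tangential varieties\<close>

definition proj_span :: "'i set \<Rightarrow> ('i \<Rightarrow> 'k::field) set set \<Rightarrow> ('i \<Rightarrow> 'k) set set" where
  "proj_span I S = {q \<in> proj_space I. q \<subseteq> fun_vec.span (\<Union>S)}"

text \<open>The rank is \<open>\<infinity>\<close> if \<open>q\<close> is not in the span of any finite subset of \<open>X\<close>.\<close>

definition X_rank :: "'i set \<Rightarrow> ('i \<Rightarrow> 'k::field) set set \<Rightarrow> ('i \<Rightarrow> 'k) set \<Rightarrow> enat" where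
  "X_rank I X q = Inf {enat (card S) | S. finite S \<and> S \<subseteq> X \<and> q \<in> proj_span I S}"

definition secant_variety ::
    "'i set \<Rightarrow> nat \<Rightarrow> ('i \<Rightarrow> 'k::field) set set \<Rightarrow> ('i \<Rightarrow> 'k) set set" where
  "secant_variety I k X =
     zariski I closure_of (\<Union>{proj_span I S | S. finite S \<and> S \<subseteq> X \<and> card S = k})"

definition vanishing_forms :: "'i set \<Rightarrow> ('i \<Rightarrow> 'k::field) set set \<Rightarrow> ('i, 'k) mpoly set" where
  "vanishing_forms I X = {f \<in> homogeneous_polys I. \<forall>p\<in>X. \<forall>v\<in>p. eval_mpoly f v = 0}"

text \<open>
  The tangent space to the affine cone over \<open>X\<close>, and the embedded projective tangent space
  \<open>T\<^sub>pX\<close>, which is its projectivisation.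
\<close>

definition cone_tangent_space ::
    "'i set \<Rightarrow> ('i \<Rightarrow> 'k::field) set set \<Rightarrow> ('i \<Rightarrow> 'k) set \<Rightarrow> ('i \<Rightarrow> 'k) set" where
  "cone_tangent_space I X p = {w \<in> coord_space I.
     \<forall>f\<in>vanishing_forms I X. \<forall>v\<in>p. (\<Sum>i\<in>I. eval_mpoly (partial_deriv i f) v * w i) = 0}"

definition tangent_space ::
    "'i set \<Rightarrow> ('i \<Rightarrow> 'k::field) set set \<Rightarrow> ('i \<Rightarrow> 'k) set \<Rightarrow> ('i \<Rightarrow> 'k) set set" where
  "tangent_space I X p = {q \<in> proj_space I. q \<subseteq> cone_tangent_space I X p}"

text \<open>
  The smooth locus of an integral variety \<open>X\<close>: the points with \<open>dim T\<^sub>pX = dim X\<close>.  The vector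
  space dimension on the left-hand side is that of the cone, hence the shift by one.
\<close>

definition smooth_locus :: "'i set \<Rightarrow> ('i \<Rightarrow> 'k::field) set set \<Rightarrow> ('i \<Rightarrow> 'k) set set" where
  "smooth_locus I X =
     {p \<in> X. enat (fun_vec.dim (cone_tangent_space I X p)) = zariski_dim I X + 1}"

definition tangential_variety ::
    "'i set \<Rightarrow> ('i \<Rightarrow> 'k::field) set set \<Rightarrow> ('i \<Rightarrow> 'k) set set" where
  "tangential_variety I X =
     zariski I closure_of (\<Union>p\<in>smooth_locus I X. tangent_space I X p)"

text \<open>\<open>\<tau>(X, b)\<close> for \<open>b \<ge> 2\<close>: the join of \<open>\<tau>(X)\<close> and \<open>b - 2\<close> copies of \<open>X\<close>.\<close>

definition tangential_join ::
    "'i set \<Rightarrow> ('i \<Rightarrow> 'k::field) set set \<Rightarrow> nat \<Rightarrow> ('i \<Rightarrow> 'k) set set" where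
  "tangential_join I X b =
     zariski I closure_of
       (\<Union>{proj_span I (insert q S) | q S.
            q \<in> tangential_variety I X \<and> finite S \<and> S \<subseteq> X \<and> card S = b - 2})"

text \<open>
  A property holds for a general point of \<open>Y\<close> if it holds on a non-empty Zariski open subset
  of \<open>Y\<close>.
\<close>

definition for_general ::
    "'i set \<Rightarrow> ('i \<Rightarrow> 'k::field) set set \<Rightarrow> (('i \<Rightarrow> 'k) set \<Rightarrow> bool) \<Rightarrow> bool" where
  "for_general I Y P \<longleftrightarrow>
     (\<exists>U. openin (subtopology (zariski I) Y) U \<and> U \<noteq> {} \<and> (\<forall>q\<in>U. P q))"

section \<open>The Segre embedding\<close>

text \<open>
  \<open>\<P>\<^sup>n\<close> is \<open>proj_space {0..n}\<close>.  The homogeneous coordinates of the target of the Segre embedding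
  of \<open>\<P>\<^bsup>n 1\<^esup> \<times> \<dots> \<times> \<P>\<^bsup>n s\<^esup>\<close> are labelled by the multi-indices \<open>(m 1, \<dots>, m s)\<close> with
  \<open>0 \<le> m i \<le> n i\<close>.
\<close>

definition multi_index :: "nat \<Rightarrow> (nat \<Rightarrow> nat) \<Rightarrow> (nat \<Rightarrow> nat) set" where
  "multi_index s n = (\<Pi>\<^sub>E i\<in>{1..s}. {0..n i})"

lemma finite_multi_index [simp]: "finite (multi_index s n)"
  by (simp add: multi_index_def finite_PiE)

lemma card_multi_index: "card (multi_index s n) = (\<Prod>i\<in>{1..s}. n i + 1)"
  by (simp add: multi_index_def card_PiE)

definition segre_vec ::
    "nat \<Rightarrow> (nat \<Rightarrow> nat) \<Rightarrow> (nat \<Rightarrow> nat \<Rightarrow> 'k) \<Rightarrow> (nat \<Rightarrow> nat) \<Rightarrow> 'k::comm_semiring_1" where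
  "segre_vec s n x = (\<lambda>m. if m \<in> multi_index s n then \<Prod>i\<in>{1..s}. x i (m i) else 0)"

text \<open>
  For lines \<open>p i\<close>, the vectors \<open>segre_vec s n x\<close> with \<open>x i \<in> p i\<close> themselves form a line
  if \<open>s > 0\<close>; see \<open>segre_map_span\<close> below for the usual description by representatives.
\<close>

definition segre_map ::
    "nat \<Rightarrow> (nat \<Rightarrow> nat) \<Rightarrow> (nat \<Rightarrow> (nat \<Rightarrow> 'k) set) \<Rightarrow> ((nat \<Rightarrow> nat) \<Rightarrow> 'k::field) set" where
  "segre_map s n p = segre_vec s n ` (\<Pi> i\<in>{1..s}. p i)"

definition segre_variety ::
    "nat \<Rightarrow> (nat \<Rightarrow> nat) \<Rightarrow> ((nat \<Rightarrow> nat) \<Rightarrow> 'k::field) set set" where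
  "segre_variety s n = segre_map s n ` (\<Pi>\<^sub>E i\<in>{1..s}. proj_space {0..n i})"

lemma segre_map_span:
  assumes "s > 0" "\<And>i. i \<in> {1..s} \<Longrightarrow> p i = fun_vec.span {x i}"
  shows "segre_map s n p = fun_vec.span {segre_vec s n x}"
proof (intro subset_antisym subsetI)
  fix w assume "w \<in> segre_map s n p"
  then obtain y where y: "w = segre_vec s n y" "\<forall>i\<in>{1..s}. y i \<in> p i"
    by (auto simp: segre_map_def)
  then have "\<forall>i\<in>{1..s}. \<exists>c. y i = fun_scale c (x i)"
    using assms(2) by (auto simp: fun_vec.span_singleton)
  then obtain c where "\<forall>i\<in>{1..s}. y i = fun_scale (c i) (x i)"
    by metis
  then have "w = fun_scale (\<Prod>i\<in>{1..s}. c i) (segre_vec s n x)"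
    by (auto simp: y(1) segre_vec_def fun_scale_def fun_eq_iff simp flip: prod.distrib)
  then show "w \<in> fun_vec.span {segre_vec s n x}"
    by (auto simp: fun_vec.span_singleton)
next
  fix w assume "w \<in> fun_vec.span {segre_vec s n x}"
  then obtain c where c: "w = fun_scale c (segre_vec s n x)"
    by (auto simp: fun_vec.span_singleton)
  define y where "y = x(1 := fun_scale c (x 1))"
  have "(\<Prod>i\<in>{1..s}. y i (m i)) = c * (\<Prod>i\<in>{1..s}. x i (m i))" for m
  proof -
    have 1: "{1..s} = insert 1 {2..s}"
      using \<open>s > 0\<close> by auto
    have "(\<Prod>i\<in>{2..s}. y i (m i)) = (\<Prod>i\<in>{2..s}. x i (m i))"
      by (intro prod.cong) (auto simp: y_def)
    then show ?thesis
      unfolding 1 by (simp add: y_def fun_scale_def)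
  qed
  then have "w = segre_vec s n y"
    by (auto simp: c segre_vec_def fun_scale_def fun_eq_iff)
  moreover have "y i \<in> p i" if "i \<in> {1..s}" for i
    using assms(2)[OF that] by (auto simp: y_def fun_vec.span_singleton intro: image_eqI[of _ _ 1])
  ultimately show "w \<in> segre_map s n p"
    by (auto simp: segre_map_def)
qed

end

theory Submission
  imports Defs
begin

text \<open>
  Write tensors on \<open>{1..s}\<close> as matrices whose rows and columns are tensors on \<open>E\<close> and \<open>F\<close>. A sum of
  \<open>b\<close> decomposable tensors, or a tangent vector plus \<open>b - 2\<close> decomposable tensors, becomes
  \<open>\<Sum>\<^sub>k x\<^sub>k \<otimes> y\<^sub>k\<close> with \<open>b\<close> summands. As the \<open>x\<^sub>k\<close> and the \<open>y\<^sub>k\<close> are linearly independent in general, a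
  relation between the derivatives forces \<open>dx\<^sub>k\<close> into the span of the \<open>x\<^sub>l\<close> and \<open>dy\<^sub>k\<close> into that of the \<open>y\<^sub>l\<close>;
  the hypotheses on \<open>E\<close> and \<open>F\<close> leave enough room for a general tuple to admit only the obvious
  variations of this kind. So the parametrisations have the expected rank, which gives both dimensions.

  If a general point of the tangential join had rank at most \<open>b\<close>, then the \<open>b\<close> summands would split in
  the same way, so the span of \<open>x\<^sub>0, \<dots>, x\<^sub>b\<^sub>-\<^sub>1\<close>, one of which is a tangent vector \<open>x\<^sub>1\<close> at \<open>x\<^sub>0\<close>, would be
  spanned by decomposable tensors. One of these, \<open>y\<close>, would involve \<open>x\<^sub>1\<close>. Lifting infinitesimal
  variations of the tuple to \<open>y\<close> by generic smoothness, the tangent space at \<open>x\<^sub>0\<close>, two second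
  derivatives at \<open>x\<^sub>0\<close> and \<open>x\<^sub>2, \<dots>, x\<^sub>b\<^sub>-\<^sub>1\<close> would lie in the span of the tangent space at \<open>y\<close> and
  the \<open>x\<^sub>k\<close> with \<open>k \<noteq> 1\<close>, whose dimension is too small by one.
\<close>

section \<open>Polynomial functions\<close>

text \<open>Dimension is defined by chains of irreducible closed sets, so the rank of a
  parametrisation has to be turned into chains and back. Both directions pass to the affine cone and
  count algebraically independent functions: a chain of length d forces d + 1 of them, and a cone
  parametrised by k coordinates carries at most k. The rank statement needs two existence results: a
  general point of a closure is the image of a generic parameter, and on a correspondence dominating
  a parameter space every infinitesimal variation lifts at some generic point. Both come from one
  theorem extending homomorphisms into the algebraically closed field together with derivations. In
  the matrix picture a tangent vector is x1 \<otimes> y0 + x0 \<otimes> y1, so the tuples on E and F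
  are paired entry by entry, except that 0 and 1 are interchanged. General position is always
  derived from one explicit tuple of coordinate tensors; the numerical hypotheses supply enough
  coordinates outside the tangent space at its base tensor.\<close>

inductive_set polyfun :: "'i set \<Rightarrow> (('i \<Rightarrow> 'k) \<Rightarrow> 'k::comm_ring_1) set" for J where
  polyfun_const: "(\<lambda>_. c) \<in> polyfun J"
| polyfun_coord: "j \<in> J \<Longrightarrow> (\<lambda>v. v j) \<in> polyfun J"
| polyfun_add: "f \<in> polyfun J \<Longrightarrow> g \<in> polyfun J \<Longrightarrow> (\<lambda>v. f v + g v) \<in> polyfun J"
| polyfun_mult: "f \<in> polyfun J \<Longrightarrow> g \<in> polyfun J \<Longrightarrow> (\<lambda>v. f v * g v) \<in> polyfun J"

lemma polyfun_uminus:
  assumes "f \<in> polyfun J" shows "(\<lambda>v. - f v) \<in> polyfun J"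
  using polyfun_mult[OF polyfun_const[of "-1"] assms] by simp

lemma polyfun_diff:
  assumes "f \<in> polyfun J" "g \<in> polyfun J" shows "(\<lambda>v. f v - g v) \<in> polyfun J"
  using polyfun_add[OF assms(1) polyfun_uminus[OF assms(2)]] by simp

lemma polyfun_sum:
  assumes "\<And>a. a \<in> A \<Longrightarrow> f a \<in> polyfun J" shows "(\<lambda>v. \<Sum>a\<in>A. f a v) \<in> polyfun J"
  using assms
  by (induction A rule: infinite_finite_induct) (auto intro: polyfun_const polyfun_add)

lemma polyfun_prod:
  assumes "\<And>a. a \<in> A \<Longrightarrow> f a \<in> polyfun J" shows "(\<lambda>v. \<Prod>a\<in>A. f a v) \<in> polyfun J"
  using assms
  by (induction A rule: infinite_finite_induct) (auto intro: polyfun_const polyfun_mult)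

lemma polyfun_power:
  assumes "f \<in> polyfun J" shows "(\<lambda>v. f v ^ k) \<in> polyfun J"
  using assms by (induction k) (auto intro: polyfun_const polyfun_mult)

lemmas polyfun_intros = polyfun_const polyfun_coord polyfun_add polyfun_mult polyfun_uminus
  polyfun_diff polyfun_sum polyfun_prod polyfun_power

lemma polyfun_compose:
  assumes "f \<in> polyfun I" "\<And>i. i \<in> I \<Longrightarrow> (\<lambda>u. G u i) \<in> polyfun J"
  shows "(\<lambda>u. f (G u)) \<in> polyfun J"
  using assms(1) by induction (auto intro: polyfun_intros assms(2))

lemma polyfun_mono:
  assumes "f \<in> polyfun I" "I \<subseteq> J" shows "f \<in> polyfun J"
  using polyfun_compose[OF assms(1), of "\<lambda>u. u" J] assms(2) by (auto intro: polyfun_intros)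

lemma polyfun_cong:
  assumes "f \<in> polyfun J" "\<And>j. j \<in> J \<Longrightarrow> v j = w j"
  shows "f v = f w"
  using assms(1) by induction (auto simp: assms(2))

lemma polyfun_along_polys:
  assumes "f \<in> polyfun J" "\<And>j. j \<in> J \<Longrightarrow> \<exists>q. \<forall>t. G t j = poly q t"
  shows "\<exists>r. \<forall>t. f (G t) = poly r t"
  using assms(1)
proof induction
  case (polyfun_const c)
  show ?case by (intro exI[of _ "[:c:]"]) simp
next
  case (polyfun_coord j)
  then show ?case using assms(2) by auto
next
  case (polyfun_add f g)
  then obtain r s where "\<forall>t. f (G t) = poly r t" "\<forall>t. g (G t) = poly s t" by auto
  then show ?case by (intro exI[of _ "r + s"]) simp
next
  case (polyfun_mult f g)
  then obtain r s where "\<forall>t. f (G t) = poly r t" "\<forall>t. g (G t) = poly s t" by auto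
  then show ?case by (intro exI[of _ "r * s"]) simp
qed

lemma poly_along_line: "\<exists>q. \<forall>t. a + t * (b::'k::comm_ring_1) = poly q t"
  by (rule exI[of _ "[:a, b:]"]) simp

lemma poly_eq_0_infinite:
  fixes p :: "'k::field_char_0 poly"
  assumes "infinite {t. poly p t = 0}" shows "p = 0"
  using assms poly_roots_finite by blast

text \<open>Scaling arguments give information only for nonzero scalars; leaving out one value still
  leaves infinitely many roots.\<close>

lemma poly_nonzero_except:
  fixes p :: "'k::field_char_0 poly"
  assumes "\<And>t. t \<noteq> a \<Longrightarrow> poly p t = 0"
  shows "p = 0"
proof (rule poly_eq_0_infinite)
  have "infinite (UNIV - {a})" using infinite_UNIV_char_0 by (simp add: infinite_remove)
  moreover have "UNIV - {a} \<subseteq> {t. poly p t = 0}" using assms by auto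
  ultimately show "infinite {t. poly p t = 0}" using finite_subset by blast
qed

lemma poly_function_eq_0:
  fixes p :: "'k::field_char_0 poly"
  assumes "\<And>t. poly p t = 0" shows "p = 0"
  using poly_nonzero_except[of 0 p] assms by blast

text \<open>On the line joining the two points both functions are nonzero one-variable polynomials,
  hence so is their product. This is the irreducibility of affine space, and the way in which two
  generic conditions are met at once.\<close>

lemma polyfun_mult_nonzero:
  fixes f g :: "('i \<Rightarrow> 'k::field_char_0) \<Rightarrow> 'k"
  assumes f: "f \<in> polyfun J" "f v \<noteq> 0" and g: "g \<in> polyfun J" "g w \<noteq> 0"
  shows "\<exists>u. f u * g u \<noteq> 0"
proof -
  define G where "G = (\<lambda>t j. v j + t * (w j - v j))"
  obtain r where r: "\<And>t. f (G t) = poly r t"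
    using polyfun_along_polys[OF f(1), of G] poly_along_line unfolding G_def by metis
  obtain s where s: "\<And>t. g (G t) = poly s t"
    using polyfun_along_polys[OF g(1), of G] poly_along_line unfolding G_def by metis
  have "G 0 = v" "G 1 = w" by (auto simp: G_def)
  with r[of 0] s[of 1] f g have "r \<noteq> 0" "s \<noteq> 0" by auto
  then have "r * s \<noteq> 0" by simp
  then obtain t where "poly (r * s) t \<noteq> 0" using poly_function_eq_0 by blast
  then show ?thesis using r s by (intro exI[of _ "G t"]) auto
qed

text \<open>Singles out one variable of an algebraic relation and leaves the others in the
  coefficients. Padding \<open>a\<close> by zeros beyond \<open>D\<close> lets sums be aligned and
  products be Cauchy products.\<close>

lemma polyfun_expand_var:
  fixes f :: "('i \<Rightarrow> 'k::idom) \<Rightarrow> 'k"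
  assumes "f \<in> polyfun (insert k J)"
  shows "\<exists>D a. (\<forall>l. a l \<in> polyfun J) \<and> (\<forall>l>D. a l = (\<lambda>_. 0)) \<and>
           (\<forall>y. f y = (\<Sum>l\<le>D. a l y * y k ^ l))"
  using assms
proof induction
  case (polyfun_const c)
  show ?case
    by (intro exI[of _ 0] exI[of _ "\<lambda>l. if l = 0 then (\<lambda>_. c) else (\<lambda>_. 0)"])
       (auto intro: polyfun_intros)
next
  case (polyfun_coord j)
  show ?case
  proof (cases "j = k")
    case True
    then show ?thesis
      by (intro exI[of _ 1] exI[of _ "\<lambda>l. if l = 1 then (\<lambda>_. 1) else (\<lambda>_. 0)"])
         (auto intro: polyfun_intros)
  next
    case False
    then show ?thesis using polyfun_coord
      by (intro exI[of _ 0] exI[of _ "\<lambda>l. if l = 0 then (\<lambda>y. y j) else (\<lambda>_. 0)"])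
         (auto intro: polyfun_intros)
  qed
next
  case (polyfun_add f g)
  then obtain D a D' b where a: "\<forall>l. a l \<in> polyfun J" "\<forall>l>D. a l = (\<lambda>_. 0)"
      "\<forall>y. f y = (\<Sum>l\<le>D. a l y * y k ^ l)"
    and b: "\<forall>l. b l \<in> polyfun J" "\<forall>l>D'. b l = (\<lambda>_. 0)"
      "\<forall>y. g y = (\<Sum>l\<le>D'. b l y * y k ^ l)" by blast
  have f: "f y = (\<Sum>l\<le>max D D'. a l y * y k ^ l)" for y
    unfolding a(3)[rule_format] by (rule sum.mono_neutral_left) (use a(2) in auto)
  have g: "g y = (\<Sum>l\<le>max D D'. b l y * y k ^ l)" for y
    unfolding b(3)[rule_format] by (rule sum.mono_neutral_left) (use b(2) in auto)
  show ?case
    using a b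
    by (intro exI[of _ "max D D'"] exI[of _ "\<lambda>l y. a l y + b l y"])
       (auto simp: f g sum.distrib distrib_right intro: polyfun_intros)
next
  case (polyfun_mult f g)
  then obtain D a D' b where a: "\<forall>l. a l \<in> polyfun J" "\<forall>l>D. a l = (\<lambda>_. 0)"
      "\<forall>y. f y = (\<Sum>l\<le>D. a l y * y k ^ l)"
    and b: "\<forall>l. b l \<in> polyfun J" "\<forall>l>D'. b l = (\<lambda>_. 0)"
      "\<forall>y. g y = (\<Sum>l\<le>D'. b l y * y k ^ l)" by blast
  define c where "c = (\<lambda>r y. \<Sum>l\<le>r. a l y * b (r - l) y)"
  have "f y * g y = (\<Sum>r\<le>D + D'. c r y * y k ^ r)" for y
    unfolding a(3)[rule_format] b(3)[rule_format] c_def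
    by (rule polynomial_product) (use a(2) b(2) in auto)
  moreover have "c r = (\<lambda>_. 0)" if "r > D + D'" for r
  proof -
    have "a l y * b (r - l) y = 0" for l y
    proof (cases "l > D")
      case False
      then have "r - l > D'" using that by linarith
      then show ?thesis using b(2) by simp
    qed (use a(2) in simp)
    then show ?thesis unfolding c_def by (simp only: sum.neutral_const)
  qed
  moreover have "c r \<in> polyfun J" for r
    unfolding c_def using a(1) b(1) by (auto intro!: polyfun_intros)
  ultimately show ?case by blast
qed

subsection \<open>Homogeneous components\<close>

lemma forms_0: "0 \<in> forms I d"
  by (simp add: forms_def)

lemma forms_add: "f \<in> forms I d \<Longrightarrow> g \<in> forms I d \<Longrightarrow> f + g \<in> forms I d"
  unfolding forms_def using Poly_Mapping.keys_add[of f g] by blast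

lemma forms_sum: "(\<And>a. a \<in> A \<Longrightarrow> f a \<in> forms I d) \<Longrightarrow> (\<Sum>a\<in>A. f a) \<in> forms I d"
  by (induction A rule: infinite_finite_induct) (auto intro: forms_0 forms_add)

lemma forms_mult:
  assumes "f \<in> forms I d" "g \<in> forms I e" shows "f * g \<in> forms I (d + e)"
  unfolding forms_def
proof safe
  fix m assume "m \<in> Poly_Mapping.keys (f * g)"
  then obtain a b where ab: "m = a + b" "a \<in> Poly_Mapping.keys f" "b \<in> Poly_Mapping.keys g"
    using keys_mult[of f g] by auto
  show "monom_degree m = d + e"
    using ab assms by (auto simp: forms_def monom_degree_add)
  show "x \<in> I" if "x \<in> Poly_Mapping.keys m" for x
    using that ab assms Poly_Mapping.keys_add[of a b] unfolding forms_def by blast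
qed

lemma eval_form_polyfun: "f \<in> forms I d \<Longrightarrow> eval_mpoly f \<in> polyfun I"
  unfolding eval_mpoly_def[abs_def] eval_monom_def forms_def
  by (intro polyfun_intros) auto

text \<open>Zariski closed sets are cut out by forms, while generic arguments yield arbitrary
  polynomial functions; this decomposition is the passage between the two.\<close>

lemma polyfun_homogeneous_components:
  fixes f :: "('i \<Rightarrow> 'k::idom) \<Rightarrow> 'k"
  assumes "f \<in> polyfun I"
  shows "\<exists>D h. (\<forall>d. h d \<in> forms I d) \<and> (\<forall>d>D. h d = 0) \<and>
           (\<forall>v. f v = (\<Sum>d\<le>D. eval_mpoly (h d) v))"
  using assms
proof induction
  case (polyfun_const c)
  have "Poly_Mapping.single 0 c \<in> forms I 0"
    by (auto simp: forms_def monom_degree_def split: if_splits)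
  then show ?case
    by (intro exI[of _ 0] exI[of _ "\<lambda>l. if l = 0 then Poly_Mapping.single 0 c else 0"])
       (auto simp: forms_0 eval_monom_def)
next
  case (polyfun_coord j)
  then have "Poly_Mapping.single (Poly_Mapping.single j 1) (1::'k) \<in> forms I 1"
    by (auto simp: forms_def monom_degree_def split: if_splits)
  then show ?case
    by (intro exI[of _ 1] exI[of _ "\<lambda>l. if l = 1 then Poly_Mapping.single (Poly_Mapping.single j 1) 1 else 0"])
       (auto simp: forms_0 eval_monom_def)
next
  case (polyfun_add f g)
  then obtain D a D' b where a: "\<forall>l. a l \<in> forms I l" "\<forall>l>D. a l = 0"
      "\<forall>y. f y = (\<Sum>l\<le>D. eval_mpoly (a l) y)"
    and b: "\<forall>l. b l \<in> forms I l" "\<forall>l>D'. b l = 0"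
      "\<forall>y. g y = (\<Sum>l\<le>D'. eval_mpoly (b l) y)" by blast
  have f: "f y = (\<Sum>l\<le>max D D'. eval_mpoly (a l) y)" for y
    unfolding a(3)[rule_format] by (rule sum.mono_neutral_left) (use a(2) in auto)
  have g: "g y = (\<Sum>l\<le>max D D'. eval_mpoly (b l) y)" for y
    unfolding b(3)[rule_format] by (rule sum.mono_neutral_left) (use b(2) in auto)
  show ?case
    using a b
    by (intro exI[of _ "max D D'"] exI[of _ "\<lambda>l. a l + b l"])
       (auto simp: f g sum.distrib eval_mpoly_add intro: forms_add)
next
  case (polyfun_mult f g)
  then obtain D a D' b where a: "\<forall>l. a l \<in> forms I l" "\<forall>l>D. a l = 0"
      "\<forall>y. f y = (\<Sum>l\<le>D. eval_mpoly (a l) y)"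
    and b: "\<forall>l. b l \<in> forms I l" "\<forall>l>D'. b l = 0"
      "\<forall>y. g y = (\<Sum>l\<le>D'. eval_mpoly (b l) y)" by blast
  define c where "c = (\<lambda>r. \<Sum>l\<le>r. a l * b (r - l))"
  have "f y * g y = (\<Sum>r\<le>D + D'. eval_mpoly (c r) y)" for y
    using polynomial_product[of D "\<lambda>l. eval_mpoly (a l) y" D' "\<lambda>l. eval_mpoly (b l) y" 1] a b
    by (simp add: c_def eval_mpoly_sum eval_mpoly_mult)
  moreover have "c r = 0" if "r > D + D'" for r
  proof -
    have "a l * b (r - l) = 0" for l
    proof (cases "l > D")
      case False
      then have "r - l > D'" using that by linarith
      then show ?thesis using b(2) by simp
    qed (use a(2) in simp)
    then show ?thesis unfolding c_def by simp
  qed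
  moreover have "c r \<in> forms I r" for r
    unfolding c_def
  proof (rule forms_sum)
    fix l assume "l \<in> {..r}"
    then show "a l * b (r - l) \<in> forms I r"
      using forms_mult[of "a l" I l "b (r - l)" "r - l"] a(1) b(1) by simp
  qed
  ultimately show ?case by blast
qed

text \<open>As a function of the scalar \<open>c\<close> the sum is a polynomial whose coefficients
  are the values of the components at \<open>v\<close>, and it has infinitely many roots.\<close>

lemma component_vanishes:
  fixes h :: "nat \<Rightarrow> ('i, 'k::field_char_0) mpoly"
  assumes "\<And>d. h d \<in> forms I d" and "\<And>c. c \<noteq> 0 \<Longrightarrow> (\<Sum>d\<le>D. eval_mpoly (h d) (fun_scale c v)) = 0" and "d \<le> D"
  shows "eval_mpoly (h d) v = 0"
proof -
  define p where "p = (\<Sum>d\<le>D. Polynomial.monom (eval_mpoly (h d) v) d)"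
  have "poly p c = 0" if "c \<noteq> 0" for c
    using assms(2)[OF that]
    by (simp add: p_def poly_sum poly_monom eval_mpoly_scale[OF assms(1)] mult.commute)
  then have "p = 0" by (rule poly_nonzero_except)
  then have "coeff p d = 0" by simp
  then show ?thesis using \<open>d \<le> D\<close> by (simp add: p_def coeff_sum)
qed

subsection \<open>Monomials and algebraic dependence\<close>

text \<open>Indexed instead of a set of vectors, so that repeated vectors count as dependent and
  coefficients are attached to indices.\<close>

definition indep_fam :: "'a set \<Rightarrow> ('a \<Rightarrow> 'i \<Rightarrow> 'k::field) \<Rightarrow> bool" where
  "indep_fam A v \<longleftrightarrow> (\<forall>c. (\<forall>i. (\<Sum>a\<in>A. c a * v a i) = 0) \<longrightarrow> (\<forall>a\<in>A. c a = 0))"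

lemma indep_famI:
  assumes "\<And>c a. (\<And>i. (\<Sum>a\<in>A. c a * v a i) = 0) \<Longrightarrow> a \<in> A \<Longrightarrow> c a = 0"
  shows "indep_fam A v"
  using assms unfolding indep_fam_def by blast

lemma indep_famD:
  assumes "indep_fam A v" "\<And>i. (\<Sum>a\<in>A. c a * v a i) = 0" "a \<in> A"
  shows "c a = 0"
  using assms unfolding indep_fam_def by blast

lemma fun_scale_apply: "fun_scale c v i = c * v i"
  by (simp add: fun_scale_def)

lemma sum_fun_apply: "(\<Sum>a\<in>A. f a) x = (\<Sum>a\<in>A. f a x)"
  by (induction A rule: infinite_finite_induct) auto

lemma indep_fam_inj:
  assumes "indep_fam A v" "finite A" shows "inj_on v A"
proof (rule inj_onI, rule ccontr)
  fix a b assume ab: "a \<in> A" "b \<in> A" "v a = v b" "a \<noteq> b"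
  let ?c = "\<lambda>x. if x = a then 1 else if x = b then -1 else 0"
  have "(\<Sum>x\<in>A. ?c x * v x i) = 0" for i
  proof -
    have "(\<Sum>x\<in>A. ?c x * v x i) = (\<Sum>x\<in>{a, b}. ?c x * v x i)"
      by (rule sum.mono_neutral_right) (use assms(2) ab in auto)
    then show ?thesis using ab by simp
  qed
  from indep_famD[OF assms(1) this ab(1)] show False by simp
qed

lemma indep_fam_independent:
  assumes "indep_fam A v" "finite A" shows "fun_vec.independent (v ` A)"
proof (rule fun_vec.independent_if_scalars_zero)
  show "finite (v ` A)" using assms by simp
  fix f x assume f: "(\<Sum>x\<in>v ` A. fun_scale (f x) x) = 0" and x: "x \<in> v ` A"
  have "(\<Sum>a\<in>A. f (v a) * v a i) = 0" for i
    using fun_cong[OF f, of i]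
    by (simp add: sum.reindex[OF indep_fam_inj[OF assms]] sum_fun_apply fun_scale_apply)
  from indep_famD[OF assms(1) this] x show "f x = 0" by auto
qed

lemma indep_fam_card_le:
  assumes "indep_fam A v" "finite A" "finite S" "\<And>a. a \<in> A \<Longrightarrow> v a \<in> fun_vec.span S"
  shows "card A \<le> card S"
proof -
  have "card (v ` A) \<le> card S"
    using fun_vec.independent_span_bound[OF assms(3) indep_fam_independent[OF assms(1,2)]] assms(4)
    by blast
  then show ?thesis using card_image[OF indep_fam_inj[OF assms(1,2)]] by simp
qed

lemma indep_fam_subset:
  assumes "indep_fam A v" "B \<subseteq> A" "finite A" shows "indep_fam B v"
proof (rule indep_famI)
  fix c a assume c: "\<And>i. (\<Sum>a\<in>B. c a * v a i) = 0" and a: "a \<in> B"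
  have "(\<Sum>a\<in>A. (if a \<in> B then c a else 0) * v a i) = 0" for i
  proof -
    have "(\<Sum>a\<in>A. (if a \<in> B then c a else 0) * v a i) = (\<Sum>a\<in>B. (if a \<in> B then c a else 0) * v a i)"
      by (rule sum.mono_neutral_right) (use assms in auto)
    then show ?thesis using c by simp
  qed
  from indep_famD[OF assms(1) this, of a] a assms(2) show "c a = 0" by auto
qed

text \<open>Exponents will be bounded in each variable separately, not in total, which makes the
  count a pure power \<open>(e + 1) ^ card J\<close>.\<close>

definition box_monom :: "'i set \<Rightarrow> ('i \<Rightarrow> nat) \<Rightarrow> ('i \<Rightarrow> 'k) \<Rightarrow> 'k::comm_ring_1" where
  "box_monom J m v = (\<Prod>j\<in>J. v j ^ m j)"

definition box_monoms :: "'i set \<Rightarrow> nat \<Rightarrow> (('i \<Rightarrow> 'k) \<Rightarrow> 'k::comm_ring_1) set" where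
  "box_monoms J e = box_monom J ` (J \<rightarrow>\<^sub>E {..e})"

lemma finite_box_monoms: "finite J \<Longrightarrow> finite (box_monoms J e)"
  by (simp add: box_monoms_def finite_PiE)

lemma card_box_monoms: "finite J \<Longrightarrow> card (box_monoms J e) \<le> (e + 1) ^ card J"
  unfolding box_monoms_def
  by (rule order.trans[OF card_image_le]) (auto simp: finite_PiE card_PiE)

lemma box_monom_restrict: "box_monom J (restrict m J) = box_monom J m"
  by (auto simp: box_monom_def fun_eq_iff intro: prod.cong)

lemma box_monom_in: "(\<And>j. j \<in> J \<Longrightarrow> m j \<le> e) \<Longrightarrow> box_monom J m \<in> box_monoms J e"
  unfolding box_monoms_def
  by (subst box_monom_restrict[symmetric], rule imageI) auto

lemma box_monoms_mono: "e \<le> e' \<Longrightarrow> box_monoms J e \<subseteq> box_monoms J e'"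
  unfolding box_monoms_def by (intro image_mono PiE_mono) auto

lemma box_monoms_mult:
  assumes "p \<in> fun_vec.span (box_monoms J e)" "q \<in> fun_vec.span (box_monoms J e')"
  shows "(\<lambda>v. p v * q v) \<in> fun_vec.span (box_monoms J (e + e') :: (('i \<Rightarrow> 'k::field) \<Rightarrow> 'k) set)"
  using assms(1)
proof (induction rule: fun_vec.span_induct_alt)
  case base
  have "(\<lambda>v. (0 :: ('i \<Rightarrow> 'k) \<Rightarrow> 'k) v * q v) = 0" by auto
  then show ?case using fun_vec.span_zero by metis
next
  case (step c x y)
  have *: "(\<lambda>v. x v * q v) \<in> fun_vec.span (box_monoms J (e + e'))"
    using assms(2)
  proof (induction rule: fun_vec.span_induct_alt)
    case base
    have "(\<lambda>v. x v * (0 :: ('i \<Rightarrow> 'k) \<Rightarrow> 'k) v) = 0" by auto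
    then show ?case using fun_vec.span_zero by metis
  next
    case (step d z w)
    obtain m m' where m: "x = box_monom J m" "z = box_monom J m'" "m \<in> J \<rightarrow>\<^sub>E {..e}" "m' \<in> J \<rightarrow>\<^sub>E {..e'}"
      using step \<open>x \<in> box_monoms J e\<close> by (auto simp: box_monoms_def)
    have "(\<lambda>v. x v * z v) = box_monom J (\<lambda>j. m j + m' j)"
      by (auto simp: m box_monom_def fun_eq_iff power_add prod.distrib)
    moreover have "box_monom J (\<lambda>j. m j + m' j) \<in> box_monoms J (e + e')"
      using m(3,4) by (intro box_monom_in add_mono) (auto simp: PiE_def Pi_def)
    ultimately have "fun_scale d (\<lambda>v. x v * z v) \<in> fun_vec.span (box_monoms J (e + e'))"
      by (metis fun_vec.span_base fun_vec.span_scale)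
    then have "fun_scale d (\<lambda>v. x v * z v) + (\<lambda>v. x v * w v) \<in> fun_vec.span (box_monoms J (e + e'))"
      using step by (auto intro: fun_vec.span_add)
    also have "fun_scale d (\<lambda>v. x v * z v) + (\<lambda>v. x v * w v) = (\<lambda>v. x v * (fun_scale d z + w) v)"
      by (auto simp: fun_eq_iff fun_scale_apply algebra_simps)
    finally show ?case .
  qed
  have "fun_scale c (\<lambda>v. x v * q v) + (\<lambda>v. y v * q v) \<in> fun_vec.span (box_monoms J (e + e'))"
    using * step by (auto intro: fun_vec.span_add fun_vec.span_scale)
  also have "fun_scale c (\<lambda>v. x v * q v) + (\<lambda>v. y v * q v) = (\<lambda>v. (fun_scale c x + y) v * q v)"
    by (auto simp: fun_eq_iff fun_scale_apply algebra_simps)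
  finally show ?case .
qed

lemma one_in_box_monoms: "(\<lambda>_. 1) \<in> box_monoms J e"
  using box_monom_in[of J "\<lambda>_. 0" e] by (simp add: box_monom_def[abs_def])

lemma polyfun_in_span_box_monoms:
  fixes f :: "('i \<Rightarrow> 'k::field) \<Rightarrow> 'k"
  assumes "f \<in> polyfun J" "finite J"
  shows "\<exists>e. f \<in> fun_vec.span (box_monoms J e)"
  using assms(1)
proof induction
  case (polyfun_const c)
  have "fun_scale c (\<lambda>_. 1) \<in> fun_vec.span (box_monoms J 0 :: (('i \<Rightarrow> 'k) \<Rightarrow> 'k) set)"
    by (intro fun_vec.span_scale fun_vec.span_base one_in_box_monoms)
  moreover have "fun_scale c (\<lambda>_. 1) = (\<lambda>_::'i \<Rightarrow> 'k. c)" by (simp add: fun_scale_def)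
  ultimately show ?case by auto
next
  case (polyfun_coord j)
  have "box_monom J (\<lambda>i. if i = j then 1 else 0) \<in> box_monoms J 1"
    by (rule box_monom_in) auto
  moreover have "box_monom J (\<lambda>i. if i = j then 1 else 0) = (\<lambda>v::'i \<Rightarrow> 'k. v j)"
  proof
    fix v :: "'i \<Rightarrow> 'k"
    have "box_monom J (\<lambda>i. if i = j then 1 else 0) v = (\<Prod>i\<in>{j}. v i)"
      unfolding box_monom_def
      by (rule prod.mono_neutral_cong_right) (use polyfun_coord assms in auto)
    then show "box_monom J (\<lambda>i. if i = j then 1 else 0) v = v j" by simp
  qed
  ultimately show ?case using fun_vec.span_base by metis
next
  case (polyfun_add f g)
  then obtain e e' where "f \<in> fun_vec.span (box_monoms J e)" "g \<in> fun_vec.span (box_monoms J e')" by auto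
  then have "f \<in> fun_vec.span (box_monoms J (max e e'))" "g \<in> fun_vec.span (box_monoms J (max e e'))"
    using fun_vec.span_mono[OF box_monoms_mono] by (meson max.cobounded1 max.cobounded2 subsetD)+
  then have "f + g \<in> fun_vec.span (box_monoms J (max e e'))" by (rule fun_vec.span_add)
  then show ?case by (auto simp: plus_fun_def)
next
  case (polyfun_mult f g)
  then show ?case using box_monoms_mult by metis
qed

lemma box_monom_prod_span:
  fixes F :: "nat \<Rightarrow> ('i \<Rightarrow> 'k::field) \<Rightarrow> 'k"
  assumes "\<And>j. j < k \<Longrightarrow> F j \<in> fun_vec.span (box_monoms J e)" "\<And>j. j < k \<Longrightarrow> m j \<le> D"
  shows "(\<lambda>v. \<Prod>j<k. F j v ^ m j) \<in> fun_vec.span (box_monoms J (k * e * D))"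
proof -
  have pow: "(\<lambda>v. F j v ^ l) \<in> fun_vec.span (box_monoms J (e * l))" if "j < k" for j l
  proof (induction l)
    case 0
    then show ?case using fun_vec.span_base[OF one_in_box_monoms] by simp
  next
    case (Suc l)
    from box_monoms_mult[OF assms(1)[OF that] Suc] show ?case by simp
  qed
  have "l \<le> k \<Longrightarrow> (\<lambda>v. \<Prod>j<l. F j v ^ m j) \<in> fun_vec.span (box_monoms J (l * e * D))" for l
  proof (induction l)
    case 0
    then show ?case using fun_vec.span_base[OF one_in_box_monoms] by simp
  next
    case (Suc l)
    have "(\<lambda>v. F l v ^ m l) \<in> fun_vec.span (box_monoms J (e * D))"
      using pow[of l "m l"] Suc.prems assms(2)[of l]
        fun_vec.span_mono[OF box_monoms_mono[of "e * m l" "e * D" J]] by auto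
    with Suc have "(\<lambda>v. (\<Prod>j<l. F j v ^ m j) * F l v ^ m l) \<in> fun_vec.span (box_monoms J (l * e * D + e * D))"
      by (intro box_monoms_mult) auto
    then show ?case by (simp add: algebra_simps)
  qed
  then show ?thesis by simp
qed

text \<open>Induction on the variables: replacing coordinate \<open>j\<close> by \<open>t\<close>
  gives a polynomial in \<open>t\<close> that vanishes identically, so the part with exponent
  \<open>l\<close> at \<open>j\<close> vanishes by itself for every \<open>l\<close>.\<close>

lemma box_monom_independent:
  fixes c :: "('i \<Rightarrow> nat) \<Rightarrow> 'k::field_char_0"
  assumes "finite J" "\<And>y. (\<Sum>m\<in>J \<rightarrow>\<^sub>E {..D}. c m * box_monom J m y) = 0" "m \<in> J \<rightarrow>\<^sub>E {..D}"
  shows "c m = 0"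
  using assms
proof (induction J arbitrary: c m rule: finite_induct)
  case empty
  then show ?case by (simp add: box_monom_def)
next
  case (insert j J)
  have bm: "box_monom (insert j J) (m(j := l)) (y(j := t)) = t ^ l * box_monom J m y" for m l y and t :: 'k
  proof -
    have "(\<Prod>i\<in>J. (y(j := t)) i ^ (m(j := l)) i) = (\<Prod>i\<in>J. y i ^ m i)"
      using insert.hyps by (intro prod.cong) auto
    then show ?thesis using insert.hyps by (simp add: box_monom_def)
  qed
  have inj: "inj_on (\<lambda>(l, m). m(j := l)) ({..D} \<times> (J \<rightarrow>\<^sub>E {..D}))"
    using insert.hyps inj_combinator[of j J "\<lambda>_. {..D}"] by simp
  define S where "S = (\<lambda>l y. \<Sum>m\<in>J \<rightarrow>\<^sub>E {..D}. c (m(j := l)) * box_monom J m y)"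
  have S0: "S l y = 0" if "l \<le> D" for l y
  proof -
    define p where "p = (\<Sum>l\<le>D. Polynomial.monom (S l y) l)"
    have "poly p t = 0" for t
    proof -
      have "poly p t = (\<Sum>l\<le>D. \<Sum>m\<in>J \<rightarrow>\<^sub>E {..D}. c (m(j := l)) * box_monom (insert j J) (m(j := l)) (y(j := t)))"
        unfolding bm by (simp add: p_def poly_sum poly_monom S_def sum_distrib_left sum_distrib_right ac_simps)
      also have "\<dots> = (\<Sum>m\<in>insert j J \<rightarrow>\<^sub>E {..D}. c m * box_monom (insert j J) m (y(j := t)))"
        unfolding PiE_insert_eq sum.reindex[OF inj]
        by (simp add: sum.cartesian_product case_prod_unfold comp_def)
      finally show ?thesis using insert.prems(1) by simp
    qed
    then have "p = 0" by (rule poly_function_eq_0)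
    then have "coeff p l = 0" by simp
    then show ?thesis using that by (simp add: p_def coeff_sum)
  qed
  from insert.prems(2) obtain l m' where m: "m = m'(j := l)" "l \<le> D" "m' \<in> J \<rightarrow>\<^sub>E {..D}"
    unfolding PiE_insert_eq by auto
  show ?case
    using insert.IH[of "\<lambda>m. c (m(j := l))" m'] S0[OF m(2)] m(3)
    unfolding m(1) S_def by blast
qed

text \<open>Algebraic independence of the restrictions of the first \<open>k\<close> functions to
  \<open>C\<close>, that is, modulo the ideal of \<open>C\<close>. On \<open>UNIV\<close> it is the
  ordinary notion.\<close>

definition alg_indep_on :: "('i \<Rightarrow> 'k) set \<Rightarrow> (nat \<Rightarrow> ('i \<Rightarrow> 'k) \<Rightarrow> 'k::comm_ring_1) \<Rightarrow> nat \<Rightarrow> bool" where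
  "alg_indep_on C F k \<longleftrightarrow>
     (\<forall>P\<in>polyfun {..<k}. (\<forall>v\<in>C. P (\<lambda>j. F j v) = 0) \<longrightarrow> (\<forall>y. P y = 0))"

text \<open>
  The \<open>(D + 1)\<^sup>k\<close> monomials with exponents at most \<open>D\<close> in the \<open>F j\<close> are polynomials in
  \<open>card J\<close> variables with exponents at most \<open>k * e * D\<close>; for large \<open>D\<close> there are too many of them.
\<close>

lemma alg_dependent_if_few_variables:
  fixes F :: "nat \<Rightarrow> ('j \<Rightarrow> 'k::field_char_0) \<Rightarrow> 'k"
  assumes "finite J" "card J < k" "\<And>j. j < k \<Longrightarrow> F j \<in> polyfun J"
  shows "\<not> alg_indep_on UNIV F k"
proof -
  have "\<forall>j\<in>{..<k}. \<exists>e. F j \<in> fun_vec.span (box_monoms J e)"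
    using polyfun_in_span_box_monoms[OF assms(3) assms(1)] by auto
  then obtain e' where e': "\<And>j. j < k \<Longrightarrow> F j \<in> fun_vec.span (box_monoms J (e' j))"
    by (metis lessThan_iff)
  define e where "e = Max (e' ` {..<k})"
  have e: "F j \<in> fun_vec.span (box_monoms J e)" if "j < k" for j
    using e'[OF that] fun_vec.span_mono[OF box_monoms_mono[of "e' j" e J]] that
    by (auto simp: e_def)
  \<comment> \<open>Chosen so that the bound \<open>((k * e + 1) * (D + 1)) ^ card J\<close> becomes
    \<open>D * (D + 1) ^ card J\<close>, which stays below
    \<open>(D + 1) ^ Suc (card J)\<close>.\<close>
  define D where "D = (k * e + 1) ^ card J"
  define A where "A = ({..<k} \<rightarrow>\<^sub>E {..D})"
  define V where "V = (\<lambda>m v. \<Prod>j<k. F j v ^ m j)"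
  have "\<not> indep_fam A V"
  proof
    assume "indep_fam A V"
    then have "card A \<le> card (box_monoms J (k * e * D) :: (('j \<Rightarrow> 'k) \<Rightarrow> 'k) set)"
    proof (rule indep_fam_card_le)
      show "finite A" by (simp add: A_def finite_PiE)
      show "finite (box_monoms J (k * e * D) :: (('j \<Rightarrow> 'k) \<Rightarrow> 'k) set)"
        using assms(1) by (rule finite_box_monoms)
      fix m assume "m \<in> A"
      then show "V m \<in> fun_vec.span (box_monoms J (k * e * D))"
        unfolding V_def A_def by (intro box_monom_prod_span e) (auto simp: PiE_def Pi_def)
    qed
    also have "\<dots> \<le> (k * e * D + 1) ^ card J" by (rule card_box_monoms[OF assms(1)])
    also have "\<dots> \<le> ((k * e + 1) * (D + 1)) ^ card J" by (intro power_mono) (auto simp: algebra_simps)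
    also have "\<dots> = D * (D + 1) ^ card J" by (simp only: power_mult_distrib D_def)
    also have "\<dots> < (D + 1) ^ Suc (card J)" by simp
    also have "\<dots> \<le> (D + 1) ^ k" using assms(2) by (intro power_increasing) auto
    also have "\<dots> = card A" by (simp add: A_def card_PiE)
    finally show False by simp
  qed
  then obtain c m where c: "\<And>v. (\<Sum>m\<in>A. c m * V m v) = 0" and m: "m \<in> A" "c m \<noteq> 0"
    unfolding indep_fam_def by blast
  define P where "P = (\<lambda>y. \<Sum>m\<in>A. c m * box_monom {..<k} m y)"
  have "P \<in> polyfun {..<k}" unfolding P_def box_monom_def by (intro polyfun_intros) auto
  moreover have "P (\<lambda>j. F j v) = 0" for v using c[of v] by (simp add: P_def box_monom_def V_def)
  moreover have "\<exists>y. P y \<noteq> 0"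
    using box_monom_independent[of "{..<k}" c D m] m unfolding P_def A_def by auto
  ultimately show ?thesis unfolding alg_indep_on_def by blast
qed

text \<open>
  This replaces the additivity of transcendence degrees: an element of the ideal of a smaller closed
  set is transcendental over any polynomials that stay independent on the smaller set.
\<close>

lemma alg_indep_on_extend:
  fixes F :: "nat \<Rightarrow> ('i \<Rightarrow> 'k::idom) \<Rightarrow> 'k"
  assumes F: "\<And>j. j < k \<Longrightarrow> F j \<in> polyfun I" and indep: "alg_indep_on C F k" and "C \<subseteq> C'"
    and f: "\<And>v. v \<in> C \<Longrightarrow> f v = 0"
    and cancel: "\<And>Q. Q \<in> polyfun I \<Longrightarrow> (\<And>v. v \<in> C' \<Longrightarrow> f v * Q v = 0) \<Longrightarrow> (\<And>v. v \<in> C' \<Longrightarrow> Q v = 0)"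
    and fI: "f \<in> polyfun I"
  shows "alg_indep_on C' (F(k := f)) (Suc k)"
  unfolding alg_indep_on_def
proof (intro ballI impI allI)
  fix P :: "(nat \<Rightarrow> 'k) \<Rightarrow> 'k" and y
  assume P: "P \<in> polyfun {..<Suc k}" "\<forall>v\<in>C'. P (\<lambda>j. (F(k := f)) j v) = 0"
  obtain D a where a: "\<And>l. a l \<in> polyfun {..<k}" "\<And>y. P y = (\<Sum>l\<le>D. a l y * y k ^ l)"
    using polyfun_expand_var[of P k "{..<k}"] P(1) by (auto simp: lessThan_Suc)
  have aF: "a l (\<lambda>j. (F(k := f)) j v) = a l (\<lambda>j. F j v)" for l v
    by (rule polyfun_cong[OF a(1)]) auto
  have aFI: "(\<lambda>v. a l (\<lambda>j. F j v)) \<in> polyfun I" if "a l \<in> polyfun {..<k}" for a :: "nat \<Rightarrow> (nat \<Rightarrow> 'k) \<Rightarrow> 'k" and l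
    by (rule polyfun_compose[OF that]) (use F in auto)
  have "\<forall>l\<le>D. \<forall>y. a l y = 0"
    if "\<And>l. a l \<in> polyfun {..<k}" "\<And>v. v \<in> C' \<Longrightarrow> (\<Sum>l\<le>D. a l (\<lambda>j. F j v) * f v ^ l) = 0"
    for D and a :: "nat \<Rightarrow> (nat \<Rightarrow> 'k) \<Rightarrow> 'k"
    using that
  proof (induction D arbitrary: a)
    case 0
    then have "\<forall>v\<in>C. a 0 (\<lambda>j. F j v) = 0" using \<open>C \<subseteq> C'\<close> by auto
    then show ?case using indep 0(1) unfolding alg_indep_on_def by auto
  next
    case (Suc D)
    have shift: "(\<Sum>l\<le>Suc D. a l (\<lambda>j. F j v) * f v ^ l) =
        a 0 (\<lambda>j. F j v) + f v * (\<Sum>l\<le>D. a (Suc l) (\<lambda>j. F j v) * f v ^ l)" for v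
      by (simp add: sum.atMost_Suc_shift sum_distrib_left ac_simps del: sum.atMost_Suc)
    \<comment> \<open>On \<open>C\<close> only the constant term survives, and independence on
      \<open>C\<close> kills it; the rest is a multiple of \<open>f\<close>, which can be cancelled
      on \<open>C'\<close>.\<close>
    have "\<forall>v\<in>C. a 0 (\<lambda>j. F j v) = 0"
    proof
      fix v assume "v \<in> C"
      then show "a 0 (\<lambda>j. F j v) = 0"
        using Suc.prems(2)[of v] \<open>C \<subseteq> C'\<close> f[of v] unfolding shift by auto
    qed
    then have a0: "\<forall>y. a 0 y = 0" using indep Suc.prems(1) unfolding alg_indep_on_def by auto
    have "(\<lambda>v. \<Sum>l\<le>D. a (Suc l) (\<lambda>j. F j v) * f v ^ l) \<in> polyfun I"
      using aFI[OF Suc.prems(1)] fI by (intro polyfun_intros) auto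
    from cancel[OF this] have "(\<Sum>l\<le>D. a (Suc l) (\<lambda>j. F j v) * f v ^ l) = 0" if "v \<in> C'" for v
      using Suc.prems(2) a0 that unfolding shift by auto
    from Suc.IH[of "\<lambda>l. a (Suc l)", OF Suc.prems(1) this] have "\<forall>l\<le>D. \<forall>y. a (Suc l) y = 0" by simp
    with a0 show ?case by (metis Suc_le_mono not0_implies_Suc)
  qed
  moreover have "(\<Sum>l\<le>D. a l (\<lambda>j. F j v) * f v ^ l) = 0" if "v \<in> C'" for v
    using P(2)[rule_format, OF that] unfolding a(2) aF by simp
  ultimately have "\<forall>l\<le>D. \<forall>y. a l y = 0" using a(1) by blast
  then show "P y = 0" by (simp add: a(2))
qed

section \<open>Directional derivatives\<close>

text \<open>The derivative along \<open>w\<close>, read off as the linear coefficient of the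
  restriction to a line: no limits are involved. It is a relation because the restriction has to be
  polynomial in the first place.\<close>

definition has_dd :: "(('i \<Rightarrow> 'k) \<Rightarrow> 'k::comm_ring_1) \<Rightarrow> ('i \<Rightarrow> 'k) \<Rightarrow> ('i \<Rightarrow> 'k) \<Rightarrow> 'k \<Rightarrow> bool" where
  "has_dd f u w c \<longleftrightarrow> (\<exists>r. (\<forall>t. f (\<lambda>i. u i + t * w i) = poly r t) \<and> coeff r 1 = c)"

lemma has_dd_unique:
  fixes c :: "'k::field_char_0"
  assumes "has_dd f u w c" "has_dd f u w d" shows "c = d"
proof -
  obtain r s where r: "\<forall>t. f (\<lambda>i. u i + t * w i) = poly r t" "coeff r 1 = c"
    and s: "\<forall>t. f (\<lambda>i. u i + t * w i) = poly s t" "coeff s 1 = d"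
    using assms by (auto simp: has_dd_def)
  then have "r - s = 0" by (intro poly_function_eq_0) (metis poly_diff right_minus_eq)
  then show ?thesis using r s by simp
qed

lemma has_dd_const: "has_dd (\<lambda>_. a) u w 0"
  unfolding has_dd_def by (intro exI[of _ "[:a:]"]) simp

lemma has_dd_coord: "has_dd (\<lambda>v. v j) u w (w j)"
  unfolding has_dd_def by (intro exI[of _ "[:u j, w j:]"]) simp

lemma has_dd_add:
  assumes "has_dd f u w c" "has_dd g u w d" shows "has_dd (\<lambda>v. f v + g v) u w (c + d)"
proof -
  obtain r s where "\<forall>t. f (\<lambda>i. u i + t * w i) = poly r t" "coeff r 1 = c"
    "\<forall>t. g (\<lambda>i. u i + t * w i) = poly s t" "coeff s 1 = d"
    using assms by (auto simp: has_dd_def)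
  then show ?thesis unfolding has_dd_def by (intro exI[of _ "r + s"]) simp
qed

lemma has_dd_mult:
  assumes "has_dd f u w c" "has_dd g u w d" shows "has_dd (\<lambda>v. f v * g v) u w (f u * d + c * g u)"
proof -
  obtain r s where r: "\<forall>t. f (\<lambda>i. u i + t * w i) = poly r t" "coeff r 1 = c"
    and s: "\<forall>t. g (\<lambda>i. u i + t * w i) = poly s t" "coeff s 1 = d"
    using assms by (auto simp: has_dd_def)
  have "f u = coeff r 0" "g u = coeff s 0"
    using r(1)[rule_format, of 0] s(1)[rule_format, of 0] by (simp_all add: poly_0_coeff_0)
  then show ?thesis
    unfolding has_dd_def using r s by (intro exI[of _ "r * s"]) (simp add: coeff_mult)
qed

lemma has_dd_cmult: "has_dd f u w c \<Longrightarrow> has_dd (\<lambda>v. a * f v) u w (a * c)"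
  using has_dd_mult[OF has_dd_const[of a u w], of f c] by simp

lemma has_dd_diff: "has_dd f u w c \<Longrightarrow> has_dd g u w d \<Longrightarrow> has_dd (\<lambda>v. f v - g v) u w (c - d)"
  using has_dd_add[of f u w c "\<lambda>v. - 1 * g v" "- 1 * d"] has_dd_cmult[of g u w d "- 1"] by simp

lemma has_dd_sum:
  assumes "\<And>a. a \<in> A \<Longrightarrow> has_dd (f a) u w (c a)"
  shows "has_dd (\<lambda>v. \<Sum>a\<in>A. f a v) u w (\<Sum>a\<in>A. c a)"
  using assms
  by (induction A rule: infinite_finite_induct) (auto intro: has_dd_const has_dd_add)

lemma has_dd_prod:
  assumes "finite A" "\<And>a. a \<in> A \<Longrightarrow> has_dd (f a) u w (c a)"
  shows "has_dd (\<lambda>v. \<Prod>a\<in>A. f a v) u w (\<Sum>a\<in>A. c a * (\<Prod>b\<in>A - {a}. f b u))"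
  using assms
proof (induction A rule: finite_induct)
  case empty
  then show ?case by (simp add: has_dd_const)
next
  case (insert a A)
  have "has_dd (\<lambda>v. f a v * (\<Prod>a\<in>A. f a v)) u w
      (f a u * (\<Sum>a\<in>A. c a * (\<Prod>b\<in>A - {a}. f b u)) + c a * (\<Prod>b\<in>A. f b u))"
    using insert by (intro has_dd_mult) auto
  moreover have "(\<Prod>b\<in>insert a A - {x}. f b u) = f a u * (\<Prod>b\<in>A - {x}. f b u)" if "x \<in> A" for x
  proof -
    have "insert a A - {x} = insert a (A - {x})" using insert.hyps that by auto
    then show ?thesis using insert.hyps by simp
  qed
  then have "(\<Sum>x\<in>A. c x * (\<Prod>b\<in>insert a A - {x}. f b u)) =
      f a u * (\<Sum>a\<in>A. c a * (\<Prod>b\<in>A - {a}. f b u))"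
    by (simp add: sum_distrib_left mult.left_commute cong: sum.cong)
  moreover have "insert a A - {a} = A" using insert.hyps by auto
  ultimately show ?case using insert.hyps by (simp add: add.commute)
qed

lemma has_dd_power: "has_dd f u w c \<Longrightarrow> has_dd (\<lambda>v. f v ^ k) u w (of_nat k * f u ^ (k - 1) * c)"
proof (induction k)
  case 0
  then show ?case by (simp add: has_dd_const)
next
  case (Suc k)
  then have "has_dd (\<lambda>v. f v * f v ^ k) u w (f u * (of_nat k * f u ^ (k - 1) * c) + c * f u ^ k)"
    by (intro has_dd_mult) auto
  moreover have "f u * (of_nat k * f u ^ (k - 1) * c) = of_nat k * f u ^ k * c"
    by (cases k) (auto simp: algebra_simps)
  ultimately show ?case by (simp add: algebra_simps)
qed

lemma has_dd_exists: "f \<in> polyfun J \<Longrightarrow> \<exists>c. has_dd f u w c"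
  by (induction rule: polyfun.induct)
     (blast intro: has_dd_const, blast intro: has_dd_coord, metis has_dd_add, metis has_dd_mult)

text \<open>\<open>c\<close> is the image of the direction \<open>w\<close> under the derivative of
  \<open>G\<close>. Induction over \<open>f\<close> produces some common value of both derivatives,
  and uniqueness identifies it with \<open>d\<close>.\<close>

lemma has_dd_chain:
  fixes G :: "('j \<Rightarrow> 'k::field_char_0) \<Rightarrow> 'i \<Rightarrow> 'k"
  assumes "f \<in> polyfun I" "has_dd f (G u) c d" "\<And>i. i \<in> I \<Longrightarrow> has_dd (\<lambda>u. G u i) u w (c i)"
  shows "has_dd (\<lambda>u. f (G u)) u w d"
proof -
  have "\<exists>d. has_dd f (G u) c d \<and> has_dd (\<lambda>u. f (G u)) u w d"
    using assms(1)
  proof induction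
    case (polyfun_const a)
    show ?case by (intro exI[of _ 0] conjI has_dd_const)
  next
    case (polyfun_coord j)
    then show ?case by (intro exI[of _ "c j"] conjI has_dd_coord assms(3))
  next
    case (polyfun_add f g)
    then obtain a b where "has_dd f (G u) c a" "has_dd (\<lambda>u. f (G u)) u w a"
      "has_dd g (G u) c b" "has_dd (\<lambda>u. g (G u)) u w b" by blast
    then show ?case by (intro exI[of _ "a + b"] conjI has_dd_add)
  next
    case (polyfun_mult f g)
    then obtain a b where "has_dd f (G u) c a" "has_dd (\<lambda>u. f (G u)) u w a"
      "has_dd g (G u) c b" "has_dd (\<lambda>u. g (G u)) u w b" by blast
    then show ?case by (intro exI[of _ "f (G u) * b + a * g (G u)"] conjI has_dd_mult)
  qed
  then obtain d' where d': "has_dd f (G u) c d'" "has_dd (\<lambda>u. f (G u)) u w d'" by blast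
  from has_dd_unique[OF this(1) assms(2)] this(2) show ?thesis by simp
qed

text \<open>Connects the formal partial derivatives in the definition of tangent spaces with
  \<open>has_dd\<close>, for which product and chain rules are at hand.\<close>

lemma has_dd_eval_form:
  fixes f :: "('i, 'k::field_char_0) mpoly"
  assumes "f \<in> forms I d" "finite I"
  shows "has_dd (eval_mpoly f) v w (\<Sum>i\<in>I. eval_mpoly (partial_deriv i f) v * w i)"
proof -
  define a where "a = Poly_Mapping.lookup f"
  define e where "e = (\<lambda>m::'i \<Rightarrow>\<^sub>0 nat. Poly_Mapping.lookup m)"
  define c where "c = (\<lambda>m. \<Sum>i\<in>I. of_nat (e m i) * v i ^ (e m i - 1) * w i * (\<Prod>j\<in>I - {i}. v j ^ e m j))"
  have keys: "Poly_Mapping.keys m \<subseteq> I" if "m \<in> Poly_Mapping.keys f" for m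
    using assms(1) that by (auto simp: forms_def)
  have "has_dd (\<lambda>v. \<Prod>i\<in>I. v i ^ e m i) v w (c m)" for m
    unfolding c_def by (intro has_dd_prod assms(2) has_dd_power has_dd_coord)
  then have "has_dd (\<lambda>v. \<Sum>m\<in>Poly_Mapping.keys f. a m * (\<Prod>i\<in>I. v i ^ e m i)) v w
      (\<Sum>m\<in>Poly_Mapping.keys f. a m * c m)"
    by (intro has_dd_sum has_dd_cmult)
  moreover have "eval_mpoly f = (\<lambda>v. \<Sum>m\<in>Poly_Mapping.keys f. a m * (\<Prod>i\<in>I. v i ^ e m i))"
    unfolding eval_mpoly_def a_def e_def
    by (intro ext sum.cong refl arg_cong2[of _ _ _ _ "(*)"] eval_monom_superset assms(2) keys)
  moreover have "(\<Sum>m\<in>Poly_Mapping.keys f. a m * c m) =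
      (\<Sum>i\<in>I. eval_mpoly (partial_deriv i f) v * w i)"
  proof -
    have *: "of_nat (e m i) * eval_monom v (m - Poly_Mapping.single i 1) =
        of_nat (e m i) * v i ^ (e m i - 1) * (\<Prod>j\<in>I - {i}. v j ^ e m j)"
      if "m \<in> Poly_Mapping.keys f" "i \<in> I" for m i
    proof -
      have sub: "Poly_Mapping.keys (m - Poly_Mapping.single i 1) \<subseteq> I"
        using keys[OF that(1)] by (auto simp: in_keys_iff lookup_minus)
      have "eval_monom v (m - Poly_Mapping.single i 1) =
          (\<Prod>j\<in>I. v j ^ Poly_Mapping.lookup (m - Poly_Mapping.single i 1) j)"
        by (rule eval_monom_superset[OF assms(2) sub])
      also have "\<dots> = v i ^ (e m i - 1) * (\<Prod>j\<in>I - {i}. v j ^ e m j)"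
        unfolding prod.remove[OF assms(2) that(2)]
        by (intro arg_cong2[of _ _ _ _ "(*)"] prod.cong)
           (auto simp: e_def lookup_minus lookup_single)
      finally show ?thesis by simp
    qed
    have "(\<Sum>i\<in>I. eval_mpoly (partial_deriv i f) v * w i) =
        (\<Sum>i\<in>I. \<Sum>m\<in>Poly_Mapping.keys f. a m * (of_nat (e m i) * eval_monom v (m - Poly_Mapping.single i 1)) * w i)"
      unfolding partial_deriv_def eval_mpoly_sum sum_distrib_right
      by (simp add: a_def e_def mult.assoc mult.left_commute)
    also have "\<dots> = (\<Sum>i\<in>I. \<Sum>m\<in>Poly_Mapping.keys f. a m * (of_nat (e m i) * v i ^ (e m i - 1) * w i * (\<Prod>j\<in>I - {i}. v j ^ e m j)))"
      by (intro sum.cong refl) (subst *, auto)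
    also have "\<dots> = (\<Sum>m\<in>Poly_Mapping.keys f. a m * c m)"
      unfolding c_def sum_distrib_left by (rule sum.swap)
    finally show ?thesis by simp
  qed
  ultimately show ?thesis by simp
qed

section \<open>Linearly independent families\<close>

lemma indep_fam_nonzero:
  assumes "indep_fam A v" "finite A" "a \<in> A" shows "\<exists>i. v a i \<noteq> 0"
proof (rule ccontr)
  assume "\<nexists>i. v a i \<noteq> 0"
  then have "(\<Sum>b\<in>A. (if b = a then 1 else 0) * v b i) = 0" for i
    by (intro sum.neutral) auto
  from indep_famD[OF assms(1) this assms(3)] show False by simp
qed

text \<open>The new vector minus its expansion by the known functionals is nonzero, say at
  coordinate \<open>j\<close>. That coordinate, corrected to vanish on the old vectors and
  normalised, is the new functional; the old ones are then corrected by multiples of it.\<close>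

lemma indep_fam_dual:
  assumes "finite A" "indep_fam A v" "finite I" "\<And>a i. a \<in> A \<Longrightarrow> i \<notin> I \<Longrightarrow> v a i = 0"
  shows "\<exists>\<mu>. \<forall>a\<in>A. \<forall>b\<in>A. (\<Sum>i\<in>I. \<mu> a i * v b i) = (if a = b then 1 else 0 :: 'k::field)"
  using assms(1,2,4)
proof (induction A rule: finite_induct)
  case empty
  then show ?case by simp
next
  case (insert a A)
  have "indep_fam A v" using indep_fam_subset[OF insert.prems(1)] insert.hyps by auto
  with insert obtain \<mu> where \<mu>: "\<And>b c. b \<in> A \<Longrightarrow> c \<in> A \<Longrightarrow> (\<Sum>i\<in>I. \<mu> b i * v c i) = (if b = c then 1 else 0)"
    by (metis insertI2)
  define M where "M = (\<lambda>b. \<Sum>i\<in>I. \<mu> b i * v a i)"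
  define w where "w = (\<lambda>i. v a i - (\<Sum>b\<in>A. M b * v b i))"
  obtain j where j: "w j \<noteq> 0"
  proof (rule ccontr)
    assume "\<not> thesis"
    then have w0: "w i = 0" for i using that by blast
    have "(\<Sum>b\<in>insert a A. (if b = a then 1 else - M b) * v b i) = 0" for i
    proof -
      have "(\<Sum>b\<in>A. (if b = a then 1 else - M b) * v b i) = - (\<Sum>b\<in>A. M b * v b i)"
        unfolding sum_negf[symmetric] using insert.hyps by (intro sum.cong) auto
      then show ?thesis using insert.hyps w0[of i] by (simp add: w_def)
    qed
    from indep_famD[OF insert.prems(1) this, of a] show False by simp
  qed
  have jI: "j \<in> I"
  proof (rule ccontr)
    assume "j \<notin> I"
    then have "v b j = 0" if "b \<in> insert a A" for b using insert.prems(2) that by blast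
    then have "w j = 0" by (simp add: w_def)
    with j show False by simp
  qed
  define \<nu> where "\<nu> = (\<lambda>i. ((if i = j then 1 else 0) - (\<Sum>b\<in>A. v b j * \<mu> b i)) / w j)"
  have \<nu>: "(\<Sum>i\<in>I. \<nu> i * x i) = (x j - (\<Sum>b\<in>A. v b j * (\<Sum>i\<in>I. \<mu> b i * x i))) / w j" for x
  proof -
    have 1: "(\<Sum>i\<in>I. (if i = j then 1 else 0) * x i) = x j"
      using jI assms(3) by (simp add: if_distrib[of "\<lambda>y. y * _"] sum.delta cong: if_cong)
    have 2: "(\<Sum>i\<in>I. (\<Sum>b\<in>A. v b j * \<mu> b i) * x i) = (\<Sum>b\<in>A. v b j * (\<Sum>i\<in>I. \<mu> b i * x i))"
      unfolding sum_distrib_right sum_distrib_left mult.assoc by (rule sum.swap)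
    have "(\<Sum>i\<in>I. \<nu> i * x i) = (\<Sum>i\<in>I. ((if i = j then 1 else 0) * x i - (\<Sum>b\<in>A. v b j * \<mu> b i) * x i)) / w j"
      unfolding \<nu>_def by (simp add: sum_divide_distrib left_diff_distrib)
    then show ?thesis unfolding sum_subtractf 1 2 .
  qed
  have \<nu>A: "(\<Sum>i\<in>I. \<nu> i * v c i) = 0" if "c \<in> A" for c
  proof -
    have "(\<Sum>b\<in>A. v b j * (\<Sum>i\<in>I. \<mu> b i * v c i)) = (\<Sum>b\<in>A. if b = c then v b j else 0)"
      by (rule sum.cong) (auto simp: \<mu> that)
    then show ?thesis unfolding \<nu> using that insert.hyps by (simp add: sum.delta)
  qed
  have \<nu>a: "(\<Sum>i\<in>I. \<nu> i * v a i) = 1"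
    unfolding \<nu> using j by (simp add: w_def M_def mult.commute)
  define \<mu>' where "\<mu>' = (\<lambda>b i. if b = a then \<nu> i else \<mu> b i - M b * \<nu> i)"
  have \<mu>'b: "(\<Sum>i\<in>I. \<mu>' b i * x i) = (\<Sum>i\<in>I. \<mu> b i * x i) - M b * (\<Sum>i\<in>I. \<nu> i * x i)" if "b \<in> A" for b x
  proof -
    have "b \<noteq> a" using that insert.hyps by auto
    then show ?thesis
      by (simp add: \<mu>'_def left_diff_distrib sum_subtractf sum_distrib_left mult.assoc)
  qed
  show ?case
  proof (intro exI[of _ \<mu>'] ballI)
    fix b c assume bc: "b \<in> insert a A" "c \<in> insert a A"
    show "(\<Sum>i\<in>I. \<mu>' b i * v c i) = (if b = c then 1 else 0)"
    proof (cases "b = a")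
      case True
      then show ?thesis using bc \<nu>A \<nu>a insert.hyps by (auto simp: \<mu>'_def)
    next
      case False
      then have b: "b \<in> A" using bc by auto
      show ?thesis
        unfolding \<mu>'b[OF b] using bc b \<mu>[OF b] \<nu>A \<nu>a insert.hyps by (auto simp: M_def)
    qed
  qed
qed

text \<open>Openness of independence by elimination instead of determinants: with a nonzero pivot
  \<open>V u0 a i\<close> the other vectors are cleared at coordinate \<open>i\<close> without
  division, and \<open>g\<close> is the product of the successive pivots.\<close>

lemma generic_indep_fam:
  fixes V :: "('j \<Rightarrow> 'k::field) \<Rightarrow> 'a \<Rightarrow> 'i \<Rightarrow> 'k"
  assumes "finite A" "\<And>a i. a \<in> A \<Longrightarrow> (\<lambda>u. V u a i) \<in> polyfun J" "indep_fam A (V u0)"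
  shows "\<exists>g\<in>polyfun J. g u0 \<noteq> 0 \<and> (\<forall>u. g u \<noteq> 0 \<longrightarrow> indep_fam A (V u))"
  using assms
proof (induction A arbitrary: V rule: finite_induct)
  case empty
  have "(\<lambda>_. 1) \<in> polyfun J" by (rule polyfun_intros)
  then show ?case by (intro bexI[of _ "\<lambda>_. 1"]) (auto simp: indep_fam_def)
next
  case (insert a A)
  obtain i where i: "V u0 a i \<noteq> 0"
    using indep_fam_nonzero[OF insert.prems(2)] insert.hyps by auto
  define V' where "V' = (\<lambda>u b j. V u a i * V u b j - V u b i * V u a j)"
  have V'sum: "(\<Sum>b\<in>A. c b * V' u b j) = V u a i * (\<Sum>b\<in>A. c b * V u b j) - (\<Sum>b\<in>A. c b * V u b i) * V u a j" for c u j
    by (simp add: V'_def sum_distrib_left sum_distrib_right sum_subtractf[symmetric] algebra_simps)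
  have "indep_fam A (V' u0)"
  proof (rule indep_famI)
    fix c b assume c: "\<And>j. (\<Sum>b\<in>A. c b * V' u0 b j) = 0" and b: "b \<in> A"
    let ?c = "\<lambda>b. if b = a then - (\<Sum>b\<in>A. c b * V u0 b i) else V u0 a i * c b"
    have "(\<Sum>b\<in>insert a A. ?c b * V u0 b j) = 0" for j
    proof -
      have "(\<Sum>b\<in>A. ?c b * V u0 b j) = V u0 a i * (\<Sum>b\<in>A. c b * V u0 b j)"
        unfolding sum_distrib_left using insert.hyps by (intro sum.cong) auto
      then show ?thesis using c[of j] insert.hyps by (simp add: V'sum)
    qed
    from indep_famD[OF insert.prems(2) this, of b] b have "?c b = 0" by blast
    then show "c b = 0" using b insert.hyps i by (cases "b = a") auto
  qed
  moreover have "(\<lambda>u. V' u b j) \<in> polyfun J" if "b \<in> A" for b j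
    unfolding V'_def using insert.prems(1) that by (intro polyfun_intros) auto
  ultimately obtain g where g: "g \<in> polyfun J" "g u0 \<noteq> 0" "\<And>u. g u \<noteq> 0 \<Longrightarrow> indep_fam A (V' u)"
    using insert.IH[of V'] by blast
  have "indep_fam (insert a A) (V u)" if u: "g u * V u a i \<noteq> 0" for u
  proof (rule indep_famI)
    fix c b assume c: "\<And>j. (\<Sum>b\<in>insert a A. c b * V u b j) = 0" and b: "b \<in> insert a A"
    have S: "(\<Sum>b\<in>A. c b * V u b j) = - c a * V u a j" for j
      using c[of j] insert.hyps by (simp add: eq_neg_iff_add_eq_0 add.commute)
    have "(\<Sum>b\<in>A. c b * V' u b j) = 0" for j by (simp add: V'sum S)
    then have A0: "c b = 0" if "b \<in> A" for b using indep_famD[OF g(3)] u that by auto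
    then have "c a * V u a i = 0" using c[of i] insert.hyps by simp
    then show "c b = 0" using u b A0 by auto
  qed
  moreover have "(\<lambda>u. g u * V u a i) \<in> polyfun J"
    using g(1) insert.prems(1) by (intro polyfun_intros) auto
  ultimately show ?case using g(2) i by (intro bexI[of _ "\<lambda>u. g u * V u a i"]) auto
qed

text \<open>
  After a linear change of coordinates, \<open>F j (\<Psi> (y0 + t w)) = t w j + O(t\<^sup>2)\<close>, so the lowest
  homogeneous component of a relation between the \<open>F j\<close> would vanish at every \<open>w\<close>.
\<close>

lemma alg_indep_if_derivative_injective:
  fixes \<Psi> :: "(nat \<Rightarrow> 'k::field_char_0) \<Rightarrow> 'i \<Rightarrow> 'k"
  assumes "finite I" and indep: "indep_fam {..<k} L" and L0: "\<And>j i. i \<notin> I \<Longrightarrow> L j i = 0"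
    and dd: "\<And>w i. i \<in> I \<Longrightarrow> has_dd (\<lambda>y. \<Psi> y i) y0 w (\<Sum>j<k. w j * L j i)"
  shows "\<exists>F. (\<forall>j. F j \<in> polyfun I) \<and> alg_indep_on (range \<Psi>) F k"
proof -
  obtain \<mu> where \<mu>: "\<And>a b. a < k \<Longrightarrow> b < k \<Longrightarrow> (\<Sum>i\<in>I. \<mu> a i * L b i) = (if a = b then 1 else 0)"
    using indep_fam_dual[OF _ indep assms(1)] L0 by (metis finite_lessThan lessThan_iff)
  define F where "F = (\<lambda>j v. \<Sum>i\<in>I. \<mu> j i * (v i - \<Psi> y0 i))"
  have "alg_indep_on (range \<Psi>) F k"
    unfolding alg_indep_on_def
  proof (intro ballI impI)
    fix P :: "(nat \<Rightarrow> 'k) \<Rightarrow> 'k"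
    assume P: "P \<in> polyfun {..<k}" "\<forall>v\<in>range \<Psi>. P (\<lambda>j. F j v) = 0"
    obtain D h where h: "\<And>d. h d \<in> forms {..<k} d" "\<And>y. P y = (\<Sum>d\<le>D. eval_mpoly (h d) y)"
      using polyfun_homogeneous_components[OF P(1)] by blast
    have hcong: "eval_mpoly (h d) y = eval_mpoly (h d) y'" if "\<And>j. j < k \<Longrightarrow> y j = y' j" for d y y'
      by (rule polyfun_cong[OF eval_form_polyfun[OF h(1)]]) (use that in auto)
    have "d \<le> D \<longrightarrow> (\<forall>w. eval_mpoly (h d) w = 0)" for d
    proof (induction d rule: less_induct)
      case (less d)
      show ?case
      proof (intro impI allI)
        assume "d \<le> D"
        fix w
        have "\<exists>S. \<forall>t. F j (\<Psi> (\<lambda>i. y0 i + t * w i)) = t * poly S t \<and> poly S 0 = w j" if "j < k" for j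
        proof -
          have "has_dd (\<lambda>y. F j (\<Psi> y)) y0 w (\<Sum>i\<in>I. \<mu> j i * ((\<Sum>l<k. w l * L l i) - 0))"
            unfolding F_def by (intro has_dd_sum has_dd_cmult has_dd_diff dd has_dd_const)
          moreover have "(\<Sum>i\<in>I. \<mu> j i * ((\<Sum>l<k. w l * L l i) - 0)) = w j"
          proof -
            have "(\<Sum>i\<in>I. \<mu> j i * ((\<Sum>l<k. w l * L l i) - 0)) = (\<Sum>l<k. w l * (\<Sum>i\<in>I. \<mu> j i * L l i))"
              unfolding diff_zero sum_distrib_left by (subst sum.swap) (simp add: mult.left_commute)
            also have "\<dots> = (\<Sum>l<k. if l = j then w l else 0)"
              by (rule sum.cong) (auto simp: \<mu> that)
            finally show ?thesis using that by simp
          qed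
          ultimately obtain r where r: "\<And>t. F j (\<Psi> (\<lambda>i. y0 i + t * w i)) = poly r t" "coeff r 1 = w j"
            by (auto simp: has_dd_def)
          have "coeff r 0 = 0" using r(1)[of 0] by (simp add: F_def poly_0_coeff_0)
          obtain c S where rS: "r = pCons c S" by (cases r)
          with \<open>coeff r 0 = 0\<close> r show ?thesis
            by (intro exI[of _ S]) (auto simp: poly_0_coeff_0)
        qed
        then obtain S where S: "\<And>j t. j < k \<Longrightarrow> F j (\<Psi> (\<lambda>i. y0 i + t * w i)) = t * poly (S j) t"
          "\<And>j. j < k \<Longrightarrow> poly (S j) 0 = w j"
          by metis
        have "\<exists>q. \<forall>t. eval_mpoly (h e) (\<lambda>j. poly (S j) t) = poly q t" for e
          by (rule polyfun_along_polys[OF eval_form_polyfun[OF h(1)]]) auto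
        then obtain Q where Q: "\<And>e t. eval_mpoly (h e) (\<lambda>j. poly (S j) t) = poly (Q e) t" by metis
        have "poly (\<Sum>e\<le>D. Polynomial.monom 1 e * Q e) t = 0" for t
        proof -
          have "eval_mpoly (h e) (\<lambda>j. F j (\<Psi> (\<lambda>i. y0 i + t * w i))) = t ^ e * poly (Q e) t" for e
          proof -
            have "eval_mpoly (h e) (\<lambda>j. F j (\<Psi> (\<lambda>i. y0 i + t * w i))) =
                eval_mpoly (h e) (fun_scale t (\<lambda>j. poly (S j) t))"
              by (rule hcong) (simp add: S fun_scale_apply)
            then show ?thesis by (simp add: eval_mpoly_scale[OF h(1)] Q)
          qed
          moreover have "P (\<lambda>j. F j (\<Psi> (\<lambda>i. y0 i + t * w i))) = 0" using P(2) by auto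
          ultimately show ?thesis by (simp add: h(2) poly_sum poly_monom)
        qed
        then have 0: "(\<Sum>e\<le>D. Polynomial.monom 1 e * Q e) = 0" by (rule poly_function_eq_0)
        have Q0: "Q e = 0" if "e < d" for e
        proof (rule poly_function_eq_0)
          fix t show "poly (Q e) t = 0" using less that \<open>d \<le> D\<close> Q[of e t] by auto
        qed
        \<comment> \<open>Compare coefficients of \<open>t ^ d\<close>: terms with
          \<open>e < d\<close> vanish by induction, terms with \<open>e > d\<close> start in higher
          degree.\<close>
        have "0 = coeff (\<Sum>e\<le>D. Polynomial.monom 1 e * Q e) d" using 0 by simp
        also have "\<dots> = (\<Sum>e\<le>D. if e = d then coeff (Q d) 0 else 0)"
          unfolding coeff_sum
        proof (rule sum.cong)
          fix e
          show "coeff (Polynomial.monom 1 e * Q e) d = (if e = d then coeff (Q d) 0 else 0)"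
            by (cases e d rule: linorder_cases) (auto simp: coeff_monom_mult Q0)
        qed simp
        also have "\<dots> = poly (Q d) 0" using \<open>d \<le> D\<close> by (simp add: poly_0_coeff_0)
        also have "\<dots> = eval_mpoly (h d) w"
          unfolding Q[symmetric] by (rule hcong) (simp add: S)
        finally show "eval_mpoly (h d) w = 0" by simp
      qed
    qed
    then show "\<forall>y. P y = 0" by (simp add: h(2))
  qed
  moreover have "F j \<in> polyfun I" for j unfolding F_def by (intro polyfun_intros)
  ultimately show ?thesis by blast
qed

section \<open>The dimension of parametrised sets\<close>

lemma alg_indep_onD:
  assumes "alg_indep_on C F k" "P \<in> polyfun {..<k}" "\<And>v. v \<in> C \<Longrightarrow> P (\<lambda>j. F j v) = 0"
  shows "P y = 0"
  using assms unfolding alg_indep_on_def by simp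

lemma proj_spaceE:
  assumes "p \<in> proj_space I"
  obtains v where "p = fun_vec.span {v}" "v \<in> coord_space I" "v \<noteq> 0"
  using assms by (auto simp: proj_space_def)

lemma proj_space_span_eq:
  assumes "p \<in> proj_space I" "v \<in> p" "v \<noteq> (0 :: 'i \<Rightarrow> 'k::field)"
  shows "p = fun_vec.span {v}" "v \<in> coord_space I"
proof -
  obtain w where w: "p = fun_vec.span {w}" "w \<in> coord_space I" "w \<noteq> 0"
    using assms(1) by (rule proj_spaceE)
  obtain c where c: "v = fun_scale c w" using assms(2) w by (auto simp: fun_vec.span_singleton)
  have "c \<noteq> 0" using c assms(3) by auto
  then have "w = fun_scale (inverse c) v" by (auto simp: c fun_scale_def fun_eq_iff)
  then have "w \<in> fun_vec.span {v}" by (auto simp: fun_vec.span_singleton)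
  moreover have "v \<in> fun_vec.span {w}" using assms(2) w by simp
  ultimately show "p = fun_vec.span {v}"
    unfolding w(1) by (metis fun_vec.span_eq singletonD subsetI)
  show "v \<in> coord_space I" using c w(2) by (auto simp: coord_space_def fun_scale_def)
qed

lemma proj_space_scale:
  "p \<in> proj_space I \<Longrightarrow> v \<in> p \<Longrightarrow> fun_scale c v \<in> p"
  by (auto simp: proj_space_def fun_vec.span_scale)

lemma span_in_proj_space: "v \<in> coord_space I \<Longrightarrow> v \<noteq> 0 \<Longrightarrow> fun_vec.span {v} \<in> proj_space I"
  by (auto simp: proj_space_def)

lemma span_in_zero_locus:
  assumes "G \<subseteq> homogeneous_polys I" "v \<in> coord_space I" "v \<noteq> 0" "\<And>f. f \<in> G \<Longrightarrow> eval_mpoly f v = 0"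
  shows "fun_vec.span {v} \<in> zero_locus I G"
  using mem_zero_locus_span[OF assms(1-3)] assms(4) by blast

lemma closedin_sub_zariski:
  "closedin (subtopology (zariski I) Y) Z \<longleftrightarrow>
     (\<exists>G. G \<subseteq> homogeneous_polys I \<and> Z = Y \<inter> zero_locus I G)"
  unfolding closedin_subtopology closedin_zariski by blast

text \<open>On a cone the homogeneous components of a vanishing function vanish separately, so
  vanishing passes from \<open>C\<close> to \<open>C'\<close> as soon as it does so for forms. This
  covers the passage to Zariski closures.\<close>

lemma polyfun_zero_at_cone:
  fixes Q :: "('i \<Rightarrow> 'k::field_char_0) \<Rightarrow> 'k"
  assumes "Q \<in> polyfun I" "\<And>v c. v \<in> C \<Longrightarrow> fun_scale c v \<in> C" "\<And>v. v \<in> C \<Longrightarrow> Q v = 0"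
    and "\<And>f v. f \<in> homogeneous_polys I \<Longrightarrow> (\<And>w. w \<in> C \<Longrightarrow> eval_mpoly f w = 0) \<Longrightarrow> v \<in> C' \<Longrightarrow> eval_mpoly f v = 0"
    and "v \<in> C'"
  shows "Q v = 0"
proof -
  obtain D h where h: "\<And>d. h d \<in> forms I d" "\<And>v. Q v = (\<Sum>d\<le>D. eval_mpoly (h d) v)"
    using polyfun_homogeneous_components[OF assms(1)] by blast
  have "eval_mpoly (h d) w = 0" if "w \<in> C" "d \<le> D" for w d
    by (rule component_vanishes[OF h(1) _ that(2)]) (use h(2) assms(2,3) that in metis)
  then have "eval_mpoly (h d) v = 0" if "d \<le> D" for d
    using assms(4)[of "h d" v] assms(5) h(1) that unfolding homogeneous_polys_def by blast
  then show ?thesis by (simp add: h(2))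
qed

text \<open>The functions on the cone over an irreducible set form a domain. Irreducibility speaks
  about zero loci of forms, so it is applied to \<open>f\<close> and each homogeneous component of
  \<open>Q\<close>.\<close>

lemma irreducible_cancel:
  fixes Z :: "('i \<Rightarrow> 'k::field_char_0) set set"
  assumes irr: "irreducible_in (subtopology (zariski I) Y) Z"
    and f: "f \<in> homogeneous_polys I" and w: "w \<in> \<Union>Z" "eval_mpoly f w \<noteq> 0"
    and Q: "Q \<in> polyfun I" "\<And>v. v \<in> \<Union>Z \<Longrightarrow> eval_mpoly f v * Q v = 0" and v: "v \<in> \<Union>Z"
  shows "Q v = 0"
proof -
  have Zsub: "Z \<subseteq> proj_space I" "Z \<subseteq> Y"
    using irr by (auto simp: irreducible_in_def)
  obtain D h where h: "\<And>d. h d \<in> forms I d" "\<And>v. Q v = (\<Sum>d\<le>D. eval_mpoly (h d) v)"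
    using polyfun_homogeneous_components[OF Q(1)] by blast
  obtain e where e: "f \<in> forms I e" using f by (auto simp: homogeneous_polys_def)
  have prod: "eval_mpoly f v * eval_mpoly (h d) v = 0" if "v \<in> \<Union>Z" "d \<le> D" for v d
  proof (cases "eval_mpoly f v = 0")
    case False
    have "(\<Sum>d\<le>D. eval_mpoly (h d) (fun_scale c v)) = 0" if "c \<noteq> 0" for c
    proof -
      have "fun_scale c v \<in> \<Union>Z" using \<open>v \<in> \<Union>Z\<close> Zsub proj_space_scale by blast
      then have "eval_mpoly f (fun_scale c v) * Q (fun_scale c v) = 0" by (rule Q(2))
      then show ?thesis using False that by (simp add: eval_mpoly_scale[OF e] h(2))
    qed
    from component_vanishes[OF h(1) this that(2)] show ?thesis by simp
  qed simp
  have "eval_mpoly (h d) v = 0" if "d \<le> D" for d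
  proof -
    have hd: "h d \<in> homogeneous_polys I" using h(1) by (auto simp: homogeneous_polys_def)
    define A where "A = Y \<inter> zero_locus I {f}"
    define B where "B = Y \<inter> zero_locus I {h d}"
    have AB: "closedin (subtopology (zariski I) Y) A" "closedin (subtopology (zariski I) Y) B"
      unfolding A_def B_def closedin_sub_zariski using f hd by blast+
    have "Z \<subseteq> A \<union> B"
    proof
      fix p assume p: "p \<in> Z"
      with Zsub(1) have "p \<in> proj_space I" by blast
      then obtain u where u: "p = fun_vec.span {u}" "u \<in> coord_space I" "u \<noteq> 0"
        by (rule proj_spaceE)
      have "u \<in> p" unfolding u(1) by (rule fun_vec.span_base) simp
      then have "u \<in> \<Union>Z" using p by blast
      from prod[OF this that] have "eval_mpoly f u = 0 \<or> eval_mpoly (h d) u = 0" by simp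
      then have "p \<in> zero_locus I {f} \<or> p \<in> zero_locus I {h d}"
        using mem_zero_locus_span[OF _ u(2,3), of "{f}"] mem_zero_locus_span[OF _ u(2,3), of "{h d}"] f hd
        unfolding u(1) by simp
      then show "p \<in> A \<union> B" using p Zsub(2) unfolding A_def B_def by blast
    qed
    then have "Z \<subseteq> A \<or> Z \<subseteq> B" using irr AB unfolding irreducible_in_def by blast
    moreover have "\<not> Z \<subseteq> A" using w by (auto simp: A_def zero_locus_def)
    ultimately show ?thesis using v by (auto simp: B_def zero_locus_def)
  qed
  then show ?thesis by (simp add: h(2))
qed

text \<open>The line over a point of \<open>Z 0\<close> carries one transcendental coordinate, and
  each strict inclusion contributes a form that vanishes on the smaller set but not on the larger
  one.\<close>

lemma chain_alg_indep:
  fixes Z :: "nat \<Rightarrow> ('i \<Rightarrow> 'k::field_char_0) set set"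
  assumes "\<And>i. i \<le> d \<Longrightarrow> closedin (subtopology (zariski I) Y) (Z i)"
    and "\<And>i. i \<le> d \<Longrightarrow> irreducible_in (subtopology (zariski I) Y) (Z i)"
    and "\<And>i. i < d \<Longrightarrow> Z i \<subset> Z (Suc i)"
  shows "l \<le> d \<Longrightarrow> \<exists>F. (\<forall>j. F j \<in> polyfun I) \<and> alg_indep_on (\<Union>(Z l)) F (Suc l)"
proof (induction l)
  case 0
  have Z0: "Z 0 \<noteq> {}" "Z 0 \<subseteq> proj_space I"
    using assms(2)[of 0] by (auto simp: irreducible_in_def)
  then obtain p where p: "p \<in> Z 0" by blast
  with Z0 have "p \<in> proj_space I" by blast
  then obtain v where v: "p = fun_vec.span {v}" "v \<in> coord_space I" "v \<noteq> 0"
    by (rule proj_spaceE)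
  have "\<exists>i. v i \<noteq> 0" using v(3) by (auto simp: fun_eq_iff)
  then obtain i where i: "v i \<noteq> 0" "i \<in> I" using v(2) unfolding coord_space_def by blast
  define F where "F = (\<lambda>j::nat. \<lambda>v::'i \<Rightarrow> 'k. v i)"
  have "alg_indep_on (\<Union>(Z 0)) F (Suc 0)"
    unfolding alg_indep_on_def
  proof (intro ballI impI allI)
    fix P :: "(nat \<Rightarrow> 'k) \<Rightarrow> 'k" and y :: "nat \<Rightarrow> 'k"
    assume P: "P \<in> polyfun {..<Suc 0}" "\<forall>v\<in>\<Union>(Z 0). P (\<lambda>j. F j v) = 0"
    have "fun_scale (y 0 / v i) v \<in> p"
      unfolding v(1) by (intro fun_vec.span_scale fun_vec.span_base) simp
    then have "P (\<lambda>j. F j (fun_scale (y 0 / v i) v)) = 0" using P(2) p by blast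
    moreover have "P (\<lambda>j. F j (fun_scale (y 0 / v i) v)) = P y"
      by (rule polyfun_cong[OF P(1)]) (use i in \<open>simp add: F_def fun_scale_apply\<close>)
    ultimately show "P y = 0" by simp
  qed
  moreover have "F j \<in> polyfun I" for j unfolding F_def using i(2) by (rule polyfun_coord)
  ultimately show ?case by blast
next
  case (Suc l)
  then obtain F where F: "\<And>j. F j \<in> polyfun I" "alg_indep_on (\<Union>(Z l)) F (Suc l)"
    using Suc_leD by blast
  have sub: "Z l \<subset> Z (Suc l)" using assms(3) Suc.prems by auto
  obtain G where G: "G \<subseteq> homogeneous_polys I" "Z l = Y \<inter> zero_locus I G"
    using assms(1)[of l] Suc.prems unfolding closedin_sub_zariski by auto
  have ZY: "Z (Suc l) \<subseteq> Y" "Z (Suc l) \<subseteq> proj_space I"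
    using assms(2)[of "Suc l"] Suc.prems by (auto simp: irreducible_in_def)
  obtain p where p: "p \<in> Z (Suc l)" "p \<notin> Z l" using sub by blast
  then have "p \<notin> zero_locus I G" "p \<in> proj_space I" using G ZY by auto
  then obtain f w where f: "f \<in> G" "w \<in> p" "eval_mpoly f w \<noteq> 0" unfolding zero_locus_def by blast
  have fh: "f \<in> homogeneous_polys I" using f G by auto
  then have fI: "eval_mpoly f \<in> polyfun I" using eval_form_polyfun unfolding homogeneous_polys_def by blast
  have "alg_indep_on (\<Union>(Z (Suc l))) (F(Suc l := eval_mpoly f)) (Suc (Suc l))"
  proof (rule alg_indep_on_extend[OF F(1) F(2)])
    show "\<Union>(Z l) \<subseteq> \<Union>(Z (Suc l))" using sub by blast
    show "eval_mpoly f v = 0" if "v \<in> \<Union>(Z l)" for v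
      using that f(1) by (auto simp: G(2) zero_locus_def)
    show "eval_mpoly f \<in> polyfun I" by (rule fI)
    show "Q v = 0" if "Q \<in> polyfun I" "\<And>v. v \<in> \<Union>(Z (Suc l)) \<Longrightarrow> eval_mpoly f v * Q v = 0" "v \<in> \<Union>(Z (Suc l))" for Q v
    proof -
      have "w \<in> \<Union>(Z (Suc l))" using p(1) f(2) by blast
      from irreducible_cancel[OF assms(2)[OF Suc.prems] fh this f(3) that] show ?thesis .
    qed
  qed
  moreover have "(F(Suc l := eval_mpoly f)) j \<in> polyfun I" for j
    using F(1) fI by simp
  ultimately show ?case by blast
qed

text \<open>Functions that are independent on the cone over the top of a chain in \<open>Y\<close>
  stay independent when pulled back to the cone over \<open>\<phi>\<close>, which has
  \<open>card J + 1\<close> variables. The additional variable is balanced by the additional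
  function that a chain provides.\<close>

lemma zariski_dim_le:
  fixes \<phi> :: "('j \<Rightarrow> 'k::field_char_0) \<Rightarrow> 'i \<Rightarrow> 'k"
  assumes J: "finite J" "card J \<le> m" and \<phi>: "\<And>i. i \<in> I \<Longrightarrow> (\<lambda>t. \<phi> t i) \<in> polyfun J"
    and dense: "\<And>f p v. f \<in> homogeneous_polys I \<Longrightarrow> (\<And>t. eval_mpoly f (\<phi> t) = 0) \<Longrightarrow> p \<in> Y \<Longrightarrow> v \<in> p \<Longrightarrow> eval_mpoly f v = 0"
  shows "zariski_dim I Y \<le> enat m"
  unfolding zariski_dim_def krull_dim_def
proof (rule Sup_least, safe)
  fix d and Z :: "nat \<Rightarrow> ('i \<Rightarrow> 'k) set set"
  assume Z: "\<forall>i\<le>d. closedin (subtopology (zariski I) Y) (Z i) \<and> irreducible_in (subtopology (zariski I) Y) (Z i)"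
    "\<forall>i<d. Z i \<subset> Z (Suc i)"
  from Z have "\<exists>F. (\<forall>j. F j \<in> polyfun I) \<and> alg_indep_on (\<Union>(Z d)) F (Suc d)"
    by (intro chain_alg_indep[of d I Y Z d]) simp_all
  then obtain F where F: "\<And>j. F j \<in> polyfun I" "alg_indep_on (\<Union>(Z d)) F (Suc d)" by blast
  have ZY: "Z d \<subseteq> Y" using Z(1) by (auto simp: irreducible_in_def)
  \<comment> \<open>\<open>None\<close> is the scaling variable of the cone.\<close>
  define \<Psi> where "\<Psi> = (\<lambda>y. fun_scale (y None) (\<phi> (\<lambda>j. y (Some j))))"
  define J' where "J' = insert None (Some ` J)"
  have cJ': "card J' = Suc (card J)" "finite J'"
    using J by (auto simp: J'_def card_image)
  have \<Psi>: "(\<lambda>y. \<Psi> y i) \<in> polyfun J'" if "i \<in> I" for i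
  proof -
    have "(\<lambda>y::'j option \<Rightarrow> 'k. \<phi> (\<lambda>j. y (Some j)) i) \<in> polyfun J'"
      by (rule polyfun_compose[OF \<phi>[OF that]]) (auto simp: J'_def intro: polyfun_intros)
    then show ?thesis unfolding \<Psi>_def fun_scale_apply
      by (intro polyfun_mult polyfun_coord) (auto simp: J'_def)
  qed
  have "alg_indep_on UNIV (\<lambda>j y. F j (\<Psi> y)) (Suc d)"
    unfolding alg_indep_on_def
  proof (intro ballI impI)
    fix P :: "(nat \<Rightarrow> 'k) \<Rightarrow> 'k"
    assume P: "P \<in> polyfun {..<Suc d}" "\<forall>y\<in>UNIV. P (\<lambda>j. F j (\<Psi> y)) = 0"
    have "P (\<lambda>j. F j v) = 0" if v: "v \<in> \<Union>(Z d)" for v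
    proof (rule polyfun_zero_at_cone[where C = "range \<Psi>" and C' = "\<Union>(Z d)" and Q = "\<lambda>v. P (\<lambda>j. F j v)" and I = I])
      show "(\<lambda>v. P (\<lambda>j. F j v)) \<in> polyfun I" by (rule polyfun_compose[OF P(1) F(1)])
      show "fun_scale c w \<in> range \<Psi>" if "w \<in> range \<Psi>" for w c
      proof -
        obtain y where y: "w = \<Psi> y" using \<open>w \<in> range \<Psi>\<close> by blast
        have "fun_scale c w = \<Psi> (y(None := c * y None))"
          by (auto simp: \<Psi>_def y fun_scale_def mult.assoc)
        then show ?thesis by blast
      qed
      show "P (\<lambda>j. F j w) = 0" if "w \<in> range \<Psi>" for w using P(2) that by auto
      show "eval_mpoly f w = 0" if f: "f \<in> homogeneous_polys I"
        "\<And>w. w \<in> range \<Psi> \<Longrightarrow> eval_mpoly f w = 0" and w: "w \<in> \<Union>(Z d)" for f w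
      proof -
        have "eval_mpoly f (\<phi> t) = 0" for t
        proof -
          have "\<Psi> (case_option 1 t) = \<phi> t" by (simp add: \<Psi>_def fun_scale_def)
          then show ?thesis using f(2)[of "\<phi> t"] by (metis rangeI)
        qed
        moreover obtain p where "p \<in> Y" "w \<in> p" using w ZY by blast
        ultimately show ?thesis by (rule dense[OF f(1)])
      qed
      show "v \<in> \<Union>(Z d)" by fact
    qed
    then show "\<forall>y. P y = 0" using alg_indep_onD[OF F(2) P(1)] by simp
  qed
  moreover have "(\<lambda>y. F j (\<Psi> y)) \<in> polyfun J'" for j
    by (rule polyfun_compose[OF F(1) \<Psi>])
  ultimately have "\<not> card J' < Suc d"
    using alg_dependent_if_few_variables[OF cJ'(2), of "Suc d" "\<lambda>j y. F j (\<Psi> y)"] by blast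
  then show "enat d \<le> enat m" using J cJ' by simp
qed

text \<open>
  The chain consists of the closures of the images of \<open>p + \<langle>w 0, \<dots>, w (l - 1)\<rangle>\<close>: the derivative shows
  that the cone over the \<open>l\<close>-th one has transcendence degree at least \<open>l + 1\<close>, the number of parameters
  that it has at most this.
\<close>

lemma zariski_dim_ge:
  fixes \<Phi> :: "('j \<Rightarrow> 'k::field_char_0) \<Rightarrow> 'i \<Rightarrow> 'k"
  assumes I: "finite I" and Y: "Y \<subseteq> proj_space I"
    and \<Phi>I: "\<And>t i. i \<notin> I \<Longrightarrow> \<Phi> t i = 0"
    and \<Phi>: "\<And>i. (\<lambda>t. \<Phi> t i) \<in> polyfun J"
    and image: "\<And>t. \<Phi> t \<noteq> 0 \<Longrightarrow> fun_vec.span {\<Phi> t} \<in> Y"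
    and dd: "\<And>c i. has_dd (\<lambda>t. \<Phi> t i) p (\<lambda>q. \<Sum>j<m. c j * w j q) (\<Sum>j<m. c j * L j i)"
    and indep: "indep_fam {..<Suc m} (case_nat (\<Phi> p) L)"
    and L: "\<And>j i. i \<notin> I \<Longrightarrow> L j i = 0"
  shows "enat m \<le> zariski_dim I Y"
proof -
  \<comment> \<open>\<open>y 0\<close> scales and \<open>y (Suc j)\<close> moves along
    \<open>w j\<close>, so level \<open>l\<close> involves \<open>l + 1\<close> variables.\<close>
  define \<Psi> where "\<Psi> = (\<lambda>l (y::nat \<Rightarrow> 'k). fun_scale (y 0) (\<Phi> (\<lambda>q. p q + (\<Sum>j<l. y (Suc j) * w j q))))"
  define G where "G = (\<lambda>l. {f \<in> homogeneous_polys I. \<forall>y. eval_mpoly f (\<Psi> l y) = 0})"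
  define Z where "Z = (\<lambda>l. Y \<inter> zero_locus I (G l))"
  have GI: "G l \<subseteq> homogeneous_polys I" for l by (auto simp: G_def)
  have \<Psi>I: "\<Psi> l y \<in> coord_space I" for l y by (auto simp: coord_space_def \<Psi>_def fun_scale_def \<Phi>I)
  have \<Psi>poly: "(\<lambda>y. \<Psi> l y i) \<in> polyfun {..<Suc l}" for l i
  proof -
    have "(\<lambda>y. \<Phi> (\<lambda>q. p q + (\<Sum>j<l. y (Suc j) * w j q)) i) \<in> polyfun {..<Suc l}"
      by (rule polyfun_compose[OF \<Phi>])
         (intro polyfun_add polyfun_sum polyfun_mult polyfun_const polyfun_coord, simp)
    then show ?thesis unfolding \<Psi>_def fun_scale_apply by (intro polyfun_mult polyfun_coord) auto
  qed
  have \<Psi>scale: "fun_scale c (\<Psi> l y) \<in> range (\<Psi> l)" for c l y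
  proof -
    have "fun_scale c (\<Psi> l y) = \<Psi> l (y(0 := c * y 0))"
      by (auto simp: \<Psi>_def fun_scale_def mult.assoc)
    then show ?thesis by blast
  qed
  have \<Psi>Z: "fun_vec.span {\<Psi> l y} \<in> Z l" if "\<Psi> l y \<noteq> 0" for l y
  proof -
    define x where "x = \<Phi> (\<lambda>q. p q + (\<Sum>j<l. y (Suc j) * w j q))"
    have x: "\<Psi> l y = fun_scale (y 0) x" by (simp add: \<Psi>_def x_def)
    have "x \<noteq> 0" "y 0 \<noteq> 0" using that by (auto simp: x)
    have "fun_vec.span {x} = fun_vec.span {\<Psi> l y}"
    proof (rule proj_space_span_eq)
      show "fun_vec.span {x} \<in> proj_space I"
        using \<open>x \<noteq> 0\<close> by (intro span_in_proj_space) (auto simp: coord_space_def x_def \<Phi>I)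
      show "\<Psi> l y \<in> fun_vec.span {x}" by (auto simp: x fun_vec.span_singleton)
    qed (rule that)
    moreover have "fun_vec.span {x} \<in> Y" unfolding x_def by (rule image) (use \<open>x \<noteq> 0\<close> x_def in auto)
    moreover have "fun_vec.span {\<Psi> l y} \<in> zero_locus I (G l)"
      by (rule span_in_zero_locus[OF GI \<Psi>I that]) (auto simp: G_def)
    ultimately show ?thesis by (simp add: Z_def)
  qed
  have "indep_fam {..<Suc l} (case_nat (\<Phi> p) L)" if "l \<le> m" for l
    by (rule indep_fam_subset[OF indep]) (use that in auto)
  then have ex: "\<exists>F. (\<forall>j. F j \<in> polyfun I) \<and> alg_indep_on (range (\<Psi> l)) F (Suc l)" if "l \<le> m" for l
  proof (rule alg_indep_if_derivative_injective[OF I _ _ , where ?y0.0 = "\<lambda>j. if j = 0 then 1 else 0"])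
    show "case_nat (\<Phi> p) L j i = 0" if "i \<notin> I" for j i using \<Phi>I L that by (cases j) auto
    fix z :: "nat \<Rightarrow> 'k" and i
    let ?y0 = "\<lambda>j::nat. if j = 0 then 1 else (0::'k)"
    have cut: "(\<Sum>j<m. (if j < l then c j else 0) * a j) = (\<Sum>j<l. c j * a j)" for c a :: "nat \<Rightarrow> 'k"
    proof -
      have "(\<Sum>j<m. (if j < l then c j else 0) * a j) = (\<Sum>j<l. (if j < l then c j else 0) * a j)"
        by (rule sum.mono_neutral_right) (use that in auto)
      then show ?thesis by simp
    qed
    from dd[of i "\<lambda>j. if j < l then z (Suc j) else 0"]
    have "has_dd (\<lambda>t. \<Phi> t i) p (\<lambda>q. \<Sum>j<l. z (Suc j) * w j q) (\<Sum>j<l. z (Suc j) * L j i)"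
      unfolding cut .
    then have "has_dd (\<lambda>y. \<Phi> (\<lambda>q. p q + (\<Sum>j<l. y (Suc j) * w j q)) i) ?y0 z (\<Sum>j<l. z (Suc j) * L j i)"
      unfolding has_dd_def by (simp add: sum_distrib_left mult.assoc)
    from has_dd_mult[OF has_dd_coord[of 0 ?y0 z] this]
    have "has_dd (\<lambda>y. \<Psi> l y i) ?y0 z ((\<Sum>j<l. z (Suc j) * L j i) + z 0 * \<Phi> p i)"
      by (simp add: \<Psi>_def fun_scale_apply)
    then show "has_dd (\<lambda>y. \<Psi> l y i) ?y0 z (\<Sum>j<Suc l. z j * case_nat (\<Phi> p) L j i)"
      by (simp add: sum.lessThan_Suc_shift add.commute del: sum.lessThan_Suc)
  qed (use that in auto)
  have p0: "\<Phi> p \<noteq> 0" using indep_fam_nonzero[OF indep, of 0] by auto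
  have \<Psi>p: "\<Psi> l (\<lambda>j. if j = 0 then 1 else 0) = \<Phi> p" for l
    by (simp add: \<Psi>_def fun_scale_def)
  have closed: "closedin (subtopology (zariski I) Y) (Z l)" for l
    unfolding closedin_sub_zariski Z_def using GI by blast
  have irr: "irreducible_in (subtopology (zariski I) Y) (Z l)" for l
    unfolding irreducible_in_def
  proof (intro conjI allI impI)
    show "Z l \<subseteq> topspace (subtopology (zariski I) Y)" using Y by (auto simp: Z_def)
    show "Z l \<noteq> {}" using \<Psi>Z[of l "\<lambda>j. if j = 0 then 1 else 0"] p0 unfolding \<Psi>p by blast
    fix A B assume AB: "closedin (subtopology (zariski I) Y) A" "closedin (subtopology (zariski I) Y) B" "Z l \<subseteq> A \<union> B"
    obtain GA where GA: "GA \<subseteq> homogeneous_polys I" "A = Y \<inter> zero_locus I GA"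
      using AB(1) unfolding closedin_sub_zariski by blast
    obtain GB where GB: "GB \<subseteq> homogeneous_polys I" "B = Y \<inter> zero_locus I GB"
      using AB(2) unfolding closedin_sub_zariski by blast
    have *: "\<exists>f\<in>H. \<exists>y. eval_mpoly f (\<Psi> l y) \<noteq> 0" if "H \<subseteq> homogeneous_polys I" "\<not> Z l \<subseteq> Y \<inter> zero_locus I H" for H
    proof (rule ccontr)
      assume "\<not> ?thesis"
      then have "H \<subseteq> G l" using that(1) by (auto simp: G_def)
      then have "zero_locus I (G l) \<subseteq> zero_locus I H" by (auto simp: zero_locus_def)
      then show False using that(2) by (auto simp: Z_def)
    qed
    show "Z l \<subseteq> A \<or> Z l \<subseteq> B"
    proof (rule ccontr)
      assume "\<not> ?thesis"
      then obtain f y g z where f: "f \<in> GA" "eval_mpoly f (\<Psi> l y) \<noteq> 0" and g: "g \<in> GB" "eval_mpoly g (\<Psi> l z) \<noteq> 0"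
        using *[OF GA(1)] *[OF GB(1)] GA(2) GB(2) by blast
      have pf: "(\<lambda>y. eval_mpoly h (\<Psi> l y)) \<in> polyfun {..<Suc l}" if h: "h \<in> homogeneous_polys I" for h
      proof -
        obtain d where "h \<in> forms I d" using h by (auto simp: homogeneous_polys_def)
        from polyfun_compose[OF eval_form_polyfun[OF this] \<Psi>poly] show ?thesis .
      qed
      have pfg: "(\<lambda>y. eval_mpoly f (\<Psi> l y)) \<in> polyfun {..<Suc l}" "(\<lambda>y. eval_mpoly g (\<Psi> l y)) \<in> polyfun {..<Suc l}"
        using pf f(1) g(1) GA(1) GB(1) by blast+
      obtain u where u: "eval_mpoly f (\<Psi> l u) * eval_mpoly g (\<Psi> l u) \<noteq> 0"
        using polyfun_mult_nonzero[OF pfg(1) f(2) pfg(2) g(2)] by blast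
      \<comment> \<open>A coordinate of \<open>\<Psi> l\<close> joins the product so that the vector
        found is nonzero and spans a point.\<close>
      obtain i where i: "\<Phi> p i \<noteq> 0" using p0 by (auto simp: fun_eq_iff)
      obtain u' where u': "eval_mpoly f (\<Psi> l u') * eval_mpoly g (\<Psi> l u') * \<Psi> l u' i \<noteq> 0"
        using polyfun_mult_nonzero[OF polyfun_mult[OF pfg] u \<Psi>poly[of l i], of "\<lambda>j. if j = 0 then 1 else 0"] i
        unfolding \<Psi>p by blast
      then have nz: "\<Psi> l u' \<noteq> 0" by auto
      then have "fun_vec.span {\<Psi> l u'} \<in> A \<union> B" using \<Psi>Z AB(3) by blast
      then show False
        using mem_zero_locus_span[OF GA(1) \<Psi>I nz] mem_zero_locus_span[OF GB(1) \<Psi>I nz] f(1) g(1) u' GA(2) GB(2)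
        by auto
    qed
  qed
  have strict: "Z l \<subset> Z (Suc l)" if l: "l < m" for l
  proof -
    have step: "\<Psi> l y = \<Psi> (Suc l) (y(Suc l := 0))" for y by (simp add: \<Psi>_def)
    have "G (Suc l) \<subseteq> G l" by (auto simp: G_def step)
    then have "Z l \<subseteq> Z (Suc l)" by (auto simp: Z_def zero_locus_def)
    moreover have "Z l \<noteq> Z (Suc l)"
    proof
      assume eq: "Z l = Z (Suc l)"
      obtain F where F: "\<And>j. F j \<in> polyfun I" "alg_indep_on (range (\<Psi> (Suc l))) F (Suc (Suc l))"
        using ex[of "Suc l"] l by auto
      \<comment> \<open>If the closures were equal, the \<open>l + 2\<close> functions independent
        on the larger cone would pull back to independent functions of only \<open>l + 1\<close>
        variables.\<close>
      have "alg_indep_on UNIV (\<lambda>j y. F j (\<Psi> l y)) (Suc (Suc l))"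
        unfolding alg_indep_on_def
      proof (intro ballI impI)
        fix P :: "(nat \<Rightarrow> 'k) \<Rightarrow> 'k"
        assume P: "P \<in> polyfun {..<Suc (Suc l)}" "\<forall>y\<in>UNIV. P (\<lambda>j. F j (\<Psi> l y)) = 0"
        have "P (\<lambda>j. F j v) = 0" if v: "v \<in> range (\<Psi> (Suc l))" for v
        proof (rule polyfun_zero_at_cone[where C = "range (\<Psi> l)" and C' = "range (\<Psi> (Suc l))" and Q = "\<lambda>v. P (\<lambda>j. F j v)" and I = I])
          show "(\<lambda>v. P (\<lambda>j. F j v)) \<in> polyfun I" by (rule polyfun_compose[OF P(1) F(1)])
          show "fun_scale c w \<in> range (\<Psi> l)" if "w \<in> range (\<Psi> l)" for w c using that \<Psi>scale by blast
          show "P (\<lambda>j. F j w) = 0" if "w \<in> range (\<Psi> l)" for w using P(2) that by auto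
          show "eval_mpoly f x = 0" if f: "f \<in> homogeneous_polys I"
            "\<And>w. w \<in> range (\<Psi> l) \<Longrightarrow> eval_mpoly f w = 0" and x: "x \<in> range (\<Psi> (Suc l))" for f x
          proof (cases "x = 0")
            case True
            have "\<Psi> l (\<lambda>_. 0) = 0" by (auto simp: \<Psi>_def fun_scale_def)
            then show ?thesis using f(2) True by (metis rangeI)
          next
            case False
            then have "fun_vec.span {x} \<in> Z l" using \<Psi>Z[of "Suc l"] x eq by auto
            moreover have "f \<in> G l" using f by (auto simp: G_def)
            ultimately show ?thesis using fun_vec.span_base[of x "{x}"] unfolding Z_def zero_locus_def by blast
          qed
          show "v \<in> range (\<Psi> (Suc l))" by fact
        qed
        then show "\<forall>y. P y = 0" using alg_indep_onD[OF F(2) P(1)] by simp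
      qed
      moreover have "(\<lambda>y. F j (\<Psi> l y)) \<in> polyfun {..<Suc l}" for j
        by (rule polyfun_compose[OF F(1) \<Psi>poly])
      ultimately show False
        using alg_dependent_if_few_variables[of "{..<Suc l}" "Suc (Suc l)" "\<lambda>j y. F j (\<Psi> l y)"] by auto
    qed
    ultimately show ?thesis by blast
  qed
  show ?thesis
    unfolding zariski_dim_def krull_dim_def
    by (rule Sup_upper) (use closed irr strict in blast)
qed

section \<open>Extension of homomorphisms and derivations\<close>

definition subring_set :: "'r::comm_ring_1 set \<Rightarrow> bool" where
  "subring_set A \<longleftrightarrow> 1 \<in> A \<and> (\<forall>a\<in>A. \<forall>b\<in>A. a + b \<in> A \<and> a * b \<in> A) \<and> (\<forall>a\<in>A. - a \<in> A)"

definition prime_ideal_in :: "'r::comm_ring_1 set \<Rightarrow> 'r set \<Rightarrow> bool" where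
  "prime_ideal_in B P \<longleftrightarrow> P \<subseteq> B \<and> 0 \<in> P \<and> (\<forall>p\<in>P. \<forall>q\<in>P. p + q \<in> P) \<and> (\<forall>b\<in>B. \<forall>p\<in>P. b * p \<in> P) \<and>
     1 \<notin> P \<and> (\<forall>x\<in>B. \<forall>y\<in>B. x * y \<in> P \<longrightarrow> x \<in> P \<or> y \<in> P)"

text \<open>A homomorphism on the image of \<open>A\<close> modulo \<open>P\<close>, described on
  representatives.\<close>

definition hom_on :: "'r::comm_ring_1 set \<Rightarrow> 'r set \<Rightarrow> ('r \<Rightarrow> 'k::field) \<Rightarrow> bool" where
  "hom_on P A \<theta> \<longleftrightarrow> \<theta> 1 = 1 \<and> (\<forall>a\<in>A. \<forall>b\<in>A. \<theta> (a + b) = \<theta> a + \<theta> b \<and> \<theta> (a * b) = \<theta> a * \<theta> b) \<and>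
     (\<forall>a\<in>A \<inter> P. \<theta> a = 0)"

text \<open>A derivation into \<open>'k\<close>, on which \<open>A\<close> acts through
  \<open>\<theta>\<close>. If \<open>\<theta>\<close> is evaluation at a point, it plays the part of
  a tangent vector there.\<close>

definition der_on :: "'r::comm_ring_1 set \<Rightarrow> 'r set \<Rightarrow> ('r \<Rightarrow> 'k::field) \<Rightarrow> ('r \<Rightarrow> 'k) \<Rightarrow> bool" where
  "der_on P A \<theta> \<delta> \<longleftrightarrow>
     (\<forall>a\<in>A. \<forall>b\<in>A. \<delta> (a + b) = \<delta> a + \<delta> b \<and> \<delta> (a * b) = \<theta> a * \<delta> b + \<delta> a * \<theta> b) \<and>
     (\<forall>a\<in>A \<inter> P. \<delta> a = 0)"

definition polys_over :: "'r::comm_ring_1 set \<Rightarrow> 'r poly set" where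
  "polys_over A = {p. \<forall>i. coeff p i \<in> A}"

definition adjoin :: "'r::comm_ring_1 set \<Rightarrow> 'r \<Rightarrow> 'r set" where
  "adjoin A z = (\<lambda>p. poly p z) ` polys_over A"

fun adjoin_list :: "'r::comm_ring_1 set \<Rightarrow> 'r list \<Rightarrow> 'r set" where
  "adjoin_list A [] = A"
| "adjoin_list A (z # zs) = adjoin_list (adjoin A z) zs"

text \<open>The library's \<open>pderiv\<close> needs a ring without zero divisors.\<close>

definition formal_deriv :: "'r::comm_ring_1 poly \<Rightarrow> 'r poly" where
  "formal_deriv p = (\<Sum>i\<le>degree p. Polynomial.monom (of_nat (Suc i) * coeff p (Suc i)) i)"

lemma coeff_formal_deriv: "coeff (formal_deriv p) i = of_nat (Suc i) * coeff p (Suc i)"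
  by (cases "i \<le> degree p") (auto simp: formal_deriv_def coeff_sum coeff_eq_0)

section \<open>Arithmetic over a subring and pseudo-division\<close>

context
  fixes A :: "'r::comm_ring_1 set"
  assumes A: "subring_set A"
begin

lemma subring_one: "1 \<in> A" and subring_add: "a \<in> A \<Longrightarrow> b \<in> A \<Longrightarrow> a + b \<in> A"
  and subring_mult: "a \<in> A \<Longrightarrow> b \<in> A \<Longrightarrow> a * b \<in> A" and subring_uminus: "a \<in> A \<Longrightarrow> - a \<in> A"
  using A by (auto simp: subring_set_def)

lemma subring_zero: "0 \<in> A"
  using subring_add[OF subring_one subring_uminus[OF subring_one]] by simp

lemma subring_diff: "a \<in> A \<Longrightarrow> b \<in> A \<Longrightarrow> a - b \<in> A"
  using subring_add[OF _ subring_uminus] by fastforce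

lemma subring_sum: "(\<And>x. x \<in> S \<Longrightarrow> f x \<in> A) \<Longrightarrow> (\<Sum>x\<in>S. f x) \<in> A"
  by (induction S rule: infinite_finite_induct) (auto intro: subring_zero subring_add)

lemma subring_power: "a \<in> A \<Longrightarrow> a ^ n \<in> A"
  by (induction n) (auto intro: subring_one subring_mult)

lemma subring_of_nat: "of_nat n \<in> A"
  by (induction n) (auto intro: subring_zero subring_one subring_add)

lemma polys_over_0: "0 \<in> polys_over A"
  by (simp add: polys_over_def subring_zero)

lemma polys_over_pCons: "a \<in> A \<Longrightarrow> p \<in> polys_over A \<Longrightarrow> pCons a p \<in> polys_over A"
  by (auto simp: polys_over_def coeff_pCons split: nat.split)

lemma polys_over_const: "a \<in> A \<Longrightarrow> [:a:] \<in> polys_over A"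
  by (intro polys_over_pCons polys_over_0)

lemma polys_over_1: "1 \<in> polys_over A"
  using polys_over_const[OF subring_one] by (simp add: one_pCons)

lemma polys_over_add: "p \<in> polys_over A \<Longrightarrow> q \<in> polys_over A \<Longrightarrow> p + q \<in> polys_over A"
  by (simp add: polys_over_def subring_add)

lemma polys_over_uminus: "p \<in> polys_over A \<Longrightarrow> - p \<in> polys_over A"
  by (simp add: polys_over_def subring_uminus)

lemma polys_over_diff: "p \<in> polys_over A \<Longrightarrow> q \<in> polys_over A \<Longrightarrow> p - q \<in> polys_over A"
  by (simp add: polys_over_def subring_diff)

lemma polys_over_mult: "p \<in> polys_over A \<Longrightarrow> q \<in> polys_over A \<Longrightarrow> p * q \<in> polys_over A"
  unfolding polys_over_def by (auto simp: coeff_mult intro!: subring_sum subring_mult)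

lemma polys_over_monom: "a \<in> A \<Longrightarrow> Polynomial.monom a n \<in> polys_over A"
  by (simp add: polys_over_def subring_zero)

lemma polys_over_pderiv: "p \<in> polys_over A \<Longrightarrow> formal_deriv p \<in> polys_over A"
  by (auto simp: polys_over_def coeff_formal_deriv simp del: of_nat_Suc intro!: subring_mult subring_of_nat)

lemma subring_poly: "p \<in> polys_over A \<Longrightarrow> z \<in> A \<Longrightarrow> poly p z \<in> A"
  unfolding poly_altdef by (intro subring_sum subring_mult subring_power) (auto simp: polys_over_def)

lemma adjoin_base: "a \<in> A \<Longrightarrow> a \<in> adjoin A z"
  unfolding adjoin_def by (rule image_eqI[of _ _ "[:a:]"]) (auto intro: polys_over_const)

lemma adjoin_elem: "z \<in> adjoin A z"
  unfolding adjoin_def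
  by (rule image_eqI[of _ _ "[:0, 1:]"]) (auto intro!: polys_over_pCons polys_over_0 subring_zero subring_one)

lemma adjoin_subring: "subring_set (adjoin A z)"
  unfolding subring_set_def
proof (intro conjI ballI)
  show "1 \<in> adjoin A z" by (rule adjoin_base[OF subring_one])
next
  fix a b assume "a \<in> adjoin A z" "b \<in> adjoin A z"
  then obtain p q where pq: "a = poly p z" "p \<in> polys_over A" "b = poly q z" "q \<in> polys_over A"
    by (auto simp: adjoin_def)
  show "a + b \<in> adjoin A z" unfolding adjoin_def
    by (rule image_eqI[of _ _ "p + q"]) (simp_all add: pq polys_over_add)
  show "a * b \<in> adjoin A z" unfolding adjoin_def
    by (rule image_eqI[of _ _ "p * q"]) (simp_all add: pq polys_over_mult)
next
  fix a assume "a \<in> adjoin A z"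
  then obtain p where p: "a = poly p z" "p \<in> polys_over A" by (auto simp: adjoin_def)
  show "- a \<in> adjoin A z" unfolding adjoin_def
    by (rule image_eqI[of _ _ "- p"]) (simp_all add: p polys_over_uminus)
qed

text \<open>Long division that multiplies by the leading coefficient where it cannot be inverted.
  \<open>m\<close> is a strict bound for the degree of \<open>q\<close>; the bound on
  \<open>s\<close> feeds the minimality argument in \<open>divides_base_element\<close>.\<close>

lemma pseudo_division:
  assumes p: "p \<in> polys_over A" "\<And>i. i > n \<Longrightarrow> coeff p i = 0"
    and q: "q \<in> polys_over A" "\<And>i. i \<ge> m \<Longrightarrow> coeff q i = 0"
  shows "\<exists>N s r. s \<in> polys_over A \<and> r \<in> polys_over A \<and> [:coeff p n ^ N:] * q = p * s + r \<and>
           (\<forall>i\<ge>n. coeff r i = 0) \<and> (\<forall>i. i + n \<ge> m \<longrightarrow> coeff s i = 0)"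
  using q
proof (induction m arbitrary: q)
  case 0
  then show ?case
    by (intro exI[of _ 0] exI[of _ 0] exI[of _ q]) (auto simp: polys_over_0)
next
  case (Suc m)
  show ?case
  proof (cases "Suc m \<le> n")
    case True
    then show ?thesis using Suc.prems
      by (intro exI[of _ 0] exI[of _ 0] exI[of _ q]) (auto simp: polys_over_0)
  next
    case False
    define a where "a = coeff p n"
    define t where "t = Polynomial.monom (coeff q m) (m - n)"
    have aA: "a \<in> A" "coeff q m \<in> A" using p(1) Suc.prems(1) by (auto simp: a_def polys_over_def)
    have t: "t \<in> polys_over A" unfolding t_def by (rule polys_over_monom[OF aA(2)])
    define q' where "q' = [:a:] * q - p * t"
    have pt: "coeff (p * t) i = (if m - n \<le> i then coeff p (i - (m - n)) * coeff q m else 0)" for i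
      using coeff_monom_mult[of "coeff q m" "m - n" p i] by (simp add: t_def mult.commute)
    have "coeff q' i = 0" if "i \<ge> m" for i
    proof (cases "i = m")
      case True
      then show ?thesis using False by (simp add: q'_def pt a_def)
    next
      case ne: False
      then have "i - (m - n) > n" using False that by linarith
      then show ?thesis using ne that Suc.prems(2)[of i] p(2) by (simp add: q'_def pt)
    qed
    moreover have "q' \<in> polys_over A"
      unfolding q'_def by (intro polys_over_diff polys_over_mult polys_over_const aA p(1) Suc.prems(1) t)
    ultimately obtain N s r where IH: "s \<in> polys_over A" "r \<in> polys_over A" "[:a ^ N:] * q' = p * s + r"
      "\<forall>i\<ge>n. coeff r i = 0" "\<forall>i. i + n \<ge> m \<longrightarrow> coeff s i = 0"
      using Suc.IH[of q'] unfolding a_def by blast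
    define s' where "s' = s + [:a ^ N:] * t"
    have "[:a ^ Suc N:] * q = [:a ^ N:] * ([:a:] * q)" by (simp add: mult.commute)
    also have "[:a:] * q = q' + p * t" by (simp add: q'_def)
    also have "[:a ^ N:] * (q' + p * t) = p * s' + r"
      unfolding distrib_left IH(3) s'_def by (simp only: ac_simps)
    finally have "[:a ^ Suc N:] * q = p * s' + r" .
    moreover have "s' \<in> polys_over A"
      unfolding s'_def by (intro polys_over_add polys_over_mult polys_over_const subring_power aA IH(1) t)
    moreover have "coeff s' i = 0" if "i + n \<ge> Suc m" for i
      using that IH(5) False by (auto simp: s'_def t_def)
    ultimately show ?thesis using IH(2,4) unfolding a_def by blast
  qed
qed

end

section \<open>Extending homomorphisms and derivations by one generator\<close>

context
  fixes A P :: "'r::comm_ring_1 set" and \<theta> :: "'r \<Rightarrow> 'k::field_char_0"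
  assumes A: "subring_set A" and hom: "hom_on P A \<theta>"
begin

lemma hom_1: "\<theta> 1 = 1" and hom_add: "a \<in> A \<Longrightarrow> b \<in> A \<Longrightarrow> \<theta> (a + b) = \<theta> a + \<theta> b"
  and hom_mult: "a \<in> A \<Longrightarrow> b \<in> A \<Longrightarrow> \<theta> (a * b) = \<theta> a * \<theta> b" and hom_ideal: "a \<in> A \<Longrightarrow> a \<in> P \<Longrightarrow> \<theta> a = 0"
  using hom[unfolded hom_on_def] by simp_all

lemma hom_0: "\<theta> 0 = 0"
proof -
  have "\<theta> (0 + 0) = \<theta> 0 + \<theta> 0" by (rule hom_add[OF subring_zero[OF A] subring_zero[OF A]])
  then show ?thesis by simp
qed

lemma hom_sum: "(\<And>x. x \<in> S \<Longrightarrow> f x \<in> A) \<Longrightarrow> \<theta> (\<Sum>x\<in>S. f x) = (\<Sum>x\<in>S. \<theta> (f x))"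
proof (induction S rule: infinite_finite_induct)
  case (insert x F)
  then have "\<theta> (f x + (\<Sum>x\<in>F. f x)) = \<theta> (f x) + \<theta> (\<Sum>x\<in>F. f x)"
    by (intro hom_add subring_sum[OF A]) auto
  with insert show ?case by simp
qed (auto simp: hom_0)

lemma hom_power: "a \<in> A \<Longrightarrow> \<theta> (a ^ n) = \<theta> a ^ n"
  by (induction n) (auto simp: hom_1 hom_mult subring_power[OF A])

lemma hom_of_nat: "\<theta> (of_nat n) = of_nat n"
  by (induction n) (auto simp: hom_0 hom_1 hom_add subring_one[OF A] subring_of_nat[OF A])

lemma map_poly_hom_add:
  assumes "p \<in> polys_over A" "q \<in> polys_over A"
  shows "map_poly \<theta> (p + q) = map_poly \<theta> p + map_poly \<theta> q"
  by (rule poly_eqI) (use assms in \<open>simp add: coeff_map_poly hom_0 polys_over_def hom_add\<close>)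

lemma map_poly_hom_mult:
  assumes "p \<in> polys_over A" "q \<in> polys_over A"
  shows "map_poly \<theta> (p * q) = map_poly \<theta> p * map_poly \<theta> q"
proof (rule poly_eqI)
  fix i
  have "\<theta> (\<Sum>j\<le>i. coeff p j * coeff q (i - j)) = (\<Sum>j\<le>i. \<theta> (coeff p j * coeff q (i - j)))"
    by (rule hom_sum) (use assms in \<open>auto simp: polys_over_def intro: subring_mult[OF A]\<close>)
  also have "\<dots> = (\<Sum>j\<le>i. \<theta> (coeff p j) * \<theta> (coeff q (i - j)))"
    using assms by (intro sum.cong refl hom_mult) (auto simp: polys_over_def)
  finally show "coeff (map_poly \<theta> (p * q)) i = coeff (map_poly \<theta> p * map_poly \<theta> q) i"
    by (simp add: coeff_map_poly hom_0 coeff_mult)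
qed

lemma map_poly_hom_ideal: "p \<in> polys_over A \<Longrightarrow> (\<And>i. coeff p i \<in> P) \<Longrightarrow> map_poly \<theta> p = 0"
  by (rule poly_eqI) (auto simp: coeff_map_poly hom_0 polys_over_def hom_ideal)

lemma map_poly_hom_pderiv: "p \<in> polys_over A \<Longrightarrow> map_poly \<theta> (formal_deriv p) = pderiv (map_poly \<theta> p)"
proof (rule poly_eqI)
  fix i assume p: "p \<in> polys_over A"
  have "\<theta> (of_nat (Suc i) * coeff p (Suc i)) = of_nat (Suc i) * \<theta> (coeff p (Suc i))"
    unfolding hom_of_nat[symmetric]
    by (rule hom_mult[OF subring_of_nat[OF A]]) (use p in \<open>auto simp: polys_over_def\<close>)
  then show "coeff (map_poly \<theta> (formal_deriv p)) i = coeff (pderiv (map_poly \<theta> p)) i"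
    by (simp only: coeff_map_poly hom_0 coeff_pderiv coeff_formal_deriv)
qed

lemma map_poly_hom_const: "map_poly \<theta> [:a:] = [:\<theta> a:]"
  by (rule poly_eqI) (simp add: coeff_map_poly hom_0 coeff_pCons split: nat.split)

lemma map_poly_hom_diff:
  assumes "p \<in> polys_over A" "q \<in> polys_over A"
  shows "map_poly \<theta> (p - q) = map_poly \<theta> p - map_poly \<theta> q"
  using map_poly_hom_add[OF polys_over_diff[OF A assms] assms(2)] by simp

context
  fixes \<delta> :: "'r \<Rightarrow> 'k"
  assumes der: "der_on P A \<theta> \<delta>"
begin

lemma der_add: "a \<in> A \<Longrightarrow> b \<in> A \<Longrightarrow> \<delta> (a + b) = \<delta> a + \<delta> b"
  and der_mult: "a \<in> A \<Longrightarrow> b \<in> A \<Longrightarrow> \<delta> (a * b) = \<theta> a * \<delta> b + \<delta> a * \<theta> b"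
  and der_ideal: "a \<in> A \<Longrightarrow> a \<in> P \<Longrightarrow> \<delta> a = 0"
  using der[unfolded der_on_def] by simp_all

lemma der_0: "\<delta> 0 = 0"
proof -
  have "\<delta> (0 + 0) = \<delta> 0 + \<delta> 0" by (rule der_add[OF subring_zero[OF A] subring_zero[OF A]])
  then show ?thesis by simp
qed

lemma der_sum: "(\<And>x. x \<in> S \<Longrightarrow> f x \<in> A) \<Longrightarrow> \<delta> (\<Sum>x\<in>S. f x) = (\<Sum>x\<in>S. \<delta> (f x))"
proof (induction S rule: infinite_finite_induct)
  case (insert x F)
  then have "\<delta> (f x + (\<Sum>x\<in>F. f x)) = \<delta> (f x) + \<delta> (\<Sum>x\<in>F. f x)"
    by (intro der_add subring_sum[OF A]) auto
  with insert show ?case by simp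
qed (auto simp: der_0)

text \<open>The value that the Leibniz rule forces on \<open>poly p z\<close> if \<open>z\<close>
  goes to \<open>\<zeta>\<close> and its derivative is \<open>\<eta>\<close>.\<close>

definition der_poly :: "'k \<Rightarrow> 'k \<Rightarrow> 'r poly \<Rightarrow> 'k" where
  "der_poly \<zeta> \<eta> p = poly (map_poly \<delta> p) \<zeta> + poly (pderiv (map_poly \<theta> p)) \<zeta> * \<eta>"

lemma der_poly_add:
  assumes "p \<in> polys_over A" "q \<in> polys_over A"
  shows "der_poly \<zeta> \<eta> (p + q) = der_poly \<zeta> \<eta> p + der_poly \<zeta> \<eta> q"
proof -
  have "map_poly \<delta> (p + q) = map_poly \<delta> p + map_poly \<delta> q"
    by (rule poly_eqI) (use assms in \<open>simp add: coeff_map_poly der_0 polys_over_def der_add\<close>)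
  then show ?thesis
    by (simp add: der_poly_def map_poly_hom_add[OF assms] pderiv_add algebra_simps)
qed

lemma der_poly_mult:
  assumes "p \<in> polys_over A" "q \<in> polys_over A"
  shows "der_poly \<zeta> \<eta> (p * q) =
    poly (map_poly \<theta> p) \<zeta> * der_poly \<zeta> \<eta> q + der_poly \<zeta> \<eta> p * poly (map_poly \<theta> q) \<zeta>"
proof -
  have "map_poly \<delta> (p * q) = map_poly \<theta> p * map_poly \<delta> q + map_poly \<delta> p * map_poly \<theta> q"
  proof (rule poly_eqI)
    fix i
    have "\<delta> (\<Sum>j\<le>i. coeff p j * coeff q (i - j)) = (\<Sum>j\<le>i. \<delta> (coeff p j * coeff q (i - j)))"
      by (rule der_sum) (use assms in \<open>auto simp: polys_over_def intro: subring_mult[OF A]\<close>)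
    also have "\<dots> = (\<Sum>j\<le>i. \<theta> (coeff p j) * \<delta> (coeff q (i - j)) + \<delta> (coeff p j) * \<theta> (coeff q (i - j)))"
      using assms by (intro sum.cong refl der_mult) (auto simp: polys_over_def)
    finally show "coeff (map_poly \<delta> (p * q)) i = coeff (map_poly \<theta> p * map_poly \<delta> q + map_poly \<delta> p * map_poly \<theta> q) i"
      by (simp add: coeff_map_poly hom_0 der_0 coeff_mult sum.distrib)
  qed
  then show ?thesis
    by (simp add: der_poly_def map_poly_hom_mult[OF assms] pderiv_mult algebra_simps)
qed

lemma der_poly_ideal: "p \<in> polys_over A \<Longrightarrow> (\<And>i. coeff p i \<in> P) \<Longrightarrow> der_poly \<zeta> \<eta> p = 0"
proof -
  assume p: "p \<in> polys_over A" "\<And>i. coeff p i \<in> P"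
  have "map_poly \<delta> p = 0"
    by (rule poly_eqI) (use p in \<open>auto simp: coeff_map_poly der_0 polys_over_def der_ideal\<close>)
  then show ?thesis by (simp add: der_poly_def map_poly_hom_ideal[OF p])
qed

lemma der_poly_const: "der_poly \<zeta> \<eta> [:a:] = \<delta> a"
proof -
  have "map_poly \<delta> [:a:] = [:\<delta> a:]"
    by (rule poly_eqI) (simp add: coeff_map_poly der_0 coeff_pCons split: nat.split)
  then show ?thesis by (simp add: der_poly_def map_poly_hom_const)
qed

end

text \<open>The only obstruction is well-definedness: polynomials with the same value at
  \<open>z\<close> must receive the same image, and by additivity it is enough to look at those with
  value in \<open>P\<close>. One \<open>\<theta>'\<close> serves for all derivations.\<close>

lemma extend_hom_der:
  assumes well: "\<And>q. q \<in> polys_over A \<Longrightarrow> poly q z \<in> P \<Longrightarrow> poly (map_poly \<theta> q) \<zeta> = 0"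
    and der: "\<And>\<delta>. der_on P A \<theta> \<delta> \<Longrightarrow>
      \<exists>\<eta>. \<forall>q\<in>polys_over A. poly q z \<in> P \<longrightarrow> der_poly \<delta> \<zeta> \<eta> q = 0"
    and P0: "0 \<in> P"
  shows "\<exists>\<theta>'. hom_on P (adjoin A z) \<theta>' \<and> (\<forall>q\<in>polys_over A. \<theta>' (poly q z) = poly (map_poly \<theta> q) \<zeta>) \<and>
    (\<forall>\<delta>. der_on P A \<theta> \<delta> \<longrightarrow> (\<exists>\<delta>'. der_on P (adjoin A z) \<theta>' \<delta>' \<and> (\<forall>a\<in>A. \<delta>' a = \<delta> a)))"
proof -
  define rep where "rep = (\<lambda>x. SOME q. q \<in> polys_over A \<and> poly q z = x)"
  have rep: "rep (poly q z) \<in> polys_over A" "poly (rep (poly q z)) z = poly q z" if "q \<in> polys_over A" for q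
    unfolding rep_def using someI[of "\<lambda>p. p \<in> polys_over A \<and> poly p z = poly q z" q] that by auto
  have wd: "f (rep (poly q z)) = f q"
    if f: "\<And>p q. p \<in> polys_over A \<Longrightarrow> q \<in> polys_over A \<Longrightarrow> f (p + q) = f p + (f q :: 'k)"
      "\<And>q. q \<in> polys_over A \<Longrightarrow> poly q z \<in> P \<Longrightarrow> f q = 0" and q: "q \<in> polys_over A" for f q
  proof -
    have d: "rep (poly q z) - q \<in> polys_over A" by (rule polys_over_diff[OF A rep(1)[OF q] q])
    moreover have "poly (rep (poly q z) - q) z \<in> P" by (simp add: rep(2)[OF q] P0)
    ultimately have "f (rep (poly q z) - q) = 0" by (rule f(2))
    with f(1)[OF d q] show ?thesis by simp
  qed
  define \<theta>' where "\<theta>' = (\<lambda>x. poly (map_poly \<theta> (rep x)) \<zeta>)"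
  have \<theta>': "\<theta>' (poly q z) = poly (map_poly \<theta> q) \<zeta>" if "q \<in> polys_over A" for q
    unfolding \<theta>'_def by (rule wd[of "\<lambda>q. poly (map_poly \<theta> q) \<zeta>"]) (auto simp: map_poly_hom_add well that)
  have "hom_on P (adjoin A z) \<theta>'"
    unfolding hom_on_def
  proof (intro conjI ballI)
    show "\<theta>' 1 = 1" using \<theta>'[OF polys_over_1[OF A]] map_poly_hom_const[of 1] hom_1 by (simp add: one_pCons)
  next
    fix a b assume "a \<in> adjoin A z" "b \<in> adjoin A z"
    then obtain p q where pq: "a = poly p z" "p \<in> polys_over A" "b = poly q z" "q \<in> polys_over A"
      by (auto simp: adjoin_def)
    show "\<theta>' (a + b) = \<theta>' a + \<theta>' b"
      using \<theta>'[OF polys_over_add[OF A pq(2,4)]] by (simp add: pq \<theta>' map_poly_hom_add)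
    show "\<theta>' (a * b) = \<theta>' a * \<theta>' b"
      using \<theta>'[OF polys_over_mult[OF A pq(2,4)]] by (simp add: pq \<theta>' map_poly_hom_mult)
  next
    fix a assume "a \<in> adjoin A z \<inter> P"
    then show "\<theta>' a = 0" by (auto simp: adjoin_def \<theta>' well)
  qed
  moreover have "\<exists>\<delta>'. der_on P (adjoin A z) \<theta>' \<delta>' \<and> (\<forall>a\<in>A. \<delta>' a = \<delta> a)" if \<delta>: "der_on P A \<theta> \<delta>" for \<delta>
  proof -
    obtain \<eta> where \<eta>: "\<And>q. q \<in> polys_over A \<Longrightarrow> poly q z \<in> P \<Longrightarrow> der_poly \<delta> \<zeta> \<eta> q = 0"
      using der[OF \<delta>] by blast
    define \<delta>' where "\<delta>' = (\<lambda>x. der_poly \<delta> \<zeta> \<eta> (rep x))"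
    have \<delta>': "\<delta>' (poly q z) = der_poly \<delta> \<zeta> \<eta> q" if "q \<in> polys_over A" for q
      unfolding \<delta>'_def by (rule wd) (auto simp: der_poly_add[OF \<delta>] \<eta> that)
    have "der_on P (adjoin A z) \<theta>' \<delta>'"
      unfolding der_on_def
    proof (intro conjI ballI)
      fix a b assume "a \<in> adjoin A z" "b \<in> adjoin A z"
      then obtain p q where pq: "a = poly p z" "p \<in> polys_over A" "b = poly q z" "q \<in> polys_over A"
        by (auto simp: adjoin_def)
      show "\<delta>' (a + b) = \<delta>' a + \<delta>' b"
        using \<delta>'[OF polys_over_add[OF A pq(2,4)]] by (simp add: pq \<delta>' der_poly_add[OF \<delta>])
      show "\<delta>' (a * b) = \<theta>' a * \<delta>' b + \<delta>' a * \<theta>' b"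
        using \<delta>'[OF polys_over_mult[OF A pq(2,4)]] by (simp add: pq \<delta>' \<theta>' der_poly_mult[OF \<delta>])
    next
      fix a assume "a \<in> adjoin A z \<inter> P"
      then show "\<delta>' a = 0" by (auto simp: adjoin_def \<delta>' \<eta>)
    qed
    moreover have "\<delta>' a = \<delta> a" if "a \<in> A" for a
      using \<delta>'[OF polys_over_const[OF A that]] by (simp add: der_poly_const[OF \<delta>])
    ultimately show ?thesis by blast
  qed
  ultimately show ?thesis using \<theta>' by blast
qed

end

lemma prime_idealD:
  assumes "prime_ideal_in B P"
  shows "P \<subseteq> B" "0 \<in> P" "p \<in> P \<Longrightarrow> q \<in> P \<Longrightarrow> p + q \<in> P" "b \<in> B \<Longrightarrow> p \<in> P \<Longrightarrow> b * p \<in> P" "1 \<notin> P"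
    "x \<in> B \<Longrightarrow> y \<in> B \<Longrightarrow> x * y \<in> P \<Longrightarrow> x \<in> P \<or> y \<in> P"
  using assms unfolding prime_ideal_in_def by blast+

text \<open>\<open>B\<close> modulo \<open>P\<close> is a domain of characteristic zero,
  \<open>A\<close> gives a subring of it and \<open>z\<close> is the element to be adjoined.
  Characteristic zero makes minimal polynomials separable.\<close>

locale simple_extension =
  fixes B P A :: "'r::comm_ring_1 set" and z :: 'r
  assumes B: "subring_set B" and P: "prime_ideal_in B P" and A: "subring_set A" and AB: "A \<subseteq> B" and zB: "z \<in> B"
    and char_0: "\<And>n. n > 0 \<Longrightarrow> of_nat n \<notin> P"
begin

lemmas P_add = prime_idealD(3)[OF P] and P_mult = prime_idealD(4)[OF P] and P_zero = prime_idealD(2)[OF P]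
  and P_prime = prime_idealD(6)[OF P]

lemma P_mult': "p \<in> P \<Longrightarrow> b \<in> B \<Longrightarrow> p * b \<in> P"
  using P_mult[of b p] by (simp add: mult.commute)

lemma P_uminus: "p \<in> P \<Longrightarrow> - p \<in> P"
  using P_mult[OF subring_uminus[OF B subring_one[OF B]], of p] by simp

lemma P_diff: "p \<in> P \<Longrightarrow> q \<in> P \<Longrightarrow> p - q \<in> P"
  using P_add[OF _ P_uminus, of p q] by simp

lemma P_sum: "(\<And>x. x \<in> S \<Longrightarrow> f x \<in> P) \<Longrightarrow> (\<Sum>x\<in>S. f x) \<in> P"
  by (induction S rule: infinite_finite_induct) (auto intro: P_zero P_add)

lemma P_cancel: "x - y \<in> P \<Longrightarrow> x \<in> P \<longleftrightarrow> y \<in> P"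
  using P_add[of "x - y" y] P_diff[of x "x - y"] by auto

lemma power_not_P: "a \<in> B \<Longrightarrow> a \<notin> P \<Longrightarrow> a ^ n \<notin> P"
proof (induction n)
  case 0
  then show ?case using prime_idealD(5)[OF P] by simp
next
  case (Suc n)
  then show ?case using P_prime[of a "a ^ n"] subring_power[OF B, of a n] by auto
qed

lemma polys_overB: "p \<in> polys_over A \<Longrightarrow> p \<in> polys_over B"
  using AB by (auto simp: polys_over_def)

lemma poly_in_B: "p \<in> polys_over A \<Longrightarrow> poly p z \<in> B"
  by (rule subring_poly[OF B polys_overB zB])

lemma coeff_in: "p \<in> polys_over A \<Longrightarrow> coeff p i \<in> A" "p \<in> polys_over A \<Longrightarrow> coeff p i \<in> B"
  using AB by (auto simp: polys_over_def)

lemma poly_in_P: "p \<in> polys_over A \<Longrightarrow> (\<And>i. coeff p i \<in> P) \<Longrightarrow> poly p z \<in> P"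
  unfolding poly_altdef by (intro P_sum P_mult' subring_power[OF B] zB)

text \<open>The minimal polynomial of \<open>z\<close> over the field of fractions of
  \<open>A\<close> modulo \<open>P\<close>, with denominators cleared; \<open>n\<close> is its
  degree.\<close>

definition min_poly :: "nat \<Rightarrow> 'r poly \<Rightarrow> bool" where
  "min_poly n p \<longleftrightarrow> p \<in> polys_over A \<and> poly p z \<in> P \<and> (\<forall>i>n. coeff p i = 0) \<and> coeff p n \<notin> P \<and> n > 0 \<and>
     (\<forall>q\<in>polys_over A. poly q z \<in> P \<longrightarrow> (\<forall>i\<ge>n. coeff q i = 0) \<longrightarrow> (\<forall>i. coeff q i \<in> P))"

lemma min_poly_exists:
  assumes "q \<in> polys_over A" "poly q z \<in> P" "coeff q j \<notin> P"
  shows "\<exists>n p. min_poly n p"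
proof -
  define R where "R = (\<lambda>n p. p \<in> polys_over A \<and> poly p z \<in> P \<and> (\<exists>i. coeff p i \<notin> P) \<and> (\<forall>i>n. coeff p i = 0))"
  have "R (degree q) q" using assms by (auto simp: R_def coeff_eq_0)
  then have ex: "\<exists>n p. R n p" by blast
  define n where "n = (LEAST n. \<exists>p. R n p)"
  have "\<exists>p. R n p" unfolding n_def using ex by (rule LeastI_ex)
  then obtain p where p: "R n p" by blast
  have least: "n \<le> m" if "R m q" for m q
    unfolding n_def using that by (intro Least_le) blast
  have pA: "p \<in> polys_over A" "poly p z \<in> P" "\<And>i. i > n \<Longrightarrow> coeff p i = 0" using p by (auto simp: R_def)
  \<comment> \<open>A leading coefficient in \<open>P\<close> could be dropped without changing
    anything modulo \<open>P\<close>, against the choice of \<open>n\<close>.\<close>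
  have lead: "coeff p n \<notin> P"
  proof
    assume a: "coeff p n \<in> P"
    define q where "q = p - Polynomial.monom (coeff p n) n"
    have q: "q \<in> polys_over A" unfolding q_def
      by (intro polys_over_diff[OF A] polys_over_monom[OF A] pA coeff_in)
    have qz: "poly q z \<in> P"
      unfolding q_def by (simp add: poly_monom) (intro P_diff pA P_mult' a subring_power[OF B] zB)
    obtain i where i: "coeff p i \<notin> P" using p by (auto simp: R_def)
    then have "i \<noteq> n" "\<not> i > n" using a pA(3)[of i] P_zero by auto
    then have "i < n" "coeff q i \<notin> P" using i by (auto simp: q_def)
    moreover have "coeff q k = 0" if "k > n - 1" for k
      using that pA(3)[of k] by (cases "k = n") (auto simp: q_def)
    ultimately have "R (n - 1) q" using q qz by (auto simp: R_def)
    from least[OF this] \<open>i < n\<close> show False by simp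
  qed
  have "n > 0"
  proof (rule ccontr)
    assume "\<not> n > 0"
    then have "p = [:coeff p 0:]"
      using pA(3) by (intro poly_eqI) (auto simp: coeff_pCons split: nat.split)
    then have "poly p z = coeff p 0" by (metis mult_zero_right add.right_neutral poly_0 poly_pCons)
    then show False using lead pA(2) \<open>\<not> n > 0\<close> by simp
  qed
  moreover have "coeff q i \<in> P" if "q \<in> polys_over A" "poly q z \<in> P" "\<forall>i\<ge>n. coeff q i = 0" for q i
  proof (rule ccontr)
    assume "coeff q i \<notin> P"
    then have "R (n - 1) q" using that by (auto simp: R_def)
    from least[OF this] \<open>n > 0\<close> show False by simp
  qed
  ultimately show ?thesis unfolding min_poly_def using pA lead by blast
qed

text \<open>
  Every element outside \<open>P\<close> divides, modulo \<open>P\<close>, an element of \<open>A\<close> outside \<open>P\<close>: run the Euclidean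
  algorithm with the minimal polynomial, as one would to invert it over the field of fractions.
\<close>

lemma divides_base_element:
  assumes p: "min_poly n p" and G: "G \<in> polys_over A" "poly G z \<notin> P"
  shows "\<exists>c\<in>A. c \<notin> P \<and> (\<exists>e\<in>polys_over A. c - poly G z * poly e z \<in> P)"
proof -
  have pA: "p \<in> polys_over A" "poly p z \<in> P" "\<And>i. i > n \<Longrightarrow> coeff p i = 0" "coeff p n \<notin> P" "n > 0"
    and pmin: "\<And>q i. q \<in> polys_over A \<Longrightarrow> poly q z \<in> P \<Longrightarrow> (\<And>i. i \<ge> n \<Longrightarrow> coeff q i = 0) \<Longrightarrow> coeff q i \<in> P"
    using p by (auto simp: min_poly_def)
  \<comment> \<open>\<open>T d\<close> says that the value of \<open>d\<close> is, modulo
    \<open>P\<close>, a nonzero multiple of that of \<open>G\<close>. The goal is a constant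
    \<open>d\<close> of this kind, found as one of least degree.\<close>
  define T where "T = (\<lambda>d. d \<in> polys_over A \<and> poly d z \<notin> P \<and>
    (\<exists>e\<in>polys_over A. poly d z - poly G z * poly e z \<in> P))"
  have "T G" unfolding T_def using G polys_over_1[OF A] P_zero by (auto intro!: bexI[of _ 1])
  define m where "m = (LEAST m. \<exists>d. T d \<and> (\<forall>i\<ge>m. coeff d i = 0))"
  have "\<exists>m d. T d \<and> (\<forall>i\<ge>m. coeff d i = 0)"
    using \<open>T G\<close> by (intro exI[of _ "Suc (degree G)"] exI[of _ G]) (auto simp: coeff_eq_0)
  then have "\<exists>d. T d \<and> (\<forall>i\<ge>m. coeff d i = 0)" unfolding m_def by (rule LeastI_ex)
  then obtain d where Td: "T d" and d0: "\<And>i. i \<ge> m \<Longrightarrow> coeff d i = 0" by blast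
  have least: "m \<le> k" if "T d" "\<And>i. i \<ge> k \<Longrightarrow> coeff d i = 0" for k d
    unfolding m_def using that by (intro Least_le) blast
  obtain e where d: "d \<in> polys_over A" "poly d z \<notin> P" "e \<in> polys_over A" "poly d z - poly G z * poly e z \<in> P"
    using Td by (auto simp: T_def)
  have "m > 0"
  proof (rule ccontr)
    assume "\<not> m > 0"
    then have "d = 0" using d0 by (intro poly_eqI) simp
    then show False using d(2) P_zero by simp
  qed
  define l where "l = coeff d (m - 1)"
  have lA: "l \<in> A" "l \<in> B" unfolding l_def using coeff_in d(1) by auto
  have "l \<notin> P"
  proof
    assume l: "l \<in> P"
    define q where "q = d - Polynomial.monom l (m - 1)"
    have lz: "l * z ^ (m - 1) \<in> P" by (intro P_mult' l subring_power[OF B] zB)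
    have qz: "poly q z = poly d z - l * z ^ (m - 1)" by (simp add: q_def poly_monom)
    have q: "q \<in> polys_over A" unfolding q_def by (intro polys_over_diff[OF A] polys_over_monom[OF A] d lA)
    have "poly q z \<notin> P" using P_cancel[of "poly d z" "poly q z"] lz d(2) by (simp add: qz)
    moreover have "poly q z - poly G z * poly e z \<in> P"
      using P_diff[OF d(4) lz] by (simp add: qz algebra_simps)
    ultimately have "T q" using q d(3) by (auto simp: T_def)
    moreover have "coeff q i = 0" if "i \<ge> m - 1" for i
      using that d0[of i] by (cases "i = m - 1") (auto simp: q_def l_def)
    ultimately have "m \<le> m - 1" by (rule least)
    with \<open>m > 0\<close> show False by simp
  qed
  \<comment> \<open>Reducing by \<open>p\<close> changes the value only by a factor that is nonzero
    modulo \<open>P\<close>.\<close>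
  have "m \<le> n"
  proof -
    obtain N s r where sr: "s \<in> polys_over A" "r \<in> polys_over A" "[:coeff p n ^ N:] * d = p * s + r"
      "\<forall>i\<ge>n. coeff r i = 0"
      using pseudo_division[OF A pA(1,3) d(1) d0] by blast
    define a where "a = coeff p n ^ N"
    have aB: "a \<in> A" "a \<in> B" "a \<notin> P"
      unfolding a_def using power_not_P[OF coeff_in(2)[OF pA(1)] pA(4)] subring_power[OF A] subring_power[OF B] coeff_in pA(1)
      by auto
    have ev: "a * poly d z = poly p z * poly s z + poly r z"
      using arg_cong[OF sr(3), of "\<lambda>q. poly q z"] by (simp add: a_def)
    have ps: "poly p z * poly s z \<in> P" by (intro P_mult' pA poly_in_B sr)
    have "poly r z \<notin> P"
    proof
      assume "poly r z \<in> P"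
      then have "a * poly d z \<in> P" unfolding ev by (rule P_add[OF ps])
      then show False using P_prime[OF aB(2) poly_in_B[OF d(1)]] aB d(2) by blast
    qed
    moreover have "poly r z - poly G z * poly ([:a:] * e) z \<in> P"
    proof -
      have "a * (poly d z - poly G z * poly e z) - poly p z * poly s z \<in> P"
        by (intro P_diff P_mult aB d ps)
      then show ?thesis using ev by (simp add: algebra_simps)
    qed
    moreover have "[:a:] * e \<in> polys_over A" by (intro polys_over_mult[OF A] polys_over_const[OF A] aB d)
    ultimately have "T r" using sr(2) unfolding T_def by blast
    then show ?thesis by (rule least) (use sr in auto)
  qed
  \<comment> \<open>Otherwise divide \<open>p\<close> by \<open>d\<close>. The remainder has smaller
    degree than \<open>d\<close>, so it cannot satisfy \<open>T\<close> and its value is in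
    \<open>P\<close>. Then \<open>s\<close> has value in \<open>P\<close> and degree below
    \<open>n\<close>, so all its coefficients are in \<open>P\<close>, and comparing coefficients of
    degree \<open>n\<close> puts a power of \<open>l\<close> times the leading coefficient of
    \<open>p\<close> into \<open>P\<close>.\<close>
  have "m = 1"
  proof (rule ccontr)
    assume "m \<noteq> 1"
    then have m2: "m \<ge> 2" using \<open>m > 0\<close> by simp
    obtain N s r where sr: "s \<in> polys_over A" "r \<in> polys_over A" "[:l ^ N:] * p = d * s + r"
      "\<forall>i\<ge>m - 1. coeff r i = 0" "\<forall>i. i + (m - 1) \<ge> Suc n \<longrightarrow> coeff s i = 0"
    proof -
      have "coeff d i = 0" if "i > m - 1" for i using d0[of i] that by simp
      moreover have "coeff p i = 0" if "i \<ge> Suc n" for i using pA(3)[of i] that by simp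
      ultimately show thesis
        using pseudo_division[OF A d(1) _ pA(1), of "m - 1" "Suc n"] that unfolding l_def by blast
    qed
    have lN: "l ^ N \<in> B" "l ^ N \<notin> P" using subring_power[OF B lA(2)] power_not_P[OF lA(2) \<open>l \<notin> P\<close>] by auto
    have ev: "l ^ N * poly p z = poly d z * poly s z + poly r z"
      using arg_cong[OF sr(3), of "\<lambda>q. poly q z"] by simp
    have lp: "l ^ N * poly p z \<in> P" by (intro P_mult lN pA)
    have "poly r z \<in> P"
    proof (rule ccontr)
      assume "poly r z \<notin> P"
      moreover have "poly r z - poly G z * poly (- (e * s)) z \<in> P"
      proof -
        have "l ^ N * poly p z - (poly d z - poly G z * poly e z) * poly s z \<in> P"
          by (intro P_diff lp P_mult' d poly_in_B sr)
        then show ?thesis using ev by (simp add: algebra_simps)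
      qed
      moreover have "- (e * s) \<in> polys_over A" by (intro polys_over_uminus[OF A] polys_over_mult[OF A] d sr)
      ultimately have "T r" using sr(2) unfolding T_def by blast
      then have "m \<le> m - 1" by (rule least) (use sr in auto)
      with \<open>m > 0\<close> show False by simp
    qed
    then have "poly d z * poly s z \<in> P" using P_diff[OF lp, of "poly r z"] ev by simp
    then have sz: "poly s z \<in> P" using P_prime[OF poly_in_B[OF d(1)] poly_in_B[OF sr(1)]] d(2) by blast
    have s0: "coeff s i \<in> P" for i
    proof (rule pmin[OF sr(1) sz])
      fix i assume "n \<le> i"
      then have "i + (m - 1) \<ge> Suc n" using m2 by simp
      then show "coeff s i = 0" using sr(5) by blast
    qed
    have "coeff (d * s) n \<in> P"
      unfolding coeff_mult by (intro P_sum P_mult s0 coeff_in d)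
    moreover have "coeff r n = 0" using sr(4) \<open>m \<le> n\<close> by simp
    moreover have "l ^ N * coeff p n = coeff (d * s) n + coeff r n"
      using arg_cong[OF sr(3), of "\<lambda>q. coeff q n"] by simp
    ultimately have "l ^ N * coeff p n \<in> P" by simp
    then show False using P_prime[OF lN(1) coeff_in(2)[OF pA(1)]] lN pA by blast
  qed
  have "d = [:l:]"
    by (rule poly_eqI) (use d0 \<open>m = 1\<close> in \<open>auto simp: l_def coeff_pCons split: nat.split\<close>)
  then have "poly d z = l" by simp
  then show ?thesis using d lA \<open>l \<notin> P\<close> by auto
qed

text \<open>If \<open>z\<close> is transcendental modulo \<open>P\<close>, every
  \<open>\<zeta>\<close> at which the image of \<open>g0\<close> does not vanish will do, and
  \<open>\<eta>\<close> is arbitrary. If \<open>z\<close> is algebraic, \<open>\<zeta>\<close> has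
  to be a root of the image of the minimal polynomial, and \<open>h\<close> keeps its leading
  coefficient, its derivative and \<open>g\<close> nonzero.\<close>

lemma extension_step:
  assumes g: "g \<in> adjoin A z" "g \<notin> P"
  shows "\<exists>h\<in>A. h \<notin> P \<and> (\<forall>\<theta> :: 'r \<Rightarrow> 'k::{field_char_0, alg_closed_field}. hom_on P A \<theta> \<longrightarrow> \<theta> h \<noteq> 0 \<longrightarrow>
    (\<exists>\<theta>'. hom_on P (adjoin A z) \<theta>' \<and> (\<forall>a\<in>A. \<theta>' a = \<theta> a) \<and> \<theta>' g \<noteq> 0 \<and>
      (\<forall>\<delta>. der_on P A \<theta> \<delta> \<longrightarrow> (\<exists>\<delta>'. der_on P (adjoin A z) \<theta>' \<delta>' \<and> (\<forall>a\<in>A. \<delta>' a = \<delta> a)))))"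
proof -
  obtain g0 where g0: "g0 \<in> polys_over A" "g = poly g0 z" using g by (auto simp: adjoin_def)
  define goal where "goal = (\<lambda>\<theta> :: 'r \<Rightarrow> 'k. \<exists>\<theta>'. hom_on P (adjoin A z) \<theta>' \<and> (\<forall>a\<in>A. \<theta>' a = \<theta> a) \<and> \<theta>' g \<noteq> 0 \<and>
      (\<forall>\<delta>. der_on P A \<theta> \<delta> \<longrightarrow> (\<exists>\<delta>'. der_on P (adjoin A z) \<theta>' \<delta>' \<and> (\<forall>a\<in>A. \<delta>' a = \<delta> a))))"
  have goalI: "goal \<theta>" if hom: "hom_on P A \<theta>"
    and well: "\<And>q. q \<in> polys_over A \<Longrightarrow> poly q z \<in> P \<Longrightarrow> poly (map_poly \<theta> q) \<zeta> = 0"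
    and der: "\<And>\<delta>. der_on P A \<theta> \<delta> \<Longrightarrow> \<exists>\<eta>. \<forall>q\<in>polys_over A. poly q z \<in> P \<longrightarrow> der_poly \<theta> \<delta> \<zeta> \<eta> q = 0"
    and gz: "poly (map_poly \<theta> g0) \<zeta> \<noteq> 0" for \<theta> :: "'r \<Rightarrow> 'k" and \<zeta>
  proof -
    obtain \<theta>' where \<theta>': "hom_on P (adjoin A z) \<theta>'"
      "\<And>q. q \<in> polys_over A \<Longrightarrow> \<theta>' (poly q z) = poly (map_poly \<theta> q) \<zeta>"
      "\<forall>\<delta>. der_on P A \<theta> \<delta> \<longrightarrow> (\<exists>\<delta>'. der_on P (adjoin A z) \<theta>' \<delta>' \<and> (\<forall>a\<in>A. \<delta>' a = \<delta> a))"
      using extend_hom_der[OF A hom well der P_zero] by blast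
    have "\<theta>' a = \<theta> a" if "a \<in> A" for a
      using \<theta>'(2)[OF polys_over_const[OF A that]] by (simp add: map_poly_hom_const[OF A hom])
    moreover have "\<theta>' g \<noteq> 0" using \<theta>'(2)[OF g0(1)] gz g0(2) by simp
    ultimately show ?thesis unfolding goal_def using \<theta>'(1,3) by blast
  qed
  show ?thesis
  proof (cases "\<exists>q j. q \<in> polys_over A \<and> poly q z \<in> P \<and> coeff q j \<notin> P")
    case False
    then have tr: "coeff q j \<in> P" if "q \<in> polys_over A" "poly q z \<in> P" for q j using that by blast
    obtain i where i: "coeff g0 i \<notin> P" using poly_in_P[OF g0(1)] g g0(2) by blast
    have "goal \<theta>" if hom: "hom_on P A \<theta>" and nz: "\<theta> (coeff g0 i) \<noteq> 0" for \<theta>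
    proof -
      have "coeff (map_poly \<theta> g0) i \<noteq> 0" using nz by (simp add: coeff_map_poly hom_0[OF A hom])
      then have "map_poly \<theta> g0 \<noteq> 0" by auto
      then obtain \<zeta> where "poly (map_poly \<theta> g0) \<zeta> \<noteq> 0" using poly_function_eq_0 by blast
      then show ?thesis
        using tr map_poly_hom_ideal[OF A hom] der_poly_ideal[OF A hom]
        by (intro goalI[OF hom, of \<zeta>]) auto
    qed
    then show ?thesis using i coeff_in(1)[OF g0(1)] unfolding goal_def by blast
  next
    case True
    then obtain n p where p: "min_poly n p" using min_poly_exists by blast
    then have pA: "p \<in> polys_over A" "poly p z \<in> P" "\<And>i. i > n \<Longrightarrow> coeff p i = 0" "coeff p n \<notin> P" "n > 0"
      and pmin: "\<And>q i. q \<in> polys_over A \<Longrightarrow> poly q z \<in> P \<Longrightarrow> (\<And>i. i \<ge> n \<Longrightarrow> coeff q i = 0) \<Longrightarrow> coeff q i \<in> P"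
      by (auto simp: min_poly_def)
    define a where "a = coeff p n"
    have aA: "a \<in> A" "a \<in> B" "a \<notin> P" using coeff_in[OF pA(1)] pA(4) by (auto simp: a_def)
    have p'A: "formal_deriv p \<in> polys_over A" by (rule polys_over_pderiv[OF A pA(1)])
    \<comment> \<open>The derivative has smaller degree and leading coefficient
      \<open>of_nat n * a\<close>, which is outside \<open>P\<close> by characteristic zero, so
      minimality of \<open>p\<close> applies.\<close>
    have "poly (formal_deriv p) z \<notin> P"
    proof
      assume "poly (formal_deriv p) z \<in> P"
      then have "coeff (formal_deriv p) (n - 1) \<in> P"
        using pA(3) by (intro pmin[OF p'A]) (auto simp: coeff_formal_deriv)
      then have "of_nat n * a \<in> P" using pA(5) by (simp add: coeff_formal_deriv a_def del: of_nat_Suc)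
      then show False
        using P_prime[OF subring_of_nat[OF B] aA(2)] aA(3) char_0[OF pA(5)] by blast
    qed
    \<comment> \<open>Treating \<open>g0\<close> and the derivative as one product yields a single
      \<open>c\<close> that keeps both nonzero at \<open>\<zeta>\<close>.\<close>
    then have "poly (g0 * formal_deriv p) z \<notin> P"
      using P_prime[OF poly_in_B[OF g0(1)] poly_in_B[OF p'A]] g g0(2) by auto
    moreover have Gp: "g0 * formal_deriv p \<in> polys_over A" by (rule polys_over_mult[OF A g0(1) p'A])
    ultimately obtain c e where c: "c \<in> A" "c \<notin> P" "e \<in> polys_over A"
      "c - poly (g0 * formal_deriv p) z * poly e z \<in> P"
      using divides_base_element[OF p Gp] by blast
    have "a * c \<in> A" "a * c \<notin> P"
      using P_prime[OF aA(2), of c] subring_mult[OF A aA(1) c(1)] aA c(1,2) AB by blast+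
    moreover have "goal \<theta>" if hom: "hom_on P A \<theta>" and ac: "\<theta> (a * c) \<noteq> 0" for \<theta>
    proof -
      have nz: "\<theta> a \<noteq> 0" "\<theta> c \<noteq> 0" using ac by (auto simp: hom_mult[OF A hom aA(1) c(1)])
      have "coeff (map_poly \<theta> p) n \<noteq> 0" using nz by (simp add: coeff_map_poly hom_0[OF A hom] a_def)
      then have "degree (map_poly \<theta> p) > 0" using pA(5) le_degree[of "map_poly \<theta> p" n] by simp
      from alg_closed_imp_poly_has_root[OF this]
      obtain \<zeta> where \<zeta>: "poly (map_poly \<theta> p) \<zeta> = 0" ..
      \<comment> \<open>Modulo \<open>P\<close> and up to powers of \<open>a\<close>, every
        polynomial with value in \<open>P\<close> is a multiple of \<open>p\<close>, so only
        \<open>p\<close> itself has to be checked.\<close>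
      have red: "\<exists>N s r. s \<in> polys_over A \<and> r \<in> polys_over A \<and> [:a ^ N:] * q = p * s + r \<and> (\<forall>i. coeff r i \<in> P)"
        if q: "q \<in> polys_over A" "poly q z \<in> P" for q
      proof -
        obtain N s r where sr: "s \<in> polys_over A" "r \<in> polys_over A" "[:a ^ N:] * q = p * s + r"
          "\<forall>i\<ge>n. coeff r i = 0"
        proof -
          have "coeff q i = 0" if "i \<ge> Suc (degree q)" for i using that by (simp add: coeff_eq_0)
          then show thesis
            using pseudo_division[OF A pA(1,3) q(1), where m = "Suc (degree q)"] that unfolding a_def by blast
        qed
        have "poly r z = a ^ N * poly q z - poly p z * poly s z"
          using arg_cong[OF sr(3), of "\<lambda>q. poly q z"] by simp
        also have "\<dots> \<in> P"
          by (intro P_diff P_mult P_mult' subring_power[OF B] aA q pA poly_in_B sr)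
        finally have "coeff r i \<in> P" for i using sr(2,4) by (intro pmin) auto
        then show ?thesis using sr by blast
      qed
      have well: "poly (map_poly \<theta> q) \<zeta> = 0" if q: "q \<in> polys_over A" "poly q z \<in> P" for q
      proof -
        obtain N s r where sr: "s \<in> polys_over A" "r \<in> polys_over A" "[:a ^ N:] * q = p * s + r" "\<forall>i. coeff r i \<in> P"
          using red[OF q] by blast
        have aN: "[:a ^ N:] \<in> polys_over A" by (intro polys_over_const[OF A] subring_power[OF A] aA)
        have "map_poly \<theta> ([:a ^ N:] * q) = map_poly \<theta> p * map_poly \<theta> s + map_poly \<theta> r"
          unfolding sr(3)
          by (simp only: map_poly_hom_add[OF A hom polys_over_mult[OF A pA(1) sr(1)] sr(2)] map_poly_hom_mult[OF A hom pA(1) sr(1)])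
        moreover have "map_poly \<theta> r = 0" by (rule map_poly_hom_ideal[OF A hom sr(2)]) (use sr in auto)
        moreover have "map_poly \<theta> ([:a ^ N:] * q) = [:\<theta> a ^ N:] * map_poly \<theta> q"
          by (simp only: map_poly_hom_mult[OF A hom aN q(1)] map_poly_hom_const[OF A hom] hom_power[OF A hom aA(1)])
        ultimately have "[:\<theta> a ^ N:] * map_poly \<theta> q = map_poly \<theta> p * map_poly \<theta> s" by simp
        from arg_cong[OF this, of "\<lambda>q. poly q \<zeta>"] show ?thesis using \<zeta> nz by simp
      qed
      have "[:c:] - g0 * formal_deriv p * e \<in> polys_over A"
        by (intro polys_over_diff[OF A] polys_over_const[OF A] polys_over_mult[OF A] c g0 p'A)
      from well[OF this] c(4)
      have "poly (map_poly \<theta> ([:c:] - g0 * formal_deriv p * e)) \<zeta> = 0" by simp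
      also have "map_poly \<theta> ([:c:] - g0 * formal_deriv p * e) =
          [:\<theta> c:] - map_poly \<theta> g0 * pderiv (map_poly \<theta> p) * map_poly \<theta> e"
        by (simp only: map_poly_hom_diff[OF A hom polys_over_const[OF A c(1)] polys_over_mult[OF A Gp c(3)]]
            map_poly_hom_mult[OF A hom Gp c(3)] map_poly_hom_mult[OF A hom g0(1) p'A]
            map_poly_hom_const[OF A hom] map_poly_hom_pderiv[OF A hom pA(1)])
      finally have nz': "poly (map_poly \<theta> g0) \<zeta> \<noteq> 0" "poly (pderiv (map_poly \<theta> p)) \<zeta> \<noteq> 0"
        using nz by auto
      show ?thesis
      proof (rule goalI[OF hom well _ nz'(1)])
        fix \<delta> assume \<delta>: "der_on P A \<theta> \<delta>"
        \<comment> \<open>Implicit differentiation of the equation \<open>p\<close>; the denominator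
          is nonzero by the choice of \<open>c\<close>.\<close>
        define \<eta> where "\<eta> = - poly (map_poly \<delta> p) \<zeta> / poly (pderiv (map_poly \<theta> p)) \<zeta>"
        have Dp: "der_poly \<theta> \<delta> \<zeta> \<eta> p = 0"
          using nz' by (simp add: der_poly_def[OF A hom \<delta>] \<eta>_def)
        have "der_poly \<theta> \<delta> \<zeta> \<eta> q = 0" if q: "q \<in> polys_over A" "poly q z \<in> P" for q
        proof -
          obtain N s r where sr: "s \<in> polys_over A" "r \<in> polys_over A" "[:a ^ N:] * q = p * s + r" "\<forall>i. coeff r i \<in> P"
            using red[OF q] by blast
          have aN: "[:a ^ N:] \<in> polys_over A" by (intro polys_over_const[OF A] subring_power[OF A] aA)
          have "der_poly \<theta> \<delta> \<zeta> \<eta> ([:a ^ N:] * q) = \<theta> a ^ N * der_poly \<theta> \<delta> \<zeta> \<eta> q"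
            using well[OF q] by (simp only: der_poly_mult[OF A hom \<delta> aN q(1)] map_poly_hom_const[OF A hom] hom_power[OF A hom aA(1)]) simp
          moreover have "der_poly \<theta> \<delta> \<zeta> \<eta> (p * s + r) = 0"
            using Dp \<zeta> der_poly_ideal[OF A hom \<delta> sr(2)] sr(4)
            by (simp add: der_poly_add[OF A hom \<delta> polys_over_mult[OF A pA(1) sr(1)] sr(2)] der_poly_mult[OF A hom \<delta> pA(1) sr(1)])
          ultimately show ?thesis using sr(3) nz by simp
        qed
        then show "\<exists>\<eta>. \<forall>q\<in>polys_over A. poly q z \<in> P \<longrightarrow> der_poly \<theta> \<delta> \<zeta> \<eta> q = 0" by blast
      qed
    qed
    ultimately show ?thesis unfolding goal_def by blast
  qed
qed

end

lemma adjoin_subset: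
  assumes "subring_set B" "A \<subseteq> B" "z \<in> B" shows "adjoin A z \<subseteq> B"
  unfolding adjoin_def using subring_poly[OF assms(1) _ assms(3)] assms(2) by (auto simp: polys_over_def)

lemma adjoin_list_subring: "subring_set A \<Longrightarrow> subring_set (adjoin_list A zs)"
  by (induction zs arbitrary: A) (auto intro: adjoin_subring)

lemma adjoin_list_base: "subring_set A \<Longrightarrow> a \<in> A \<Longrightarrow> a \<in> adjoin_list A zs"
  by (induction zs arbitrary: A) (auto intro: adjoin_subring adjoin_base)

lemma adjoin_list_elem: "subring_set A \<Longrightarrow> z \<in> set zs \<Longrightarrow> z \<in> adjoin_list A zs"
  by (induction zs arbitrary: A) (auto intro: adjoin_subring adjoin_list_base adjoin_elem)

text \<open>
  For a domain this is Chevalley's theorem in its strong form; the statement about derivations is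
  generic smoothness. Working modulo a prime ideal \<open>P\<close> avoids quotient rings.
\<close>

theorem extension_theorem:
  fixes B P A :: "'r::comm_ring_1 set"
  assumes "subring_set B" "prime_ideal_in B P" "\<forall>n>0. of_nat n \<notin> P"
    and "subring_set A" "A \<subseteq> B" "set zs \<subseteq> B" "g \<in> adjoin_list A zs" "g \<notin> P"
  shows "\<exists>h\<in>A. h \<notin> P \<and> (\<forall>\<theta> :: 'r \<Rightarrow> 'k::{field_char_0, alg_closed_field}. hom_on P A \<theta> \<longrightarrow> \<theta> h \<noteq> 0 \<longrightarrow>
    (\<exists>\<theta>'. hom_on P (adjoin_list A zs) \<theta>' \<and> (\<forall>a\<in>A. \<theta>' a = \<theta> a) \<and> \<theta>' g \<noteq> 0 \<and>
      (\<forall>\<delta>. der_on P A \<theta> \<delta> \<longrightarrow> (\<exists>\<delta>'. der_on P (adjoin_list A zs) \<theta>' \<delta>' \<and> (\<forall>a\<in>A. \<delta>' a = \<delta> a)))))"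
  using assms(4-8)
proof (induction zs arbitrary: A)
  case Nil
  then show ?case by auto
next
  case (Cons z zs)
  interpret simple_extension B P A z
    using assms(1-3) Cons.prems by unfold_locales auto
  have sub: "subring_set (adjoin A z)" "adjoin A z \<subseteq> B"
    using Cons.prems adjoin_subring adjoin_subset[OF assms(1)] by auto
  obtain h1 where h1: "h1 \<in> adjoin A z" "h1 \<notin> P" and ext1:
    "\<And>\<theta> :: 'r \<Rightarrow> 'k. hom_on P (adjoin A z) \<theta> \<Longrightarrow> \<theta> h1 \<noteq> 0 \<Longrightarrow>
    (\<exists>\<theta>'. hom_on P (adjoin_list (adjoin A z) zs) \<theta>' \<and> (\<forall>a\<in>adjoin A z. \<theta>' a = \<theta> a) \<and> \<theta>' g \<noteq> 0 \<and>
      (\<forall>\<delta>. der_on P (adjoin A z) \<theta> \<delta> \<longrightarrow> (\<exists>\<delta>'. der_on P (adjoin_list (adjoin A z) zs) \<theta>' \<delta>' \<and> (\<forall>a\<in>adjoin A z. \<delta>' a = \<delta> a))))"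
    using Cons.IH[OF sub] Cons.prems by auto
  obtain h where h: "h \<in> A" "h \<notin> P" and ext:
    "\<And>\<theta> :: 'r \<Rightarrow> 'k. hom_on P A \<theta> \<Longrightarrow> \<theta> h \<noteq> 0 \<Longrightarrow>
    (\<exists>\<theta>'. hom_on P (adjoin A z) \<theta>' \<and> (\<forall>a\<in>A. \<theta>' a = \<theta> a) \<and> \<theta>' h1 \<noteq> 0 \<and>
      (\<forall>\<delta>. der_on P A \<theta> \<delta> \<longrightarrow> (\<exists>\<delta>'. der_on P (adjoin A z) \<theta>' \<delta>' \<and> (\<forall>a\<in>A. \<delta>' a = \<delta> a))))"
    using extension_step[OF h1] by blast
  have base: "a \<in> adjoin A z" if "a \<in> A" for a using adjoin_base[OF A that] .
  show ?case
  proof (intro bexI[of _ h] conjI allI impI h)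
    fix \<theta> :: "'r \<Rightarrow> 'k" assume "hom_on P A \<theta>" "\<theta> h \<noteq> 0"
    from ext[OF this] obtain \<theta>1 where \<theta>1: "hom_on P (adjoin A z) \<theta>1" "\<forall>a\<in>A. \<theta>1 a = \<theta> a" "\<theta>1 h1 \<noteq> 0"
      "\<And>\<delta>. der_on P A \<theta> \<delta> \<Longrightarrow> \<exists>\<delta>'. der_on P (adjoin A z) \<theta>1 \<delta>' \<and> (\<forall>a\<in>A. \<delta>' a = \<delta> a)"
      by blast
    from ext1[OF \<theta>1(1,3)] obtain \<theta>2 where \<theta>2: "hom_on P (adjoin_list (adjoin A z) zs) \<theta>2"
      "\<forall>a\<in>adjoin A z. \<theta>2 a = \<theta>1 a" "\<theta>2 g \<noteq> 0"
      "\<And>\<delta>. der_on P (adjoin A z) \<theta>1 \<delta> \<Longrightarrow>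
        \<exists>\<delta>'. der_on P (adjoin_list (adjoin A z) zs) \<theta>2 \<delta>' \<and> (\<forall>a\<in>adjoin A z. \<delta>' a = \<delta> a)"
      by blast
    show "\<exists>\<theta>'. hom_on P (adjoin_list A (z # zs)) \<theta>' \<and> (\<forall>a\<in>A. \<theta>' a = \<theta> a) \<and> \<theta>' g \<noteq> 0 \<and>
      (\<forall>\<delta>. der_on P A \<theta> \<delta> \<longrightarrow> (\<exists>\<delta>'. der_on P (adjoin_list A (z # zs)) \<theta>' \<delta>' \<and> (\<forall>a\<in>A. \<delta>' a = \<delta> a)))"
    proof (rule exI[of _ \<theta>2], intro conjI allI impI)
      fix \<delta> assume "der_on P A \<theta> \<delta>"
      from \<theta>1(4)[OF this] obtain \<delta>1 where \<delta>1: "der_on P (adjoin A z) \<theta>1 \<delta>1" "\<forall>a\<in>A. \<delta>1 a = \<delta> a" by blast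
      from \<theta>2(4)[OF \<delta>1(1)] \<delta>1(2) base
      show "\<exists>\<delta>'. der_on P (adjoin_list A (z # zs)) \<theta>2 \<delta>' \<and> (\<forall>a\<in>A. \<delta>' a = \<delta> a)" by auto
    qed (use \<theta>2 \<theta>1(2) base in auto)
  qed
qed

section \<open>Images and fibres of polynomial maps\<close>

lemma polyfun_subring: "subring_set (polyfun J)"
  unfolding subring_set_def plus_fun_def times_fun_def one_fun_def fun_Compl_def
  by (intro conjI ballI polyfun_const polyfun_add polyfun_mult polyfun_uminus)

lemma polyfun_no_zero_divisors:
  fixes f g :: "('j \<Rightarrow> 'k::field_char_0) \<Rightarrow> 'k"
  assumes "f \<in> polyfun J" "g \<in> polyfun J" "f * g = 0"
  shows "f = 0 \<or> g = 0"
proof (rule ccontr)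
  assume "\<not> ?thesis"
  then obtain v w where vw: "f v \<noteq> 0" "g w \<noteq> 0" by (auto simp: fun_eq_iff)
  obtain u where "f u * g u \<noteq> 0" using polyfun_mult_nonzero[OF assms(1) vw(1) assms(2) vw(2)] by blast
  then show False using fun_cong[OF assms(3), of u] by simp
qed

lemma polyfun_in_adjoin_list:
  assumes "subring_set A" "\<And>c. (\<lambda>_. c) \<in> A" "\<And>j. j \<in> J \<Longrightarrow> (\<lambda>v. v j) \<in> A \<or> (\<lambda>v. v j) \<in> set zs"
    and "f \<in> polyfun J"
  shows "f \<in> adjoin_list A zs"
  using assms(4)
proof induction
  case (polyfun_const c)
  show ?case by (rule adjoin_list_base[OF assms(1) assms(2)])
next
  case (polyfun_coord j)
  from assms(3)[OF this] show ?case
    by (elim disjE) (intro adjoin_list_base[OF assms(1)] adjoin_list_elem[OF assms(1)]; assumption)+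
next
  case (polyfun_add f g)
  have "f + g \<in> adjoin_list A zs"
    by (intro subring_add[OF adjoin_list_subring[OF assms(1)]] polyfun_add.IH)
  then show ?case by (simp add: plus_fun_def)
next
  case (polyfun_mult f g)
  have "f * g \<in> adjoin_list A zs"
    by (intro subring_mult[OF adjoin_list_subring[OF assms(1)]] polyfun_mult.IH)
  then show ?case by (simp add: times_fun_def)
qed

text \<open>Points are homomorphisms: the extension theorem constructs homomorphisms, and this turns
  them into parameter values.\<close>

lemma hom_on_polyfun:
  fixes \<theta> :: "(('j \<Rightarrow> 'k) \<Rightarrow> 'k) \<Rightarrow> 'k::field_char_0"
  assumes S: "subring_set S" "hom_on P S \<theta>" and sub: "polyfun J \<subseteq> S"
    and c: "\<And>c. \<theta> (\<lambda>_. c) = c" and f: "f \<in> polyfun J"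
  shows "\<theta> f = f (\<lambda>j. \<theta> (\<lambda>v. v j))"
  using f
proof induction
  case (polyfun_add f g)
  then have "\<theta> (f + g) = \<theta> f + \<theta> g" using sub by (intro hom_add[OF S]) auto
  then show ?case using polyfun_add by (simp add: plus_fun_def)
next
  case (polyfun_mult f g)
  then have "\<theta> (f * g) = \<theta> f * \<theta> g" using sub by (intro hom_mult[OF S]) auto
  then show ?case using polyfun_mult by (simp add: times_fun_def)
qed (simp_all add: c)

text \<open>The counterpart of \<open>hom_on_polyfun\<close> for tangent vectors: extended
  derivations become lifted directions.\<close>

lemma der_on_polyfun:
  fixes \<theta> :: "(('j \<Rightarrow> 'k) \<Rightarrow> 'k) \<Rightarrow> 'k::field_char_0"
  assumes S: "subring_set S" "hom_on P S \<theta>" "der_on P S \<theta> \<delta>" and sub: "polyfun J \<subseteq> S"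
    and c: "\<And>c. \<theta> (\<lambda>_. c) = c" "\<And>c. \<delta> (\<lambda>_. c) = 0" and f: "f \<in> polyfun J"
  shows "has_dd f (\<lambda>j. \<theta> (\<lambda>v. v j)) (\<lambda>j. \<delta> (\<lambda>v. v j)) (\<delta> f)"
  using f
proof induction
  case (polyfun_const c)
  show ?case unfolding c by (rule has_dd_const)
next
  case (polyfun_coord j)
  show ?case by (rule has_dd_coord)
next
  case (polyfun_add f g)
  then have "\<delta> (f + g) = \<delta> f + \<delta> g" using sub by (intro der_add[OF S]) auto
  then show ?case using has_dd_add[OF polyfun_add.IH] by (simp add: plus_fun_def)
next
  case (polyfun_mult f g)
  then have "\<delta> (f * g) = \<theta> f * \<delta> g + \<delta> f * \<theta> g" using sub by (intro der_mult[OF S]) auto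
  then show ?case
    using has_dd_mult[OF polyfun_mult.IH] hom_on_polyfun[OF S(1,2) sub c(1)] polyfun_mult.hyps
    by (simp add: times_fun_def)
qed

text \<open>A point \<open>v\<close> satisfying all equations of the image defines a homomorphism on
  the subring of pulled back functions. Where \<open>F\<close> does not vanish it extends to all
  polynomial functions of the parameters, and the extension is a preimage of \<open>v\<close>;
  \<open>g\<close> is the element whose nonvanishing is preserved.\<close>

theorem image_contains_open:
  fixes \<Phi> :: "('j \<Rightarrow> 'k::{field_char_0, alg_closed_field}) \<Rightarrow> 'i \<Rightarrow> 'k"
  assumes J: "finite J" and \<Phi>: "\<And>i. i \<in> I \<Longrightarrow> (\<lambda>u. \<Phi> u i) \<in> polyfun J"
    and g: "g \<in> polyfun J" "g u0 \<noteq> 0"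
  shows "\<exists>F\<in>polyfun I. (\<exists>u. F (\<Phi> u) \<noteq> 0) \<and>
    (\<forall>v. (\<forall>f\<in>polyfun I. (\<forall>u. f (\<Phi> u) = 0) \<longrightarrow> f v = 0) \<longrightarrow> F v \<noteq> 0 \<longrightarrow>
      (\<exists>u. (\<forall>i\<in>I. \<Phi> u i = v i) \<and> g u \<noteq> 0))"
proof -
  define A where "A = (\<lambda>F u. F (\<Phi> u)) ` polyfun I"
  define P :: "(('j \<Rightarrow> 'k) \<Rightarrow> 'k) set" where "P = {0}"
  obtain js where js: "set js = J" using finite_list[OF J] by blast
  define zs :: "(('j \<Rightarrow> 'k) \<Rightarrow> 'k) list" where "zs = map (\<lambda>j v. v j) js"
  have A: "subring_set A"
    unfolding subring_set_def
  proof (intro conjI ballI)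
    show "1 \<in> A" unfolding A_def
      by (rule image_eqI[of _ _ "\<lambda>_. 1"]) (auto simp: one_fun_def intro: polyfun_const)
  next
    fix a b assume "a \<in> A" "b \<in> A"
    then obtain F F' where F: "a = (\<lambda>u. F (\<Phi> u))" "F \<in> polyfun I" "b = (\<lambda>u. F' (\<Phi> u))" "F' \<in> polyfun I"
      by (auto simp: A_def)
    show "a + b \<in> A" unfolding A_def
      by (rule image_eqI[of _ _ "\<lambda>v. F v + F' v"]) (simp_all add: F plus_fun_def polyfun_add)
    show "a * b \<in> A" unfolding A_def
      by (rule image_eqI[of _ _ "\<lambda>v. F v * F' v"]) (simp_all add: F times_fun_def polyfun_mult)
  next
    fix a assume "a \<in> A"
    then obtain F where F: "a = (\<lambda>u. F (\<Phi> u))" "F \<in> polyfun I" by (auto simp: A_def)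
    show "- a \<in> A" unfolding A_def
      by (rule image_eqI[of _ _ "\<lambda>v. - F v"]) (simp_all add: F fun_Compl_def polyfun_uminus)
  qed
  have constA: "(\<lambda>_. c) \<in> A" for c unfolding A_def by (rule image_eqI[of _ _ "\<lambda>_. c"]) (auto intro: polyfun_const)
  have AB: "A \<subseteq> polyfun J"
    using polyfun_compose[OF _ \<Phi>] by (auto simp: A_def)
  have zsB: "set zs \<subseteq> polyfun J" by (auto simp: zs_def js intro: polyfun_coord)
  have prime: "prime_ideal_in (polyfun J) P"
    unfolding prime_ideal_in_def
  proof (intro conjI ballI impI)
    show "P \<subseteq> polyfun J" by (auto simp: P_def zero_fun_def intro: polyfun_const)
    show "x \<in> P \<or> y \<in> P" if "x \<in> polyfun J" "y \<in> polyfun J" "x * y \<in> P" for x y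
      using polyfun_no_zero_divisors[OF that(1,2)] that(3) by (simp add: P_def)
  qed (auto simp: P_def)
  have nat: "\<forall>n>0. of_nat n \<notin> P" by (simp add: P_def)
  have "polyfun J \<subseteq> adjoin_list A zs"
    by (rule subsetI, rule polyfun_in_adjoin_list[OF A constA]) (auto simp: zs_def js)
  note sub = this
  have "g \<notin> P" using g by (auto simp: P_def)
  have gz: "g \<in> adjoin_list A zs" using sub g(1) by blast
  from extension_theorem[where ?'k = 'k, OF polyfun_subring prime nat A AB zsB gz \<open>g \<notin> P\<close>]
  obtain h where h: "h \<in> A" "h \<notin> P" and ext: "\<forall>\<theta> :: (('j \<Rightarrow> 'k) \<Rightarrow> 'k) \<Rightarrow> 'k. hom_on P A \<theta> \<longrightarrow> \<theta> h \<noteq> 0 \<longrightarrow>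
    (\<exists>\<theta>'. hom_on P (adjoin_list A zs) \<theta>' \<and> (\<forall>a\<in>A. \<theta>' a = \<theta> a) \<and> \<theta>' g \<noteq> 0 \<and>
      (\<forall>\<delta>. der_on P A \<theta> \<delta> \<longrightarrow> (\<exists>\<delta>'. der_on P (adjoin_list A zs) \<theta>' \<delta>' \<and> (\<forall>a\<in>A. \<delta>' a = \<delta> a))))"
    by (elim bexE conjE)
  obtain F where F: "F \<in> polyfun I" "h = (\<lambda>u. F (\<Phi> u))" using h(1) by (auto simp: A_def)
  have "\<exists>u. F (\<Phi> u) \<noteq> 0" using h(2) by (auto simp: P_def F(2))
  moreover have "\<exists>u. (\<forall>i\<in>I. \<Phi> u i = v i) \<and> g u \<noteq> 0"
    if v: "\<forall>f\<in>polyfun I. (\<forall>u. f (\<Phi> u) = 0) \<longrightarrow> f v = 0" and Fv: "F v \<noteq> 0" for v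
  proof -
    \<comment> \<open>A pulled back function may come from several functions on the target; the
      equations satisfied by \<open>v\<close> make the value at \<open>v\<close> independent of the
      choice.\<close>
    define rep where "rep = (\<lambda>a. SOME F. F \<in> polyfun I \<and> (\<lambda>u. F (\<Phi> u)) = a)"
    define \<theta> where "\<theta> = (\<lambda>a. rep a v)"
    have \<theta>: "\<theta> (\<lambda>u. f (\<Phi> u)) = f v" if f: "f \<in> polyfun I" for f
    proof -
      let ?f = "rep (\<lambda>u. f (\<Phi> u))"
      have r: "?f \<in> polyfun I \<and> (\<lambda>u. ?f (\<Phi> u)) = (\<lambda>u. f (\<Phi> u))"
        unfolding rep_def by (rule someI[of _ f]) (use f in simp)
      then have "(\<lambda>v. ?f v - f v) \<in> polyfun I" using f by (intro polyfun_diff) auto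
      moreover have "?f (\<Phi> u) - f (\<Phi> u) = 0" for u using fun_cong[OF conjunct2[OF r], of u] by simp
      ultimately have "?f v - f v = 0" using v by auto
      then show ?thesis by (simp add: \<theta>_def)
    qed
    have "hom_on P A \<theta>"
      unfolding hom_on_def
    proof (intro conjI ballI)
      show "\<theta> 1 = 1" using \<theta>[OF polyfun_const[of 1]] by (simp add: one_fun_def)
    next
      fix a b assume "a \<in> A" "b \<in> A"
      then obtain F F' where F: "a = (\<lambda>u. F (\<Phi> u))" "F \<in> polyfun I" "b = (\<lambda>u. F' (\<Phi> u))" "F' \<in> polyfun I"
        by (auto simp: A_def)
      show "\<theta> (a + b) = \<theta> a + \<theta> b" using \<theta>[OF polyfun_add[OF F(2,4)]] by (simp add: F \<theta> plus_fun_def)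
      show "\<theta> (a * b) = \<theta> a * \<theta> b" using \<theta>[OF polyfun_mult[OF F(2,4)]] by (simp add: F \<theta> times_fun_def)
    next
      fix a assume "a \<in> A \<inter> P"
      then have "a = (\<lambda>_. 0)" by (auto simp: P_def)
      then show "\<theta> a = 0" using \<theta>[OF polyfun_const[of 0]] by simp
    qed
    moreover have "\<theta> h \<noteq> 0" using \<theta>[OF F(1)] Fv F(2) by simp
    ultimately have "\<exists>\<theta>'. hom_on P (adjoin_list A zs) \<theta>' \<and> (\<forall>a\<in>A. \<theta>' a = \<theta> a) \<and> \<theta>' g \<noteq> 0 \<and>
      (\<forall>\<delta>. der_on P A \<theta> \<delta> \<longrightarrow> (\<exists>\<delta>'. der_on P (adjoin_list A zs) \<theta>' \<delta>' \<and> (\<forall>a\<in>A. \<delta>' a = \<delta> a)))"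
      by (rule ext[rule_format])
    then obtain \<theta>' where \<theta>': "hom_on P (adjoin_list A zs) \<theta>'" "\<forall>a\<in>A. \<theta>' a = \<theta> a" "\<theta>' g \<noteq> 0"
      by (elim exE conjE)
    note \<theta>' = \<theta>'(1) \<theta>'(2)[rule_format] \<theta>'(3)
    define u where "u = (\<lambda>j. \<theta>' (\<lambda>v. v j))"
    have "\<theta>' (\<lambda>_. c) = c" for c using \<theta>'(2)[OF constA, of c] \<theta>[OF polyfun_const[of c]] by simp
    from hom_on_polyfun[OF adjoin_list_subring[OF A] \<theta>'(1) sub this]
    have ev: "\<theta>' f = f u" if "f \<in> polyfun J" for f using that unfolding u_def by blast
    have "\<Phi> u i = v i" if i: "i \<in> I" for i
    proof -
      have "(\<lambda>u. \<Phi> u i) \<in> A"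
        unfolding A_def by (rule image_eqI[of _ _ "\<lambda>v. v i"]) (auto intro: polyfun_coord i)
      from \<theta>'(2)[OF this] show ?thesis using ev[OF \<Phi>[OF i]] \<theta>[OF polyfun_coord[OF i]] by simp
    qed
    moreover have "g u \<noteq> 0" using \<theta>'(3) ev[OF g(1)] by simp
    ultimately show ?thesis by blast
  qed
  ultimately show ?thesis using F(1) by blast
qed

text \<open>Zorn's lemma for ideals that contain \<open>I0\<close> and meet \<open>A\<close> only in
  0. Enlarging a maximal one by an outside element captures a nonzero element of \<open>A\<close>;
  if \<open>x\<close> and \<open>y\<close> are outside and \<open>x * y\<close> is inside, the
  product of the two captured elements is inside as well, although it is nonzero.\<close>

lemma prime_ideal_avoiding:
  fixes I0 B A :: "'r::comm_ring_1 set"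
  assumes B: "subring_set B" and A: "subring_set A" "A \<subseteq> B" "1 \<noteq> (0::'r)"
    and dom: "\<And>x y. x \<in> A \<Longrightarrow> y \<in> A \<Longrightarrow> x * y = 0 \<Longrightarrow> x = 0 \<or> y = 0"
    and I0: "I0 \<subseteq> B" "0 \<in> I0" "\<And>p q. p \<in> I0 \<Longrightarrow> q \<in> I0 \<Longrightarrow> p + q \<in> I0" "\<And>b p. b \<in> B \<Longrightarrow> p \<in> I0 \<Longrightarrow> b * p \<in> I0"
      "I0 \<inter> A \<subseteq> {0}"
  shows "\<exists>P. prime_ideal_in B P \<and> I0 \<subseteq> P \<and> P \<inter> A \<subseteq> {0}"
proof -
  define \<A> where "\<A> = {Q. Q \<subseteq> B \<and> I0 \<subseteq> Q \<and> (\<forall>p\<in>Q. \<forall>q\<in>Q. p + q \<in> Q) \<and> (\<forall>b\<in>B. \<forall>p\<in>Q. b * p \<in> Q) \<and> Q \<inter> A \<subseteq> {0}}"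
  have "\<exists>M\<in>\<A>. \<forall>X\<in>\<A>. M \<subseteq> X \<longrightarrow> X = M"
  proof (rule subset_Zorn_nonempty)
    have "I0 \<in> \<A>" unfolding \<A>_def by (intro CollectI conjI ballI I0 subset_refl)
    then show "\<A> \<noteq> {}" by blast
    fix C assume C: "C \<noteq> {}" "subset.chain \<A> C"
    have CA: "C \<subseteq> \<A>" using C(2) by (auto simp: subset.chain_def)
    have CD: "X \<subseteq> B" "I0 \<subseteq> X" "X \<inter> A \<subseteq> {0}" "p \<in> X \<Longrightarrow> q \<in> X \<Longrightarrow> p + q \<in> X" "b \<in> B \<Longrightarrow> p \<in> X \<Longrightarrow> b * p \<in> X"
      if "X \<in> C" for X b p q
      using CA that unfolding \<A>_def by (simp_all add: subset_iff)
    have "p + q \<in> \<Union>C" if pq: "p \<in> \<Union>C" "q \<in> \<Union>C" for p q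
    proof -
      obtain X Y where XY: "X \<in> C" "p \<in> X" "Y \<in> C" "q \<in> Y" using pq by blast
      have "X \<subseteq> Y \<or> Y \<subseteq> X" using C(2) XY(1,3) by (auto simp: subset.chain_def)
      then obtain Z where "Z \<in> C" "p \<in> Z" "q \<in> Z" using XY by blast
      then have "p + q \<in> Z" by (intro CD(4))
      then show ?thesis using \<open>Z \<in> C\<close> by (rule UnionI[rotated])
    qed
    moreover have "b * p \<in> \<Union>C" if "b \<in> B" "p \<in> \<Union>C" for b p
      using that CD(5) by (metis UnionE UnionI)
    moreover have "\<Union>C \<subseteq> B" "\<Union>C \<inter> A \<subseteq> {0}" using CD(1,3) by blast+
    moreover have "I0 \<subseteq> \<Union>C" using CD(2) C(1) by blast
    ultimately show "\<Union>C \<in> \<A>" unfolding \<A>_def by simp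
  qed
  then obtain M where M: "M \<in> \<A>" and max: "\<And>X. X \<in> \<A> \<Longrightarrow> M \<subseteq> X \<Longrightarrow> X = M" by blast
  have MB: "M \<subseteq> B" "I0 \<subseteq> M" "M \<inter> A \<subseteq> {0}" and Madd: "\<And>p q. p \<in> M \<Longrightarrow> q \<in> M \<Longrightarrow> p + q \<in> M"
    and Mmult: "\<And>b p. b \<in> B \<Longrightarrow> p \<in> M \<Longrightarrow> b * p \<in> M"
    using M by (auto simp: \<A>_def)
  have M0: "0 \<in> M" using MB I0 by blast
  have enlarge: "\<exists>a\<in>A. a \<noteq> 0 \<and> (\<exists>m\<in>M. \<exists>b\<in>B. a = m + b * x)" if x: "x \<in> B" "x \<notin> M" for x
  proof (rule ccontr)
    assume no: "\<not> ?thesis"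
    define X where "X = {m + b * x | m b. m \<in> M \<and> b \<in> B}"
    have MX: "M \<subseteq> X"
    proof
      fix m assume "m \<in> M"
      then have "m = m + 0 * x \<and> m \<in> M \<and> 0 \<in> B" using subring_zero[OF B] by simp
      then show "m \<in> X" unfolding X_def by blast
    qed
    have "X \<in> \<A>"
      unfolding \<A>_def
    proof (intro CollectI conjI ballI)
      show "X \<subseteq> B" using MB(1) x(1) subring_add[OF B] subring_mult[OF B] by (auto simp: X_def)
      show "I0 \<subseteq> X" using MX MB by blast
      show "X \<inter> A \<subseteq> {0}" using no unfolding X_def by blast
      fix p q assume "p \<in> X" "q \<in> X"
      then obtain m b m' b' where "p = m + b * x" "q = m' + b' * x" "m \<in> M" "b \<in> B" "m' \<in> M" "b' \<in> B"
        by (auto simp: X_def)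
      then have "p + q = (m + m') + (b + b') * x \<and> m + m' \<in> M \<and> b + b' \<in> B"
        using Madd subring_add[OF B] by (simp add: algebra_simps)
      then show "p + q \<in> X" unfolding X_def by blast
    next
      fix c p assume "c \<in> B" "p \<in> X"
      then obtain m b where "p = m + b * x" "m \<in> M" "b \<in> B" by (auto simp: X_def)
      then have "c * p = c * m + (c * b) * x \<and> c * m \<in> M \<and> c * b \<in> B"
        using Mmult subring_mult[OF B] \<open>c \<in> B\<close> by (simp add: algebra_simps)
      then show "c * p \<in> X" unfolding X_def by blast
    qed
    from max[OF this MX] have "X = M" .
    moreover have "x = 0 + 1 * x \<and> 0 \<in> M \<and> 1 \<in> B" using M0 subring_one[OF B] by simp
    then have "x \<in> X" unfolding X_def by blast
    ultimately show False using x by blast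
  qed
  have "prime_ideal_in B M"
    unfolding prime_ideal_in_def
  proof (intro conjI ballI impI)
    show "1 \<notin> M" using MB(3) subring_one[OF A(1)] A(3) by blast
    fix x y assume xy: "x \<in> B" "y \<in> B" "x * y \<in> M"
    show "x \<in> M \<or> y \<in> M"
    proof (rule ccontr)
      assume "\<not> ?thesis"
      then have "x \<notin> M" "y \<notin> M" by auto
      obtain a m b where a: "a \<in> A" "a \<noteq> 0" "m \<in> M" "b \<in> B" "a = m + b * x"
        using enlarge[OF xy(1) \<open>x \<notin> M\<close>] by blast
      obtain a' m' b' where a': "a' \<in> A" "a' \<noteq> 0" "m' \<in> M" "b' \<in> B" "a' = m' + b' * y"
        using enlarge[OF xy(2) \<open>y \<notin> M\<close>] by blast
      have "a * a' = (m' + b' * y) * m + (b * x) * m' + (b * b') * (x * y)"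
        by (simp add: a(5) a'(5) algebra_simps)
      also have "\<dots> \<in> M"
      proof -
        have "m' \<in> B" using a'(3) MB(1) by blast
        then have "m' + b' * y \<in> B" "b * x \<in> B" "b * b' \<in> B"
          using a(4) a'(4) xy by (simp_all add: subring_mult[OF B] subring_add[OF B])
        then show ?thesis by (intro Madd) (rule Mmult, assumption, rule a(3) a'(3) xy(3))+
      qed
      finally have "a * a' = 0" using MB(3) subring_mult[OF A(1) a(1) a'(1)] by blast
      from dom[OF a(1) a'(1) this] show False using a(2) a'(2) by simp
    qed
  qed (rule MB M0 Madd Mmult; assumption)+
  with MB show ?thesis by (intro exI[of _ M] conjI)
qed

text \<open>\<open>J\<close> indexes parameters, \<open>L\<close> auxiliary unknowns, and the
  solutions of the equations \<open>E\<close> are dense over the parameters. The prime ideal selects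
  a component of the solutions that still dominates the parameters, and directions are lifted by
  extending derivations from \<open>polyfun J\<close>.\<close>

theorem generic_smoothness:
  fixes E :: "(('j \<Rightarrow> 'k::{field_char_0, alg_closed_field}) \<Rightarrow> 'k) set"
  assumes L: "finite L" and E: "E \<subseteq> polyfun (J \<union> L)"
    and dense: "\<And>f u. f \<in> polyfun J \<Longrightarrow> (\<And>x. (\<And>e. e \<in> E \<Longrightarrow> e x = 0) \<Longrightarrow> f x = 0) \<Longrightarrow> f u = 0"
    and g: "g \<in> polyfun J" "g u1 \<noteq> 0"
  shows "\<exists>x. g x \<noteq> 0 \<and> (\<forall>e\<in>E. e x = 0) \<and>
    (\<forall>w. \<exists>w'. (\<forall>j\<in>J. w' j = w j) \<and> (\<forall>e\<in>E. has_dd e x w' 0))"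
proof -
  define A where "A = (polyfun J :: (('j \<Rightarrow> 'k) \<Rightarrow> 'k) set)"
  define B where "B = (polyfun (J \<union> L) :: (('j \<Rightarrow> 'k) \<Rightarrow> 'k) set)"
  \<comment> \<open>All functions vanishing on the solutions, not just the ideal generated by
    \<open>E\<close>: density then says exactly that only 0 of \<open>A\<close> lies in it.\<close>
  define I0 where "I0 = {f \<in> B. \<forall>x. (\<forall>e\<in>E. e x = 0) \<longrightarrow> f x = 0}"
  obtain ls where ls: "set ls = L" using finite_list[OF L] by blast
  define zs :: "(('j \<Rightarrow> 'k) \<Rightarrow> 'k) list" where "zs = map (\<lambda>j v. v j) ls"
  have A: "subring_set A" and B: "subring_set B" by (simp_all add: A_def B_def polyfun_subring)
  have AB: "A \<subseteq> B" unfolding A_def B_def using polyfun_mono by blast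
  have I0A: "I0 \<inter> A \<subseteq> {0}"
  proof
    fix f assume f: "f \<in> I0 \<inter> A"
    have "f u = 0" for u
      by (rule dense) (use f in \<open>auto simp: A_def I0_def\<close>)
    then show "f \<in> {0}" by (simp add: fun_eq_iff)
  qed
  have "\<exists>P. prime_ideal_in B P \<and> I0 \<subseteq> P \<and> P \<inter> A \<subseteq> {0}"
  proof (rule prime_ideal_avoiding[OF B A AB _ _ _ _ _ _ I0A])
    show "x = 0 \<or> y = 0" if "x \<in> A" "y \<in> A" "x * y = 0" for x y
      using polyfun_no_zero_divisors that by (auto simp: A_def)
    show "I0 \<subseteq> B" by (auto simp: I0_def)
    show "0 \<in> I0" using subring_zero[OF B] by (auto simp: I0_def)
    show "p + q \<in> I0" if "p \<in> I0" "q \<in> I0" for p q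
      using that subring_add[OF B] by (auto simp: I0_def)
    show "b * p \<in> I0" if "b \<in> B" "p \<in> I0" for b p
      using that subring_mult[OF B] by (auto simp: I0_def)
  qed simp
  then obtain P where P: "prime_ideal_in B P" "I0 \<subseteq> P" "P \<inter> A \<subseteq> {0}" by (elim exE conjE)
  have nat: "\<forall>n>0. of_nat n \<notin> P"
  proof (intro allI impI notI)
    fix n :: nat assume "n > 0"
    assume "of_nat n \<in> P"
    then have "of_nat n = (0 :: ('j \<Rightarrow> 'k) \<Rightarrow> 'k)" using P(3) subring_of_nat[OF A] by blast
    then show False using \<open>n > 0\<close> by simp
  qed
  have constA: "(\<lambda>_. c) \<in> A" for c by (simp add: A_def polyfun_const)
  have sub: "B \<subseteq> adjoin_list A zs"
    unfolding B_def
    by (rule subsetI, rule polyfun_in_adjoin_list[OF A constA]) (auto simp: zs_def ls A_def intro: polyfun_coord)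
  have zsB: "set zs \<subseteq> B" by (auto simp: zs_def ls B_def intro: polyfun_coord)
  have "1 \<in> adjoin_list A zs" "1 \<notin> P"
    using subring_one[OF adjoin_list_subring[OF A]] prime_idealD(5)[OF P(1)] by auto
  note one = this
  from extension_theorem[where ?'k = 'k, OF B P(1) nat A AB zsB one]
  obtain h where h: "h \<in> A" "h \<notin> P" and ext: "\<forall>\<theta> :: (('j \<Rightarrow> 'k) \<Rightarrow> 'k) \<Rightarrow> 'k. hom_on P A \<theta> \<longrightarrow> \<theta> h \<noteq> 0 \<longrightarrow>
    (\<exists>\<theta>'. hom_on P (adjoin_list A zs) \<theta>' \<and> (\<forall>a\<in>A. \<theta>' a = \<theta> a) \<and> \<theta>' 1 \<noteq> 0 \<and>
      (\<forall>\<delta>. der_on P A \<theta> \<delta> \<longrightarrow> (\<exists>\<delta>'. der_on P (adjoin_list A zs) \<theta>' \<delta>' \<and> (\<forall>a\<in>A. \<delta>' a = \<delta> a))))"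
    by (elim bexE conjE)
  have "h \<noteq> 0" using h(2) prime_idealD(2)[OF P(1)] by auto
  then obtain u2 where "h u2 \<noteq> 0" by (auto simp: fun_eq_iff)
  then obtain u where u: "h u * g u \<noteq> 0"
    using polyfun_mult_nonzero[of h J u2 g u1] h(1) g by (auto simp: A_def)
  define \<theta> where "\<theta> = (\<lambda>f :: ('j \<Rightarrow> 'k) \<Rightarrow> 'k. f u)"
  have "hom_on P A \<theta>" unfolding hom_on_def \<theta>_def using P(3) by auto
  moreover have "\<theta> h \<noteq> 0" using u by (auto simp: \<theta>_def)
  ultimately have "\<exists>\<theta>'. hom_on P (adjoin_list A zs) \<theta>' \<and> (\<forall>a\<in>A. \<theta>' a = \<theta> a) \<and> \<theta>' 1 \<noteq> 0 \<and>
      (\<forall>\<delta>. der_on P A \<theta> \<delta> \<longrightarrow> (\<exists>\<delta>'. der_on P (adjoin_list A zs) \<theta>' \<delta>' \<and> (\<forall>a\<in>A. \<delta>' a = \<delta> a)))"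
    by (rule ext[rule_format])
  then obtain \<theta>' where \<theta>': "hom_on P (adjoin_list A zs) \<theta>'" "\<forall>a\<in>A. \<theta>' a = \<theta> a" and
    der: "\<forall>\<delta>. der_on P A \<theta> \<delta> \<longrightarrow> (\<exists>\<delta>'. der_on P (adjoin_list A zs) \<theta>' \<delta>' \<and> (\<forall>a\<in>A. \<delta>' a = \<delta> a))"
    by (elim exE conjE)
  note \<theta>' = \<theta>'(1) \<theta>'(2)[rule_format]
  define x where "x = (\<lambda>j. \<theta>' (\<lambda>v. v j))"
  have c: "\<theta>' (\<lambda>_. c) = c" for c using \<theta>'(2)[OF constA, of c] by (simp add: \<theta>_def)
  have ev: "\<theta>' f = f x" if "f \<in> B" for f
    using hom_on_polyfun[OF adjoin_list_subring[OF A] \<theta>'(1) _ c, of "J \<union> L" f] sub that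
    unfolding x_def B_def by blast
  have gx: "g x \<noteq> 0"
  proof -
    have "g x = \<theta>' g" using ev[of g] g(1) AB by (auto simp: A_def)
    also have "\<dots> = g u" using \<theta>'(2)[of g] g(1) by (simp add: A_def \<theta>_def)
    finally show ?thesis using u by auto
  qed
  have EP: "e \<in> P" if "e \<in> E" for e
    using that E P(2) by (auto simp: I0_def B_def)
  have Ex: "e x = 0" if "e \<in> E" for e
  proof -
    have "e \<in> B" using that E by (auto simp: B_def)
    moreover have "\<theta>' e = 0"
      by (rule hom_ideal[OF adjoin_list_subring[OF A] \<theta>'(1)]) (use EP that \<open>e \<in> B\<close> sub in auto)
    ultimately show ?thesis using ev by simp
  qed
  have "\<exists>w'. (\<forall>j\<in>J. w' j = w j) \<and> (\<forall>e\<in>E. has_dd e x w' 0)" for w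
  proof -
    define \<delta> where "\<delta> = (\<lambda>f. SOME c. has_dd f u w c)"
    have \<delta>: "\<delta> f = c" if "has_dd f u w c" for f c
      unfolding \<delta>_def using someI[of "has_dd f u w", OF that] has_dd_unique that by blast
    have "der_on P A \<theta> \<delta>"
      unfolding der_on_def
    proof (intro conjI ballI)
      fix a b assume "a \<in> A" "b \<in> A"
      then obtain c d where cd: "has_dd a u w c" "has_dd b u w d"
        using has_dd_exists unfolding A_def by blast
      show "\<delta> (a + b) = \<delta> a + \<delta> b"
        using \<delta>[OF has_dd_add[OF cd]] \<delta>[OF cd(1)] \<delta>[OF cd(2)] by (simp add: plus_fun_def)
      show "\<delta> (a * b) = \<theta> a * \<delta> b + \<delta> a * \<theta> b"
        using \<delta>[OF has_dd_mult[OF cd]] \<delta>[OF cd(1)] \<delta>[OF cd(2)] by (simp add: times_fun_def \<theta>_def)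
    next
      fix a assume "a \<in> A \<inter> P"
      then have "a = (\<lambda>_. 0)" using P(3) by (auto simp: fun_eq_iff)
      then show "\<delta> a = 0" using \<delta>[OF has_dd_const[of 0 u w]] by simp
    qed
    from der[rule_format, OF this] obtain \<delta>' where \<delta>': "der_on P (adjoin_list A zs) \<theta>' \<delta>'" "\<forall>a\<in>A. \<delta>' a = \<delta> a"
      by (elim exE conjE)
    note \<delta>' = \<delta>'(1) \<delta>'(2)[rule_format]
    define w' where "w' = (\<lambda>j. \<delta>' (\<lambda>v. v j))"
    have c': "\<delta>' (\<lambda>_. c) = 0" for c
      using \<delta>'(2)[OF constA, of c] \<delta>[OF has_dd_const[of c u w]] by simp
    have dd: "has_dd f x w' (\<delta>' f)" if "f \<in> B" for f
    proof -
      have f: "f \<in> polyfun (J \<union> L)" and s: "polyfun (J \<union> L) \<subseteq> adjoin_list A zs"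
        using that sub by (simp_all only: B_def)
      show ?thesis
        unfolding x_def w'_def
        by (rule der_on_polyfun[OF adjoin_list_subring[OF A] \<theta>'(1) \<delta>'(1) s _ _ f]) (rule c, rule c')
    qed
    have "w' j = w j" if "j \<in> J" for j
      using \<delta>'(2)[of "\<lambda>v. v j"] \<delta>[OF has_dd_coord[of j u w]] polyfun_coord[OF that]
      by (simp add: w'_def A_def)
    moreover have "has_dd e x w' 0" if "e \<in> E" for e
    proof -
      have e: "e \<in> B" using that E by (auto simp: B_def)
      have "\<delta>' e = 0"
        by (rule der_ideal[OF adjoin_list_subring[OF A] \<theta>'(1) \<delta>'(1)]) (use EP that e sub in auto)
      then show ?thesis using dd[OF e] by simp
    qed
    ultimately show ?thesis by (intro exI[of _ w']) simp
  qed
  with gx Ex show ?thesis by (intro exI[of _ x]) simp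
qed

section \<open>Decomposable tensors\<close>

definition tensor_index :: "(nat \<Rightarrow> nat) \<Rightarrow> nat set \<Rightarrow> (nat \<Rightarrow> nat) set" where
  "tensor_index n B = (\<Pi>\<^sub>E i\<in>B. {0..n i})"

text \<open>The decomposable tensor with factors \<open>u i\<close>, extended by 0 so that it lies
  in the coordinate space for \<open>B\<close>.\<close>

definition sv :: "(nat \<Rightarrow> nat) \<Rightarrow> nat set \<Rightarrow> (nat \<Rightarrow> nat \<Rightarrow> 'k) \<Rightarrow> (nat \<Rightarrow> nat) \<Rightarrow> 'k::comm_ring_1" where
  "sv n B u = (\<lambda>m. if m \<in> tensor_index n B then \<Prod>i\<in>B. u i (m i) else 0)"

text \<open>The derivative of \<open>sv\<close> at \<open>u\<close> in direction \<open>w\<close>.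
  At a nonzero tensor these vectors fill the tangent space of the cone.\<close>

definition tv :: "(nat \<Rightarrow> nat) \<Rightarrow> nat set \<Rightarrow> (nat \<Rightarrow> nat \<Rightarrow> 'k) \<Rightarrow> (nat \<Rightarrow> nat \<Rightarrow> 'k) \<Rightarrow> (nat \<Rightarrow> nat) \<Rightarrow> 'k::comm_ring_1" where
  "tv n B u w = (\<lambda>m. \<Sum>i\<in>B. sv n B (u(i := w i)) m)"

text \<open>The change of \<open>tv n B u w\<close> when \<open>u\<close> moves along
  \<open>d\<close>. The sum runs over ordered pairs, so \<open>sec n B u w w\<close> counts every
  pair of factors twice.\<close>

definition sec :: "(nat \<Rightarrow> nat) \<Rightarrow> nat set \<Rightarrow> (nat \<Rightarrow> nat \<Rightarrow> 'k) \<Rightarrow> (nat \<Rightarrow> nat \<Rightarrow> 'k) \<Rightarrow> (nat \<Rightarrow> nat \<Rightarrow> 'k) \<Rightarrow>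
    (nat \<Rightarrow> nat) \<Rightarrow> 'k::comm_ring_1" where
  "sec n B u w d = (\<lambda>m. \<Sum>i\<in>B. \<Sum>j\<in>B - {i}. sv n B (u(i := w i, j := d j)) m)"

definition unit_vec :: "nat \<Rightarrow> nat \<Rightarrow> 'k::comm_ring_1" where
  "unit_vec k = (\<lambda>l. if l = k then 1 else 0)"

lemma finite_tensor_index: "finite B \<Longrightarrow> finite (tensor_index n B)"
  by (simp add: tensor_index_def finite_PiE)

lemma tensor_index_le: "m \<in> tensor_index n B \<Longrightarrow> i \<in> B \<Longrightarrow> m i \<le> n i"
  by (auto simp: tensor_index_def PiE_def Pi_def)

lemma tensor_index_upd: "m \<in> tensor_index n B \<Longrightarrow> i \<in> B \<Longrightarrow> k \<le> n i \<Longrightarrow> m(i := k) \<in> tensor_index n B"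
  by (auto simp: tensor_index_def PiE_def extensional_def Pi_def)

lemma tensor_index_eqI:
  "m \<in> tensor_index n B \<Longrightarrow> m' \<in> tensor_index n B \<Longrightarrow> (\<And>i. i \<in> B \<Longrightarrow> m i = m' i) \<Longrightarrow> m = m'"
  unfolding tensor_index_def by (rule PiE_ext)

lemma sv_outside: "m \<notin> tensor_index n B \<Longrightarrow> sv n B u m = 0"
  by (simp add: sv_def)

lemma sv_cong:
  assumes "\<And>i k. i \<in> B \<Longrightarrow> k \<le> n i \<Longrightarrow> u i k = u' i k" shows "sv n B u = sv n B u'"
  unfolding sv_def by (intro ext if_cong prod.cong refl assms tensor_index_le)

lemma sv_upd:
  assumes "finite B" "i \<in> B" "m \<in> tensor_index n B"
  shows "sv n B (u(i := x)) m = x (m i) * (\<Prod>j\<in>B - {i}. u j (m j))"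
proof -
  have "(\<Prod>j\<in>B - {i}. (u(i := x)) j (m j)) = (\<Prod>j\<in>B - {i}. u j (m j))"
    by (rule prod.cong) auto
  then show ?thesis using assms by (simp add: sv_def prod.remove[OF assms(1,2)])
qed

lemma sv_remove:
  assumes "finite B" "i \<in> B" "m \<in> tensor_index n B"
  shows "sv n B u m = u i (m i) * (\<Prod>j\<in>B - {i}. u j (m j))"
  using assms by (simp add: sv_def prod.remove[OF assms(1,2)])

lemma sv_scale:
  assumes "finite B" "i \<in> B" shows "sv n B (u(i := (\<lambda>k. c * u i k))) m = c * sv n B u m"
proof (cases "m \<in> tensor_index n B")
  case True
  show ?thesis by (simp add: sv_upd[OF assms True] sv_remove[OF assms True] mult.assoc)
qed (simp add: sv_outside)

lemma sv_unit:
  assumes "finite B" "m \<in> tensor_index n B"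
  shows "sv n B (\<lambda>i. unit_vec (m i)) m' = (if m' = m then 1 else 0)"
proof (cases "m' \<in> tensor_index n B")
  case True
  show ?thesis
  proof (cases "m' = m")
    case False
    then obtain i where "i \<in> B" "m' i \<noteq> m i" using tensor_index_eqI[OF True assms(2)] by blast
    then have "(\<Prod>i\<in>B. unit_vec (m i) (m' i)) = (0::'a)"
      using assms(1) by (intro prod_zero) (auto simp: unit_vec_def)
    then show ?thesis using False True by (simp add: sv_def)
  qed (simp add: sv_def assms unit_vec_def)
qed (use assms in \<open>auto simp: sv_outside\<close>)

lemma tv_outside: "m \<notin> tensor_index n B \<Longrightarrow> tv n B u w m = 0"
  by (simp add: tv_def sv_outside)

lemma sec_outside: "m \<notin> tensor_index n B \<Longrightarrow> sec n B u w d m = 0"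
  by (simp add: sec_def sv_outside)

lemma tv_linear:
  assumes "finite B" "\<And>i k. i \<in> B \<Longrightarrow> w i k = a * x i k + b * y i k"
  shows "tv n B u w m = a * tv n B u x m + b * tv n B u y m"
proof (cases "m \<in> tensor_index n B")
  case True
  have "sv n B (u(i := w i)) m = a * sv n B (u(i := x i)) m + b * sv n B (u(i := y i)) m" if "i \<in> B" for i
    using assms(2)[OF that] by (simp add: sv_upd[OF assms(1) that True] algebra_simps)
  then show ?thesis by (simp add: tv_def sum.distrib sum_distrib_left)
qed (simp add: tv_outside)

lemma tv_scale: "finite B \<Longrightarrow> tv n B u (\<lambda>i k. a * x i k) m = a * tv n B u x m"
  using tv_linear[of B "\<lambda>i k. a * x i k" a x 0 x] by simp

subsection \<open>Derivatives\<close>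

lemma has_dd_sv:
  fixes U :: "('p \<Rightarrow> 'k) \<Rightarrow> nat \<Rightarrow> nat \<Rightarrow> 'k::comm_ring_1"
  assumes "finite B" "\<And>i k. i \<in> B \<Longrightarrow> has_dd (\<lambda>t. U t i k) p w (W i k)"
  shows "has_dd (\<lambda>t. sv n B (U t) m) p w (tv n B (U p) W m)"
proof (cases "m \<in> tensor_index n B")
  case True
  have "has_dd (\<lambda>t. \<Prod>i\<in>B. U t i (m i)) p w (\<Sum>i\<in>B. W i (m i) * (\<Prod>j\<in>B - {i}. U p j (m j)))"
    by (rule has_dd_prod[OF assms])
  moreover have "(\<Sum>i\<in>B. W i (m i) * (\<Prod>j\<in>B - {i}. U p j (m j))) = tv n B (U p) W m"
    unfolding tv_def by (rule sum.cong) (simp_all add: sv_upd[OF assms(1) _ True])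
  ultimately show ?thesis using True by (simp add: sv_def)
qed (simp add: sv_outside tv_outside has_dd_const)

lemma has_dd_tv:
  fixes U V :: "('p \<Rightarrow> 'k) \<Rightarrow> nat \<Rightarrow> nat \<Rightarrow> 'k::comm_ring_1"
  assumes B: "finite B" and U: "\<And>i k. i \<in> B \<Longrightarrow> has_dd (\<lambda>t. U t i k) p w (W i k)"
    and V: "\<And>i k. i \<in> B \<Longrightarrow> has_dd (\<lambda>t. V t i k) p w (W' i k)"
  shows "has_dd (\<lambda>t. tv n B (U t) (V t) m) p w (tv n B (U p) W' m + sec n B (U p) (V p) W m)"
proof -
  have "has_dd (\<lambda>t. tv n B (U t) (V t) m) p w (\<Sum>i\<in>B. tv n B ((U p)(i := V p i)) (W(i := W' i)) m)"
    unfolding tv_def[of n B "U _"]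
  proof (rule has_dd_sum)
    fix i assume i: "i \<in> B"
    show "has_dd (\<lambda>t. sv n B ((U t)(i := V t i)) m) p w (tv n B ((U p)(i := V p i)) (W(i := W' i)) m)"
      by (rule has_dd_sv[OF B, of "\<lambda>t. (U t)(i := V t i)"]) (use U V i in auto)
  qed
  moreover have "tv n B ((U p)(i := V p i)) (W(i := W' i)) m =
      sv n B ((U p)(i := W' i)) m + (\<Sum>j\<in>B - {i}. sv n B ((U p)(i := V p i, j := W j)) m)" if "i \<in> B" for i
    unfolding tv_def using that by (simp add: sum.remove[OF B])
  ultimately show ?thesis by (simp add: tv_def[of n B "U p"] sec_def sum.distrib cong: sum.cong)
qed

subsection \<open>A basis of the tangent space\<close>

text \<open>\<open>None\<close> stands for the tensor itself, \<open>Some (i, k)\<close> for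
  replacing factor \<open>i\<close> by the \<open>k\<close>-th unit vector. The case
  \<open>k = m0 i\<close> is left out: if \<open>u i (m0 i)\<close> is nonzero, that replacement is
  a combination of the others.\<close>

definition tb_index :: "(nat \<Rightarrow> nat) \<Rightarrow> nat set \<Rightarrow> (nat \<Rightarrow> nat) \<Rightarrow> (nat \<times> nat) option set" where
  "tb_index n B m0 = insert None (Some ` (SIGMA i:B. {0..n i} - {m0 i}))"

definition tb :: "(nat \<Rightarrow> nat) \<Rightarrow> nat set \<Rightarrow> (nat \<Rightarrow> nat \<Rightarrow> 'k) \<Rightarrow> (nat \<times> nat) option \<Rightarrow> (nat \<Rightarrow> nat) \<Rightarrow> 'k::comm_ring_1" where
  "tb n B u a = (case a of None \<Rightarrow> sv n B u | Some (i, k) \<Rightarrow> sv n B (u(i := unit_vec k)))"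

text \<open>Subtracting a multiple of \<open>u i\<close> from \<open>w i\<close> clears its entry at
  \<open>m0 i\<close>; the multiples add up to the coefficient of the tensor itself.\<close>

definition tb_coeff :: "nat set \<Rightarrow> (nat \<Rightarrow> nat) \<Rightarrow> (nat \<Rightarrow> nat \<Rightarrow> 'k) \<Rightarrow> (nat \<Rightarrow> nat \<Rightarrow> 'k) \<Rightarrow> (nat \<times> nat) option \<Rightarrow> 'k::field" where
  "tb_coeff B m0 u w a = (case a of None \<Rightarrow> \<Sum>i\<in>B. w i (m0 i) / u i (m0 i)
     | Some (i, k) \<Rightarrow> w i k - w i (m0 i) / u i (m0 i) * u i k)"

lemma finite_tb_index: "finite B \<Longrightarrow> finite (tb_index n B m0)"
  by (simp add: tb_index_def)

lemma card_tb_index: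
  assumes "finite B" "\<And>i. i \<in> B \<Longrightarrow> m0 i \<le> n i"
  shows "card (tb_index n B m0) = Suc (\<Sum>i\<in>B. n i)"
proof -
  have "card (SIGMA i:B. {0..n i} - {m0 i}) = (\<Sum>i\<in>B. card ({0..n i} - {m0 i}))"
    by (rule card_SigmaI) (use assms in auto)
  also have "\<dots> = (\<Sum>i\<in>B. n i)" by (rule sum.cong) (use assms in auto)
  finally show ?thesis
    unfolding tb_index_def using assms(1) by (subst card_insert_disjoint) (auto simp: card_image)
qed

lemma sum_tb_index:
  assumes "finite B"
  shows "(\<Sum>a\<in>tb_index n B m0. f a) = f None + (\<Sum>i\<in>B. \<Sum>k\<in>{0..n i} - {m0 i}. f (Some (i, k)))"
proof -
  have "(\<Sum>a\<in>tb_index n B m0. f a) = f None + (\<Sum>a\<in>Some ` (SIGMA i:B. {0..n i} - {m0 i}). f a)"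
    unfolding tb_index_def using assms by (subst sum.insert) auto
  also have "(\<Sum>a\<in>Some ` (SIGMA i:B. {0..n i} - {m0 i}). f a) = (\<Sum>x\<in>(SIGMA i:B. {0..n i} - {m0 i}). f (Some x))"
    by (subst sum.reindex) auto
  also have "\<dots> = (\<Sum>i\<in>B. \<Sum>k\<in>{0..n i} - {m0 i}. f (Some (i, k)))"
    using assms by (subst sum.Sigma) auto
  finally show ?thesis .
qed

lemma tb_outside: "m \<notin> tensor_index n B \<Longrightarrow> tb n B u a m = 0"
  by (auto simp: tb_def sv_outside split: option.split)

lemma tv_expand:
  fixes u :: "nat \<Rightarrow> nat \<Rightarrow> 'k::field"
  assumes B: "finite B" and u: "\<And>i. i \<in> B \<Longrightarrow> u i (m0 i) \<noteq> 0"
  shows "tv n B u w m = (\<Sum>a\<in>tb_index n B m0. tb_coeff B m0 u w a * tb n B u a m)"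
proof (cases "m \<in> tensor_index n B")
  case True
  have "sv n B (u(i := w i)) m = w i (m0 i) / u i (m0 i) * sv n B u m +
      (\<Sum>k\<in>{0..n i} - {m0 i}. (w i k - w i (m0 i) / u i (m0 i) * u i k) * sv n B (u(i := unit_vec k)) m)"
    if i: "i \<in> B" for i
  proof -
    let ?c = "\<lambda>k. w i k - w i (m0 i) / u i (m0 i) * u i k" and ?p = "\<Prod>j\<in>B - {i}. u j (m j)"
    have "(\<Sum>k\<in>{0..n i} - {m0 i}. ?c k * sv n B (u(i := unit_vec k)) m) =
        (\<Sum>k\<in>{0..n i} - {m0 i}. if m i = k then ?c k * ?p else 0)"
      by (rule sum.cong) (auto simp: sv_upd[OF B i True] unit_vec_def)
    also have "\<dots> = ?c (m i) * ?p"
      using tensor_index_le[OF True i] u[OF i] by (auto simp: sum.delta)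
    finally show ?thesis
      by (simp add: sv_upd[OF B i True] sv_remove[OF B i True] algebra_simps)
  qed
  then show ?thesis
    unfolding tv_def sum_tb_index[OF B]
    by (simp add: tb_coeff_def tb_def sum.distrib sum_distrib_right cong: sum.cong)
qed (simp add: tv_outside tb_outside)

text \<open>At \<open>m0\<close> and the indices differing from it in one place the basis vectors
  form a triangular system. This yields independence and also lets the coordinates of a tangent
  vector be read off.\<close>

lemma tb_at_base:
  assumes B: "finite B" and m0: "m0 \<in> tensor_index n B" and i: "i \<in> B" "k \<in> {0..n i} - {m0 i}"
  shows "tb n B u (Some (i, k)) m0 = 0"
    and "a \<in> tb_index n B m0 \<Longrightarrow> a \<noteq> None \<Longrightarrow> a \<noteq> Some (i, k) \<Longrightarrow> tb n B u a (m0(i := k)) = 0"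
    and "tb n B u (Some (i, k)) (m0(i := k)) = (\<Prod>j\<in>B - {i}. u j (m0 j))"
proof -
  show "tb n B u (Some (i, k)) m0 = 0"
    using i by (simp add: tb_def sv_upd[OF B i(1) m0] unit_vec_def)
  have m: "m0(i := k) \<in> tensor_index n B" using tensor_index_upd[OF m0 i(1)] i(2) by simp
  have "(\<Prod>j\<in>B - {i}. u j ((m0(i := k)) j)) = (\<Prod>j\<in>B - {i}. u j (m0 j))" by (rule prod.cong) auto
  then show "tb n B u (Some (i, k)) (m0(i := k)) = (\<Prod>j\<in>B - {i}. u j (m0 j))"
    by (simp add: tb_def sv_upd[OF B i(1) m] unit_vec_def)
  assume a: "a \<in> tb_index n B m0" "a \<noteq> None" "a \<noteq> Some (i, k)"
  then obtain j l where jl: "a = Some (j, l)" "j \<in> B" "l \<in> {0..n j} - {m0 j}" by (auto simp: tb_index_def)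
  have "(m0(i := k)) j \<noteq> l" using a(3) jl by auto
  then show "tb n B u a (m0(i := k)) = 0"
    by (simp add: jl tb_def sv_upd[OF B jl(2) m] unit_vec_def)
qed

lemma indep_fam_tb:
  fixes u :: "nat \<Rightarrow> nat \<Rightarrow> 'k::field"
  assumes B: "finite B" and m0: "m0 \<in> tensor_index n B" and u: "\<And>i. i \<in> B \<Longrightarrow> u i (m0 i) \<noteq> 0"
  shows "indep_fam (tb_index n B m0) (tb n B u)"
proof (rule indep_famI)
  fix c a assume c: "\<And>m. (\<Sum>a\<in>tb_index n B m0. c a * tb n B u a m) = 0" and a: "a \<in> tb_index n B m0"
  have "(\<Sum>a\<in>tb_index n B m0. c a * tb n B u a m0) = c None * sv n B u m0"
  proof -
    have "(\<Sum>i\<in>B. \<Sum>k\<in>{0..n i} - {m0 i}. c (Some (i, k)) * tb n B u (Some (i, k)) m0) = 0"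
      by (intro sum.neutral ballI) (simp only: tb_at_base(1)[OF B m0] mult_zero_right)
    then show ?thesis unfolding sum_tb_index[OF B] by (simp add: tb_def)
  qed
  moreover have "sv n B u m0 \<noteq> 0" using u B m0 by (simp add: sv_def)
  ultimately have c0: "c None = 0" using c[of m0] by simp
  show "c a = 0"
  proof (cases a)
    case (Some x)
    obtain i k where x: "x = (i, k)" by (cases x)
    have ik: "a = Some (i, k)" "i \<in> B" "k \<in> {0..n i} - {m0 i}"
      using a by (auto simp: tb_index_def Some x)
    have "(\<Sum>b\<in>tb_index n B m0. c b * tb n B u b (m0(i := k))) = (\<Sum>b\<in>{a}. c b * tb n B u b (m0(i := k)))"
    proof (rule sum.mono_neutral_right[OF finite_tb_index[OF B]])
      show "\<forall>b\<in>tb_index n B m0 - {a}. c b * tb n B u b (m0(i := k)) = 0"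
      proof
        fix b assume b: "b \<in> tb_index n B m0 - {a}"
        show "c b * tb n B u b (m0(i := k)) = 0"
          using tb_at_base(2)[OF B m0 ik(2,3), of b u] b c0 ik(1) by (cases "b = None") auto
      qed
    qed (use a in simp)
    then have "c a * (\<Prod>j\<in>B - {i}. u j (m0 j)) = 0"
      unfolding tb_at_base(3)[OF B m0 ik(2,3), of u, symmetric] using c[of "m0(i := k)"] ik(1) by simp
    moreover have "(\<Prod>j\<in>B - {i}. u j (m0 j)) \<noteq> 0" using u B by simp
    ultimately show ?thesis by simp
  qed (use c0 in simp)
qed

section \<open>The Segre variety\<close>

lemma multi_index_eq: "multi_index s n = tensor_index n {1..s}"
  by (simp add: multi_index_def tensor_index_def)

lemma segre_vec_eq: "segre_vec s n u = sv n {1..s} u"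
  unfolding segre_vec_def sv_def multi_index_eq ..

lemma sv_nonzero_factor:
  assumes "sv n B u \<noteq> 0" shows "\<exists>m\<in>tensor_index n B. sv n B u m \<noteq> 0"
proof -
  obtain m where "sv n B u m \<noteq> 0" using assms by (auto simp: fun_eq_iff)
  then show ?thesis using sv_outside by blast
qed

lemma segre_variety_eq:
  assumes "s > 0"
  shows "segre_variety s n = {fun_vec.span {sv n {1..s} u} | u. sv n {1..s} u \<noteq> (0 :: _ \<Rightarrow> 'k::field)}"
proof (intro subset_antisym subsetI)
  fix p :: "((nat \<Rightarrow> nat) \<Rightarrow> 'k) set" assume "p \<in> segre_variety s n"
  then obtain q where q: "p = segre_map s n q" "q \<in> (\<Pi>\<^sub>E i\<in>{1..s}. proj_space {0..n i})"
    by (auto simp: segre_variety_def)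
  have "\<exists>x. \<forall>i\<in>{1..s}. q i = fun_vec.span {x i} \<and> x i \<in> coord_space {0..n i} \<and> x i \<noteq> 0"
  proof (intro bchoice ballI)
    fix i assume "i \<in> {1..s}"
    with q(2) have "q i \<in> proj_space {0..n i}" by (rule PiE_mem)
    then show "\<exists>x. q i = fun_vec.span {x} \<and> x \<in> coord_space {0..n i} \<and> x \<noteq> 0"
      unfolding proj_space_def by blast
  qed
  then obtain x where x: "\<And>i. i \<in> {1..s} \<Longrightarrow> q i = fun_vec.span {x i}"
    "\<And>i. i \<in> {1..s} \<Longrightarrow> x i \<in> coord_space {0..n i}" "\<And>i. i \<in> {1..s} \<Longrightarrow> x i \<noteq> 0" by blast
  have p: "p = fun_vec.span {sv n {1..s} x}"
    unfolding q(1) segre_vec_eq[symmetric] by (rule segre_map_span[OF assms x(1)])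
  have "\<exists>k. x i k \<noteq> 0" if "i \<in> {1..s}" for i using x(3)[OF that] by (auto simp: fun_eq_iff)
  then have "\<exists>m. \<forall>i\<in>{1..s}. x i (m i) \<noteq> 0" by (intro bchoice) blast
  then obtain m where m: "\<And>i. i \<in> {1..s} \<Longrightarrow> x i (m i) \<noteq> 0" by blast
  have mle: "m i \<le> n i" if "i \<in> {1..s}" for i
  proof (rule ccontr)
    assume "\<not> m i \<le> n i"
    then have "x i (m i) = 0" using x(2)[OF that] by (simp add: coord_space_def)
    with m[OF that] show False ..
  qed
  have "restrict m {1..s} \<in> tensor_index n {1..s}" using mle by (auto simp: tensor_index_def)
  then have "sv n {1..s} x (restrict m {1..s}) \<noteq> 0" using m by (simp add: sv_def)
  then have "sv n {1..s} x \<noteq> 0" by (metis zero_fun_apply)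
  then show "p \<in> {fun_vec.span {sv n {1..s} u} | u. sv n {1..s} u \<noteq> 0}" using p by blast
next
  fix p :: "((nat \<Rightarrow> nat) \<Rightarrow> 'k) set"
  assume "p \<in> {fun_vec.span {sv n {1..s} u} | u. sv n {1..s} u \<noteq> 0}"
  then obtain u where u: "p = fun_vec.span {sv n {1..s} u}" "sv n {1..s} u \<noteq> 0" by blast
  obtain m where m: "m \<in> tensor_index n {1..s}" "sv n {1..s} u m \<noteq> 0" using sv_nonzero_factor[OF u(2)] by blast
  define x where "x = (\<lambda>i k. if k \<le> n i then u i k else 0)"
  define q where "q = (\<lambda>i\<in>{1..s}. fun_vec.span {x i})"
  have "x i \<noteq> 0" if i: "i \<in> {1..s}" for i
  proof -
    have "u i (m i) \<noteq> 0" using m i by (auto simp: sv_def)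
    then have "x i (m i) \<noteq> 0" using tensor_index_le[OF m(1) i] by (simp add: x_def)
    then show ?thesis by (metis zero_fun_apply)
  qed
  moreover have "x i \<in> coord_space {0..n i}" for i by (auto simp: x_def coord_space_def)
  ultimately have "q \<in> (\<Pi>\<^sub>E i\<in>{1..s}. proj_space {0..n i})"
    by (auto simp: q_def intro!: span_in_proj_space)
  moreover have "segre_map s n q = p"
    using segre_map_span[OF assms, of q x n] sv_cong[of "{1..s}" n x u]
    by (simp add: q_def u segre_vec_eq x_def)
  ultimately show "p \<in> segre_variety s n" unfolding segre_variety_def by blast
qed

text \<open>Scalars are absorbed into one factor, so linear combinations of points become plain sums
  of decomposable tensors.\<close>

lemma span_sv:
  assumes "s > 0" "v \<in> fun_vec.span {sv n {1..s} u}"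
  shows "\<exists>u'. v = (sv n {1..s} u' :: _ \<Rightarrow> 'k::field)"
proof -
  obtain c where c: "v = fun_scale c (sv n {1..s} u)" using assms(2) by (auto simp: fun_vec.span_singleton)
  have "1 \<in> {1..s}" using assms(1) by simp
  then have "v = sv n {1..s} (u(1 := (\<lambda>k. c * u 1 k)))"
    using sv_scale[of "{1..s}" 1 n u c] by (auto simp: c fun_scale_def)
  then show ?thesis by blast
qed

lemma sv_exists_nonzero:
  assumes "finite B" shows "\<exists>u. sv n B u \<noteq> (0 :: _ \<Rightarrow> 'k::comm_ring_1)"
proof -
  have "restrict (\<lambda>_. 0) B \<in> tensor_index n B" by (auto simp: tensor_index_def)
  then have "sv n B (\<lambda>_ _. 1) (restrict (\<lambda>_. 0) B) = (1::'k)" by (simp add: sv_def)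
  then have "sv n B (\<lambda>_ _. 1) \<noteq> (0 :: _ \<Rightarrow> 'k)" by (metis zero_fun_apply zero_neq_one)
  then show ?thesis by blast
qed

lemma vanishing_form_sv:
  assumes "s > 0" "f \<in> vanishing_forms I (segre_variety s n)"
  shows "eval_mpoly f (sv n {1..s} u) = (0::'k::field)"
proof (cases "sv n {1..s} u = 0")
  case False
  then have "fun_vec.span {sv n {1..s} u} \<in> segre_variety s n" unfolding segre_variety_eq[OF assms(1)] by blast
  then show ?thesis using assms(2) fun_vec.span_base[of _ "{sv n {1..s} u}"] unfolding vanishing_forms_def by blast
next
  case True
  obtain u' :: "nat \<Rightarrow> nat \<Rightarrow> 'k" where "sv n {1..s} u' \<noteq> 0" using sv_exists_nonzero[of "{1..s}"] by blast
  then have "fun_vec.span {sv n {1..s} u'} \<in> segre_variety s n" unfolding segre_variety_eq[OF assms(1)] by blast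
  moreover have "sv n {1..s} u \<in> fun_vec.span {sv n {1..s} u'}" unfolding True by (rule fun_vec.span_zero)
  ultimately show ?thesis using assms(2) unfolding vanishing_forms_def by blast
qed

text \<open>Differentiating the vanishing of \<open>f\<close> on multiples \<open>c * sv\<close>
  gives the tangency equation up to the factor \<open>c\<close>. The definition also asks for it at
  the zero vector of the line, which is reached because the equation is polynomial in
  \<open>c\<close>.\<close>

lemma tv_in_cone_tangent_space:
  fixes u w :: "nat \<Rightarrow> nat \<Rightarrow> 'k::field_char_0"
  assumes "s > 0" and I: "I = multi_index s n"
  shows "tv n {1..s} u w \<in> cone_tangent_space I (segre_variety s n) (fun_vec.span {sv n {1..s} u})"
  unfolding cone_tangent_space_def
proof (intro CollectI conjI ballI)
  show "tv n {1..s} u w \<in> coord_space I" by (auto simp: coord_space_def I multi_index_eq tv_outside)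
  fix f :: "(nat \<Rightarrow> nat, 'k) mpoly" and v
  assume f: "f \<in> vanishing_forms I (segre_variety s n)" and v: "v \<in> fun_vec.span {sv n {1..s} u}"
  obtain d where d: "f \<in> forms I d" using f by (auto simp: vanishing_forms_def homogeneous_polys_def)
  have finI: "finite I" by (simp add: I)
  define x where "x = sv n {1..s} u"
  define G where "G = (\<lambda>c (t :: nat \<times> nat \<Rightarrow> 'k) m. c * sv n {1..s} (\<lambda>i k. t (i, k)) m)"
  define p where "p = (\<lambda>(i, k). u i k)"
  define q where "q = (\<lambda>(i, k). w i k)"
  have zero: "eval_mpoly f (G c t) = 0" for c t
  proof -
    have "G c t \<in> fun_vec.span {sv n {1..s} (\<lambda>i k. t (i, k))}"
      unfolding fun_vec.span_singleton by (auto simp: G_def fun_scale_def)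
    from span_sv[OF assms(1) this] obtain u' where "G c t = sv n {1..s} u'" by blast
    then show ?thesis using vanishing_form_sv[OF assms(1) f] by simp
  qed
  have sum0: "c * (\<Sum>i\<in>I. eval_mpoly (partial_deriv i f) (fun_scale c x) * tv n {1..s} u w i) = 0" for c
  proof -
    have Gp: "G c p = fun_scale c x" by (auto simp: G_def p_def x_def fun_scale_def)
    have "has_dd (\<lambda>t. G c t m) p q (c * tv n {1..s} u w m)" for m
    proof -
      have "has_dd (\<lambda>t. sv n {1..s} (\<lambda>i k. t (i, k)) m) p q (tv n {1..s} (\<lambda>i k. p (i, k)) w m)"
      proof (rule has_dd_sv)
        fix i k
        have "q (i, k) = w i k" by (simp add: q_def)
        then show "has_dd (\<lambda>t. t (i, k)) p q (w i k)" using has_dd_coord[of "(i, k)" p q] by simp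
      qed simp
      then show ?thesis unfolding G_def p_def by (simp add: has_dd_cmult)
    qed
    then have "has_dd (\<lambda>t. eval_mpoly f (G c t)) p q (\<Sum>i\<in>I. eval_mpoly (partial_deriv i f) (G c p) * (c * tv n {1..s} u w i))"
      by (rule has_dd_chain[OF eval_form_polyfun[OF d] has_dd_eval_form[OF d finI]])
    moreover have "has_dd (\<lambda>t. eval_mpoly f (G c t)) p q 0"
      unfolding zero by (rule has_dd_const)
    ultimately have "(\<Sum>i\<in>I. eval_mpoly (partial_deriv i f) (G c p) * (c * tv n {1..s} u w i)) = 0"
      by (rule has_dd_unique)
    then show ?thesis by (simp add: Gp sum_distrib_left mult.left_commute)
  qed
  obtain c where c: "v = fun_scale c x" using v by (auto simp: x_def fun_vec.span_singleton)
  have pf: "eval_mpoly (partial_deriv i f) \<in> polyfun UNIV" for i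
    unfolding eval_mpoly_def[abs_def] eval_monom_def by (intro polyfun_intros) auto
  have "\<exists>r. \<forall>t. eval_mpoly (partial_deriv i f) (fun_scale t x) = poly r t" for i
    by (rule polyfun_along_polys[OF pf]) (auto simp: fun_scale_def intro: exI[of _ "[:0, x _:]"])
  then obtain r where r: "\<And>i t. eval_mpoly (partial_deriv i f) (fun_scale t x) = poly (r i) t" by metis
  define R where "R = (\<Sum>i\<in>I. Polynomial.smult (tv n {1..s} u w i) (r i))"
  have R: "poly R t = (\<Sum>i\<in>I. eval_mpoly (partial_deriv i f) (fun_scale t x) * tv n {1..s} u w i)" for t
    by (simp add: R_def poly_sum r mult.commute)
  have "poly R t = 0" if "t \<noteq> 0" for t using sum0[of t] that unfolding R by simp
  then have "R = 0" by (rule poly_nonzero_except)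
  then show "(\<Sum>i\<in>I. eval_mpoly (partial_deriv i f) v * tv n {1..s} u w i) = 0"
    unfolding c using R[of c] by simp
qed

text \<open>The quadrics \<open>v\<^sub>a v\<^sub>b = v\<^sub>c v\<^sub>d\<close>, where \<open>c\<close> and \<open>d\<close> arise from \<open>a\<close> and \<open>b\<close> by exchanging the \<open>i\<close>-th entries.\<close>

lemma cone_tangent_quadric:
  fixes w :: "(nat \<Rightarrow> nat) \<Rightarrow> 'k::field_char_0"
  assumes s: "s > 0" and I: "I = multi_index s n"
    and w: "w \<in> cone_tangent_space I (segre_variety s n) (fun_vec.span {v})"
    and ab: "a \<in> I" "b \<in> I" and i: "i \<in> {1..s}"
  shows "w a * v b + v a * w b = w (a(i := b i)) * v (b(i := a i)) + v (a(i := b i)) * w (b(i := a i))"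
proof -
  define c d where "c = a(i := b i)" and "d = b(i := a i)"
  have cd: "c \<in> I" "d \<in> I" unfolding c_def d_def
    using ab i tensor_index_upd tensor_index_le unfolding I multi_index_eq by blast+
  define Q :: "(nat \<Rightarrow> nat, 'k) mpoly" where
    "Q = Poly_Mapping.single (Poly_Mapping.single a 1 + Poly_Mapping.single b 1) 1
       + Poly_Mapping.single (Poly_Mapping.single c 1 + Poly_Mapping.single d 1) (- 1)"
  have ev: "eval_mpoly Q x = x a * x b - x c * x d" for x
    by (simp add: Q_def eval_mpoly_add eval_monom_add) (simp add: eval_monom_def)
  have Q2: "Q \<in> forms I 2"
    unfolding Q_def
  proof (rule forms_add)
    have *: "Poly_Mapping.single (Poly_Mapping.single x 1 + Poly_Mapping.single y 1) z \<in> forms I 2"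
      if "x \<in> I" "y \<in> I" for x y and z :: 'k
    proof -
      have "monom_degree (Poly_Mapping.single x 1 + Poly_Mapping.single y 1) = 2" for x y :: "nat \<Rightarrow> nat"
        unfolding monom_degree_add by (simp add: monom_degree_def)
      moreover have "Poly_Mapping.keys (Poly_Mapping.single x 1 + Poly_Mapping.single y (1::nat)) \<subseteq> I"
        using Poly_Mapping.keys_add[of "Poly_Mapping.single x (1::nat)" "Poly_Mapping.single y 1"] that by auto
      ultimately show ?thesis by (auto simp: forms_def split: if_splits)
    qed
    show "Poly_Mapping.single (Poly_Mapping.single a 1 + Poly_Mapping.single b 1) (1::'k) \<in> forms I 2"
      by (rule *[OF ab])
    show "Poly_Mapping.single (Poly_Mapping.single c 1 + Poly_Mapping.single d 1) (- 1 :: 'k) \<in> forms I 2"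
      by (rule *[OF cd])
  qed
  have "sv n {1..s} u a * sv n {1..s} u b = sv n {1..s} u c * sv n {1..s} u d" for u :: "nat \<Rightarrow> nat \<Rightarrow> 'k"
  proof -
    have "(\<Prod>j\<in>{1..s}. u j (a j) * u j (b j)) = (\<Prod>j\<in>{1..s}. u j (c j) * u j (d j))"
      by (rule prod.cong) (auto simp: c_def d_def mult.commute)
    then show ?thesis using ab cd by (simp add: sv_def I multi_index_eq prod.distrib)
  qed
  moreover have "\<exists>u. x = sv n {1..s} u" if "p \<in> segre_variety s n" "x \<in> p" for p and x :: "(nat \<Rightarrow> nat) \<Rightarrow> 'k"
    using that span_sv[OF s] unfolding segre_variety_eq[OF s] by blast
  ultimately have "eval_mpoly Q x = 0" if "p \<in> segre_variety s n" "x \<in> p" for p x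
    unfolding ev using that by fastforce
  then have "Q \<in> vanishing_forms I (segre_variety s n)"
    using Q2 unfolding vanishing_forms_def homogeneous_polys_def by blast
  then have 0: "(\<Sum>i\<in>I. eval_mpoly (partial_deriv i Q) v * w i) = 0"
    using w fun_vec.span_base[of v "{v}"] unfolding cone_tangent_space_def by blast
  have "has_dd (eval_mpoly Q) v w 0"
    using has_dd_eval_form[OF Q2, of v w] 0 by (simp add: I)
  moreover have "has_dd (\<lambda>x. x a * x b - x c * x d) v w ((v a * w b + w a * v b) - (v c * w d + w c * v d))"
    by (intro has_dd_diff has_dd_mult has_dd_coord)
  ultimately have "0 = (v a * w b + w a * v b) - (v c * w d + w c * v d)"
    using has_dd_unique unfolding ev[abs_def] by blast
  then show ?thesis by (simp add: c_def d_def algebra_simps)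
qed

text \<open>Induction on the number of places where \<open>m\<close> differs from \<open>m0\<close>:
  in the linearised quadric for \<open>m\<close> and \<open>m0\<close> all other terms involve
  \<open>w\<close> at an index closer to \<open>m0\<close> or at one where it is assumed to
  vanish.\<close>

lemma cone_tangent_zero:
  fixes w :: "(nat \<Rightarrow> nat) \<Rightarrow> 'k::field_char_0"
  assumes s: "s > 0" and I: "I = multi_index s n"
    and w: "w \<in> cone_tangent_space I (segre_variety s n) (fun_vec.span {v})"
    and m0: "m0 \<in> I" "v m0 \<noteq> 0" and w0: "w m0 = 0" "\<And>i k. i \<in> {1..s} \<Longrightarrow> k \<le> n i \<Longrightarrow> w (m0(i := k)) = 0"
  shows "w = 0"
proof -
  have "m \<in> I \<Longrightarrow> w m = 0" for m
  proof (induction "card {i \<in> {1..s}. m i \<noteq> m0 i}" arbitrary: m rule: less_induct)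
    case less
    show ?case
    proof (cases "{i \<in> {1..s}. m i \<noteq> m0 i} = {}")
      case True
      then have "m = m0" using less.prems m0 unfolding I multi_index_eq by (intro tensor_index_eqI) auto
      then show ?thesis using w0 by simp
    next
      case False
      then obtain i where i: "i \<in> {1..s}" "m i \<noteq> m0 i" by blast
      have "{j \<in> {1..s}. (m(i := m0 i)) j \<noteq> m0 j} \<subset> {i \<in> {1..s}. m i \<noteq> m0 i}" using i by auto
      then have "card {j \<in> {1..s}. (m(i := m0 i)) j \<noteq> m0 j} < card {i \<in> {1..s}. m i \<noteq> m0 i}"
        by (intro psubset_card_mono) auto
      moreover have "m(i := m0 i) \<in> I"
        using less.prems m0 i tensor_index_upd tensor_index_le unfolding I multi_index_eq by blast
      ultimately have "w (m(i := m0 i)) = 0" by (rule less.hyps)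
      moreover have "w (m0(i := m i)) = 0"
        using w0(2)[OF i(1)] tensor_index_le[of m n "{1..s}" i] less.prems i(1) unfolding I multi_index_eq by blast
      ultimately have "w m * v m0 = 0"
        using cone_tangent_quadric[OF s I w less.prems m0(1) i(1)] w0(1) by simp
      then show ?thesis using m0 by simp
    qed
  qed
  moreover have "w m = 0" if "m \<notin> I" for m
    using w that by (auto simp: cone_tangent_space_def coord_space_def)
  ultimately show ?thesis by (auto simp: fun_eq_iff)
qed

text \<open>Any vector of the tangent space is matched at \<open>m0\<close> and its neighbours by a
  combination of the \<open>tb\<close> vectors, and by \<open>cone_tangent_zero\<close> these
  entries determine it. So the quadrics already cut out the tangent space.\<close>

lemma cone_tangent_space_segre:
  fixes u :: "nat \<Rightarrow> nat \<Rightarrow> 'k::field_char_0"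
  assumes s: "s > 0" and I: "I = multi_index s n" and u: "sv n {1..s} u \<noteq> 0"
  shows "cone_tangent_space I (segre_variety s n) (fun_vec.span {sv n {1..s} u}) = range (tv n {1..s} u)"
    and "fun_vec.dim (range (tv n {1..s} u)) = Suc (\<Sum>i\<in>{1..s}. n i)"
proof -
  let ?B = "{1..s}" and ?C = "cone_tangent_space I (segre_variety s n) (fun_vec.span {sv n {1..s} u})"
  have B: "finite ?B" and i1: "1 \<in> ?B" using s by auto
  obtain m0 where m0: "m0 \<in> tensor_index n ?B" "sv n ?B u m0 \<noteq> 0" using sv_nonzero_factor[OF u] by blast
  have um0: "u i (m0 i) \<noteq> 0" if "i \<in> ?B" for i using m0 that by (auto simp: sv_def)
  let ?T = "tb_index n ?B m0"
  have comb: "(\<lambda>m. \<Sum>a\<in>?T. \<gamma> a * tb n ?B u a m) \<in> range (tv n ?B u)" for \<gamma> :: "_ \<Rightarrow> 'k"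
  proof -
    \<comment> \<open>\<open>W1\<close> realises the coefficients of the single replacements,
      \<open>W2\<close> the multiple of the tensor itself, by moving factor 1 along itself.\<close>
    define W where "W = (\<lambda>i k. (if k = m0 i then 0 else \<gamma> (Some (i, k))) + (if i = 1 then \<gamma> None * u 1 k else 0))"
    define W1 where "W1 = (\<lambda>i k. if k = m0 i then 0 else \<gamma> (Some (i, k)))"
    define W2 where "W2 = (\<lambda>i k. if i = (1::nat) then \<gamma> None * u 1 k else 0)"
    have "tv n ?B u W m = tv n ?B u W1 m + tv n ?B u W2 m" for m
      using tv_linear[OF B, of W 1 W1 1 W2 n u m] by (simp add: W_def W1_def W2_def)
    moreover have "tv n ?B u W1 m = (\<Sum>i\<in>?B. \<Sum>k\<in>{0..n i} - {m0 i}. \<gamma> (Some (i, k)) * tb n ?B u (Some (i, k)) m)" for m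
    proof -
      have c0: "tb_coeff ?B m0 u W1 None = 0" by (simp add: tb_coeff_def W1_def)
      have cik: "tb_coeff ?B m0 u W1 (Some (i, k)) = \<gamma> (Some (i, k))" if "k \<in> {0..n i} - {m0 i}" for i k
        using that by (simp add: tb_coeff_def W1_def)
      have "tv n ?B u W1 m = (\<Sum>a\<in>?T. tb_coeff ?B m0 u W1 a * tb n ?B u a m)"
        by (rule tv_expand[OF B]) (rule um0)
      also have "\<dots> = (\<Sum>i\<in>?B. \<Sum>k\<in>{0..n i} - {m0 i}. tb_coeff ?B m0 u W1 (Some (i, k)) * tb n ?B u (Some (i, k)) m)"
        unfolding sum_tb_index[OF B] c0 mult_zero_left add_0_left ..
      also have "\<dots> = (\<Sum>i\<in>?B. \<Sum>k\<in>{0..n i} - {m0 i}. \<gamma> (Some (i, k)) * tb n ?B u (Some (i, k)) m)"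
        by (intro sum.cong refl arg_cong2[of _ _ _ _ "(*)"] cik)
      finally show ?thesis .
    qed
    moreover have "tv n ?B u W2 m = \<gamma> None * sv n ?B u m" for m
    proof (cases "m \<in> tensor_index n ?B")
      case True
      have "sv n ?B (u(i := W2 i)) m = (if i = 1 then \<gamma> None * sv n ?B u m else 0)" if "i \<in> ?B" for i
      proof (cases "i = 1")
        case True
        then show ?thesis using sv_scale[OF B i1, of n u "\<gamma> None" m] by (simp add: W2_def)
      next
        case False
        then show ?thesis using sv_upd[OF B that True, of u "W2 i"] by (simp add: W2_def)
      qed
      then show ?thesis unfolding tv_def using i1 by simp
    qed (simp add: tv_outside sv_outside)
    ultimately have "tv n ?B u W = (\<lambda>m. \<Sum>a\<in>?T. \<gamma> a * tb n ?B u a m)"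
      unfolding sum_tb_index[OF B] by (simp add: fun_eq_iff tb_def add.commute)
    then show ?thesis by (metis rangeI)
  qed
  show C: "?C = range (tv n ?B u)"
  proof (intro subset_antisym subsetI)
    fix w assume w: "w \<in> ?C"
    define \<gamma> where "\<gamma> = (\<lambda>a. case a of None \<Rightarrow> w m0 / sv n ?B u m0
      | Some (i, k) \<Rightarrow> (w (m0(i := k)) - w m0 / sv n ?B u m0 * sv n ?B u (m0(i := k))) / (\<Prod>j\<in>?B - {i}. u j (m0 j)))"
    define t where "t = (\<lambda>m. \<Sum>a\<in>?T. \<gamma> a * tb n ?B u a m)"
    have tC: "t \<in> range (tv n ?B u)" unfolding t_def by (rule comb)
    then have "t \<in> ?C" using tv_in_cone_tangent_space[OF s I] by auto
    then have wt: "(\<lambda>m. w m - t m) \<in> ?C"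
      using w by (auto simp: cone_tangent_space_def coord_space_def right_diff_distrib sum_subtractf)
    have tm0: "t m0 = w m0"
    proof -
      have "t m0 = \<gamma> None * sv n ?B u m0"
      proof -
        have "(\<Sum>i\<in>?B. \<Sum>k\<in>{0..n i} - {m0 i}. \<gamma> (Some (i, k)) * tb n ?B u (Some (i, k)) m0) = 0"
          by (intro sum.neutral ballI) (simp only: tb_at_base(1)[OF B m0(1)] mult_zero_right)
        then show ?thesis unfolding t_def sum_tb_index[OF B] by (simp add: tb_def)
      qed
      then show ?thesis using m0 by (simp add: \<gamma>_def)
    qed
    have tik: "t (m0(i := k)) = w (m0(i := k))" if i: "i \<in> ?B" "k \<le> n i" for i k
    proof (cases "k = m0 i")
      case True
      then show ?thesis using tm0 by simp
    next
      case False
      then have k: "k \<in> {0..n i} - {m0 i}" using i by simp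
      then have mem: "Some (i, k) \<in> ?T" "None \<in> ?T" using i by (auto simp: tb_index_def)
      have "t (m0(i := k)) = (\<Sum>a\<in>{None, Some (i, k)}. \<gamma> a * tb n ?B u a (m0(i := k)))"
        unfolding t_def
        by (rule sum.mono_neutral_right[OF finite_tb_index[OF B]])
           (use mem tb_at_base(2)[OF B m0(1) i(1) k] in auto)
      also have "\<dots> = \<gamma> None * sv n ?B u (m0(i := k)) + \<gamma> (Some (i, k)) * (\<Prod>j\<in>?B - {i}. u j (m0 j))"
        using tb_at_base(3)[OF B m0(1) i(1) k, of u] by (simp add: tb_def)
      also have "(\<Prod>j\<in>?B - {i}. u j (m0 j)) \<noteq> 0" using um0 by simp
      then have "\<gamma> (Some (i, k)) * (\<Prod>j\<in>?B - {i}. u j (m0 j)) = w (m0(i := k)) - \<gamma> None * sv n ?B u (m0(i := k))"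
        by (simp add: \<gamma>_def)
      finally show ?thesis unfolding add_diff_eq add_diff_cancel_left' .
    qed
    have "(\<lambda>m. w m - t m) = 0"
      by (rule cone_tangent_zero[OF s I wt, of m0]) (use m0 tm0 tik in \<open>auto simp: I multi_index_eq\<close>)
    then have "w = t" by (auto simp: fun_eq_iff)
    then show "w \<in> range (tv n ?B u)" using tC by simp
  next
    fix w assume "w \<in> range (tv n ?B u)"
    then show "w \<in> ?C" using tv_in_cone_tangent_space[OF s I] by auto
  qed
  have expand: "tv n ?B u w m = (\<Sum>a\<in>?T. tb_coeff ?B m0 u w a * tb n ?B u a m)" for w m
    by (rule tv_expand[OF B]) (rule um0)
  have ind: "indep_fam ?T (tb n ?B u)" by (rule indep_fam_tb[where u = u, OF B m0(1) um0])
  have "fun_vec.dim (range (tv n ?B u)) = card (tb n ?B u ` ?T)"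
  proof (rule fun_vec.dim_unique)
    show "tb n ?B u ` ?T \<subseteq> range (tv n ?B u)"
    proof
      fix x assume "x \<in> tb n ?B u ` ?T"
      then obtain a where a: "a \<in> ?T" "x = tb n ?B u a" by blast
      have "(\<Sum>b\<in>?T. (if b = a then 1 else 0) * tb n ?B u b m) = tb n ?B u a m" for m
      proof -
        have "(\<Sum>b\<in>?T. (if b = a then 1 else 0) * tb n ?B u b m) = (\<Sum>b\<in>?T. if b = a then tb n ?B u b m else 0)"
          by (rule sum.cong) auto
        then show ?thesis using a(1) finite_tb_index[OF B] by (simp add: sum.delta)
      qed
      then have "x = (\<lambda>m. \<Sum>b\<in>?T. (if b = a then 1 else 0) * tb n ?B u b m)" by (simp add: a(2))
      with comb[of "\<lambda>b. if b = a then 1 else 0"] show "x \<in> range (tv n ?B u)" by simp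
    qed
    show "range (tv n ?B u) \<subseteq> fun_vec.span (tb n ?B u ` ?T)"
    proof
      fix x assume "x \<in> range (tv n ?B u)"
      then obtain w where w: "x = tv n ?B u w" by blast
      have "x = (\<Sum>a\<in>?T. fun_scale (tb_coeff ?B m0 u w a) (tb n ?B u a))"
        by (rule ext) (simp only: w expand sum_fun_apply fun_scale_apply)
      also have "\<dots> \<in> fun_vec.span (tb n ?B u ` ?T)"
        by (intro fun_vec.span_sum fun_vec.span_scale fun_vec.span_base) auto
      finally show "x \<in> fun_vec.span (tb n ?B u ` ?T)" .
    qed
    show "fun_vec.independent (tb n ?B u ` ?T)"
      by (rule indep_fam_independent[OF ind finite_tb_index[OF B]])
  qed simp
  also have "\<dots> = card ?T"
    using indep_fam_inj[OF ind finite_tb_index[OF B]] by (rule card_image)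
  also have "\<dots> = Suc (\<Sum>i\<in>?B. n i)"
  proof (rule card_tb_index[OF B])
    show "m0 i \<le> n i" if "i \<in> ?B" for i by (rule tensor_index_le[OF m0(1) that])
  qed
  finally show "fun_vec.dim (range (tv n ?B u)) = Suc (\<Sum>i\<in>?B. n i)" .
qed

lemma has_dd_gradient:
  fixes f :: "('j \<Rightarrow> 'k::comm_ring_1) \<Rightarrow> 'k"
  assumes "f \<in> polyfun J" "finite J"
  shows "\<exists>G. \<forall>w. has_dd f p w (\<Sum>j\<in>J. w j * G j)"
  using assms(1)
proof induction
  case (polyfun_const c)
  then show ?case by (intro exI[of _ "\<lambda>_. 0"]) (simp add: has_dd_const)
next
  case (polyfun_coord j)
  have "(\<Sum>i\<in>J. w i * (if i = j then 1 else 0)) = w j" for w :: "'j \<Rightarrow> 'k"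
    using polyfun_coord assms(2) by (simp add: if_distrib[of "\<lambda>x. _ * x"] sum.delta cong: if_cong)
  then show ?case by (intro exI[of _ "\<lambda>i. if i = j then 1 else 0"]) (simp add: has_dd_coord)
next
  case (polyfun_add f g)
  then obtain G H where "\<forall>w. has_dd f p w (\<Sum>j\<in>J. w j * G j)" "\<forall>w. has_dd g p w (\<Sum>j\<in>J. w j * H j)" by blast
  then have "has_dd (\<lambda>v. f v + g v) p w ((\<Sum>j\<in>J. w j * G j) + (\<Sum>j\<in>J. w j * H j))" for w
    by (intro has_dd_add) auto
  then show ?case by (intro exI[of _ "\<lambda>j. G j + H j"]) (simp add: distrib_left sum.distrib)
next
  case (polyfun_mult f g)
  then obtain G H where "\<forall>w. has_dd f p w (\<Sum>j\<in>J. w j * G j)" "\<forall>w. has_dd g p w (\<Sum>j\<in>J. w j * H j)" by blast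
  then have "has_dd (\<lambda>v. f v * g v) p w (f p * (\<Sum>j\<in>J. w j * H j) + (\<Sum>j\<in>J. w j * G j) * g p)" for w
    by (intro has_dd_mult) auto
  moreover have "f p * (\<Sum>j\<in>J. w j * H j) + (\<Sum>j\<in>J. w j * G j) * g p = (\<Sum>j\<in>J. w j * (f p * H j + G j * g p))" for w
    by (simp add: sum_distrib_left sum_distrib_right sum.distrib algebra_simps)
  ultimately show ?case by (intro exI[of _ "\<lambda>j. f p * H j + G j * g p"]) simp
qed

text \<open>Coordinate form of \<open>zariski_dim_ge\<close>: \<open>D\<close> selects the
  parameters left after normalisation, and injectivity includes the cone direction
  \<open>\<Phi> p\<close>, so that the rank is counted in projective space.\<close>

lemma zariski_dim_ge_injective:
  fixes \<Phi> :: "('j \<Rightarrow> 'k::field_char_0) \<Rightarrow> 'i \<Rightarrow> 'k"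
  assumes I: "finite I" and Y: "Y \<subseteq> proj_space I"
    and \<Phi>I: "\<And>t i. i \<notin> I \<Longrightarrow> \<Phi> t i = 0"
    and \<Phi>: "\<And>i. (\<lambda>t. \<Phi> t i) \<in> polyfun J" and J: "finite J"
    and image: "\<And>t. \<Phi> t \<noteq> 0 \<Longrightarrow> fun_vec.span {\<Phi> t} \<in> Y"
    and D: "D \<subseteq> J"
    and dd: "\<And>w i. (\<And>q. q \<notin> D \<Longrightarrow> w q = 0) \<Longrightarrow> has_dd (\<lambda>t. \<Phi> t i) p w (d\<Phi> w i)"
    and inj: "\<And>c w. (\<And>q. q \<notin> D \<Longrightarrow> w q = 0) \<Longrightarrow> (\<And>i. c * \<Phi> p i + d\<Phi> w i = 0) \<Longrightarrow> c = 0 \<and> (\<forall>q\<in>D. w q = 0)"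
  shows "enat (card D) \<le> zariski_dim I Y"
proof -
  have finD: "finite D" using D J finite_subset by blast
  define m where "m = card D"
  obtain e where e: "bij_betw e {..<m} D" using ex_bij_betw_nat_finite[OF finD] by (auto simp: m_def atLeast0LessThan)
  have eD: "e j \<in> D" if "j < m" for j using bij_betwE[OF e] that by auto
  have "\<forall>i. \<exists>G. \<forall>w. has_dd (\<lambda>t. \<Phi> t i) p w (\<Sum>j\<in>J. w j * G j)"
    using has_dd_gradient[OF \<Phi> J] by blast
  then have "\<exists>G. \<forall>i. \<forall>w. has_dd (\<lambda>t. \<Phi> t i) p w (\<Sum>j\<in>J. w j * G i j)" by (rule choice)
  then obtain G where "\<forall>i. \<forall>w. has_dd (\<lambda>t. \<Phi> t i) p w (\<Sum>j\<in>J. w j * G i j)" by (rule exE)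
  then have G: "has_dd (\<lambda>t. \<Phi> t i) p w (\<Sum>j\<in>J. w j * G i j)" for i w by simp
  define L where "L = (\<lambda>j i. if j < m then G i (e j) else 0)"
  have wsum: "(\<Sum>j<m. c j * (if q = e j then 1 else 0)) = (if q \<in> D then c (the_inv_into {..<m} e q) else 0)" for c :: "nat \<Rightarrow> 'k" and q
  proof (cases "q \<in> D")
    case True
    then obtain l where l: "l < m" "q = e l" using e by (auto simp: bij_betw_def)
    have inje: "inj_on e {..<m}" using e by (simp add: bij_betw_def)
    have "(\<Sum>j<m. c j * (if q = e j then 1 else 0)) = (\<Sum>j<m. if j = l then c j else 0)"
      using l inj_onD[OF inje] by (intro sum.cong) auto
    then show ?thesis using l True the_inv_into_f_f[OF inje, of l] by simp
  next
    case False
    then have "q \<noteq> e j" if "j < m" for j using eD[OF that] by blast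
    then show ?thesis using False by simp
  qed
  define W where "W = (\<lambda>c q. \<Sum>j<m. c j * (if q = e j then 1 else (0::'k)))"
  have W0: "W c q = 0" if "q \<notin> D" for c q using that by (simp add: W_def wsum)
  have WL: "(\<Sum>q\<in>J. W c q * G i q) = (\<Sum>j<m. c j * L j i)" for c i
  proof -
    have "(\<Sum>q\<in>J. W c q * G i q) = (\<Sum>j<m. \<Sum>q\<in>J. c j * (if q = e j then G i q else 0))"
      unfolding W_def sum_distrib_right by (subst sum.swap) (intro sum.cong refl, simp)
    also have "\<dots> = (\<Sum>j<m. c j * L j i)"
      using eD D J by (intro sum.cong refl) (auto simp: sum_distrib_left[symmetric] L_def sum.delta)
    finally show ?thesis .
  qed
  have ddW: "has_dd (\<lambda>t. \<Phi> t i) p (W c) (\<Sum>j<m. c j * L j i)" for c i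
    using G[of i "W c"] unfolding WL .
  have "enat m \<le> zariski_dim I Y"
  proof (rule zariski_dim_ge[OF I Y \<Phi>I \<Phi> image])
    show "has_dd (\<lambda>t. \<Phi> t i) p (\<lambda>q. \<Sum>j<m. c j * (if q = e j then 1 else 0)) (\<Sum>j<m. c j * L j i)" for c i
      using ddW unfolding W_def .
    show L0: "L j i = 0" if i: "i \<notin> I" for j i
    proof (cases "j < m")
      case True
      have "has_dd (\<lambda>t. \<Phi> t i) p (W (\<lambda>l. if l = j then 1 else 0)) 0"
        unfolding \<Phi>I[OF i] by (rule has_dd_const)
      from has_dd_unique[OF this ddW]
      have "(\<Sum>l<m. (if l = j then 1 else 0) * L l i) = 0" by simp
      also have "(\<Sum>l<m. (if l = j then 1 else 0) * L l i) = (\<Sum>l<m. if l = j then L l i else 0)"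
        by (rule sum.cong) auto
      finally show ?thesis using True by simp
    next
      case False
      then show ?thesis by (simp add: L_def)
    qed
    show "indep_fam {..<Suc m} (case_nat (\<Phi> p) L)"
    proof (rule indep_famI)
      fix c a assume c: "\<And>i. (\<Sum>a\<in>{..<Suc m}. c a * case_nat (\<Phi> p) L a i) = 0" and a: "a \<in> {..<Suc m}"
      let ?w = "W (\<lambda>j. c (Suc j))"
      have "d\<Phi> ?w i = (\<Sum>j<m. c (Suc j) * L j i)" for i
        by (rule has_dd_unique[OF dd ddW]) (rule W0)
      then have "c 0 * \<Phi> p i + d\<Phi> ?w i = 0" for i
        using c[of i] by (simp add: sum.lessThan_Suc_shift del: sum.lessThan_Suc)
      from inj[OF W0 this] have *: "c 0 = 0" "\<And>q. q \<in> D \<Longrightarrow> ?w q = 0" by auto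
      have "c (Suc j) = 0" if "j < m" for j
      proof -
        have "inj_on e {..<m}" using e by (simp add: bij_betw_def)
        then show ?thesis using *(2)[OF eD[OF that]] eD[OF that] that by (simp add: W_def wsum the_inv_into_f_f)
      qed
      with *(1) a show "c a = 0" by (cases a) auto
    qed
  qed
  then show ?thesis by (simp add: m_def)
qed

section \<open>Closures\<close>

lemma closure_iff:
  assumes S: "S \<subseteq> proj_space I" and v: "v \<in> coord_space I" "v \<noteq> (0 :: 'i \<Rightarrow> 'k::field)"
  shows "fun_vec.span {v} \<in> zariski I closure_of S \<longleftrightarrow>
    (\<forall>f\<in>homogeneous_polys I. (\<forall>p\<in>S. \<forall>w\<in>p. eval_mpoly f w = 0) \<longrightarrow> eval_mpoly f v = 0)"
proof
  assume cl: "fun_vec.span {v} \<in> zariski I closure_of S"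
  show "\<forall>f\<in>homogeneous_polys I. (\<forall>p\<in>S. \<forall>w\<in>p. eval_mpoly f w = 0) \<longrightarrow> eval_mpoly f v = 0"
  proof (intro ballI impI)
    fix f :: "('i, 'k) mpoly" assume f: "f \<in> homogeneous_polys I" "\<forall>p\<in>S. \<forall>w\<in>p. eval_mpoly f w = 0"
    have "closedin (zariski I) (zero_locus I {f})" unfolding closedin_zariski using f(1) by blast
    moreover have "S \<subseteq> zero_locus I {f}" using S f(2) by (auto simp: zero_locus_def)
    ultimately have "zariski I closure_of S \<subseteq> zero_locus I {f}" by (metis closure_of_minimal)
    then show "eval_mpoly f v = 0" using cl mem_zero_locus_span[OF _ v, of "{f}"] f(1) by auto
  qed
next
  assume R: "\<forall>f\<in>homogeneous_polys I. (\<forall>p\<in>S. \<forall>w\<in>p. eval_mpoly f w = 0) \<longrightarrow> eval_mpoly f v = 0"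
  obtain G :: "('i, 'k) mpoly set" where G: "G \<subseteq> homogeneous_polys I" "zariski I closure_of S = zero_locus I G"
    using closedin_closure_of[of "zariski I" S] unfolding closedin_zariski by blast
  have "S \<subseteq> zero_locus I G" unfolding G(2)[symmetric] by (rule closure_of_subset) (simp add: S)
  then have "\<forall>p\<in>S. \<forall>w\<in>p. eval_mpoly f w = 0" if "f \<in> G" for f
    using that unfolding zero_locus_def by blast
  then have "eval_mpoly f v = 0" if "f \<in> G" for f using R G(1) that by blast
  then show "fun_vec.span {v} \<in> zariski I closure_of S"
    unfolding G(2) mem_zero_locus_span[OF G(1) v] by blast
qed

lemma span_union_lines:
  assumes "finite S" "S \<subseteq> proj_space I" "w \<in> fun_vec.span (\<Union>S)"
  shows "\<exists>c. (\<forall>p\<in>S. c p \<in> p) \<and> w = (\<Sum>p\<in>S. c p)"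
  using assms
proof (induction S arbitrary: w rule: finite_induct)
  case empty
  then show ?case by simp
next
  case (insert p S)
  have p: "fun_vec.span p = p"
  proof -
    obtain v where "p = fun_vec.span {v}" using insert.prems(1) by (auto simp: proj_space_def)
    then show ?thesis by (simp add: fun_vec.span_span)
  qed
  have "w \<in> fun_vec.span (p \<union> \<Union>S)" using insert.prems(2) by simp
  then obtain x y where xy: "w = x + y" "x \<in> p" "y \<in> fun_vec.span (\<Union>S)"
    unfolding fun_vec.span_Un p by blast
  obtain c where c: "\<forall>q\<in>S. c q \<in> q" "y = (\<Sum>q\<in>S. c q)"
    using insert.IH[OF _ xy(3)] insert.prems(1) by auto
  have "(\<Sum>q\<in>insert p S. (c(p := x)) q) = x + (\<Sum>q\<in>S. (c(p := x)) q)" using insert.hyps by simp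
  also have "(\<Sum>q\<in>S. (c(p := x)) q) = (\<Sum>q\<in>S. c q)" using insert.hyps by (intro sum.cong) auto
  finally have "w = (\<Sum>q\<in>insert p S. (c(p := x)) q)" by (simp only: xy(1) c(2))
  moreover have "\<forall>q\<in>insert p S. (c(p := x)) q \<in> q" using c(1) xy(2) by auto
  ultimately show ?case by blast
qed

text \<open>Secant varieties are defined with exactly \<open>k\<close> points, so sums with
  vanishing or repeated terms have to be padded.\<close>

lemma extend_to_card:
  assumes "infinite X" "finite A" "A \<subseteq> X" "card A \<le> k"
  shows "\<exists>S. A \<subseteq> S \<and> S \<subseteq> X \<and> finite S \<and> card S = k"
proof -
  obtain B where B: "finite B" "card B = k - card A" "B \<subseteq> X - A"
    using infinite_arbitrarily_large[of "X - A" "k - card A"] assms by auto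
  then have "card (A \<union> B) = k" using assms by (subst card_Un_disjoint) auto
  then show ?thesis using B assms by (intro exI[of _ "A \<union> B"]) auto
qed

text \<open>The parameters are indexed by triples: a summand, a factor of the multiprojective space, a coordinate.\<close>

definition block :: "(nat \<times> nat \<times> nat \<Rightarrow> 'k) \<Rightarrow> nat \<Rightarrow> nat \<Rightarrow> nat \<Rightarrow> 'k" where
  "block t j = (\<lambda>i k. t (j, i, k))"

definition secant_map :: "(nat \<Rightarrow> nat) \<Rightarrow> nat set \<Rightarrow> nat \<Rightarrow> (nat \<times> nat \<times> nat \<Rightarrow> 'k) \<Rightarrow> (nat \<Rightarrow> nat) \<Rightarrow> 'k::comm_ring_1" where
  "secant_map n B b t = (\<lambda>m. \<Sum>j<b. sv n B (block t j) m)"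

text \<open>Block 0 is the point of contact and block 1 the direction of the tangent vector.\<close>

definition join_map :: "(nat \<Rightarrow> nat) \<Rightarrow> nat set \<Rightarrow> nat \<Rightarrow> (nat \<times> nat \<times> nat \<Rightarrow> 'k) \<Rightarrow> (nat \<Rightarrow> nat) \<Rightarrow> 'k::comm_ring_1" where
  "join_map n B b t = (\<lambda>m. tv n B (block t 0) (block t 1) m + (\<Sum>j\<in>{2..<b}. sv n B (block t j) m))"

definition params :: "(nat \<Rightarrow> nat) \<Rightarrow> nat set \<Rightarrow> nat \<Rightarrow> (nat \<times> nat \<times> nat) set" where
  "params n B b = {..<b} \<times> (SIGMA i:B. {0..n i})"

lemma finite_params: "finite B \<Longrightarrow> finite (params n B b)"
  by (simp add: params_def)

lemma polyfun_sv:
  assumes "\<And>i k. i \<in> B \<Longrightarrow> k \<le> n i \<Longrightarrow> (\<lambda>t. U t i k) \<in> polyfun J"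
  shows "(\<lambda>t. sv n B (U t) m) \<in> polyfun J"
proof (cases "m \<in> tensor_index n B")
  case True
  have "(\<lambda>t. \<Prod>i\<in>B. U t i (m i)) \<in> polyfun J"
    by (rule polyfun_prod) (rule assms, assumption, rule tensor_index_le[OF True])
  then show ?thesis using True by (simp add: sv_def)
next
  case False
  then show ?thesis by (simp add: sv_outside polyfun_const)
qed

lemma polyfun_tv:
  assumes "\<And>i k. i \<in> B \<Longrightarrow> k \<le> n i \<Longrightarrow> (\<lambda>t. U t i k) \<in> polyfun J" "\<And>i k. i \<in> B \<Longrightarrow> k \<le> n i \<Longrightarrow> (\<lambda>t. V t i k) \<in> polyfun J"
  shows "(\<lambda>t. tv n B (U t) (V t) m) \<in> polyfun J"
  unfolding tv_def
proof (intro polyfun_sum polyfun_sv)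
  fix i j k assume "i \<in> B" "j \<in> B" "k \<le> n j"
  then show "(\<lambda>t. ((U t)(i := V t i)) j k) \<in> polyfun J"
    using assms by (cases "j = i") simp_all
qed

lemma polyfun_block: "j < b \<Longrightarrow> i \<in> B \<Longrightarrow> k \<le> n i \<Longrightarrow> (\<lambda>t. block t j i k) \<in> polyfun (params n B b)"
  unfolding block_def by (rule polyfun_coord) (simp add: params_def)

lemma polyfun_secant_map: "(\<lambda>t. secant_map n B b t m) \<in> polyfun (params n B b)"
  unfolding secant_map_def by (intro polyfun_sum polyfun_sv polyfun_block) auto

lemma polyfun_join_map: "b \<ge> 2 \<Longrightarrow> (\<lambda>t. join_map n B b t m) \<in> polyfun (params n B b)"
  unfolding join_map_def by (intro polyfun_add polyfun_sum polyfun_sv polyfun_tv polyfun_block) auto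

lemma secant_map_outside: "m \<notin> tensor_index n B \<Longrightarrow> secant_map n B b t m = 0"
  by (simp add: secant_map_def sv_outside)

lemma join_map_outside: "m \<notin> tensor_index n B \<Longrightarrow> join_map n B b t m = 0"
  by (simp add: join_map_def sv_outside tv_outside)

section \<open>The Segre variety and the equations of its secant variety and tangential join\<close>

locale segre =
  fixes s :: nat and n :: "nat \<Rightarrow> nat" and I :: "(nat \<Rightarrow> nat) set"
    and X :: "((nat \<Rightarrow> nat) \<Rightarrow> 'k::field_char_0) set set"
  assumes s: "s > 0" and n1: "n 1 > 0" and I_eq: "I = multi_index s n" and X_eq: "X = segre_variety s n"
begin

abbreviation "T \<equiv> {1..s}"

lemma I_tensor: "I = tensor_index n T"
  by (simp only: I_eq multi_index_eq)

lemma finI: "finite I"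
  by (simp add: I_eq)

lemma one_T: "1 \<in> T" using s by simp

lemma X_char: "X = {fun_vec.span {sv n T u} | u. sv n T u \<noteq> 0}"
  unfolding X_eq by (rule segre_variety_eq[OF s])

lemma sv_coord: "sv n T u \<in> coord_space I" "tv n T u w \<in> coord_space I"
  by (auto simp: coord_space_def I_tensor sv_outside tv_outside)

lemma span_sv_in_X: "sv n T u \<noteq> 0 \<Longrightarrow> fun_vec.span {sv n T u} \<in> X"
  unfolding X_char by blast

lemma X_proj: "X \<subseteq> proj_space I"
  unfolding X_char using span_in_proj_space[OF sv_coord(1)] by blast

lemma in_X: "p \<in> X \<Longrightarrow> v \<in> p \<Longrightarrow> \<exists>u. v = sv n T u"
  using span_sv[OF s] unfolding X_char by blast

text \<open>Supplies the points for \<open>extend_to_card\<close>: a curve on which the ratio of two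
  coordinates takes every value.\<close>

lemma infinite_X: "infinite X"
proof -
  define u where "u = (\<lambda>(c::'k) (i::nat) k. if k = (0::nat) then 1 else c)"
  define m0 where "m0 = restrict (\<lambda>_. 0::nat) T"
  define m1 where "m1 = m0(1 := 1)"
  have m: "m0 \<in> tensor_index n T" "m1 \<in> tensor_index n T"
    using n1 one_T by (auto simp: m0_def m1_def tensor_index_def PiE_def extensional_def)
  have 0: "sv n T (u c) m0 = 1" for c using m by (simp add: sv_def u_def m0_def)
  have 1: "sv n T (u c) m1 = c" for c
  proof -
    have "(\<Prod>i\<in>T. u c i (m1 i)) = (\<Prod>i\<in>T. if i = 1 then c else 1)"
      by (rule prod.cong) (auto simp: u_def m1_def m0_def)
    then show ?thesis using m one_T by (simp add: sv_def)
  qed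
  have nz: "sv n T (u c) \<noteq> 0" for c using 0[of c] by (metis zero_fun_apply zero_neq_one)
  have "inj (\<lambda>c. fun_vec.span {sv n T (u c)})"
  proof (rule injI)
    fix c d assume "fun_vec.span {sv n T (u c)} = fun_vec.span {sv n T (u d)}"
    then have "sv n T (u c) \<in> fun_vec.span {sv n T (u d)}"
      using fun_vec.span_base[of "sv n T (u c)" "{sv n T (u c)}"] by simp
    then obtain a where a: "sv n T (u c) = fun_scale a (sv n T (u d))" by (auto simp: fun_vec.span_singleton)
    have "a = 1" using fun_cong[OF a, of m0] 0 by (simp add: fun_scale_apply)
    then show "c = d" using fun_cong[OF a, of m1] 1 by (simp add: fun_scale_apply)
  qed
  moreover have "range (\<lambda>c. fun_vec.span {sv n T (u c)}) \<subseteq> X" using span_sv_in_X[OF nz] by blast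
  ultimately show ?thesis
    using infinite_UNIV_char_0 finite_imageD finite_subset by blast
qed

lemma eval_homogeneous_polyfun:
  assumes "f \<in> homogeneous_polys I" "\<And>m. m \<in> I \<Longrightarrow> (\<lambda>t. G t m) \<in> polyfun J"
  shows "(\<lambda>t. eval_mpoly f (G t)) \<in> polyfun J"
proof -
  obtain d where "f \<in> forms I d" using assms(1) by (auto simp: homogeneous_polys_def)
  from polyfun_compose[OF eval_form_polyfun[OF this] assms(2)] show ?thesis .
qed

lemma polyfun_zero_if_generic:
  fixes f g :: "('j \<Rightarrow> 'k) \<Rightarrow> 'k"
  assumes "f \<in> polyfun J" "g \<in> polyfun J" "g v \<noteq> 0" "\<And>u. g u \<noteq> 0 \<Longrightarrow> f u = 0"
  shows "f u = 0"
proof (rule ccontr)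
  assume "f u \<noteq> 0"
  from polyfun_mult_nonzero[OF assms(1) this assms(2,3)] assms(4) show False by auto
qed

lemma eval_at_0:
  assumes "f \<in> homogeneous_polys I" "p \<in> S" "S \<subseteq> proj_space I" "\<forall>p\<in>S. \<forall>w\<in>p. eval_mpoly f w = 0"
  shows "eval_mpoly f 0 = 0"
proof -
  have "0 \<in> p" using assms(2,3) fun_vec.span_zero by (auto simp: proj_space_def)
  then show ?thesis using assms(2,4) by blast
qed

text \<open>Both bounds use the coordinates left when entry 0 of every factor is set to 1: this
  chart is dense, and its derivative at the all-ones tensor is injective together with the cone
  direction.\<close>

lemma zariski_dim_X: "zariski_dim I X = enat (\<Sum>i\<in>T. n i)"
proof (rule antisym)
  define J where "J = (SIGMA i:T. {1..n i})"
  define U where "U = (\<lambda>(t::nat \<times> nat \<Rightarrow> 'k) i k. if k = 0 then 1 else t (i, k))"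
  show "zariski_dim I X \<le> enat (\<Sum>i\<in>T. n i)"
  proof (rule zariski_dim_le[where \<phi> = "\<lambda>t. sv n T (U t)" and J = J])
    show "finite J" by (simp add: J_def)
    show "card J \<le> (\<Sum>i\<in>T. n i)" by (simp add: J_def)
    show "(\<lambda>t. sv n T (U t) m) \<in> polyfun J" for m
    proof (rule polyfun_sv)
      fix i k assume "i \<in> T" "k \<le> n i"
      then show "(\<lambda>t. U t i k) \<in> polyfun J"
        by (cases "k = 0") (simp_all add: U_def polyfun_const polyfun_coord J_def)
    qed
    fix f :: "(nat \<Rightarrow> nat, 'k) mpoly" and p v
    assume f: "f \<in> homogeneous_polys I" "\<And>t. eval_mpoly f (sv n T (U t)) = 0" and p: "p \<in> X" "v \<in> p"
    obtain u where u: "v = sv n T u" using in_X[OF p] by blast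
    define K where "K = (SIGMA i:T. {0..n i})"
    have "eval_mpoly f (sv n T (\<lambda>i k. x (i, k))) = 0" for x
    proof (rule polyfun_zero_if_generic[where f = "\<lambda>x. eval_mpoly f (sv n T (\<lambda>i k. x (i, k)))" and g = "\<lambda>x. \<Prod>i\<in>T. x (i, 0)" and J = K])
      show "(\<lambda>x. eval_mpoly f (sv n T (\<lambda>i k. x (i, k)))) \<in> polyfun K"
        by (intro eval_homogeneous_polyfun[OF f(1)] polyfun_sv polyfun_coord) (simp add: K_def)
      show "(\<lambda>x. \<Prod>i\<in>T. x (i, 0)) \<in> polyfun K"
        by (intro polyfun_prod polyfun_coord) (simp add: K_def)
      show "(\<Prod>i\<in>T. (\<lambda>_. 1) (i, 0)) \<noteq> (0::'k)" by simp
      fix x :: "nat \<times> nat \<Rightarrow> 'k" assume x: "(\<Prod>i\<in>T. x (i, 0)) \<noteq> 0"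
      define t where "t = (\<lambda>(i, k). x (i, k) / x (i, 0))"
      have xi: "x (i, 0) \<noteq> 0" if "i \<in> T" for i using x that by auto
      have "sv n T (\<lambda>i k. x (i, k)) = fun_scale (\<Prod>i\<in>T. x (i, 0)) (sv n T (U t))"
      proof
        fix m
        have "(\<Prod>i\<in>T. x (i, m i)) = (\<Prod>i\<in>T. x (i, 0) * U t i (m i))"
          by (rule prod.cong) (use xi in \<open>auto simp: U_def t_def\<close>)
        then show "sv n T (\<lambda>i k. x (i, k)) m = fun_scale (\<Prod>i\<in>T. x (i, 0)) (sv n T (U t)) m"
          by (simp add: sv_def fun_scale_apply prod.distrib)
      qed
      moreover obtain d where "f \<in> forms I d" using f(1) by (auto simp: homogeneous_polys_def)
      ultimately show "eval_mpoly f (sv n T (\<lambda>i k. x (i, k))) = 0"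
        using f(2)[of t] by (simp add: eval_mpoly_scale)
    qed
    from this[of "\<lambda>(i, k). u i k"] show "eval_mpoly f v = 0" by (simp add: u)
  qed
  define J' where "J' = (SIGMA i:T. {0..n i})"
  have "enat (card J) \<le> zariski_dim I X"
  proof (rule zariski_dim_ge_injective[where \<Phi> = "\<lambda>t. sv n T (\<lambda>i k. t (i, k))" and J = J' and D = J and p = "\<lambda>_. 1"
        and d\<Phi> = "\<lambda>w. tv n T (\<lambda>_ _. 1) (\<lambda>i k. w (i, k))", OF finI X_proj])
    show "sv n T (\<lambda>i k. t (i, k)) m = 0" if "m \<notin> I" for t m using that by (simp add: I_tensor sv_outside)
    show "(\<lambda>t. sv n T (\<lambda>i k. t (i, k)) m) \<in> polyfun J'" for m
      by (intro polyfun_sv polyfun_coord) (simp add: J'_def)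
    show "finite J'" by (simp add: J'_def)
    show "J \<subseteq> J'" by (auto simp: J_def J'_def)
    show "has_dd (\<lambda>t. sv n T (\<lambda>i k. t (i, k)) m) (\<lambda>_. 1) w (tv n T (\<lambda>_ _. 1) (\<lambda>i k. w (i, k)) m)" for w m
      by (rule has_dd_sv) (simp_all add: has_dd_coord)
    show "fun_vec.span {sv n T (\<lambda>i k. t (i, k))} \<in> X" if "sv n T (\<lambda>i k. t (i, k)) \<noteq> 0" for t
      by (rule span_sv_in_X[OF that])
    fix c and w :: "nat \<times> nat \<Rightarrow> 'k"
    assume w: "\<And>q. q \<notin> J \<Longrightarrow> w q = 0" and 0: "\<And>m. c * sv n T (\<lambda>i k. 1) m + tv n T (\<lambda>_ _. 1) (\<lambda>i k. w (i, k)) m = 0"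
    define u where "u = (\<lambda>(i::nat) (k::nat). 1::'k)"
    define m0 where "m0 = restrict (\<lambda>_. 0::nat) T"
    have m0: "m0 \<in> tensor_index n T" by (auto simp: m0_def tensor_index_def)
    define W where "W = (\<lambda>i k. w (i, k))"
    define a where "a = (\<lambda>x. (if x = None then c else 0) + tb_coeff T m0 u W x)"
    have "(\<Sum>x\<in>tb_index n T m0. a x * tb n T u x m) = 0" for m
    proof -
      have "(\<Sum>x\<in>tb_index n T m0. (if x = None then c else 0) * tb n T u x m) = c * sv n T u m"
        unfolding sum_tb_index[OF finite_atLeastAtMost] by (simp add: tb_def)
      moreover have "tv n T u W m = (\<Sum>x\<in>tb_index n T m0. tb_coeff T m0 u W x * tb n T u x m)"
        by (rule tv_expand) (simp_all add: u_def)
      ultimately show ?thesis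
        using 0[of m] by (simp add: a_def distrib_right sum.distrib u_def W_def)
    qed
    moreover have "indep_fam (tb_index n T m0) (tb n T u)"
      by (rule indep_fam_tb[OF _ m0]) (simp_all add: u_def)
    ultimately have a0: "a x = 0" if "x \<in> tb_index n T m0" for x
      using that by (intro indep_famD[of "tb_index n T m0" "tb n T u" a x])
    have W0: "W i (m0 i) = 0" if "i \<in> T" for i using w[of "(i, 0)"] that by (simp add: W_def m0_def J_def)
    have "c = 0" using a0[of None] W0 by (simp add: a_def tb_coeff_def tb_index_def)
    moreover have "w (i, k) = 0" if "(i, k) \<in> J" for i k
    proof -
      have "i \<in> T" "k \<in> {0..n i} - {m0 i}" using that by (auto simp: J_def m0_def)
      then have "Some (i, k) \<in> tb_index n T m0" unfolding tb_index_def by blast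
      from a0[OF this] W0[OF \<open>i \<in> T\<close>] show ?thesis by (simp add: a_def tb_coeff_def W_def)
    qed
    ultimately show "c = 0 \<and> (\<forall>q\<in>J. w q = 0)" by auto
  qed
  then show "enat (\<Sum>i\<in>T. n i) \<le> zariski_dim I X" by (simp add: J_def)
qed

lemma cone_tangent: "sv n T u \<noteq> 0 \<Longrightarrow> cone_tangent_space I X (fun_vec.span {sv n T u}) = range (tv n T u)"
  unfolding X_eq by (rule cone_tangent_space_segre(1)[OF s I_eq])

lemma smooth_locus_X: "smooth_locus I X = X"
proof -
  have "enat (fun_vec.dim (cone_tangent_space I X p)) = zariski_dim I X + 1" if p: "p \<in> X" for p
  proof -
    obtain u where u: "p = fun_vec.span {sv n T u}" "sv n T u \<noteq> 0" using p unfolding X_char by blast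
    show ?thesis
      unfolding u(1) cone_tangent[OF u(2)] cone_tangent_space_segre(2)[OF s I_eq u(2)] zariski_dim_X
      by (simp add: one_enat_def)
  qed
  then show ?thesis unfolding smooth_locus_def by blast
qed

text \<open>Euler's relation: moving a single factor along itself stays on the line, so the tensor
  lies in its own tangent space.\<close>

lemma tv_euler: "tv n T u (\<lambda>i k. if i = 1 then u i k else 0) = sv n T u"
proof
  fix m
  show "tv n T u (\<lambda>i k. if i = 1 then u i k else 0) m = sv n T u m"
  proof (cases "m \<in> tensor_index n T")
    case True
    have "sv n T (u(i := \<lambda>k. if i = 1 then u i k else 0)) m = (if i = 1 then sv n T u m else 0)" if "i \<in> T" for i
      using sv_upd[OF finite_atLeastAtMost that True, of u "\<lambda>k. if i = 1 then u i k else 0"] by auto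
    then show ?thesis using one_T by (simp add: tv_def)
  qed (simp add: tv_outside sv_outside)
qed

text \<open>The parameters include those \<open>u\<close> with \<open>sv n T u = 0\<close>, which
  define no point. A form vanishing for all other \<open>u\<close> vanishes there too, being
  polynomial in the parameters.\<close>

lemma tangential_iff:
  assumes v: "v \<in> coord_space I" "v \<noteq> 0"
  shows "fun_vec.span {v} \<in> tangential_variety I X \<longleftrightarrow>
    (\<forall>f\<in>homogeneous_polys I. (\<forall>u w. eval_mpoly f (tv n T u w) = 0) \<longrightarrow> eval_mpoly f v = 0)"
proof -
  define S where "S = (\<Union>p\<in>X. tangent_space I X p)"
  have S: "S \<subseteq> proj_space I" by (auto simp: S_def tangent_space_def)
  have in_S: "fun_vec.span {tv n T u w} \<in> S" if "sv n T u \<noteq> 0" "tv n T u w \<noteq> 0" for u w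
  proof -
    have "fun_vec.span {tv n T u w} \<subseteq> range (tv n T u)"
    proof
      fix x assume "x \<in> fun_vec.span {tv n T u w}"
      then obtain c where "x = fun_scale c (tv n T u w)" by (auto simp: fun_vec.span_singleton)
      then have "x = tv n T u (\<lambda>i k. c * w i k)" by (simp add: fun_eq_iff fun_scale_apply tv_scale)
      then show "x \<in> range (tv n T u)" by blast
    qed
    then have "fun_vec.span {tv n T u w} \<in> tangent_space I X (fun_vec.span {sv n T u})"
      using span_in_proj_space[OF sv_coord(2) that(2)] unfolding tangent_space_def cone_tangent[OF that(1)] by blast
    then show ?thesis using span_sv_in_X[OF that(1)] unfolding S_def by blast
  qed
  have "(\<forall>p\<in>S. \<forall>w\<in>p. eval_mpoly f w = 0) \<longleftrightarrow> (\<forall>u w. eval_mpoly f (tv n T u w) = 0)"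
    if f: "f \<in> homogeneous_polys I" for f
  proof
    assume f0: "\<forall>p\<in>S. \<forall>w\<in>p. eval_mpoly f w = 0"
    obtain u1 :: "nat \<Rightarrow> nat \<Rightarrow> 'k" where u1: "sv n T u1 \<noteq> 0" using sv_exists_nonzero[of T n] by auto
    have "fun_vec.span {sv n T u1} \<in> S"
      using in_S[OF u1, of "\<lambda>i k. if i = 1 then u1 i k else 0"] u1 unfolding tv_euler by simp
    then have f00: "eval_mpoly f 0 = 0" by (rule eval_at_0[OF f _ S f0])
    have gen: "eval_mpoly f (tv n T u w) = 0" if "sv n T u \<noteq> 0" for u w
    proof (cases "tv n T u w = 0")
      case False
      from in_S[OF that False] f0 fun_vec.span_base[of "tv n T u w" "{tv n T u w}"] show ?thesis by blast
    qed (simp add: f00)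
    obtain m1 where m1: "sv n T u1 m1 \<noteq> 0" using sv_nonzero_factor[OF u1] by blast
    show "\<forall>u w. eval_mpoly f (tv n T u w) = 0"
    proof (intro allI)
      fix u w :: "nat \<Rightarrow> nat \<Rightarrow> 'k"
      have "eval_mpoly f (tv n T (block t 0) (block t 1)) = 0" for t :: "nat \<times> nat \<times> nat \<Rightarrow> 'k"
      proof (rule polyfun_zero_if_generic[where f = "\<lambda>t. eval_mpoly f (tv n T (block t 0) (block t 1))"
            and g = "\<lambda>t. sv n T (block t 0) m1" and J = "params n T 2"])
        show "(\<lambda>t. eval_mpoly f (tv n T (block t 0) (block t 1))) \<in> polyfun (params n T 2)"
          by (intro eval_homogeneous_polyfun[OF f] polyfun_tv polyfun_block) auto
        show "(\<lambda>t. sv n T (block t 0) m1) \<in> polyfun (params n T 2)"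
          by (intro polyfun_sv polyfun_block) auto
        show "sv n T (block (\<lambda>(j, i, k). u1 i k) 0) m1 \<noteq> 0" using m1 by (simp add: block_def)
        fix t :: "nat \<times> nat \<times> nat \<Rightarrow> 'k" assume "sv n T (block t 0) m1 \<noteq> 0"
        then have "sv n T (block t 0) \<noteq> 0" by (metis zero_fun_apply)
        then show "eval_mpoly f (tv n T (block t 0) (block t 1)) = 0" by (rule gen)
      qed
      from this[of "\<lambda>(j, i, k). if j = 0 then u i k else w i k"]
      show "eval_mpoly f (tv n T u w) = 0" by (simp add: block_def)
    qed
  next
    assume f0: "\<forall>u w. eval_mpoly f (tv n T u w) = 0"
    show "\<forall>p\<in>S. \<forall>w\<in>p. eval_mpoly f w = 0"
    proof (intro ballI)
      fix q x assume q: "q \<in> S" "x \<in> q"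
      then obtain p where p: "p \<in> X" "q \<subseteq> cone_tangent_space I X p" by (auto simp: S_def tangent_space_def)
      obtain u where u: "p = fun_vec.span {sv n T u}" "sv n T u \<noteq> 0" using p(1) unfolding X_char by blast
      have "x \<in> range (tv n T u)" using p(2) q(2) unfolding u(1) cone_tangent[OF u(2)] by blast
      then show "eval_mpoly f x = 0" using f0 by auto
    qed
  qed
  then show ?thesis
    unfolding tangential_variety_def smooth_locus_X S_def[symmetric] closure_iff[OF S v] by simp
qed

lemma tv_in_tangential:
  assumes "tv n T u w \<noteq> 0" shows "fun_vec.span {tv n T u w} \<in> tangential_variety I X"
  unfolding tangential_iff[OF sv_coord(2) assms] by blast

lemma tangential_proj: "tangential_variety I X \<subseteq> proj_space I"
  unfolding tangential_variety_def using closure_of_subset_topspace[of "zariski I"] by simp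

lemma sum_sv_in_span:
  assumes "finite K" "card K \<le> k"
  shows "\<exists>S. finite S \<and> S \<subseteq> X \<and> card S = k \<and> (\<lambda>m. \<Sum>j\<in>K. sv n T (V j) m) \<in> fun_vec.span (\<Union>S)"
proof -
  define A where "A = (\<lambda>j. fun_vec.span {sv n T (V j)}) ` {j \<in> K. sv n T (V j) \<noteq> 0}"
  have "card A \<le> card {j \<in> K. sv n T (V j) \<noteq> 0}" unfolding A_def using assms(1) by (intro card_image_le) auto
  also have "\<dots> \<le> card K" using assms(1) by (intro card_mono) auto
  finally have "card A \<le> k" using assms(2) by simp
  moreover have "finite A" "A \<subseteq> X" using assms(1) span_sv_in_X by (auto simp: A_def)
  ultimately obtain S where S: "A \<subseteq> S" "S \<subseteq> X" "finite S" "card S = k"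
    using extend_to_card[OF infinite_X] by blast
  have "sv n T (V j) \<in> fun_vec.span (\<Union>S)" if "j \<in> K" for j
  proof (cases "sv n T (V j) = 0")
    case True
    then show ?thesis using fun_vec.span_zero by metis
  next
    case False
    then have "fun_vec.span {sv n T (V j)} \<in> S" using that S(1) by (auto simp: A_def)
    then have "sv n T (V j) \<in> \<Union>S" using fun_vec.span_base[of "sv n T (V j)" "{sv n T (V j)}"] by blast
    then show ?thesis by (rule fun_vec.span_base)
  qed
  then have "(\<Sum>j\<in>K. sv n T (V j)) \<in> fun_vec.span (\<Union>S)" by (rule fun_vec.span_sum)
  also have "(\<Sum>j\<in>K. sv n T (V j)) = (\<lambda>m. \<Sum>j\<in>K. sv n T (V j) m)" by (rule ext) (rule sum_fun_apply)
  finally show ?thesis using S by blast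
qed

lemma span_points:
  assumes S: "finite S" "S \<subseteq> X" and w: "w \<in> fun_vec.span (\<Union>S)" and K: "finite K" "card K = card S"
  shows "\<exists>V. w = (\<lambda>m. \<Sum>j\<in>K. sv n T (V j) m)"
proof -
  have "S \<subseteq> proj_space I" using S(2) X_proj by blast
  from span_union_lines[OF S(1) this w] obtain c where c: "\<forall>p\<in>S. c p \<in> p" "w = (\<Sum>p\<in>S. c p)" by blast
  have "\<forall>p\<in>S. \<exists>u. c p = sv n T u" using c(1) S(2) in_X by blast
  then obtain U where U: "\<forall>p\<in>S. c p = sv n T (U p)" by (rule bchoice[elim_format]) blast
  obtain e where e: "bij_betw e K S" using finite_same_card_bij[OF K(1) S(1) K(2)] by blast
  have "w = (\<Sum>j\<in>K. c (e j))" unfolding c(2) by (rule sum.reindex_bij_betw[OF e, symmetric])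
  also have "\<dots> = (\<Sum>j\<in>K. sv n T (U (e j)))" using U bij_betwE[OF e] by (intro sum.cong) auto
  also have "\<dots> = (\<lambda>m. \<Sum>j\<in>K. sv n T (U (e j)) m)" by (rule ext) (rule sum_fun_apply)
  finally show ?thesis by (intro exI[of _ "\<lambda>j. U (e j)"])
qed

lemma sv_zero: "sv n T (\<lambda>i k. 0) = 0"
proof
  fix m show "sv n T (\<lambda>i k. 0) m = 0 m" using s by (auto simp: sv_def zero_power)
qed

lemma secant_coord: "secant_map n T b t \<in> coord_space I"
  by (auto simp: coord_space_def I_tensor secant_map_outside)

lemma join_coord: "join_map n T b t \<in> coord_space I"
  by (auto simp: coord_space_def I_tensor join_map_outside)

lemma secant_proj: "secant_variety I b X \<subseteq> proj_space I"
  unfolding secant_variety_def using closure_of_subset_topspace[of "zariski I"] by simp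

lemma join_proj: "tangential_join I X b \<subseteq> proj_space I"
  unfolding tangential_join_def using closure_of_subset_topspace[of "zariski I"] by simp

lemma proj_spanI: "v \<in> coord_space I \<Longrightarrow> v \<noteq> 0 \<Longrightarrow> v \<in> fun_vec.span (\<Union>S) \<Longrightarrow> fun_vec.span {v} \<in> proj_span I S"
  unfolding proj_span_def using span_in_proj_space[of v I] fun_vec.span_minimal[of "{v}" "fun_vec.span (\<Union>S)"]
  by (simp add: fun_vec.subspace_span)

lemma join_nonzero: "\<exists>t. join_map n T b t \<noteq> (0 :: _ \<Rightarrow> 'k)"
proof -
  obtain u :: "nat \<Rightarrow> nat \<Rightarrow> 'k" where u: "sv n T u \<noteq> 0" using sv_exists_nonzero[of T n] by auto
  define t where "t = (\<lambda>(j::nat, i, k). if j = 0 then u i k else if j = 1 \<and> i = 1 then u i k else 0)"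
  have "block t 0 = u" "block t 1 = (\<lambda>i k. if i = 1 then u i k else 0)"
    "\<And>j. j \<in> {2..<b} \<Longrightarrow> block t j = (\<lambda>i k. 0)" by (auto simp: block_def t_def)
  then have "join_map n T b t = (\<lambda>m. tv n T u (\<lambda>i k. if i = 1 then u i k else 0) m + (\<Sum>j\<in>{2..<b}. 0))"
    unfolding join_map_def by (intro ext arg_cong2[of _ _ _ _ "(+)"] sum.cong) (simp_all only: sv_zero zero_fun_apply)
  then have "join_map n T b t = sv n T u" unfolding tv_euler by simp
  then show ?thesis using u by metis
qed

lemma secant_nonzero: "b > 0 \<Longrightarrow> \<exists>t. secant_map n T b t \<noteq> (0 :: _ \<Rightarrow> 'k)"
proof -
  assume b: "b > 0"
  obtain u :: "nat \<Rightarrow> nat \<Rightarrow> 'k" where u: "sv n T u \<noteq> 0" using sv_exists_nonzero[of T n] by auto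
  define t where "t = (\<lambda>(j::nat, i, k). if j = 0 then u i k else 0)"
  have t: "sv n T (block t j) m = (if j = 0 then sv n T u m else 0)" for j m
  proof (cases "j = 0")
    case False
    then have "block t j = (\<lambda>i k. 0)" by (auto simp: block_def t_def)
    then show ?thesis using False by (simp only: sv_zero zero_fun_apply if_False)
  qed (simp add: block_def t_def)
  have "secant_map n T b t = sv n T u"
    unfolding secant_map_def t using b by (simp add: sum.delta)
  then show ?thesis using u by metis
qed

lemma secant_iff:
  assumes b: "b > 0" and v: "v \<in> coord_space I" "v \<noteq> 0"
  shows "fun_vec.span {v} \<in> secant_variety I b X \<longleftrightarrow>
    (\<forall>f\<in>homogeneous_polys I. (\<forall>t. eval_mpoly f (secant_map n T b t) = 0) \<longrightarrow> eval_mpoly f v = 0)"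
proof -
  define S where "S = \<Union>{proj_span I S | S. finite S \<and> S \<subseteq> X \<and> card S = b}"
  have S: "S \<subseteq> proj_space I" by (auto simp: S_def proj_span_def)
  have in_S: "fun_vec.span {secant_map n T b t} \<in> S" if nz: "secant_map n T b t \<noteq> 0" for t
  proof -
    obtain S' where "finite S'" "S' \<subseteq> X" "card S' = b" "(\<lambda>m. \<Sum>j<b. sv n T (block t j) m) \<in> fun_vec.span (\<Union>S')"
      using sum_sv_in_span[of "{..<b}" b "block t"] by auto
    then show ?thesis unfolding S_def using proj_spanI[OF secant_coord nz, of S'] unfolding secant_map_def by blast
  qed
  have "(\<forall>p\<in>S. \<forall>w\<in>p. eval_mpoly f w = 0) \<longleftrightarrow> (\<forall>t. eval_mpoly f (secant_map n T b t) = 0)"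
    if f: "f \<in> homogeneous_polys I" for f
  proof
    assume f0: "\<forall>p\<in>S. \<forall>w\<in>p. eval_mpoly f w = 0"
    obtain t0 where "secant_map n T b t0 \<noteq> (0 :: _ \<Rightarrow> 'k)" using secant_nonzero[OF b] by blast
    from eval_at_0[OF f in_S[OF this] S f0] have f00: "eval_mpoly f 0 = 0" .
    show "\<forall>t. eval_mpoly f (secant_map n T b t) = 0"
    proof
      fix t
      show "eval_mpoly f (secant_map n T b t) = 0"
      proof (cases "secant_map n T b t = 0")
        case False
        from in_S[OF False] f0 fun_vec.span_base[of "secant_map n T b t" "{secant_map n T b t}"] show ?thesis by blast
      qed (simp add: f00)
    qed
  next
    assume f0: "\<forall>t. eval_mpoly f (secant_map n T b t) = 0"
    show "\<forall>p\<in>S. \<forall>w\<in>p. eval_mpoly f w = 0"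
    proof (intro ballI)
      fix p w assume pw: "p \<in> S" "w \<in> p"
      then obtain S' where S': "finite S'" "S' \<subseteq> X" "card S' = b" "p \<in> proj_span I S'" unfolding S_def by blast
      then have "w \<in> fun_vec.span (\<Union>S')" using pw(2) by (auto simp: proj_span_def)
      from span_points[OF S'(1,2) this, of "{..<b}"] S'(3)
      obtain V where V: "w = (\<lambda>m. \<Sum>j<b. sv n T (V j) m)" by auto
      have "w = secant_map n T b (\<lambda>(j, i, k). V j i k)" by (simp add: V secant_map_def block_def)
      then show "eval_mpoly f w = 0" using f0 by simp
    qed
  qed
  then show ?thesis unfolding secant_variety_def S_def[symmetric] closure_iff[OF S v] by simp
qed

text \<open>A point of the tangential variety may be only a limit of tangent vectors, so the summand
  \<open>y\<close> need not be some \<open>tv\<close>. For fixed \<open>z\<close> the condition is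
  polynomial in \<open>y\<close>, and tangent vectors form a cone, so it extends to the
  closure.\<close>

lemma join_iff:
  assumes b: "b \<ge> 2" and v: "v \<in> coord_space I" "v \<noteq> 0"
  shows "fun_vec.span {v} \<in> tangential_join I X b \<longleftrightarrow>
    (\<forall>f\<in>homogeneous_polys I. (\<forall>t. eval_mpoly f (join_map n T b t) = 0) \<longrightarrow> eval_mpoly f v = 0)"
proof -
  define S where "S = \<Union>{proj_span I (insert q S) | q S. q \<in> tangential_variety I X \<and> finite S \<and> S \<subseteq> X \<and> card S = b - 2}"
  have S: "S \<subseteq> proj_space I" by (auto simp: S_def proj_span_def)
  obtain u1 :: "nat \<Rightarrow> nat \<Rightarrow> 'k" where u1: "sv n T u1 \<noteq> 0" using sv_exists_nonzero[of T n] by auto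
  have q1: "fun_vec.span {sv n T u1} \<in> tangential_variety I X"
    using tv_in_tangential[of u1 "\<lambda>i k. if i = 1 then u1 i k else 0"] u1 unfolding tv_euler by simp
  have in_S: "fun_vec.span {join_map n T b t} \<in> S" if nz: "join_map n T b t \<noteq> 0" for t
  proof -
    define x where "x = tv n T (block t 0) (block t 1)"
    obtain S' where S': "finite S'" "S' \<subseteq> X" "card S' = b - 2"
      "(\<lambda>m. \<Sum>j\<in>{2..<b}. sv n T (block t j) m) \<in> fun_vec.span (\<Union>S')"
      using sum_sv_in_span[of "{2..<b}" "b - 2" "block t"] by auto
    have "\<exists>q\<in>tangential_variety I X. x \<in> q"
    proof (cases "x = 0")
      case True
      then show ?thesis using q1 fun_vec.span_zero by metis
    next
      case False
      then have "fun_vec.span {x} \<in> tangential_variety I X" unfolding x_def by (rule tv_in_tangential)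
      then show ?thesis using fun_vec.span_base[of x "{x}"] by blast
    qed
    then obtain q where q: "q \<in> tangential_variety I X" "x \<in> q" by blast
    have "join_map n T b t = x + (\<lambda>m. \<Sum>j\<in>{2..<b}. sv n T (block t j) m)"
      by (simp add: join_map_def x_def fun_eq_iff)
    also have "\<dots> \<in> fun_vec.span (\<Union>(insert q S'))"
    proof (rule fun_vec.span_add)
      show "x \<in> fun_vec.span (\<Union>(insert q S'))" using q(2) by (intro fun_vec.span_base) blast
      show "(\<lambda>m. \<Sum>j\<in>{2..<b}. sv n T (block t j) m) \<in> fun_vec.span (\<Union>(insert q S'))"
        using S'(4) fun_vec.span_mono[of "\<Union>S'" "\<Union>(insert q S')"] by blast
    qed
    finally have "fun_vec.span {join_map n T b t} \<in> proj_span I (insert q S')"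
      by (rule proj_spanI[OF join_coord nz])
    then show ?thesis unfolding S_def using q(1) S'(1-3) by blast
  qed
  have "(\<forall>p\<in>S. \<forall>w\<in>p. eval_mpoly f w = 0) \<longleftrightarrow> (\<forall>t. eval_mpoly f (join_map n T b t) = 0)"
    if f: "f \<in> homogeneous_polys I" for f
  proof
    assume f0: "\<forall>p\<in>S. \<forall>w\<in>p. eval_mpoly f w = 0"
    obtain t0 where "join_map n T b t0 \<noteq> (0 :: _ \<Rightarrow> 'k)" using join_nonzero by blast
    from eval_at_0[OF f in_S[OF this] S f0] have f00: "eval_mpoly f 0 = 0" .
    show "\<forall>t. eval_mpoly f (join_map n T b t) = 0"
    proof
      fix t
      show "eval_mpoly f (join_map n T b t) = 0"
      proof (cases "join_map n T b t = 0")
        case False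
        from in_S[OF False] f0 fun_vec.span_base[of "join_map n T b t" "{join_map n T b t}"] show ?thesis by blast
      qed (simp add: f00)
    qed
  next
    assume f0: "\<forall>t. eval_mpoly f (join_map n T b t) = 0"
    show "\<forall>p\<in>S. \<forall>w\<in>p. eval_mpoly f w = 0"
    proof (intro ballI)
      fix p w assume pw: "p \<in> S" "w \<in> p"
      then obtain q S' where S': "q \<in> tangential_variety I X" "finite S'" "S' \<subseteq> X" "card S' = b - 2"
        "p \<in> proj_span I (insert q S')" unfolding S_def by blast
      have qp: "q \<in> proj_space I" using S'(1) tangential_proj by blast
      have "w \<in> fun_vec.span (q \<union> \<Union>S')" using pw(2) S'(5) by (auto simp: proj_span_def)
      moreover have "fun_vec.span q = q" using qp by (auto simp: proj_space_def fun_vec.span_span)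
      ultimately obtain y z where yz: "w = y + z" "y \<in> q" "z \<in> fun_vec.span (\<Union>S')"
        unfolding fun_vec.span_Un by auto
      from span_points[OF S'(2,3) yz(3), of "{2..<b}"] S'(4)
      obtain V where V: "z = (\<lambda>m. \<Sum>j\<in>{2..<b}. sv n T (V j) m)" by auto
      have tvz: "eval_mpoly f (\<lambda>m. tv n T u x m + z m) = 0" for u x
      proof -
        have "(\<lambda>m. tv n T u x m + z m) = join_map n T b (\<lambda>(j, i, k). if j = 0 then u i k else if j = 1 then x i k else V j i k)"
          unfolding join_map_def V
          by (intro ext arg_cong2[of _ _ _ _ "(+)"] sum.cong) (auto simp: block_def)
        then show ?thesis using f0 by simp
      qed
      have "eval_mpoly f (\<lambda>m. y m + z m) = 0"
      proof (rule polyfun_zero_at_cone[where C = "{tv n T u x | u x. True}" and C' = "{y}" and I = I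
            and Q = "\<lambda>y. eval_mpoly f (\<lambda>m. y m + z m)"])
        show "(\<lambda>y. eval_mpoly f (\<lambda>m. y m + z m)) \<in> polyfun I"
          by (intro eval_homogeneous_polyfun[OF f] polyfun_add polyfun_const polyfun_coord)
        show "fun_scale c x \<in> {tv n T u x | u x. True}" if xC: "x \<in> {tv n T u x | u x. True}" for x c
        proof -
          obtain u y where x: "x = tv n T u y" using xC by blast
          have "fun_scale c x = tv n T u (\<lambda>i k. c * y i k)" by (simp add: x fun_eq_iff fun_scale_apply tv_scale)
          then show ?thesis by blast
        qed
        show "eval_mpoly f (\<lambda>m. x m + z m) = 0" if "x \<in> {tv n T u x | u x. True}" for x
          using that tvz by blast
        show "eval_mpoly g x = 0" if g: "g \<in> homogeneous_polys I"
          "\<And>w. w \<in> {tv n T u x | u x. True} \<Longrightarrow> eval_mpoly g w = 0" and x: "x \<in> {y}" for g x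
        proof -
          have gt: "eval_mpoly g (tv n T u w) = 0" for u w by (rule g(2)) blast
          show ?thesis
          proof (cases "y = 0")
            case True
            have "tv n T (\<lambda>_ _. 0) (\<lambda>_ _. 0) = (0 :: _ \<Rightarrow> 'k)"
            proof
              fix m show "tv n T (\<lambda>_ _. 0) (\<lambda>_ _. 0) m = (0 :: _ \<Rightarrow> 'k) m"
                using tv_scale[of T n "\<lambda>_ _. 0" 0 "\<lambda>_ _. 0" m] by simp
            qed
            then show ?thesis using gt[of "\<lambda>_ _. 0" "\<lambda>_ _. 0"] x True by simp
          next
            case False
            from proj_space_span_eq[OF qp yz(2) False]
            have "fun_vec.span {y} \<in> tangential_variety I X" "y \<in> coord_space I" using S'(1) by auto
            then show ?thesis using tangential_iff[of y] False g(1) gt x by blast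
          qed
        qed
      qed simp
      then show "eval_mpoly f w = 0" by (simp add: yz(1) plus_fun_def)
    qed
  qed
  then show ?thesis unfolding tangential_join_def S_def[symmetric] closure_iff[OF S v] by simp
qed

end

section \<open>Generic independence\<close>

text \<open>The witness is a principal open set, so conjunctions correspond to products of
  polynomials.\<close>

definition generically :: "'j set \<Rightarrow> (('j \<Rightarrow> 'k::field_char_0) \<Rightarrow> bool) \<Rightarrow> bool" where
  "generically J P \<longleftrightarrow> (\<exists>g\<in>polyfun J. (\<exists>u. g u \<noteq> 0) \<and> (\<forall>u. g u \<noteq> 0 \<longrightarrow> P u))"

lemma generically_ex: "generically J P \<Longrightarrow> \<exists>u. P u"
  unfolding generically_def by blast

lemma generically_nonzero: "g \<in> polyfun J \<Longrightarrow> g u \<noteq> 0 \<Longrightarrow> generically J (\<lambda>u. g u \<noteq> 0)"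
  unfolding generically_def by blast

lemma generically_mono: "generically J P \<Longrightarrow> J \<subseteq> J' \<Longrightarrow> (\<And>u. P u \<Longrightarrow> Q u) \<Longrightarrow> generically J' Q"
  unfolding generically_def using polyfun_mono by metis

lemma generically_conj:
  assumes "generically J P" "generically J Q" shows "generically J (\<lambda>u. P u \<and> Q u)"
proof -
  obtain g u where g: "g \<in> polyfun J" "g u \<noteq> 0" "\<forall>u. g u \<noteq> 0 \<longrightarrow> P u"
    using assms(1) unfolding generically_def by blast
  obtain h w where h: "h \<in> polyfun J" "h w \<noteq> 0" "\<forall>u. h u \<noteq> 0 \<longrightarrow> Q u"
    using assms(2) unfolding generically_def by blast
  obtain x where "g x * h x \<noteq> 0" using polyfun_mult_nonzero[OF g(1,2) h(1,2)] by blast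
  then show ?thesis
    unfolding generically_def using polyfun_mult[OF g(1) h(1)] g(3) h(3)
    by (intro bexI[of _ "\<lambda>u. g u * h u"]) auto
qed

lemma generically_ball:
  assumes "finite A" "\<And>a. a \<in> A \<Longrightarrow> generically J (P a)" shows "generically J (\<lambda>u. \<forall>a\<in>A. P a u)"
  using assms
proof (induction A rule: finite_induct)
  case empty
  have "(\<lambda>_. 1) \<in> polyfun J" by (rule polyfun_const)
  then show ?case unfolding generically_def by (intro bexI[of _ "\<lambda>_. 1"]) auto
next
  case (insert a A)
  then have "generically J (\<lambda>u. P a u \<and> (\<forall>a\<in>A. P a u))" by (intro generically_conj) auto
  then show ?case by simp
qed

lemma generically_indep:
  fixes V :: "('j \<Rightarrow> 'k::field_char_0) \<Rightarrow> 'a \<Rightarrow> 'i \<Rightarrow> 'k"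
  assumes "finite A" "\<And>a i. a \<in> A \<Longrightarrow> (\<lambda>u. V u a i) \<in> polyfun J" "indep_fam A (V u0)"
  shows "generically J (\<lambda>u. indep_fam A (V u))"
  using generic_indep_fam[of A V J u0] assms unfolding generically_def by blast

lemma indep_fam_coord:
  assumes "finite A" "inj_on \<mu> A" "\<And>a. a \<in> A \<Longrightarrow> c a \<noteq> 0" "\<And>a m. a \<in> A \<Longrightarrow> v a m = (if m = \<mu> a then c a else 0)"
  shows "indep_fam A (v :: 'a \<Rightarrow> 'i \<Rightarrow> 'k::field)"
proof (rule indep_famI)
  fix d a assume d: "\<And>i. (\<Sum>a\<in>A. d a * v a i) = 0" and a: "a \<in> A"
  have "(\<Sum>b\<in>A. d b * v b (\<mu> a)) = (\<Sum>b\<in>A. if b = a then d b * c b else 0)"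
    by (rule sum.cong) (use assms(4) a inj_onD[OF assms(2)] in auto)
  then have "d a * c a = 0" using d[of "\<mu> a"] a assms(1) by simp
  then show "d a = 0" using assms(3)[OF a] by simp
qed

definition base_index :: "nat set \<Rightarrow> nat \<Rightarrow> nat" where
  "base_index B = restrict (\<lambda>_. 0) B"

lemma base_index_in: "base_index B \<in> tensor_index n B"
  by (auto simp: base_index_def tensor_index_def)

lemma base_index_apply: "i \<in> B \<Longrightarrow> base_index B i = 0"
  by (simp add: base_index_def)

abbreviation tan_index :: "(nat \<Rightarrow> nat) \<Rightarrow> nat set \<Rightarrow> (nat \<times> nat) option set" where
  "tan_index n B \<equiv> tb_index n B (base_index B)"

definition indep_mod_tangent ::
    "(nat \<Rightarrow> nat) \<Rightarrow> nat set \<Rightarrow> (nat \<Rightarrow> nat \<Rightarrow> 'k) \<Rightarrow> nat set \<Rightarrow> (nat \<Rightarrow> (nat \<Rightarrow> nat) \<Rightarrow> 'k::field) \<Rightarrow> bool" where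
  "indep_mod_tangent n B u K y \<longleftrightarrow> indep_fam (Inl ` tan_index n B \<union> Inr ` K) (case_sum (tb n B u) y)"

lemma sum_tangent_family:
  assumes "finite B" "finite K"
  shows "(\<Sum>a\<in>Inl ` tan_index n B \<union> Inr ` K. f a) = (\<Sum>a\<in>tan_index n B. f (Inl a)) + (\<Sum>l\<in>K. f (Inr l))"
  using assms finite_tb_index[OF assms(1)]
  by (subst sum.union_disjoint) (auto simp: sum.reindex)

text \<open>Compare coefficients in the tangent basis extended by the \<open>y l\<close>. This is
  how general position is used: a variation that stays in the span of the tensor and the
  \<open>y l\<close> only rescales the factors.\<close>

lemma tangent_relation:
  fixes u w :: "nat \<Rightarrow> nat \<Rightarrow> 'k::field"
  assumes B: "finite B" and K: "finite K" and ind: "indep_mod_tangent n B u K y"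
    and u: "\<And>i. i \<in> B \<Longrightarrow> u i 0 \<noteq> 0"
    and eq: "\<And>m. tv n B u w m = \<alpha> * sv n B u m + (\<Sum>l\<in>K. c l * y l m)"
  shows "l \<in> K \<Longrightarrow> c l = 0" and "\<alpha> = (\<Sum>i\<in>B. w i 0 / u i 0)"
    and "i \<in> B \<Longrightarrow> k \<le> n i \<Longrightarrow> w i k = w i 0 / u i 0 * u i k"
proof -
  let ?T = "tan_index n B" and ?z = "base_index B"
  have u0: "u i (?z i) \<noteq> 0" if "i \<in> B" for i using u that by (simp add: base_index_apply)
  have exp: "tv n B u w m = (\<Sum>a\<in>?T. tb_coeff B ?z u w a * tb n B u a m)" for m
    by (rule tv_expand[OF B]) (rule u0)
  define d where "d = case_sum (\<lambda>a. tb_coeff B ?z u w a - (if a = None then \<alpha> else 0)) (\<lambda>l. - c l)"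
  have "(\<Sum>a\<in>Inl ` ?T \<union> Inr ` K. d a * case_sum (tb n B u) y a m) = 0" for m
  proof -
    have "(\<Sum>a\<in>?T. (if a = None then \<alpha> else 0) * tb n B u a m) = \<alpha> * sv n B u m"
      unfolding sum_tb_index[OF B] by (simp add: tb_def)
    then show ?thesis
      using eq[of m] exp[of m]
      by (simp add: sum_tangent_family[OF B K] d_def left_diff_distrib sum_subtractf sum_negf)
  qed
  then have d0: "d a = 0" if "a \<in> Inl ` ?T \<union> Inr ` K" for a
    using ind that unfolding indep_mod_tangent_def by (intro indep_famD[of "Inl ` ?T \<union> Inr ` K" "case_sum (tb n B u) y" d a])
  show "l \<in> K \<Longrightarrow> c l = 0" using d0[of "Inr l"] by (simp add: d_def)
  have "None \<in> ?T" by (simp add: tb_index_def)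
  then have "d (Inl None) = 0" by (intro d0) simp
  then show "\<alpha> = (\<Sum>i\<in>B. w i 0 / u i 0)"
    by (simp add: d_def tb_coeff_def base_index_apply cong: sum.cong)
  assume i: "i \<in> B" "k \<le> n i"
  show "w i k = w i 0 / u i 0 * u i k"
  proof (cases "k = 0")
    case True
    then show ?thesis using u[OF i(1)] by simp
  next
    case False
    then have "k \<in> {0..n i} - {?z i}" using i by (simp add: base_index_apply)
    then have "Some (i, k) \<in> ?T" using i(1) unfolding tb_index_def by blast
    then have "d (Inl (Some (i, k))) = 0" by (intro d0) simp
    then show ?thesis using i by (simp add: d_def tb_coeff_def base_index_apply)
  qed
qed

definition join_tuple :: "(nat \<Rightarrow> nat) \<Rightarrow> nat set \<Rightarrow> (nat \<times> nat \<times> nat \<Rightarrow> 'k) \<Rightarrow> nat \<Rightarrow> (nat \<Rightarrow> nat) \<Rightarrow> 'k::comm_ring_1" where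
  "join_tuple n B t k = (if k = 1 then tv n B (block t 0) (block t 1) else sv n B (block t k))"

definition unit_dir :: "nat \<times> nat \<Rightarrow> nat \<Rightarrow> nat \<Rightarrow> 'k::comm_ring_1" where
  "unit_dir = (\<lambda>(i, p) j l. if j = i \<and> l = p then 1 else 0)"

lemma sv_unit':
  assumes "finite B" "m \<in> tensor_index n B" "\<And>i. i \<in> B \<Longrightarrow> u i = unit_vec (m i)"
  shows "sv n B u m' = (if m' = m then 1 else 0)"
proof -
  have "sv n B u = sv n B (\<lambda>i. unit_vec (m i))" by (rule sv_cong) (simp add: assms(3))
  then show ?thesis by (simp add: sv_unit[OF assms(1,2)])
qed

lemma sv_zero_factor: "finite B \<Longrightarrow> i \<in> B \<Longrightarrow> u i = (\<lambda>_. 0) \<Longrightarrow> sv n B u m = 0"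
  unfolding sv_def by (auto intro!: prod_zero bexI[of _ i])

lemma polyfun_tb:
  assumes "\<And>i k. i \<in> B \<Longrightarrow> k \<le> n i \<Longrightarrow> (\<lambda>t. U t i k) \<in> polyfun J"
  shows "(\<lambda>t. tb n B (U t) a m) \<in> polyfun J"
proof (cases a)
  case None
  then show ?thesis using polyfun_sv[OF assms] by (simp add: tb_def)
next
  case (Some x)
  obtain i k where x: "x = (i, k)" by (cases x)
  have "(\<lambda>t. sv n B ((U t)(i := unit_vec k)) m) \<in> polyfun J"
  proof (rule polyfun_sv)
    fix j l assume "j \<in> B" "l \<le> n j"
    then show "(\<lambda>t. ((U t)(i := unit_vec k)) j l) \<in> polyfun J"
      using assms by (cases "j = i") (simp_all add: polyfun_const)
  qed
  then show ?thesis by (simp add: tb_def Some x)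
qed

lemma polyfun_sec:
  assumes "\<And>i k. i \<in> B \<Longrightarrow> k \<le> n i \<Longrightarrow> (\<lambda>t. U t i k) \<in> polyfun J" "\<And>i k. i \<in> B \<Longrightarrow> k \<le> n i \<Longrightarrow> (\<lambda>t. V t i k) \<in> polyfun J"
    and "\<And>i k. i \<in> B \<Longrightarrow> k \<le> n i \<Longrightarrow> (\<lambda>t. W t i k) \<in> polyfun J"
  shows "(\<lambda>t. sec n B (U t) (V t) (W t) m) \<in> polyfun J"
  unfolding sec_def
proof (intro polyfun_sum polyfun_sv)
  fix i j l k assume "i \<in> B" "j \<in> B - {i}" "l \<in> B" "k \<le> n l"
  then show "(\<lambda>t. ((U t)(i := V t i, j := W t j)) l k) \<in> polyfun J"
    using assms by (cases "l = j"; cases "l = i") simp_all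
qed

lemma polyfun_join_tuple: "b \<ge> 2 \<Longrightarrow> k < b \<Longrightarrow> (\<lambda>t. join_tuple n B t k m) \<in> polyfun (params n B b)"
  unfolding join_tuple_def by (cases "k = 1") (auto intro!: polyfun_sv polyfun_tv polyfun_block)

section \<open>General position of tuples on one half of the splitting\<close>

locale big_factors =
  fixes n :: "nat \<Rightarrow> nat" and B :: "nat set" and b :: nat and ty :: "'k::field_char_0 itself"
  assumes B: "finite B" and pos: "\<And>i. i \<in> B \<Longrightarrow> n i > 0" and b: "b \<ge> 2"
    and big: "(\<Prod>i\<in>B. (n i + 1)) > b + 3 + (\<Sum>i\<in>B. n i)"
begin

text \<open>Combined with a change in factor \<open>i1\<close>, the two directions lead to two
  different indices at distance two from the base index. The inequality rules out a single factor as
  well as two factors that are both projective lines.\<close>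

lemma three_directions:
  "\<exists>i1 i p i' p'. i1 \<in> B \<and> i \<in> B \<and> i' \<in> B \<and> i \<noteq> i1 \<and> i' \<noteq> i1 \<and> 1 \<le> p \<and> p \<le> n i \<and> 1 \<le> p' \<and> p' \<le> n i' \<and> (i, p) \<noteq> (i', p')"
proof -
  have "B \<noteq> {}" using big by auto
  then obtain x where x: "x \<in> B" by blast
  have "B \<noteq> {x}" using big by auto
  then obtain y where y: "y \<in> B" "y \<noteq> x" using x by blast
  show ?thesis
  proof (cases "\<exists>i\<in>B. n i \<ge> 2")
    case True
    then obtain i where i: "i \<in> B" "n i \<ge> 2" by blast
    obtain j where "j \<in> B" "j \<noteq> i" using x y by blast
    then show ?thesis using i by (intro exI[of _ j] exI[of _ i] exI[of _ 1] exI[of _ i] exI[of _ 2]) auto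
  next
    case False
    have n1: "n i = 1" if "i \<in> B" for i using False pos[OF that] that by (metis One_nat_def less_2_cases not_le neq0_conv)
    have "B \<noteq> {x, y}" using big y n1[OF x] n1[OF y(1)] by auto
    then obtain z where "z \<in> B" "z \<noteq> x" "z \<noteq> y" using x y by blast
    then show ?thesis using x y n1
      by (intro exI[of _ x] exI[of _ y] exI[of _ 1] exI[of _ z] exI[of _ 1]) auto
  qed
qed

text \<open>The coordinate picked out by the tangent basis vector \<open>a\<close> at the base
  tensor, all of whose factors are the unit vector 0.\<close>

definition near :: "(nat \<times> nat) option \<Rightarrow> nat \<Rightarrow> nat" where
  "near a = (case a of None \<Rightarrow> base_index B | Some (i, k) \<Rightarrow> (base_index B)(i := k))"

text \<open>Coordinate tensors outside the tangent space at the base tensor, available for the other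
  members of a tuple.\<close>

definition far :: "(nat \<Rightarrow> nat) set" where
  "far = tensor_index n B - near ` tan_index n B"

text \<open>At most \<open>1 + (\<Sum>i\<in>B. n i)\<close> indices are near, and the strict
  inequality makes up for the 1.\<close>

lemma far_card: "finite far" "card far \<ge> b + 3"
proof -
  have fT: "finite (tensor_index n B)" by (rule finite_tensor_index[OF B])
  then show "finite far" by (simp add: far_def)
  have "card (tensor_index n B) = (\<Prod>i\<in>B. n i + 1)" by (simp add: tensor_index_def card_PiE B)
  moreover have "card (near ` tan_index n B) \<le> card (tan_index n B)"
    by (rule card_image_le[OF finite_tb_index[OF B]])
  moreover have "card (tan_index n B) = Suc (\<Sum>i\<in>B. n i)"
    using B by (intro card_tb_index) (simp_all add: base_index_apply)
  moreover have "card (tensor_index n B) - card (near ` tan_index n B) \<le> card far"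
    unfolding far_def by (rule diff_card_le_card_Diff) (simp add: finite_tb_index[OF B])
  ultimately show "card far \<ge> b + 3" using big by linarith
qed

lemma far_inj:
  assumes "finite K" "finite Z" "card K + card Z \<le> b + 3"
  shows "\<exists>\<nu>. inj_on \<nu> K \<and> (\<forall>l\<in>K. \<nu> l \<in> far - Z)"
proof -
  have "card far - card Z \<le> card (far - Z)" by (rule diff_card_le_card_Diff[OF assms(2)])
  then have "card K \<le> card (far - Z)" using assms(3) far_card by linarith
  from card_le_inj[OF assms(1) _ this] far_card(1) show ?thesis by auto
qed

lemma farI:
  assumes "i \<in> B" "j \<in> B" "i \<noteq> j" "m i \<noteq> 0" "m j \<noteq> 0" "m \<in> tensor_index n B" shows "m \<in> far"
proof -
  have "m \<noteq> near a" for a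
  proof
    assume m: "m = near a"
    show False
    proof (cases a)
      case None
      then show ?thesis using m assms by (simp add: near_def base_index_apply)
    next
      case (Some x)
      obtain k l where "x = (k, l)" by (cases x)
      then have "m i = (if i = k then l else 0)" "m j = (if j = k then l else 0)"
        using m Some assms(1,2) by (simp_all add: near_def base_index_apply)
      then show ?thesis using assms by (auto split: if_splits)
    qed
  qed
  then show ?thesis using assms(6) by (auto simp: far_def)
qed

lemma far_index: "m \<in> far \<Longrightarrow> m \<in> tensor_index n B"
  by (simp add: far_def)

lemma near_inj: "inj_on near (tan_index n B)"
proof (rule inj_onI)
  have val: "near (Some (i, k)) j = (if j = i then k else 0)" if "j \<in> B" for i j k
    using that by (simp add: near_def base_index_apply)
  have val0: "near None j = 0" if "j \<in> B" for j
    using that by (simp add: near_def base_index_apply)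
  have pos: "i \<in> B \<and> k \<noteq> 0" if "Some (i, k) \<in> tan_index n B" for i k
    using that by (auto simp: tb_index_def base_index_apply)
  fix x y assume xy: "x \<in> tan_index n B" "y \<in> tan_index n B" "near x = near y"
  show "x = y"
  proof (cases x)
    case None
    show ?thesis
    proof (cases y)
      case (Some z)
      obtain i k where z: "z = (i, k)" by (cases z)
      have ik: "i \<in> B \<and> k \<noteq> 0" using pos[of i k] xy(2) Some z by simp
      then have "near y i = k" using val[of i i k] Some z by simp
      then show ?thesis using xy(3) None val0[of i] ik by simp
    qed (simp add: None)
  next
    case (Some z)
    obtain i k where z: "z = (i, k)" by (cases z)
    have ik: "i \<in> B \<and> k \<noteq> 0" using pos[of i k] xy(1) Some z by simp
    then have nx: "near x i = k" using val[of i i k] Some z by simp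
    show ?thesis
    proof (cases y)
      case None
      then show ?thesis using nx xy(3) val0[of i] ik by simp
    next
      case y: (Some z')
      obtain j l where z': "z' = (j, l)" by (cases z')
      then have "k = (if i = j then l else 0)" using nx xy(3) val[of i j l] ik y by simp
      then show ?thesis using ik Some y z z' by (auto split: if_splits)
    qed
  qed
qed

lemma tb_unit:
  fixes u :: "nat \<Rightarrow> nat \<Rightarrow> 'k"
  assumes u: "\<And>i. i \<in> B \<Longrightarrow> u i = unit_vec 0" and a: "a \<in> tan_index n B"
  shows "tb n B u a m = (if m = near a then 1 else 0)"
proof (cases a)
  case None
  have "sv n B u m = (if m = base_index B then 1 else 0)"
    by (rule sv_unit'[OF B base_index_in]) (simp add: u base_index_apply)
  then show ?thesis by (simp add: tb_def near_def None)
next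
  case (Some x)
  obtain i k where x: "x = (i, k)" by (cases x)
  have ik: "i \<in> B" "k \<le> n i" using a Some x by (auto simp: tb_index_def)
  have "(base_index B)(i := k) \<in> tensor_index n B" using ik by (intro tensor_index_upd base_index_in)
  then have "sv n B (u(i := unit_vec k)) m = (if m = (base_index B)(i := k) then 1 else 0)"
    by (rule sv_unit'[OF B]) (simp add: u base_index_apply)
  then show ?thesis by (simp add: tb_def near_def Some x)
qed

text \<open>With the base tensor and multiples of distinct far coordinate tensors independence is
  visible. The coefficients \<open>c\<close> accommodate the factor 2 of a repeated second
  derivative.\<close>

lemma indep_mod_tangent_coord:
  fixes u :: "nat \<Rightarrow> nat \<Rightarrow> 'k"
  assumes u: "\<And>i. i \<in> B \<Longrightarrow> u i = unit_vec 0" and K: "finite K" and \<nu>: "inj_on \<nu> K" "\<And>l. l \<in> K \<Longrightarrow> \<nu> l \<in> far"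
    and y: "\<And>l. l \<in> K \<Longrightarrow> c l \<noteq> 0" "\<And>l m. l \<in> K \<Longrightarrow> y l m = (if m = \<nu> l then c l else 0)"
  shows "indep_mod_tangent n B u K y"
  unfolding indep_mod_tangent_def
proof (rule indep_fam_coord[where \<mu> = "case_sum near \<nu>" and c = "case_sum (\<lambda>_. 1) c"])
  show "finite (Inl ` tan_index n B \<union> Inr ` K)" using K finite_tb_index[OF B] by simp
  have "near a \<noteq> \<nu> l" if "a \<in> tan_index n B" "l \<in> K" for a l
    using \<nu>(2)[OF that(2)] imageI[OF that(1), of near] by (auto simp: far_def)
  then show "inj_on (case_sum near \<nu>) (Inl ` tan_index n B \<union> Inr ` K)"
    using inj_onD[OF near_inj] inj_onD[OF \<nu>(1)] by (intro inj_onI) (auto, metis)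
  show "case_sum (\<lambda>_. 1) c a \<noteq> 0" if "a \<in> Inl ` tan_index n B \<union> Inr ` K" for a
    using that y(1) by auto
  show "case_sum (tb n B u) y a m = (if m = case_sum near \<nu> a then case_sum (\<lambda>_. 1) c a else 0)"
    if "a \<in> Inl ` tan_index n B \<union> Inr ` K" for a m
    using that y(2) tb_unit[of u] u by auto
qed

lemma generically_indep_mod_tangent:
  fixes U :: "(nat \<times> nat \<times> nat \<Rightarrow> 'k) \<Rightarrow> nat \<Rightarrow> nat \<Rightarrow> 'k"
  assumes "finite K" "\<And>i k. i \<in> B \<Longrightarrow> k \<le> n i \<Longrightarrow> (\<lambda>t. U t i k) \<in> polyfun J"
    and "\<And>l m. l \<in> K \<Longrightarrow> (\<lambda>t. y t l m) \<in> polyfun J" and "indep_mod_tangent n B (U t0) K (y t0)"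
  shows "generically J (\<lambda>t. indep_mod_tangent n B (U t) K (y t))"
  unfolding indep_mod_tangent_def
proof (rule generically_indep[where V = "\<lambda>t. case_sum (tb n B (U t)) (y t)"])
  show "finite (Inl ` tan_index n B \<union> Inr ` K)" using assms(1) finite_tb_index[OF B] by simp
  show "(\<lambda>t. case_sum (tb n B (U t)) (y t) a m) \<in> polyfun J" if "a \<in> Inl ` tan_index n B \<union> Inr ` K" for a m
    using that polyfun_tb[OF assms(2)] assms(3) by auto
  show "indep_fam (Inl ` tan_index n B \<union> Inr ` K) (case_sum (tb n B (U t0)) (y t0))"
    using assms(4) by (simp add: indep_mod_tangent_def)
qed

text \<open>The example has the base tensor in block \<open>k\<close> and coordinate tensors at
  distinct far indices elsewhere.\<close>

lemma generically_secant:
  assumes k: "k < b"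
  shows "generically (params n B b) (\<lambda>t :: nat \<times> nat \<times> nat \<Rightarrow> 'k.
    indep_mod_tangent n B (block t k) ({..<b} - {k}) (\<lambda>l. sv n B (block t l)))"
proof -
  have "card ({..<b} - {k}) + card {} \<le> b + 3" using k by simp
  then obtain \<nu> where \<nu>: "inj_on \<nu> ({..<b} - {k})" "\<forall>l\<in>{..<b} - {k}. \<nu> l \<in> far - {}"
    using far_inj[of "{..<b} - {k}" "{}"] by blast
  define t :: "nat \<times> nat \<times> nat \<Rightarrow> 'k" where "t = (\<lambda>(j, i, l). if j = k then unit_vec 0 l else unit_vec (\<nu> j i) l)"
  have "indep_mod_tangent n B (block t k) ({..<b} - {k}) (\<lambda>l. sv n B (block t l))"
  proof (rule indep_mod_tangent_coord[where \<nu> = \<nu> and c = "\<lambda>_. 1"])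
    show "block t k i = unit_vec 0" for i by (simp add: block_def t_def)
    show "sv n B (block t l) m = (if m = \<nu> l then 1 else 0)" if l: "l \<in> {..<b} - {k}" for l m
      by (rule sv_unit'[OF B far_index]) (use \<nu>(2) l in \<open>auto simp: block_def t_def\<close>)
  qed (use \<nu> in auto)
  then show ?thesis
    by (intro generically_indep_mod_tangent[where U = "\<lambda>t. block t k" and y = "\<lambda>t l. sv n B (block t l)" and ?t0.0 = t])
       (auto intro!: polyfun_sv polyfun_block k)
qed

lemma tv_single_direction:
  assumes "i \<in> B" "\<And>j. j \<in> B \<Longrightarrow> j \<noteq> i \<Longrightarrow> w j = (\<lambda>_. 0)"
  shows "tv n B u w m = (sv n B (u(i := w i)) m :: 'k)"
proof -
  have "tv n B u w m = (\<Sum>j\<in>B. if j = i then sv n B (u(i := w i)) m else 0)"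
    unfolding tv_def using assms by (intro sum.cong refl) (auto intro: sv_zero_factor[OF B])
  then show ?thesis using assms(1) B by simp
qed

text \<open>In the example the tangent vector at position 1 must be a far coordinate tensor, too: it
  arises from position 0, at \<open>m1\<close>, by replacing one factor so that the index becomes
  \<open>m2\<close>.\<close>

lemma generically_join:
  assumes k: "2 \<le> k" "k < b"
  shows "generically (params n B b) (\<lambda>t :: nat \<times> nat \<times> nat \<Rightarrow> 'k.
    indep_mod_tangent n B (block t k) ({..<b} - {k}) (join_tuple n B t))"
proof -
  obtain i1 i p i' p' where d: "i1 \<in> B" "i \<in> B" "i' \<in> B" "i \<noteq> i1" "i' \<noteq> i1" "1 \<le> p" "p \<le> n i" "1 \<le> p'" "p' \<le> n i'" "(i, p) \<noteq> (i', p')"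
    using three_directions by blast
  define m1 where "m1 = (base_index B)(i1 := 1, i := p)"
  define m2 where "m2 = m1(i' := p')"
  have m1T: "m1 \<in> tensor_index n B" unfolding m1_def
    using d pos[OF d(1)] by (intro tensor_index_upd base_index_in) auto
  have m2T: "m2 \<in> tensor_index n B" unfolding m2_def using d by (intro tensor_index_upd m1T) auto
  have m1f: "m1 \<in> far" by (rule farI[of i1 i]) (use d m1T in \<open>auto simp: m1_def\<close>)
  have m2f: "m2 \<in> far" by (rule farI[of i1 i']) (use d m2T in \<open>auto simp: m1_def m2_def\<close>)
  have m12: "m1 \<noteq> m2"
  proof
    assume eq: "m1 = m2"
    have "m1 i' = m2 i'" by (simp only: eq)
    then have "m1 i' = p'" by (simp add: m2_def)
    then show False using d by (auto simp: m1_def base_index_apply split: if_splits)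
  qed
  have "card ({2..<b} - {k}) + card {m1, m2} \<le> b + 3" using k m12 by simp
  then obtain \<nu> where \<nu>: "inj_on \<nu> ({2..<b} - {k})" "\<forall>l\<in>{2..<b} - {k}. \<nu> l \<in> far - {m1, m2}"
    using far_inj[of "{2..<b} - {k}" "{m1, m2}"] by auto
  define \<nu>' where "\<nu>' = (\<lambda>l. if l = 0 then m1 else if l = 1 then m2 else \<nu> l)"
  define t :: "nat \<times> nat \<times> nat \<Rightarrow> 'k" where "t = (\<lambda>(j, a, l). if j = k then unit_vec 0 l
    else if j = 1 then (if a = i' then unit_vec p' l else 0) else unit_vec (\<nu>' j a) l)"
  have "indep_mod_tangent n B (block t k) ({..<b} - {k}) (join_tuple n B t)"
  proof (rule indep_mod_tangent_coord[where \<nu> = \<nu>' and c = "\<lambda>_. 1"])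
    show "block t k i = unit_vec 0" for i by (simp add: block_def t_def)
    show \<nu>'far: "\<nu>' l \<in> far" if "l \<in> {..<b} - {k}" for l using that \<nu>(2) m1f m2f by (auto simp: \<nu>'_def)
    show "inj_on \<nu>' ({..<b} - {k})"
    proof (rule inj_onI)
      fix x y assume xy: "x \<in> {..<b} - {k}" "y \<in> {..<b} - {k}" "\<nu>' x = \<nu>' y"
      have c: "z = 0 \<or> z = 1 \<or> z \<in> {2..<b} - {k}" if "z \<in> {..<b} - {k}" for z using that by auto
      show "x = y"
        using c[OF xy(1)] c[OF xy(2)] xy(3) m12 \<nu>(2) inj_onD[OF \<nu>(1), of x y]
        by (auto simp: \<nu>'_def split: if_splits)
    qed
    show "join_tuple n B t l m = (if m = \<nu>' l then 1 else 0)" if l: "l \<in> {..<b} - {k}" for l m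
    proof (cases "l = 1")
      case True
      have "tv n B (block t 0) (block t 1) m = sv n B ((block t 0)(i' := block t 1 i')) m"
        by (rule tv_single_direction[OF d(3)]) (use k in \<open>auto simp: block_def t_def\<close>)
      also have "\<dots> = (if m = m2 then 1 else 0)"
        by (rule sv_unit'[OF B m2T]) (use k in \<open>auto simp: block_def t_def m2_def \<nu>'_def\<close>)
      finally show ?thesis using True by (simp add: join_tuple_def \<nu>'_def)
    next
      case False
      have "sv n B (block t l) m = (if m = \<nu>' l then 1 else 0)"
        by (rule sv_unit'[OF B far_index[OF \<nu>'far[OF l]]]) (use l False in \<open>auto simp: block_def t_def\<close>)
      then show ?thesis using False by (simp add: join_tuple_def)
    qed
  qed auto
  then show ?thesis
    using b k by (intro generically_indep_mod_tangent[where U = "\<lambda>t. block t k" and y = "\<lambda>t. join_tuple n B t" and ?t0.0 = t])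
       (auto intro!: polyfun_join_tuple polyfun_block)
qed

lemma sec_two_directions:
  assumes "i \<in> B" "j \<in> B" "i \<noteq> j" "\<And>l. l \<in> B \<Longrightarrow> l \<noteq> i \<Longrightarrow> v l = (\<lambda>_. 0)" "\<And>l. l \<in> B \<Longrightarrow> l \<noteq> j \<Longrightarrow> w l = (\<lambda>_. 0)"
  shows "sec n B u v w m = (sv n B (u(i := v i, j := w j)) m :: 'k)"
proof -
  have z: "sv n B (u(a := v a, c := w c)) m = (if a = i \<and> c = j then sv n B (u(i := v i, j := w j)) m else 0)"
    if "a \<in> B" "c \<in> B - {a}" for a c
  proof (cases "a = i \<and> c = j")
    case False
    then consider "a \<noteq> i" | "c \<noteq> j" by blast
    then have "sv n B (u(a := v a, c := w c)) m = 0"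
    proof cases
      case 1
      then show ?thesis using that assms(4) by (intro sv_zero_factor[OF B that(1)]) auto
    next
      case 2
      then show ?thesis using that assms(5)[of c] by (intro sv_zero_factor[OF B, of c]) auto
    qed
    then show ?thesis using False by auto
  qed simp
  have "sec n B u v w m = (\<Sum>a\<in>B. \<Sum>c\<in>B - {a}. if a = i \<and> c = j then sv n B (u(i := v i, j := w j)) m else 0)"
    unfolding sec_def by (intro sum.cong refl z)
  also have "\<dots> = (\<Sum>a\<in>B. if a = i then sv n B (u(i := v i, j := w j)) m else 0)"
  proof (intro sum.cong refl)
    fix a assume "a \<in> B"
    show "(\<Sum>c\<in>B - {a}. if a = i \<and> c = j then sv n B (u(i := v i, j := w j)) m else 0) =
        (if a = i then sv n B (u(i := v i, j := w j)) m else 0)"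
      using assms B by (cases "a = i") (simp_all add: sum.delta)
  qed
  also have "\<dots> = sv n B (u(i := v i, j := w j)) m" using assms(1) B by simp
  finally show ?thesis .
qed

text \<open>The first two members become second derivatives at the point of contact, along the
  tangent vector and one unit direction each. Together with the tangent space these vectors enter
  the final dimension count.\<close>

definition second_order :: "(nat \<times> nat) \<times> (nat \<times> nat) \<Rightarrow> (nat \<times> nat \<times> nat \<Rightarrow> 'k) \<Rightarrow> nat \<Rightarrow> (nat \<Rightarrow> nat) \<Rightarrow> 'k" where
  "second_order d t l = (if l = 0 then sec n B (block t 0) (block t 1) (unit_dir (fst d))
     else if l = 1 then sec n B (block t 0) (block t 1) (unit_dir (snd d)) else sv n B (block t l))"

text \<open>At the base tensor with a direction in factor \<open>i1\<close> only, the derivative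
  along a unit direction in another factor is a single far coordinate tensor, and the two directions
  give different ones. In \<open>join_tuple\<close> the first two members are near and the rest
  far.\<close>

lemma generically_second_order:
  "\<exists>d. generically (params n B b) (\<lambda>t :: nat \<times> nat \<times> nat \<Rightarrow> 'k.
      indep_mod_tangent n B (block t 0) {..<b} (second_order d t))"
  and generically_join_tuple:
  "generically (params n B b) (\<lambda>t :: nat \<times> nat \<times> nat \<Rightarrow> 'k. indep_fam {..<b} (join_tuple n B t))"
proof -
  obtain i1 i p i' p' where d: "i1 \<in> B" "i \<in> B" "i' \<in> B" "i \<noteq> i1" "i' \<noteq> i1" "1 \<le> p" "p \<le> n i" "1 \<le> p'" "p' \<le> n i'" "(i, p) \<noteq> (i', p')"
    using three_directions by blast
  define m1 where "m1 = (base_index B)(i1 := 1, i := p)"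
  define m2 where "m2 = (base_index B)(i1 := 1, i' := p')"
  have mT: "(base_index B)(i1 := 1) \<in> tensor_index n B"
    using pos[OF d(1)] by (intro tensor_index_upd base_index_in d) auto
  have m1T: "m1 \<in> tensor_index n B" unfolding m1_def using d by (intro tensor_index_upd mT) auto
  have m2T: "m2 \<in> tensor_index n B" unfolding m2_def using d by (intro tensor_index_upd mT) auto
  have m1f: "m1 \<in> far" by (rule farI[of i1 i]) (use d m1T in \<open>auto simp: m1_def\<close>)
  have m2f: "m2 \<in> far" by (rule farI[of i1 i']) (use d m2T in \<open>auto simp: m2_def\<close>)
  have m12: "m1 \<noteq> m2"
  proof
    assume eq: "m1 = m2"
    have "m1 i' = m2 i'" by (simp only: eq)
    then have "m1 i' = p'" by (simp add: m2_def)
    then show False using d by (auto simp: m1_def base_index_apply split: if_splits)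
  qed
  have "card {2..<b} + card {m1, m2} \<le> b + 3" using m12 by simp
  then obtain \<nu> where \<nu>: "inj_on \<nu> {2..<b}" "\<forall>l\<in>{2..<b}. \<nu> l \<in> far - {m1, m2}"
    using far_inj[of "{2..<b}" "{m1, m2}"] by auto
  define t :: "nat \<times> nat \<times> nat \<Rightarrow> 'k" where "t = (\<lambda>(j, a, l). if j = 0 then unit_vec 0 l
    else if j = 1 then (if a = i1 then unit_vec 1 l else 0) else unit_vec (\<nu> j a) l)"
  have t0: "block t 0 a = unit_vec 0" for a by (simp add: block_def t_def)
  have t1: "block t 1 i1 = unit_vec 1" "a \<noteq> i1 \<Longrightarrow> block t 1 a = (\<lambda>_. 0)" for a
    by (simp_all add: block_def t_def fun_eq_iff)
  have t2: "sv n B (block t l) m = (if m = \<nu> l then 1 else 0)" if l: "l \<in> {2..<b}" for l m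
    by (rule sv_unit'[OF B far_index]) (use \<nu>(2) l in \<open>auto simp: block_def t_def\<close>)
  have dir: "sec n B (block t 0) (block t 1) (unit_dir (a, q)) m = (if m = (base_index B)(i1 := 1, a := q) then 1 else 0)"
    if "a \<in> B" "a \<noteq> i1" "q \<le> n a" for a q m
  proof -
    have "(base_index B)(i1 := 1, a := q) \<in> tensor_index n B"
      using that by (intro tensor_index_upd mT)
    have "sec n B (block t 0) (block t 1) (unit_dir (a, q)) m = sv n B ((block t 0)(i1 := block t 1 i1, a := unit_dir (a, q) a)) m"
      by (rule sec_two_directions[OF d(1) that(1)]) (use that t1 in \<open>auto simp: unit_dir_def fun_eq_iff\<close>)
    also have "\<dots> = (if m = (base_index B)(i1 := 1, a := q) then 1 else 0)"
      by (rule sv_unit'[OF B]) (fact, use that in \<open>auto simp: t0 t1[unfolded One_nat_def] unit_dir_def unit_vec_def base_index_apply fun_eq_iff\<close>)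
    finally show ?thesis .
  qed
  define \<nu>' where "\<nu>' = (\<lambda>l. if l = 0 then m1 else if l = 1 then m2 else \<nu> l)"
  have split: "z = 0 \<or> z = 1 \<or> z \<in> {2..<b}" if "z \<in> {..<b}" for z using that by auto
  have "indep_mod_tangent n B (block t 0) {..<b} (second_order ((i, p), (i', p')) t)"
  proof (rule indep_mod_tangent_coord[where \<nu> = \<nu>' and c = "\<lambda>_. 1"])
    show "\<nu>' l \<in> far" if "l \<in> {..<b}" for l using split[OF that] \<nu>(2) m1f m2f by (auto simp: \<nu>'_def)
    show "inj_on \<nu>' {..<b}"
    proof (rule inj_onI)
      fix x y assume xy: "x \<in> {..<b}" "y \<in> {..<b}" "\<nu>' x = \<nu>' y"
      show "x = y"
        using split[OF xy(1)] split[OF xy(2)] xy(3) m12 \<nu>(2) inj_onD[OF \<nu>(1), of x y]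
        by (auto simp: \<nu>'_def split: if_splits)
    qed
    show "second_order ((i, p), (i', p')) t l m = (if m = \<nu>' l then 1 else 0)" if "l \<in> {..<b}" for l m
      using split[OF that] dir[OF d(2,4,7)] dir[OF d(3,5,9)] t2[of l m]
      by (auto simp: second_order_def \<nu>'_def m1_def m2_def)
  qed (auto simp: t0)
  then have "generically (params n B b) (\<lambda>t :: nat \<times> nat \<times> nat \<Rightarrow> 'k.
      indep_mod_tangent n B (block t 0) {..<b} (second_order ((i, p), (i', p')) t))"
  proof (intro generically_indep_mod_tangent[where U = "\<lambda>t. block t 0" and y = "second_order ((i, p), (i', p'))" and ?t0.0 = t])
    show "(\<lambda>t. second_order ((i, p), (i', p')) t l m) \<in> polyfun (params n B b)" if "l \<in> {..<b}" for l m
      using that b split[OF that] unfolding second_order_def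
      by (auto intro!: polyfun_sec polyfun_sv polyfun_block polyfun_const)
  qed (use b in \<open>auto intro: polyfun_block\<close>)
  then show "\<exists>d. generically (params n B b) (\<lambda>t :: nat \<times> nat \<times> nat \<Rightarrow> 'k.
      indep_mod_tangent n B (block t 0) {..<b} (second_order d t))" by blast
  define \<nu>'' where "\<nu>'' = (\<lambda>l. if l = 0 then base_index B else if l = 1 then (base_index B)(i1 := 1) else \<nu> l)"
  have nearT: "base_index B \<in> near ` tan_index n B" "(base_index B)(i1 := 1) \<in> near ` tan_index n B"
  proof -
    have "base_index B = near None" "None \<in> tan_index n B" by (auto simp: near_def tb_index_def)
    then show "base_index B \<in> near ` tan_index n B" by blast
    have "(base_index B)(i1 := 1) = near (Some (i1, 1))" "Some (i1, 1) \<in> tan_index n B"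
      using pos[OF d(1)] d(1) by (auto simp: near_def tb_index_def base_index_apply)
    then show "(base_index B)(i1 := 1) \<in> near ` tan_index n B" by blast
  qed
  have "indep_fam {..<b} (join_tuple n B t)"
  proof (rule indep_fam_coord[where \<mu> = \<nu>'' and c = "\<lambda>_. 1"])
    have ne: "base_index B \<noteq> (base_index B)(i1 := 1)"
    proof
      assume eq: "base_index B = (base_index B)(i1 := 1)"
      have "base_index B i1 = ((base_index B)(i1 := 1)) i1" by (simp only: eq[symmetric])
      then show False using d(1) by (simp add: base_index_apply)
    qed
    have nf: "\<nu> l \<noteq> base_index B" "\<nu> l \<noteq> (base_index B)(i1 := 1)" if "l \<in> {2..<b}" for l
    proof -
      have "\<nu> l \<in> far" using \<nu>(2) that by blast
      then have nl: "\<nu> l \<notin> near ` tan_index n B" unfolding far_def by blast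
      show "\<nu> l \<noteq> base_index B" by (rule notI) (use nl nearT(1) in simp)
      show "\<nu> l \<noteq> (base_index B)(i1 := 1)" by (rule notI) (use nl nearT(2) in simp)
    qed
    show "inj_on \<nu>'' {..<b}"
    proof (rule inj_onI)
      fix x y assume xy: "x \<in> {..<b}" "y \<in> {..<b}" "\<nu>'' x = \<nu>'' y"
      show "x = y"
        using split[OF xy(1)] split[OF xy(2)] xy(3) ne nf[of x] nf[of y] inj_onD[OF \<nu>(1), of x y]
        by (auto simp: \<nu>''_def split: if_splits)
    qed
    show "join_tuple n B t l m = (if m = \<nu>'' l then 1 else 0)" if "l \<in> {..<b}" for l m
    proof -
      have "sv n B (block t 0) m = (if m = base_index B then 1 else 0)"
        by (rule sv_unit'[OF B base_index_in]) (simp add: t0 base_index_apply)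
      moreover have "tv n B (block t 0) (block t 1) m = (if m = (base_index B)(i1 := 1) then 1 else 0)"
      proof -
        have "tv n B (block t 0) (block t 1) m = sv n B ((block t 0)(i1 := block t 1 i1)) m"
          by (rule tv_single_direction[OF d(1)]) (rule t1(2))
        also have "\<dots> = (if m = (base_index B)(i1 := 1) then 1 else 0)"
          by (rule sv_unit'[OF B mT]) (simp add: t0 t1[unfolded One_nat_def] base_index_apply)
        finally show ?thesis .
      qed
      ultimately show ?thesis using split[OF that] t2[of l m] by (auto simp: join_tuple_def \<nu>''_def)
    qed
  qed auto
  then show "generically (params n B b) (\<lambda>t :: nat \<times> nat \<times> nat \<Rightarrow> 'k. indep_fam {..<b} (join_tuple n B t))"
    using b by (intro generically_indep[where ?u0.0 = t]) (auto intro: polyfun_join_tuple)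
qed

text \<open>Considered for indices from 1 on, as the point of contact already lies in its own
  tangent space.\<close>

definition hessian_tuple :: "(nat \<times> nat \<times> nat \<Rightarrow> 'k) \<Rightarrow> nat \<Rightarrow> (nat \<Rightarrow> nat) \<Rightarrow> 'k" where
  "hessian_tuple t l = (if l = 1 then sec n B (block t 0) (block t 1) (block t 1) else sv n B (block t l))"

text \<open>The direction needs components in two factors, \<open>i1\<close> and \<open>i\<close>,
  for its second derivative to be nonzero. The two orders contribute equally, which gives the
  coefficient 2, nonzero in characteristic zero.\<close>

lemma generically_hessian:
  "generically (params n B b) (\<lambda>t :: nat \<times> nat \<times> nat \<Rightarrow> 'k.
      indep_mod_tangent n B (block t 0) {1..<b} (hessian_tuple t))"
proof -
  obtain i1 i p i' p' where d: "i1 \<in> B" "i \<in> B" "i' \<in> B" "i \<noteq> i1" "i' \<noteq> i1" "1 \<le> p" "p \<le> n i" "1 \<le> p'" "p' \<le> n i'" "(i, p) \<noteq> (i', p')"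
    using three_directions by blast
  define m1 where "m1 = (base_index B)(i1 := 1, i := p)"
  have m1T: "m1 \<in> tensor_index n B" unfolding m1_def
    using d pos[OF d(1)] by (intro tensor_index_upd base_index_in) auto
  have m1f: "m1 \<in> far" by (rule farI[of i1 i]) (use d m1T in \<open>auto simp: m1_def\<close>)
  have "card {2..<b} + card {m1} \<le> b + 3" by simp
  then obtain \<nu> where \<nu>: "inj_on \<nu> {2..<b}" "\<forall>l\<in>{2..<b}. \<nu> l \<in> far - {m1}"
    using far_inj[of "{2..<b}" "{m1}"] by auto
  define t :: "nat \<times> nat \<times> nat \<Rightarrow> 'k" where "t = (\<lambda>(j, a, l). if j = 0 then unit_vec 0 l
    else if j = 1 then (if a = i1 then unit_vec 1 l else if a = i then unit_vec p l else 0) else unit_vec (\<nu> j a) l)"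
  have t0: "block t 0 a = unit_vec 0" for a by (simp add: block_def t_def)
  have t1: "block t 1 i1 = unit_vec 1" "block t 1 i = unit_vec p" "a \<noteq> i1 \<Longrightarrow> a \<noteq> i \<Longrightarrow> block t 1 a = (\<lambda>_. 0)" for a
    using d(4) by (simp_all add: block_def t_def fun_eq_iff)
  have t2: "sv n B (block t l) m = (if m = \<nu> l then 1 else 0)" if l: "l \<in> {2..<b}" for l m
    by (rule sv_unit'[OF B far_index]) (use \<nu>(2) l in \<open>auto simp: block_def t_def\<close>)
  have hess: "sec n B (block t 0) (block t 1) (block t 1) m = (if m = m1 then 2 else 0)" for m
  proof -
    let ?u = "block t 0" and ?w = "block t 1"
    have e: "sv n B (?u(i1 := ?w i1, i := ?w i)) m = (if m = m1 then 1 else 0)"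
      by (rule sv_unit'[OF B m1T]) (use d in \<open>auto simp: t0 t1[unfolded One_nat_def] m1_def base_index_apply\<close>)
    have e': "?u(i := ?w i, i1 := ?w i1) = ?u(i1 := ?w i1, i := ?w i)" using d(4) by (rule fun_upd_twist)
    have z: "sv n B (?u(a := ?w a, c := ?w c)) m = (if a = i1 \<and> c = i \<or> a = i \<and> c = i1 then (if m = m1 then 1 else 0) else 0)"
      if ac: "a \<in> B" "c \<in> B - {a}" for a c
    proof (cases "a = i1 \<and> c = i \<or> a = i \<and> c = i1")
      case True
      then show ?thesis using e e' by auto
    next
      case False
      then consider "a \<noteq> i1" "a \<noteq> i" | "c \<noteq> i1" "c \<noteq> i" using ac by blast
      then have "sv n B (?u(a := ?w a, c := ?w c)) m = 0"
      proof cases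
        case 1
        then show ?thesis using ac t1(3) by (intro sv_zero_factor[OF B ac(1)]) auto
      next
        case 2
        then show ?thesis using ac t1(3)[of c] by (intro sv_zero_factor[OF B, of c]) auto
      qed
      then show ?thesis using False by simp
    qed
    have "sec n B ?u ?w ?w m = (\<Sum>a\<in>B. \<Sum>c\<in>B - {a}. if a = i1 \<and> c = i \<or> a = i \<and> c = i1 then (if m = m1 then 1 else 0) else 0)"
      unfolding sec_def by (intro sum.cong refl z)
    also have "\<dots> = (\<Sum>a\<in>B. (if a = i1 then (if m = m1 then 1 else 0) else 0) + (if a = i then (if m = m1 then 1 else 0) else 0))"
    proof (intro sum.cong refl)
      fix a assume "a \<in> B"
      have "(\<Sum>c\<in>B - {a}. if a = i1 \<and> c = i \<or> a = i \<and> c = i1 then (if m = m1 then 1 else 0) else 0) =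
          (\<Sum>c\<in>B - {a}. (if c = i then if a = i1 then (if m = m1 then 1 else 0) else 0 else 0)
            + (if c = i1 then if a = i then (if m = m1 then 1 else (0::'k)) else 0 else 0))"
        using d(4) by (intro sum.cong) auto
      also have "\<dots> = (if a = i1 then (if m = m1 then 1 else 0) else 0) + (if a = i then (if m = m1 then 1 else 0) else 0)"
        unfolding sum.distrib using d B by (simp add: sum.delta)
      finally show "(\<Sum>c\<in>B - {a}. if a = i1 \<and> c = i \<or> a = i \<and> c = i1 then (if m = m1 then 1 else 0) else 0) =
          (if a = i1 then (if m = m1 then 1 else 0) else 0) + (if a = i then (if m = m1 then 1 else (0::'k)) else 0)" .
    qed
    also have "\<dots> = (if m = m1 then 2 else 0)" unfolding sum.distrib using d B by simp
    finally show ?thesis .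
  qed
  define \<nu>' where "\<nu>' = (\<lambda>l. if l = 1 then m1 else \<nu> l)"
  have split: "z = 1 \<or> z \<in> {2..<b}" if "z \<in> {1..<b}" for z using that by auto
  have "indep_mod_tangent n B (block t 0) {1..<b} (hessian_tuple t)"
  proof (rule indep_mod_tangent_coord[where \<nu> = \<nu>' and c = "\<lambda>l. if l = 1 then 2 else 1"])
    show "\<nu>' l \<in> far" if "l \<in> {1..<b}" for l using split[OF that] \<nu>(2) m1f by (auto simp: \<nu>'_def)
    show "inj_on \<nu>' {1..<b}"
    proof (rule inj_onI)
      fix x y assume xy: "x \<in> {1..<b}" "y \<in> {1..<b}" "\<nu>' x = \<nu>' y"
      show "x = y"
        using split[OF xy(1)] split[OF xy(2)] xy(3) \<nu>(2) inj_onD[OF \<nu>(1), of x y]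
        by (auto simp: \<nu>'_def split: if_splits)
    qed
    show "hessian_tuple t l m = (if m = \<nu>' l then if l = 1 then 2 else 1 else 0)" if "l \<in> {1..<b}" for l m
      using split[OF that] hess[of m] t2[of l m] by (auto simp: hessian_tuple_def \<nu>'_def)
  qed (auto simp: t0)
  then show ?thesis
  proof (intro generically_indep_mod_tangent[where U = "\<lambda>t. block t 0" and y = hessian_tuple and ?t0.0 = t])
    show "(\<lambda>t. hessian_tuple t l m) \<in> polyfun (params n B b)" if "l \<in> {1..<b}" for l m
      using that b unfolding hessian_tuple_def
      by (cases "l = 1") (auto intro!: polyfun_sec polyfun_sv polyfun_block)
  qed (use b in \<open>auto intro: polyfun_block\<close>)
qed

end

section \<open>Flattenings\<close>

lemma restrict_tensor_index: "m \<in> tensor_index n B \<Longrightarrow> E \<subseteq> B \<Longrightarrow> restrict m E \<in> tensor_index n E"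
  by (auto simp: tensor_index_def)

lemma sv_split:
  assumes "finite E" "finite F" "E \<inter> F = {}" "m \<in> tensor_index n (E \<union> F)"
  shows "sv n (E \<union> F) u m = sv n E u (restrict m E) * sv n F u (restrict m F)"
proof -
  have "(\<Prod>i\<in>E \<union> F. u i (m i)) = (\<Prod>i\<in>E. u i (restrict m E i)) * (\<Prod>i\<in>F. u i (restrict m F i))"
    using assms(1-3) by (simp add: prod.union_disjoint)
  then show ?thesis using assms(4) restrict_tensor_index[OF assms(4)] by (simp add: sv_def)
qed

lemma tv_split:
  assumes "finite E" "finite F" "E \<inter> F = {}" "m \<in> tensor_index n (E \<union> F)"
  shows "tv n (E \<union> F) u w m = tv n E u w (restrict m E) * sv n F u (restrict m F)
    + sv n E u (restrict m E) * tv n F u w (restrict m F)"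
proof -
  have "sv n (E \<union> F) (u(i := w i)) m = sv n E (u(i := w i)) (restrict m E) * sv n F u (restrict m F)" if "i \<in> E" for i
  proof -
    have "sv n F (u(i := w i)) = sv n F u" by (rule sv_cong) (use that assms(3) in auto)
    then show ?thesis by (simp add: sv_split[OF assms])
  qed
  moreover have "sv n (E \<union> F) (u(i := w i)) m = sv n E u (restrict m E) * sv n F (u(i := w i)) (restrict m F)" if "i \<in> F" for i
  proof -
    have "sv n E (u(i := w i)) = sv n E u" by (rule sv_cong) (use that assms(3) in auto)
    then show ?thesis by (simp add: sv_split[OF assms])
  qed
  ultimately show ?thesis
    unfolding tv_def using assms(1-3) by (simp add: sum.union_disjoint sum_distrib_left sum_distrib_right)
qed

lemma merge_tensor_index:
  assumes "E \<inter> F = {}" "e \<in> tensor_index n E" "f \<in> tensor_index n F"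
  shows "\<exists>m\<in>tensor_index n (E \<union> F). restrict m E = e \<and> restrict m F = f"
proof
  let ?m = "\<lambda>i. if i \<in> E then e i else f i"
  show "?m \<in> tensor_index n (E \<union> F)"
    using assms by (auto simp: tensor_index_def PiE_def Pi_def extensional_def)
  show "restrict ?m E = e \<and> restrict ?m F = f"
    using assms by (auto simp: tensor_index_def PiE_def extensional_def restrict_def fun_eq_iff)
qed

text \<open>Contracting with functionals dual to the \<open>y k\<close> puts \<open>dx k\<close>
  into the span of the \<open>x l\<close>; substituting back, independence of the \<open>x l\<close>
  determines \<open>dy\<close>. Up to the scalar \<open>c\<close> only base changes of the tuples
  remain, by \<open>M\<close> on one side and its negative transpose on the other.\<close>

lemma flattening_relation:
  fixes x dx :: "'a \<Rightarrow> 'e \<Rightarrow> 'k::field" and y dy :: "'a \<Rightarrow> 'f \<Rightarrow> 'k"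
  assumes K: "finite K" and fin: "finite IE" "finite IF" and ind: "indep_fam K x" "indep_fam K y"
    and out: "\<And>k e. e \<notin> IE \<Longrightarrow> x k e = 0" "\<And>k e. e \<notin> IE \<Longrightarrow> dx k e = 0"
      "\<And>k f. f \<notin> IF \<Longrightarrow> y k f = 0" "\<And>k f. f \<notin> IF \<Longrightarrow> dy k f = 0"
    and eq: "\<And>e f. e \<in> IE \<Longrightarrow> f \<in> IF \<Longrightarrow> (\<Sum>k\<in>K. (dx k e + c * x k e) * y k f + x k e * dy k f) = 0"
  shows "\<exists>M. (\<forall>k\<in>K. \<forall>e. dx k e = (\<Sum>l\<in>K. M k l * x l e)) \<and>
    (\<forall>l\<in>K. \<forall>f. dy l f = (\<Sum>k\<in>K. (- M k l - (if k = l then c else 0)) * y k f))"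
proof -
  obtain \<mu> where \<mu>: "\<forall>a\<in>K. \<forall>b\<in>K. (\<Sum>f\<in>IF. \<mu> a f * y b f) = (if a = b then 1 else 0)"
    using indep_fam_dual[OF K ind(2) fin(2)] out(3) by blast
  define M where "M = (\<lambda>k l. - (\<Sum>f\<in>IF. \<mu> k f * dy l f) - (if k = l then c else 0))"
  have dx: "dx k e = (\<Sum>l\<in>K. M k l * x l e)" if k: "k \<in> K" for k e
  proof (cases "e \<in> IE")
    case True
    have "0 = (\<Sum>f\<in>IF. \<mu> k f * (\<Sum>l\<in>K. (dx l e + c * x l e) * y l f + x l e * dy l f))"
      using eq[OF True] by simp
    also have "\<dots> = (\<Sum>l\<in>K. \<Sum>f\<in>IF. \<mu> k f * ((dx l e + c * x l e) * y l f + x l e * dy l f))"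
      unfolding sum_distrib_left by (rule sum.swap)
    also have "\<dots> = (\<Sum>l\<in>K. (dx l e + c * x l e) * (\<Sum>f\<in>IF. \<mu> k f * y l f) + x l e * (\<Sum>f\<in>IF. \<mu> k f * dy l f))"
      by (simp add: sum_distrib_left sum.distrib algebra_simps)
    also have "\<dots> = (\<Sum>l\<in>K. (if l = k then dx l e else 0) - M k l * x l e)"
      using \<mu> k by (intro sum.cong) (auto simp: M_def algebra_simps)
    also have "\<dots> = dx k e - (\<Sum>l\<in>K. M k l * x l e)" using K k by (simp add: sum_subtractf)
    finally show ?thesis by simp
  qed (simp add: out)
  moreover have "dy l f = (\<Sum>k\<in>K. (- M k l - (if k = l then c else 0)) * y k f)" if l: "l \<in> K" for l f
  proof (cases "f \<in> IF")
    case True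
    define a where "a = (\<lambda>l. dy l f + (\<Sum>k\<in>K. (M k l + (if k = l then c else 0)) * y k f))"
    have "(\<Sum>l\<in>K. a l * x l e) = 0" for e
    proof (cases "e \<in> IE")
      case e: True
      have "(\<Sum>l\<in>K. (\<Sum>k\<in>K. (M k l + (if k = l then c else 0)) * y k f) * x l e) =
          (\<Sum>k\<in>K. \<Sum>l\<in>K. (M k l + (if k = l then c else 0)) * x l e * y k f)"
        unfolding sum_distrib_right by (subst sum.swap) (simp add: ac_simps)
      also have "\<dots> = (\<Sum>k\<in>K. (dx k e + c * x k e) * y k f)"
      proof (rule sum.cong)
        fix k assume k: "k \<in> K"
        have "(\<Sum>l\<in>K. (M k l + (if k = l then c else 0)) * x l e) = (\<Sum>l\<in>K. M k l * x l e + (if l = k then c * x l e else 0))"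
          by (rule sum.cong) (auto simp: algebra_simps)
        also have "\<dots> = dx k e + c * x k e" using K k by (simp add: sum.distrib dx)
        finally have "(\<Sum>l\<in>K. (M k l + (if k = l then c else 0)) * x l e) = dx k e + c * x k e" .
        then show "(\<Sum>l\<in>K. (M k l + (if k = l then c else 0)) * x l e * y k f) = (dx k e + c * x k e) * y k f"
          by (simp add: sum_distrib_right[symmetric])
      qed simp
      finally have "(\<Sum>l\<in>K. a l * x l e) = (\<Sum>l\<in>K. dy l f * x l e) + (\<Sum>k\<in>K. (dx k e + c * x k e) * y k f)"
        unfolding a_def distrib_right[of "dy _ f"] sum.distrib by (simp only:)
      also have "(\<Sum>l\<in>K. dy l f * x l e) = (\<Sum>l\<in>K. x l e * dy l f)" by (simp only: mult.commute)
      finally show ?thesis using eq[OF e True] unfolding sum.distrib by (simp only: add.commute)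
    qed (simp add: out)
    then have "a l = 0" using indep_famD[OF ind(1) _ l] by blast
    then have "dy l f = - (\<Sum>k\<in>K. (M k l + (if k = l then c else 0)) * y k f)"
      by (simp only: a_def eq_neg_iff_add_eq_0)
    moreover have "(\<Sum>k\<in>K. (- M k l - (if k = l then c else 0)) * y k f) = - (\<Sum>k\<in>K. (M k l + (if k = l then c else 0)) * y k f)"
      unfolding sum_negf[symmetric] by (rule sum.cong) (simp_all add: algebra_simps)
    ultimately show ?thesis by (simp only:)
  qed (simp add: out)
  ultimately show ?thesis by blast
qed

lemma sec_linear:
  assumes "finite B" "\<And>i k. i \<in> B \<Longrightarrow> w i k = a * x i k + c * y i k"
  shows "sec n B u v w m = a * sec n B u v x m + c * sec n B u v y m"
proof (cases "m \<in> tensor_index n B")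
  case True
  have "sv n B (u(i := v i, j := w j)) m = a * sv n B (u(i := v i, j := x j)) m + c * sv n B (u(i := v i, j := y j)) m"
    if "j \<in> B - {i}" for i j
  proof -
    have j: "j \<in> B" using that by simp
    show ?thesis using assms(2)[OF j] by (simp only: sv_upd[OF assms(1) j True]) (simp add: algebra_simps)
  qed
  then show ?thesis by (simp add: sec_def sum.distrib sum_distrib_left)
qed (simp add: sec_outside)

text \<open>Moving factor \<open>j\<close> along itself only scales, so such a second derivative is
  again a tangent vector; in slot \<open>i\<close> the scales of the other factors add up.\<close>

lemma sec_scaled_base:
  assumes "finite B"
  shows "sec n B u v (\<lambda>j k. r j * u j k) m = tv n B u (\<lambda>i k. (\<Sum>j\<in>B - {i}. r j) * v i k) m"
proof (cases "m \<in> tensor_index n B")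
  case True
  have "(\<Sum>j\<in>B - {i}. sv n B (u(i := v i, j := (\<lambda>k. r j * u j k))) m) = sv n B (u(i := (\<lambda>k. (\<Sum>j\<in>B - {i}. r j) * v i k))) m"
    if i: "i \<in> B" for i
  proof -
    have "sv n B (u(i := v i, j := (\<lambda>k. r j * u j k))) m = r j * sv n B (u(i := v i)) m" if "j \<in> B - {i}" for j
      using sv_scale[OF assms, of j n "u(i := v i)" "r j" m] that by simp
    then show ?thesis by (simp add: sum_distrib_right sv_upd[OF assms i True] mult.assoc)
  qed
  then show ?thesis by (simp add: sec_def tv_def)
qed (simp add: sec_outside tv_outside)

section \<open>Variations of a generic tuple inside its own span\<close>

definition join_deriv :: "(nat \<Rightarrow> nat) \<Rightarrow> nat set \<Rightarrow> (nat \<times> nat \<times> nat \<Rightarrow> 'k) \<Rightarrow> (nat \<times> nat \<times> nat \<Rightarrow> 'k) \<Rightarrow> nat \<Rightarrow> (nat \<Rightarrow> nat) \<Rightarrow> 'k::comm_ring_1" where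
  "join_deriv n B t w k = (\<lambda>m. if k = 1 then tv n B (block t 0) (block w 1) m + sec n B (block t 0) (block t 1) (block w 0) m
     else tv n B (block t k) (block w k) m)"

lemma has_dd_join_tuple: "finite B \<Longrightarrow> has_dd (\<lambda>t. join_tuple n B t k m) p w (join_deriv n B p w k m)"
  unfolding join_tuple_def join_deriv_def
  by (cases "k = 1") (auto intro!: has_dd_sv has_dd_tv simp: block_def intro: has_dd_coord)

context big_factors
begin

text \<open>Lets \<open>base_index B\<close> serve as reference index for the tangent bases at all
  tensors of the tuple.\<close>

definition base_nonzero :: "(nat \<times> nat \<times> nat \<Rightarrow> 'k) \<Rightarrow> bool" where
  "base_nonzero t \<longleftrightarrow> (\<forall>k<b. \<forall>i\<in>B. t (k, i, 0) \<noteq> 0)"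

definition secant_generic :: "(nat \<times> nat \<times> nat \<Rightarrow> 'k) \<Rightarrow> bool" where
  "secant_generic t \<longleftrightarrow> base_nonzero t \<and>
     (\<forall>k<b. indep_mod_tangent n B (block t k) ({..<b} - {k}) (\<lambda>l. sv n B (block t l)))"

definition join_generic :: "(nat \<times> nat \<times> nat \<Rightarrow> 'k) \<Rightarrow> bool" where
  "join_generic t \<longleftrightarrow> base_nonzero t \<and> indep_fam {..<b} (join_tuple n B t) \<and>
     (\<forall>k\<in>{2..<b}. indep_mod_tangent n B (block t k) ({..<b} - {k}) (join_tuple n B t)) \<and>
     indep_mod_tangent n B (block t 0) {1..<b} (hessian_tuple t)"

lemma generically_base_nonzero: "generically (params n B b) base_nonzero"
proof (rule generically_mono[OF generically_nonzero])
  show "(\<lambda>t :: nat \<times> nat \<times> nat \<Rightarrow> 'k. \<Prod>k<b. \<Prod>i\<in>B. t (k, i, 0)) \<in> polyfun (params n B b)"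
    by (intro polyfun_prod polyfun_coord) (auto simp: params_def)
  show "(\<Prod>k<b. \<Prod>i\<in>B. (\<lambda>_. 1) (k, i, 0)) \<noteq> (0::'k)" by simp
  show "base_nonzero t" if "(\<Prod>k<b. \<Prod>i\<in>B. t (k, i, 0)) \<noteq> 0" for t
    using that B unfolding base_nonzero_def by auto
qed simp

lemma generically_secant_generic: "generically (params n B b) secant_generic"
proof -
  have "generically (params n B b) (\<lambda>t :: nat \<times> nat \<times> nat \<Rightarrow> 'k. base_nonzero t \<and>
     (\<forall>k\<in>{..<b}. indep_mod_tangent n B (block t k) ({..<b} - {k}) (\<lambda>l. sv n B (block t l))))"
    by (intro generically_conj generically_ball generically_base_nonzero generically_secant) auto
  then show ?thesis by (rule generically_mono) (auto simp: secant_generic_def)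
qed

lemma generically_join_generic: "generically (params n B b) join_generic"
proof -
  have "generically (params n B b) (\<lambda>t :: nat \<times> nat \<times> nat \<Rightarrow> 'k. base_nonzero t \<and> indep_fam {..<b} (join_tuple n B t) \<and>
     (\<forall>k\<in>{2..<b}. indep_mod_tangent n B (block t k) ({..<b} - {k}) (join_tuple n B t)) \<and>
     indep_mod_tangent n B (block t 0) {1..<b} (hessian_tuple t))"
    by (intro generically_conj generically_ball generically_base_nonzero generically_join generically_join_tuple generically_hessian) auto
  then show ?thesis by (rule generically_mono) (auto simp: join_generic_def)
qed

lemma secant_tangent:
  assumes t: "secant_generic t" and k: "k < b"
    and eq: "\<And>m. tv n B (block t k) (block w k) m = (\<Sum>l<b. M l * sv n B (block t l) m)"
  shows "l < b \<Longrightarrow> l \<noteq> k \<Longrightarrow> M l = 0" and "M k = (\<Sum>i\<in>B. w (k, i, 0) / t (k, i, 0))"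
    and "i \<in> B \<Longrightarrow> q \<le> n i \<Longrightarrow> w (k, i, q) = w (k, i, 0) / t (k, i, 0) * t (k, i, q)"
proof -
  have ind: "indep_mod_tangent n B (block t k) ({..<b} - {k}) (\<lambda>l. sv n B (block t l))"
    using t k by (auto simp: secant_generic_def)
  have u: "block t k i 0 \<noteq> 0" if "i \<in> B" for i
    using t k that by (auto simp: secant_generic_def base_nonzero_def block_def)
  have "tv n B (block t k) (block w k) m = M k * sv n B (block t k) m + (\<Sum>l\<in>{..<b} - {k}. M l * sv n B (block t l) m)" for m
    unfolding eq using k by (simp add: sum.remove)
  note rel = tangent_relation[OF B _ ind u this]
  show "l < b \<Longrightarrow> l \<noteq> k \<Longrightarrow> M l = 0" using rel(1)[of l] by simp
  show "M k = (\<Sum>i\<in>B. w (k, i, 0) / t (k, i, 0))" using rel(2) by (simp add: block_def)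
  show "i \<in> B \<Longrightarrow> q \<le> n i \<Longrightarrow> w (k, i, q) = w (k, i, 0) / t (k, i, 0) * t (k, i, q)"
    using rel(3)[of i q] by (simp add: block_def)
qed

lemma secant_indep: "secant_generic t \<Longrightarrow> indep_fam {..<b} (\<lambda>l. sv n B (block t l))"
proof (rule indep_famI)
  \<comment> \<open>The zero variation of block \<open>a\<close> will turn this linear relation into
    a relation of tangent type.\<close>
  fix c a assume t: "secant_generic t" and c: "\<And>m. (\<Sum>l<b. c l * sv n B (block t l) m) = 0" and a: "a \<in> {..<b}"
  have "tv n B (block t a) (block (\<lambda>_. 0) a) m = (\<Sum>l<b. c l * sv n B (block t l) m)" for m
    unfolding c using tv_scale[OF B, of n "block t a" 0 "\<lambda>_ _. 0" m] by (simp add: block_def)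
  from secant_tangent(2)[OF t _ this] a show "c a = 0" by simp
qed

lemma join_tangent:
  assumes t: "join_generic t" and k: "k < b" "2 \<le> k"
    and eq: "\<And>m. join_deriv n B t w k m = (\<Sum>l<b. M l * join_tuple n B t l m)"
  shows "l < b \<Longrightarrow> l \<noteq> k \<Longrightarrow> M l = 0" and "M k = (\<Sum>i\<in>B. w (k, i, 0) / t (k, i, 0))"
    and "i \<in> B \<Longrightarrow> q \<le> n i \<Longrightarrow> w (k, i, q) = w (k, i, 0) / t (k, i, 0) * t (k, i, q)"
proof -
  have ind: "indep_mod_tangent n B (block t k) ({..<b} - {k}) (join_tuple n B t)"
    using t k by (auto simp: join_generic_def)
  have u: "block t k i 0 \<noteq> 0" if "i \<in> B" for i
    using t k that by (auto simp: join_generic_def base_nonzero_def block_def)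
  have "tv n B (block t k) (block w k) m = M k * sv n B (block t k) m + (\<Sum>l\<in>{..<b} - {k}. M l * join_tuple n B t l m)" for m
  proof -
    have "tv n B (block t k) (block w k) m = join_deriv n B t w k m" using k by (simp add: join_deriv_def)
    also have "\<dots> = M k * join_tuple n B t k m + (\<Sum>l\<in>{..<b} - {k}. M l * join_tuple n B t l m)"
      unfolding eq using k by (simp add: sum.remove)
    also have "join_tuple n B t k = sv n B (block t k)" using k by (simp add: join_tuple_def)
    finally show ?thesis .
  qed
  note rel = tangent_relation[OF B _ ind u this]
  show "l < b \<Longrightarrow> l \<noteq> k \<Longrightarrow> M l = 0" using rel(1)[of l] by simp
  show "M k = (\<Sum>i\<in>B. w (k, i, 0) / t (k, i, 0))" using rel(2) by (simp add: block_def)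
  show "i \<in> B \<Longrightarrow> q \<le> n i \<Longrightarrow> w (k, i, q) = w (k, i, 0) / t (k, i, 0) * t (k, i, q)"
    using rel(3)[of i q] by (simp add: block_def)
qed

text \<open>
  The first two blocks describe a point of the tangential variety. If its variation stays in the span of the
  tuple, the base point moves in the direction of the tangent vector itself, up to scalars, and then the
  second derivative in that direction, which is independent of everything else, has to vanish.
\<close>

lemma join_tangent_base:
  assumes t: "join_generic t" and norm: "\<And>i. i \<in> B \<Longrightarrow> w (0, i, 0) = 0" "\<And>i. i \<in> B \<Longrightarrow> w (1, i, 0) = 0"
    and eq0: "\<And>m. join_deriv n B t w 0 m = (\<Sum>l<b. M0 l * join_tuple n B t l m)"
    and eq1: "\<And>m. join_deriv n B t w 1 m = (\<Sum>l<b. M1 l * join_tuple n B t l m)"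
  shows "l < b \<Longrightarrow> M0 l = 0" and "i \<in> B \<Longrightarrow> q \<le> n i \<Longrightarrow> w (0, i, q) = 0"
    and "l \<in> {2..<b} \<Longrightarrow> M1 l = 0" and "M1 0 = - M1 1 * (\<Sum>i\<in>B. t (1, i, 0) / t (0, i, 0))"
    and "i \<in> B \<Longrightarrow> q \<le> n i \<Longrightarrow> w (1, i, q) = M1 1 * (t (1, i, q) - t (1, i, 0) / t (0, i, 0) * t (0, i, q))"
proof -
  let ?u = "block t 0" and ?v = "block t 1" and ?w0 = "block w 0" and ?w1 = "block w 1"
  have ind: "indep_mod_tangent n B ?u {1..<b} (hessian_tuple t)" using t by (simp add: join_generic_def)
  have u: "?u i 0 \<noteq> 0" if "i \<in> B" for i
    using t b that by (auto simp: join_generic_def base_nonzero_def block_def)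
  have split: "(\<Sum>l<b. M l * join_tuple n B t l m) = M 0 * sv n B ?u m + M 1 * tv n B ?u ?v m + (\<Sum>l\<in>{2..<b}. M l * sv n B (block t l) m)"
    for M :: "nat \<Rightarrow> 'k" and m
  proof -
    have "{..<b} = insert 0 (insert 1 {2..<b})" using b by auto
    moreover have "(\<Sum>l\<in>{2..<b}. M l * join_tuple n B t l m) = (\<Sum>l\<in>{2..<b}. M l * sv n B (block t l) m)"
      by (rule sum.cong) (auto simp: join_tuple_def)
    ultimately show ?thesis by (simp add: join_tuple_def)
  qed
  have hsplit: "(\<Sum>l\<in>{1..<b}. c l * hessian_tuple t l m) = c 1 * sec n B ?u ?v ?v m + (\<Sum>l\<in>{2..<b}. c l * sv n B (block t l) m)"
    for c :: "nat \<Rightarrow> 'k" and m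
  proof -
    have "{1..<b} = insert 1 {2..<b}" using b by auto
    moreover have "(\<Sum>l\<in>{2..<b}. c l * hessian_tuple t l m) = (\<Sum>l\<in>{2..<b}. c l * sv n B (block t l) m)"
      by (rule sum.cong) (auto simp: hessian_tuple_def)
    ultimately show ?thesis by (simp add: hessian_tuple_def)
  qed
  \<comment> \<open>Without its component along the tangent vector, the variation of the base point
    stays in the span of the base point and the tensors from 2 on, so it is a rescaling of factors,
    recorded in \<open>r\<close>.\<close>
  define a where "a = (\<lambda>i q. ?w0 i q - M0 1 * ?v i q)"
  have "tv n B ?u a m = M0 0 * sv n B ?u m + (\<Sum>l\<in>{1..<b}. (if l = 1 then 0 else M0 l) * hessian_tuple t l m)" for m
  proof -
    have "tv n B ?u a m = tv n B ?u ?w0 m - M0 1 * tv n B ?u ?v m"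
      using tv_linear[OF B, of a 1 ?w0 "- M0 1" ?v n ?u m] by (simp add: a_def)
    moreover have "(\<Sum>l\<in>{2..<b}. (if l = 1 then 0 else M0 l) * sv n B (block t l) m) = (\<Sum>l\<in>{2..<b}. M0 l * sv n B (block t l) m)"
      by (rule sum.cong) auto
    ultimately show ?thesis using eq0[of m] unfolding split hsplit by (simp add: join_deriv_def)
  qed
  note rel0 = tangent_relation[OF B _ ind u this]
  define r where "r = (\<lambda>i. a i 0 / ?u i 0)"
  have r: "r i = - M0 1 * ?v i 0 / ?u i 0" if "i \<in> B" for i
    using norm(1)[OF that] by (simp add: r_def a_def block_def)
  have w0: "?w0 i q = M0 1 * ?v i q + r i * ?u i q" if "i \<in> B" "q \<le> n i" for i q
    using rel0(3)[of i q] that by (simp add: a_def r_def algebra_simps)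
  \<comment> \<open>Inserting the formula for \<open>?w0\<close> into the second derivative yields
    \<open>M0 1\<close> times the Hessian plus a tangent vector, which \<open>a'\<close> absorbs.
    The resulting relation has coefficient \<open>- M0 1\<close> at the Hessian, so this is
    0.\<close>
  define a' where "a' = (\<lambda>i q. ?w1 i q + (\<Sum>j\<in>B - {i}. r j) * ?v i q - M1 1 * ?v i q)"
  have "tv n B ?u a' m = M1 0 * sv n B ?u m + (\<Sum>l\<in>{1..<b}. (if l = 1 then - M0 1 else M1 l) * hessian_tuple t l m)" for m
  proof -
    define \<rho> where "\<rho> = (\<lambda>i q. (\<Sum>j\<in>B - {i}. r j) * ?v i q)"
    have "sec n B ?u ?v ?w0 m = sec n B ?u ?v (\<lambda>i q. M0 1 * ?v i q + r i * ?u i q) m"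
    proof -
      have "sv n B (?u(i := ?v i, j := ?w0 j)) = sv n B (?u(i := ?v i, j := (\<lambda>q. M0 1 * ?v j q + r j * ?u j q)))"
        if "j \<in> B - {i}" for i j
        using that w0 by (intro sv_cong) auto
      then show ?thesis by (simp add: sec_def)
    qed
    also have "\<dots> = M0 1 * sec n B ?u ?v ?v m + 1 * sec n B ?u ?v (\<lambda>i q. r i * ?u i q) m"
      by (rule sec_linear[OF B]) simp
    finally have sec: "sec n B ?u ?v ?w0 m = M0 1 * sec n B ?u ?v ?v m + tv n B ?u \<rho> m"
      by (simp add: sec_scaled_base[OF B] \<rho>_def)
    define x where "x = (\<lambda>i q. ?w1 i q + \<rho> i q)"
    have "tv n B ?u a' m = tv n B ?u x m - M1 1 * tv n B ?u ?v m"
      using tv_linear[OF B, of a' 1 x "- M1 1" ?v n ?u m] by (simp add: a'_def x_def \<rho>_def)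
    moreover have "tv n B ?u x m = tv n B ?u ?w1 m + tv n B ?u \<rho> m"
      using tv_linear[OF B, of x 1 ?w1 1 \<rho> n ?u m] by (simp add: x_def)
    moreover have "(\<Sum>l\<in>{2..<b}. (if l = 1 then - M0 1 else M1 l) * sv n B (block t l) m) = (\<Sum>l\<in>{2..<b}. M1 l * sv n B (block t l) m)"
      by (rule sum.cong) auto
    moreover have e: "tv n B ?u ?w1 m + sec n B ?u ?v ?w0 m =
        M1 0 * sv n B ?u m + M1 1 * tv n B ?u ?v m + (\<Sum>l\<in>{2..<b}. M1 l * sv n B (block t l) m)"
      using eq1[of m] unfolding split by (simp add: join_deriv_def)
    moreover have "A = k + (- q + \<sigma>)" if "A = X - p" "X = W + R" "S = q + R" "W + S = k + p + \<sigma>"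
      for A X p W R S q k \<sigma> :: 'k
    proof -
      have "W = k + p + \<sigma> - S" using that(4) by (simp only: eq_diff_eq)
      then show ?thesis using that(1-3) by simp
    qed
    ultimately show ?thesis using sec unfolding hsplit by simp
  qed
  note rel1 = tangent_relation[OF B _ ind u this]
  have M01: "M0 1 = 0" using rel1(1)[of 1] b by simp
  \<comment> \<open>Fixing entry 0 of the base factors ties the rescalings to \<open>M0 1\<close>,
    so they vanish with it.\<close>
  then have r0: "r i = 0" if "i \<in> B" for i using r[OF that] by simp
  have "M0 0 = (\<Sum>i\<in>B. r i)" using rel0(2) by (simp add: r_def)
  then have M00: "M0 0 = 0" using r0 by simp
  show "l < b \<Longrightarrow> M0 l = 0"
    using rel0(1)[of l] M00 M01 by (cases "l = 0"; cases "l = 1") auto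
  show "i \<in> B \<Longrightarrow> q \<le> n i \<Longrightarrow> w (0, i, q) = 0" using w0[of i q] M01 r0 by (simp add: block_def)
  show "l \<in> {2..<b} \<Longrightarrow> M1 l = 0" using rel1(1)[of l] by auto
  have a': "a' i q = ?w1 i q - M1 1 * ?v i q" if "i \<in> B" for i q
  proof -
    have "(\<Sum>j\<in>B - {i}. r j) = 0" using r0 by (intro sum.neutral) auto
    then show ?thesis by (simp add: a'_def)
  qed
  have a'0: "a' i 0 = - M1 1 * t (1, i, 0)" if "i \<in> B" for i
    using a'[OF that] norm(2)[OF that] by (simp add: block_def)
  show "M1 0 = - M1 1 * (\<Sum>i\<in>B. t (1, i, 0) / t (0, i, 0))"
    using rel1(2) a'0 by (simp add: block_def sum_distrib_left sum_negf)
  show "i \<in> B \<Longrightarrow> q \<le> n i \<Longrightarrow> w (1, i, q) = M1 1 * (t (1, i, q) - t (1, i, 0) / t (0, i, 0) * t (0, i, q))"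
    using rel1(3)[of i q] a'[of i q] a'0[of i] by (simp add: block_def algebra_simps)
qed

end

section \<open>Dimensions of the secant variety and the tangential join\<close>

lemma indep_fam_reindex:
  assumes "bij_betw h A A'" "indep_fam A' v" shows "indep_fam A (\<lambda>a. v (h a))"
proof (rule indep_famI)
  fix c a assume c: "\<And>i. (\<Sum>a\<in>A. c a * v (h a) i) = 0" and a: "a \<in> A"
  have inj: "inj_on h A" using assms(1) by (simp add: bij_betw_def)
  have "(\<Sum>x\<in>A'. c (the_inv_into A h x) * v x i) = 0" for i
  proof -
    have "(\<Sum>x\<in>A'. c (the_inv_into A h x) * v x i) = (\<Sum>a\<in>A. c (the_inv_into A h (h a)) * v (h a) i)"
      by (rule sum.reindex_bij_betw[OF assms(1), symmetric])
    also have "\<dots> = (\<Sum>a\<in>A. c a * v (h a) i)" by (rule sum.cong) (simp_all add: the_inv_into_f_f[OF inj])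
    finally show ?thesis using c by simp
  qed
  from indep_famD[OF assms(2) this, of "h a"] show "c a = 0"
    using a bij_betwE[OF assms(1)] by (simp add: the_inv_into_f_f[OF inj])
qed

lemma sv_divide: "finite B \<Longrightarrow> sv n B (\<lambda>i k. v i k / d i) m = sv n B v m / (\<Prod>i\<in>B. d i :: 'k::field)"
  by (simp add: sv_def prod_dividef)

lemma tv_divide:
  assumes "finite B"
  shows "tv n B (\<lambda>i k. u i k / d i) (\<lambda>i k. w i k / d i) m = tv n B u w m / (\<Prod>i\<in>B. d i :: 'k::field)"
proof -
  have "sv n B ((\<lambda>i k. u i k / d i)(j := \<lambda>k. w j k / d j)) m = sv n B (u(j := w j)) m / (\<Prod>i\<in>B. d i)" for j
  proof -
    have "(\<lambda>i k. u i k / d i)(j := \<lambda>k. w j k / d j) = (\<lambda>i k. (u(j := w j)) i k / d i)" by auto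
    then show ?thesis by (simp only: sv_divide[OF assms])
  qed
  then show ?thesis by (simp add: tv_def sum_divide_distrib)
qed

lemma tv_scaled_base:
  assumes "finite B" shows "tv n B u (\<lambda>i k. r i * u i k) m = (\<Sum>i\<in>B. r i) * sv n B u m"
  unfolding tv_def sum_distrib_right by (rule sum.cong) (simp_all add: sv_scale[OF assms])

text \<open>Across E and F a tangent vector splits as x1 \<otimes> y0 + x0 \<otimes> y1: position 0
  on one side meets position 1 on the other.\<close>

definition swap01 :: "nat \<Rightarrow> nat" where
  "swap01 k = (if k = 0 then 1 else if k = 1 then 0 else k)"

lemma swap01_simps [simp]: "swap01 0 = 1" "swap01 1 = 0" "swap01 (Suc 0) = 0" "2 \<le> k \<Longrightarrow> swap01 k = k"
  "swap01 (swap01 k) = k"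
  by (auto simp: swap01_def)

lemma swap01_bij: "b \<ge> 2 \<Longrightarrow> bij_betw swap01 {..<b} {..<b}"
  by (rule bij_betwI[where g = swap01]) (auto simp: swap01_def)

lemma sum_first_two: "b \<ge> 2 \<Longrightarrow> (\<Sum>k<b. f k) = f 0 + f 1 + (\<Sum>k\<in>{2..<b}. f k :: 'k::comm_ring_1)" for b :: nat
proof -
  assume "b \<ge> 2"
  then have "{..<b} = insert 0 (insert 1 {2..<b})" by auto
  then show ?thesis by (simp add: add.assoc)
qed

section \<open>Both halves of the splitting together: lower bounds for the dimensions\<close>

locale split_segre =
  fixes s b :: nat and n :: "nat \<Rightarrow> nat" and E F :: "nat set" and I :: "(nat \<Rightarrow> nat) set"
    and X :: "((nat \<Rightarrow> nat) \<Rightarrow> 'k::field_char_0) set set"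
  assumes n_pos: "\<forall>i\<in>{1..s}. n i > 0" and I_def: "I = multi_index s n" and X_def: "X = segre_variety s n"
    and b2: "b \<ge> 2" and EF: "E \<union> F = {1..s}" "E \<inter> F = {}"
    and big_E: "(\<Prod>i\<in>E. (n i + 1)) > b + 3 + (\<Sum>i\<in>E. n i)"
    and big_F: "(\<Prod>i\<in>F. (n i + 1)) > b + 3 + (\<Sum>i\<in>F. n i)"
begin

lemma finE: "finite E" and finF: "finite F"
  using EF(1) finite_Un[of E F] by auto

sublocale E: big_factors n E b "TYPE('k)"
  using finE n_pos b2 EF(1) big_E by unfold_locales auto

sublocale F: big_factors n F b "TYPE('k)"
  using finF n_pos b2 EF(1) big_F by unfold_locales auto

lemma E_nonempty: "E \<noteq> {}"
  using big_E by auto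

lemma s_pos: "s > 0"
  using E_nonempty EF(1) by (cases s) auto

sublocale segre s n I X
  using s_pos n_pos I_def X_def by unfold_locales auto

text \<open>The factor that records the scale of a summand. As it lies in E, all entries 0 on the
  side of F can be fixed.\<close>

definition i0 :: nat where "i0 = (SOME i. i \<in> E)"

lemma i0: "i0 \<in> E" "i0 \<notin> F" "i0 \<in> T"
proof -
  show "i0 \<in> E" unfolding i0_def using E_nonempty by (auto intro: someI)
  then show "i0 \<notin> F" "i0 \<in> T" using EF by auto
qed

text \<open>Rescaling factors against each other normalises all entries 0 except one per summand,
  kept in factor \<open>i0\<close>. Block 0 loses even this to the projective scale
  (\<open>c = 1\<close>); in the join blocks 0 and 1 form one summand and both lose it
  (\<open>c = 2\<close>).\<close>

definition free :: "nat \<Rightarrow> (nat \<times> nat \<times> nat) set" where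
  "free c = {..<b} \<times> (SIGMA i:T. {1..n i}) \<union> (\<lambda>j. (j, i0, 0)) ` {c..<b}"

lemma card_free: "card (free c) = b * (\<Sum>i\<in>T. n i) + (b - c)"
proof -
  have "card ((\<lambda>j. (j, i0, 0::nat)) ` {c..<b}) = b - c"
    by (subst card_image) (auto simp: inj_on_def)
  moreover have "card ({..<b} \<times> (SIGMA i:T. {1..n i})) = b * (\<Sum>i\<in>T. n i)"
    by (simp add: card_cartesian_product)
  ultimately show ?thesis
    unfolding free_def by (subst card_Un_disjoint) auto
qed

lemma free_sub: "free c \<subseteq> params n T b"
  using i0(3) by (auto simp: free_def params_def)

lemma free_zero: "(j, i, 0) \<in> free c \<longleftrightarrow> i = i0 \<and> c \<le> j \<and> j < b"
  by (auto simp: free_def)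

lemma finite_free: "finite (free c)"
  by (simp add: free_def)

lemma params_E: "params n E b \<subseteq> params n T b" and params_F: "params n F b \<subseteq> params n T b"
  using EF(1) by (auto simp: params_def)

lemma T_split:
  assumes "m \<in> tensor_index n T"
  shows "sv n T u m = sv n E u (restrict m E) * sv n F u (restrict m F)"
    and "tv n T u w m = tv n E u w (restrict m E) * sv n F u (restrict m F) + sv n E u (restrict m E) * tv n F u w (restrict m F)"
  using sv_split[OF finE finF EF(2), of m n u] tv_split[OF finE finF EF(2), of m n u w] assms EF(1) by auto

lemma T_merge:
  assumes "e \<in> tensor_index n E" "f \<in> tensor_index n F"
  shows "\<exists>m\<in>tensor_index n T. restrict m E = e \<and> restrict m F = f"
  using merge_tensor_index[OF EF(2) assms] EF(1) by simp

lemma w_eq_0_on_free: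
  assumes "\<And>j i k. j < b \<Longrightarrow> i \<in> E \<Longrightarrow> k \<le> n i \<Longrightarrow> w (j, i, k) = 0"
    and "\<And>j i k. j < b \<Longrightarrow> i \<in> F \<Longrightarrow> k \<le> n i \<Longrightarrow> w (j, i, k) = 0"
  shows "\<forall>q\<in>free c. w q = (0::'k)"
proof
  fix q assume "q \<in> free c"
  then have "q \<in> params n T b" using free_sub by blast
  then obtain j i k where q: "q = (j, i, k)" "j < b" "i \<in> T" "k \<le> n i" by (auto simp: params_def)
  then show "w q = 0" using assms EF(1) by blast
qed

lemma secant_dim_ge: "enat (b * (\<Sum>i\<in>T. n i) + (b - 1)) \<le> zariski_dim I (secant_variety I b X)"
proof -
  have "generically (params n T b) (\<lambda>t. E.secant_generic t \<and> F.secant_generic t)"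
    by (intro generically_conj generically_mono[OF E.generically_secant_generic params_E]
        generically_mono[OF F.generically_secant_generic params_F])
  then obtain t :: "nat \<times> nat \<times> nat \<Rightarrow> 'k" where t: "E.secant_generic t" "F.secant_generic t"
    using generically_ex by blast
  have "enat (card (free 1)) \<le> zariski_dim I (secant_variety I b X)"
  proof (rule zariski_dim_ge_injective[where \<Phi> = "secant_map n T b" and J = "params n T b" and D = "free 1" and p = t
        and d\<Phi> = "\<lambda>w m. \<Sum>j<b. tv n T (block t j) (block w j) m", OF finI secant_proj])
    show "secant_map n T b u m = 0" if "m \<notin> I" for u :: "nat \<times> nat \<times> nat \<Rightarrow> 'k" and m
      using that by (simp add: I_tensor secant_map_outside)
    show "(\<lambda>u :: nat \<times> nat \<times> nat \<Rightarrow> 'k. secant_map n T b u m) \<in> polyfun (params n T b)" for m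
      by (rule polyfun_secant_map)
    show "finite (params n T b)" by (simp add: finite_params)
    show "free 1 \<subseteq> params n T b" by (rule free_sub)
    show "fun_vec.span {secant_map n T b u} \<in> secant_variety I b X" if "secant_map n T b u \<noteq> 0" for u
      using secant_iff[OF _ secant_coord that] b2 by auto
    show "has_dd (\<lambda>u. secant_map n T b u m) t w (\<Sum>j<b. tv n T (block t j) (block w j) m)" for w m
      unfolding secant_map_def by (intro has_dd_sum has_dd_sv) (auto simp: block_def intro: has_dd_coord)
    fix c and w :: "nat \<times> nat \<times> nat \<Rightarrow> 'k"
    assume w: "\<And>q. q \<notin> free 1 \<Longrightarrow> w q = 0"
      and rel: "\<And>m. c * secant_map n T b t m + (\<Sum>j<b. tv n T (block t j) (block w j) m) = 0"
    have "\<exists>M. (\<forall>k\<in>{..<b}. \<forall>e. tv n E (block t k) (block w k) e = (\<Sum>l<b. M k l * sv n E (block t l) e)) \<and>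
      (\<forall>l\<in>{..<b}. \<forall>f. tv n F (block t l) (block w l) f = (\<Sum>k<b. (- M k l - (if k = l then c else 0)) * sv n F (block t k) f))"
    proof (rule flattening_relation[where IE = "tensor_index n E" and IF = "tensor_index n F" and K = "{..<b}"])
      fix e f assume ef: "e \<in> tensor_index n E" "f \<in> tensor_index n F"
      obtain m where m: "m \<in> tensor_index n T" "restrict m E = e" "restrict m F = f"
        using T_merge[OF ef] by blast
      have "0 = c * secant_map n T b t m + (\<Sum>j<b. tv n T (block t j) (block w j) m)" using rel by simp
      also have "\<dots> = (\<Sum>k<b. (tv n E (block t k) (block w k) e + c * sv n E (block t k) e) * sv n F (block t k) f +
          sv n E (block t k) e * tv n F (block t k) (block w k) f)"
        unfolding secant_map_def sum_distrib_left sum.distrib[symmetric]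
        by (rule sum.cong) (simp_all only: T_split[OF m(1)] m(2,3) ring_distribs ac_simps)
      finally show "(\<Sum>k<b. (tv n E (block t k) (block w k) e + c * sv n E (block t k) e) * sv n F (block t k) f +
          sv n E (block t k) e * tv n F (block t k) (block w k) f) = 0" by simp
    qed (auto simp: finite_tensor_index finE finF sv_outside tv_outside intro: E.secant_indep F.secant_indep t)
    then obtain M where ME: "\<And>k e. k < b \<Longrightarrow> tv n E (block t k) (block w k) e = (\<Sum>l<b. M k l * sv n E (block t l) e)"
      and MF: "\<And>l f. l < b \<Longrightarrow> tv n F (block t l) (block w l) f = (\<Sum>k<b. (- M k l - (if k = l then c else 0)) * sv n F (block t k) f)"
      by auto
    \<comment> \<open>On F all entries 0 are fixed, so the diagonal of \<open>M\<close> is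
      \<open>- c\<close>; on E it is the relative change of scale in \<open>i0\<close>, which is 0
      for block 0. Hence \<open>c\<close> is 0.\<close>
    have wF0: "w (l, i, 0) = 0" if "i \<in> F" for l i using w[of "(l, i, 0)"] that i0(2) by (auto simp: free_zero)
    have Mll: "M l l = - c" if l: "l < b" for l
    proof -
      have "- M l l - (if l = l then c else 0) = (\<Sum>i\<in>F. w (l, i, 0) / t (l, i, 0))"
        by (rule F.secant_tangent(2)[OF t(2) l MF[OF l]])
      then show ?thesis using wF0 by (simp add: eq_neg_iff_add_eq_0 neg_eq_iff_add_eq_0)
    qed
    have wF: "w (l, i, k) = 0" if "l < b" "i \<in> F" "k \<le> n i" for l i k
      using F.secant_tangent(3)[OF t(2) that(1) MF[OF that(1)] that(2,3)] wF0[OF that(2)] by simp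
    have MllE: "M l l = w (l, i0, 0) / t (l, i0, 0)" if l: "l < b" for l
    proof -
      have "M l l = (\<Sum>i\<in>E. w (l, i, 0) / t (l, i, 0))" by (rule E.secant_tangent(2)[OF t(1) l ME[OF l]])
      also have "\<dots> = (\<Sum>i\<in>{i0}. w (l, i, 0) / t (l, i, 0))"
        by (rule sum.mono_neutral_right) (use finE i0 w in \<open>auto simp: free_zero\<close>)
      finally show ?thesis by simp
    qed
    have "w (0, i0, 0) = 0" using w[of "(0, i0, 0)"] by (simp add: free_zero)
    then have c0: "c = 0" using Mll[of 0] MllE[of 0] b2 by simp
    have "w (l, i, k) = 0" if "l < b" "i \<in> E" "k \<le> n i" for l i k
    proof -
      have "t (l, i, 0) \<noteq> 0" "t (l, i0, 0) \<noteq> 0"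
        using t(1) that i0 by (auto simp: E.secant_generic_def E.base_nonzero_def)
      then have "w (l, i, 0) = 0"
        using MllE[OF that(1)] Mll[OF that(1)] c0 w[of "(l, i, 0)"] by (cases "i = i0") (auto simp: free_zero)
      then show ?thesis using E.secant_tangent(3)[OF t(1) that(1) ME[OF that(1)] that(2,3)] by simp
    qed
    then show "c = 0 \<and> (\<forall>q\<in>free 1. w q = 0)" using c0 w_eq_0_on_free[where w = w, OF _ wF] by blast
  qed
  then show ?thesis by (simp add: card_free)
qed

lemma join_map_split:
  assumes m: "m \<in> tensor_index n T"
  shows "join_map n T b t m = (\<Sum>k<b. join_tuple n E t k (restrict m E) * join_tuple n F t (swap01 k) (restrict m F))"
proof -
  have "(\<Sum>k\<in>{2..<b}. join_tuple n E t k (restrict m E) * join_tuple n F t (swap01 k) (restrict m F)) = (\<Sum>k\<in>{2..<b}. sv n T (block t k) m)"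
    by (rule sum.cong) (simp, unfold T_split(1)[OF m], simp add: join_tuple_def)
  then show ?thesis
    unfolding sum_first_two[OF b2] join_map_def T_split(2)[OF m] by (simp add: join_tuple_def)
qed

text \<open>The coordinate at \<open>base_index T\<close> of the tangent vector given by blocks 0
  and 1; up to a nonzero factor it is the sum of the slopes
  \<open>t (1, i, 0) / t (0, i, 0)\<close>.\<close>

definition slope_sum :: "(nat \<times> nat \<times> nat \<Rightarrow> 'k) \<Rightarrow> 'k" where
  "slope_sum t = (\<Sum>i\<in>T. t (1, i, 0) * (\<Prod>j\<in>T - {i}. t (0, j, 0)))"

lemma slope_sum_eq:
  assumes "\<And>i. i \<in> T \<Longrightarrow> t (0, i, 0) \<noteq> 0"
  shows "slope_sum t = (\<Prod>j\<in>T. t (0, j, 0)) * (\<Sum>i\<in>T. t (1, i, 0) / t (0, i, 0))"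
  unfolding slope_sum_def sum_distrib_left
proof (rule sum.cong)
  fix i assume i: "i \<in> T"
  have "(\<Prod>j\<in>T. t (0, j, 0)) = t (0, i, 0) * (\<Prod>j\<in>T - {i}. t (0, j, 0))" by (rule prod.remove[OF _ i]) simp
  then show "t (1, i, 0) * (\<Prod>j\<in>T - {i}. t (0, j, 0)) = (\<Prod>j\<in>T. t (0, j, 0)) * (t (1, i, 0) / t (0, i, 0))"
    using assms[OF i] by (simp add: field_simps)
qed simp

lemma polyfun_slope_sum: "slope_sum \<in> polyfun (params n T b)"
  unfolding slope_sum_def[abs_def] using b2
  by (intro polyfun_sum polyfun_mult polyfun_prod polyfun_coord) (auto simp: params_def)

lemma slope_sum_ones: "slope_sum (\<lambda>_. 1) \<noteq> 0"
  using s by (simp add: slope_sum_def)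

lemma join_dim_ge: "enat (b * (\<Sum>i\<in>T. n i) + (b - 2)) \<le> zariski_dim I (tangential_join I X b)"
proof -
  have "generically (params n T b) (\<lambda>t. (E.join_generic t \<and> F.join_generic t) \<and> slope_sum t \<noteq> 0)"
    by (intro generically_conj generically_mono[OF E.generically_join_generic params_E]
        generically_mono[OF F.generically_join_generic params_F] generically_nonzero[OF polyfun_slope_sum slope_sum_ones])
  then obtain t :: "nat \<times> nat \<times> nat \<Rightarrow> 'k" where t: "E.join_generic t" "F.join_generic t" "slope_sum t \<noteq> 0"
    using generically_ex by blast
  let ?r = "\<lambda>m B. restrict m B :: nat \<Rightarrow> nat"
  define d where "d = (\<lambda>w m. if m \<in> tensor_index n T then
    (\<Sum>k<b. join_tuple n E t k (?r m E) * join_deriv n F t w (swap01 k) (?r m F)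
      + join_deriv n E t w k (?r m E) * join_tuple n F t (swap01 k) (?r m F)) else 0)"
  have "enat (card (free 2)) \<le> zariski_dim I (tangential_join I X b)"
  proof (rule zariski_dim_ge_injective[where \<Phi> = "join_map n T b" and J = "params n T b" and D = "free 2" and p = t
        and d\<Phi> = d, OF finI join_proj])
    show "join_map n T b u m = 0" if "m \<notin> I" for u :: "nat \<times> nat \<times> nat \<Rightarrow> 'k" and m
      using that by (simp add: I_tensor join_map_outside)
    show "(\<lambda>u :: nat \<times> nat \<times> nat \<Rightarrow> 'k. join_map n T b u m) \<in> polyfun (params n T b)" for m
      by (rule polyfun_join_map[OF b2])
    show "finite (params n T b)" by (simp add: finite_params)
    show "free 2 \<subseteq> params n T b" by (rule free_sub)
    show "fun_vec.span {join_map n T b u} \<in> tangential_join I X b" if "join_map n T b u \<noteq> 0" for u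
      using join_iff[OF b2 join_coord that] by auto
    show "has_dd (\<lambda>u. join_map n T b u m) t w (d w m)" for w m
    proof (cases "m \<in> tensor_index n T")
      case True
      then show ?thesis
        unfolding join_map_split[OF True] d_def using finE finF
        by (simp only: if_True) (intro has_dd_sum has_dd_mult has_dd_join_tuple)
    next
      case False
      then show ?thesis by (simp add: join_map_outside d_def has_dd_const)
    qed
    fix c and w :: "nat \<times> nat \<times> nat \<Rightarrow> 'k"
    assume w: "\<And>q. q \<notin> free 2 \<Longrightarrow> w q = 0" and rel: "\<And>m. c * join_map n T b t m + d w m = 0"
    have indF: "indep_fam {..<b} (\<lambda>k. join_tuple n F t (swap01 k))"
      by (rule indep_fam_reindex[OF swap01_bij[OF b2]]) (use t(2) in \<open>simp add: F.join_generic_def\<close>)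
    have out: "join_tuple n B' t k x = 0" "join_deriv n B' t w k x = 0" if "x \<notin> tensor_index n B'" for B' k x
      using that by (auto simp: join_tuple_def join_deriv_def sv_outside tv_outside sec_outside)
    have "\<exists>M. (\<forall>k\<in>{..<b}. \<forall>e. join_deriv n E t w k e = (\<Sum>l<b. M k l * join_tuple n E t l e)) \<and>
      (\<forall>l\<in>{..<b}. \<forall>f. join_deriv n F t w (swap01 l) f = (\<Sum>k<b. (- M k l - (if k = l then c else 0)) * join_tuple n F t (swap01 k) f))"
    proof (rule flattening_relation[where IE = "tensor_index n E" and IF = "tensor_index n F" and K = "{..<b}", OF _ _ _ _ indF])
      fix e f assume ef: "e \<in> tensor_index n E" "f \<in> tensor_index n F"
      obtain m where m: "m \<in> tensor_index n T" "restrict m E = e" "restrict m F = f"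
        using T_merge[OF ef] by blast
      have "0 = c * join_map n T b t m + d w m" using rel by simp
      also have "\<dots> = (\<Sum>k<b. (join_deriv n E t w k e + c * join_tuple n E t k e) * join_tuple n F t (swap01 k) f +
          join_tuple n E t k e * join_deriv n F t w (swap01 k) f)"
        unfolding join_map_split[OF m(1)] d_def m(2,3) using m(1)
        by (simp add: sum_distrib_left sum.distrib[symmetric] algebra_simps)
      finally show "(\<Sum>k<b. (join_deriv n E t w k e + c * join_tuple n E t k e) * join_tuple n F t (swap01 k) f +
          join_tuple n E t k e * join_deriv n F t w (swap01 k) f) = 0" by simp
    qed (use t(1) out in \<open>auto simp: finite_tensor_index finE finF E.join_generic_def\<close>)
    then obtain M where ME: "\<And>k e. k < b \<Longrightarrow> join_deriv n E t w k e = (\<Sum>l<b. M k l * join_tuple n E t l e)"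
      and MF: "\<And>l f. l < b \<Longrightarrow> join_deriv n F t w (swap01 l) f =
        (\<Sum>k<b. (- M k l - (if k = l then c else 0)) * join_tuple n F t (swap01 k) f)"
      by auto
    \<comment> \<open>The coefficients for the F side in its own order: transposed, negated and
      reindexed by \<open>swap01\<close>.\<close>
    define M' where "M' = (\<lambda>a l. - M (swap01 l) (swap01 a) - (if l = a then c else 0))"
    have MF': "join_deriv n F t w a f = (\<Sum>l<b. M' a l * join_tuple n F t l f)" if a: "a < b" for a f
    proof -
      have sa: "swap01 a < b" using bij_betwE[OF swap01_bij[OF b2]] a by auto
      have inj: "swap01 k = swap01 a \<longleftrightarrow> k = a" for k using swap01_simps(5) by metis
      have "join_deriv n F t w a f = (\<Sum>k<b. (- M k (swap01 a) - (if k = swap01 a then c else 0)) * join_tuple n F t (swap01 k) f)"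
        using MF[OF sa, of f] by simp
      also have "\<dots> = (\<Sum>l<b. (- M (swap01 l) (swap01 a) - (if swap01 l = swap01 a then c else 0)) * join_tuple n F t (swap01 (swap01 l)) f)"
        by (rule sum.reindex_bij_betw[OF swap01_bij[OF b2], symmetric])
      finally show ?thesis by (simp only: inj M'_def swap01_simps(5))
    qed
    have b01: "0 < b" "1 < b" using b2 by auto
    have w0: "w (j, i, 0) = 0" if "i \<noteq> i0 \<or> j < 2" for j i using w[of "(j, i, 0)"] that by (auto simp: free_zero)
    have wE0: "w (0, i, 0) = 0" "w (1, i, 0) = 0" for i using w0 by auto
    have wF0: "w (k, i, 0) = 0" if "i \<in> F" for k i using i0(2) that by (intro w0) auto
    note baseE = E.join_tangent_base[where ?M0.0 = "M 0" and ?M1.0 = "M 1", OF t(1) wE0 ME[OF b01(1)] ME[OF b01(2)]]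
    note baseF = F.join_tangent_base[where ?M0.0 = "M' 0" and ?M1.0 = "M' 1", OF t(2) wE0 MF'[OF b01(1)] MF'[OF b01(2)]]
    have M11: "M 1 1 = - c" using baseF(1)[OF b01(1)] by (simp add: M'_def eq_neg_iff_add_eq_0 neg_eq_iff_add_eq_0)
    have M00: "M 0 0 = 0" using baseE(1)[OF b01(1)] .
    \<comment> \<open>Both sides compute \<open>M 1 0\<close> from their share of the slopes, with
      opposite signs. Adding gives \<open>c\<close> times the total slope, which is nonzero for the
      chosen \<open>t\<close>.\<close>
    have "c * (\<Sum>i\<in>T. t (1, i, 0) / t (0, i, 0)) = 0"
    proof -
      have "(\<Sum>i\<in>T. t (1, i, 0) / t (0, i, 0)) = (\<Sum>i\<in>E. t (1, i, 0) / t (0, i, 0)) + (\<Sum>i\<in>F. t (1, i, 0) / t (0, i, 0))"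
        unfolding EF(1)[symmetric] by (rule sum.union_disjoint[OF finE finF EF(2)])
      moreover have a: "M 1 0 = c * (\<Sum>i\<in>E. t (1, i, 0) / t (0, i, 0))" using baseE(4) M11 by simp
      moreover have b: "- M 1 0 = c * (\<Sum>i\<in>F. t (1, i, 0) / t (0, i, 0))" using baseF(4) M00 by (simp add: M'_def)
      ultimately show ?thesis by (simp only: distrib_left a[symmetric] b[symmetric]) simp
    qed
    moreover have "(\<Sum>i\<in>T. t (1, i, 0) / t (0, i, 0)) \<noteq> 0"
    proof -
      have "t (0, i, 0) \<noteq> 0" if "i \<in> T" for i
        proof -
        have "i \<in> E \<union> F" using that EF(1) by simp
        then show ?thesis using t(1,2) b01(1) by (auto simp: E.join_generic_def F.join_generic_def E.base_nonzero_def F.base_nonzero_def)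
      qed
      then show ?thesis using slope_sum_eq[of t] t(3) by auto
    qed
    ultimately have c0: "c = 0" by simp
    have M'11: "M' 1 1 = 0" using M00 c0 by (simp add: M'_def)
    have wF: "w (k, i, q) = 0" if "k < b" "i \<in> F" "q \<le> n i" for k i q
    proof -
      consider "k = 0" | "k = 1" | "2 \<le> k" by linarith
      then show ?thesis
      proof cases
        case 1
        then show ?thesis using baseF(2)[OF that(2,3)] by simp
      next
        case 2
        then show ?thesis using baseF(5)[OF that(2,3)] M'11 by simp
      next
        case 3
        then show ?thesis using F.join_tangent(3)[OF t(2) that(1) 3 MF'[OF that(1)] that(2,3)] wF0[OF that(2)] by simp
      qed
    qed
    have wE: "w (k, i, q) = 0" if "k < b" "i \<in> E" "q \<le> n i" for k i q
    proof -
      consider "k = 0" | "k = 1" | "2 \<le> k" by linarith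
      then show ?thesis
      proof cases
        case 1
        then show ?thesis using baseE(2)[OF that(2,3)] by simp
      next
        case 2
        then show ?thesis using baseE(5)[OF that(2,3)] M11 c0 by simp
      next
        case 3
        have "M' k k = (\<Sum>i\<in>F. w (k, i, 0) / t (k, i, 0))" by (rule F.join_tangent(2)[OF t(2) that(1) 3 MF'[OF that(1)]])
        then have Mkk: "M k k = 0" using wF0 c0 3 by (simp add: M'_def)
        have "M k k = (\<Sum>i\<in>E. w (k, i, 0) / t (k, i, 0))" by (rule E.join_tangent(2)[OF t(1) that(1) 3 ME[OF that(1)]])
        also have "\<dots> = (\<Sum>i\<in>{i0}. w (k, i, 0) / t (k, i, 0))"
          by (rule sum.mono_neutral_right) (use finE i0 w0 in auto)
        finally have "w (k, i0, 0) = 0"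
          using Mkk t(1) i0(1) that(1) by (auto simp: E.join_generic_def E.base_nonzero_def)
        then have "w (k, i, 0) = 0" using w0[of i k] by (cases "i = i0") auto
        then show ?thesis using E.join_tangent(3)[OF t(1) that(1) 3 ME[OF that(1)] that(2,3)] by simp
      qed
    qed
    show "c = 0 \<and> (\<forall>q\<in>free 2. w q = 0)" using c0 w_eq_0_on_free[where w = w, OF wE wF] by blast
  qed
  then show ?thesis by (simp add: card_free)
qed

section \<open>Normalised charts and upper bounds for the dimensions\<close>

definition secant_chart :: "(nat \<times> nat \<times> nat \<Rightarrow> 'k) \<Rightarrow> nat \<times> nat \<times> nat \<Rightarrow> 'k" where
  "secant_chart t = (\<lambda>(j, i, k). if k = 0 \<and> \<not> (i = i0 \<and> 1 \<le> j) then 1 else t (j, i, k))"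

text \<open>Rescalings of the base factors with total weight 0 can be added to the direction without
  changing the tangent vector, so only the sum of the slopes matters; it is normalised to 1 and
  placed in factor \<open>i0\<close>.\<close>

definition join_chart :: "(nat \<times> nat \<times> nat \<Rightarrow> 'k) \<Rightarrow> nat \<times> nat \<times> nat \<Rightarrow> 'k" where
  "join_chart t = (\<lambda>(j, i, k). if k = 0 \<and> \<not> (i = i0 \<and> 2 \<le> j) then if j = 1 \<and> i \<noteq> i0 then 0 else 1 else t (j, i, k))"

lemma polyfun_charts:
  assumes "q \<in> params n T b"
  shows "(\<lambda>t. secant_chart t q) \<in> polyfun (free 1)" "(\<lambda>t. join_chart t q) \<in> polyfun (free 2)"
proof -
  obtain j i k where q: "q = (j, i, k)" "j < b" "i \<in> T" "k \<le> n i" using assms by (auto simp: params_def)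
  show "(\<lambda>t. secant_chart t q) \<in> polyfun (free 1)"
  proof (cases "k = 0 \<and> \<not> (i = i0 \<and> 1 \<le> j)")
    case True
    then show ?thesis by (simp add: q secant_chart_def polyfun_const)
  next
    case False
    then have "(j, i, k) \<in> free 1" using q by (cases "k = 0") (auto simp: free_def)
    then show ?thesis using False unfolding q secant_chart_def prod.case by (subst if_not_P) (auto intro: polyfun_coord)
  qed
  show "(\<lambda>t. join_chart t q) \<in> polyfun (free 2)"
  proof (cases "k = 0 \<and> \<not> (i = i0 \<and> 2 \<le> j)")
    case True
    then show ?thesis by (simp add: q join_chart_def polyfun_const)
  next
    case False
    then have "(j, i, k) \<in> free 2" using q by (cases "k = 0") (auto simp: free_def)
    then show ?thesis using False unfolding q join_chart_def prod.case by (subst if_not_P) (auto intro: polyfun_coord)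
  qed
qed

lemma sv_normalised:
  fixes u v :: "nat \<Rightarrow> nat \<Rightarrow> 'k"
  assumes "\<And>i k. i \<in> T \<Longrightarrow> k \<le> n i \<Longrightarrow> v i k = (if i = i0 then a else 1) * (u i k / u i 0)"
  shows "sv n T v m = a * (sv n T u m / (\<Prod>i\<in>T. u i 0))"
proof -
  define x where "x = (\<lambda>i k. u i k / u i 0)"
  have "sv n T v = sv n T (x(i0 := \<lambda>k. a * x i0 k))"
    by (rule sv_cong) (simp add: assms x_def)
  then have "sv n T v m = a * sv n T x m" by (simp only: sv_scale[OF finite_atLeastAtMost i0(3)])
  then show ?thesis using sv_divide[OF finite_atLeastAtMost, of n 1 s u "\<lambda>i. u i 0" m] by (simp only: x_def)
qed

lemma secant_chart_dense:
  assumes "\<And>j i. j < b \<Longrightarrow> i \<in> T \<Longrightarrow> t (j, i, 0) \<noteq> 0"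
  shows "\<exists>c t'. secant_map n T b t = fun_scale c (secant_map n T b (secant_chart t'))"
proof -
  define P where "P = (\<lambda>j. \<Prod>i\<in>T. t (j, i, 0))"
  have P: "P j \<noteq> 0" if "j < b" for j using assms[OF that] by (simp add: P_def)
  \<comment> \<open>The scale of block \<open>j\<close> relative to block 0 goes into factor
    \<open>i0\<close>.\<close>
  define t' where "t' = (\<lambda>(j, i, k). (if i = i0 then P j / P 0 else 1) * (t (j, i, k) / t (j, i, 0)))"
  have "P 0 * sv n T (block (secant_chart t') j) m = sv n T (block t j) m" if j: "j < b" for j m
  proof -
    have "sv n T (block (secant_chart t') j) m = P j / P 0 * (sv n T (block t j) m / (\<Prod>i\<in>T. block t j i 0))"
    proof (rule sv_normalised)
      fix i k assume i: "i \<in> T" "k \<le> n i"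
      show "block (secant_chart t') j i k = (if i = i0 then P j / P 0 else 1) * (block t j i k / block t j i 0)"
        using assms[OF j i(1)] P[of 0] b2 by (cases "j = 0") (auto simp: block_def secant_chart_def t'_def)
    qed
    then show ?thesis using P[OF j] P[of 0] b2 by (simp add: P_def block_def)
  qed
  then have "secant_map n T b t = fun_scale (P 0) (secant_map n T b (secant_chart t'))"
    by (simp add: secant_map_def fun_scale_def sum_distrib_left)
  then show ?thesis by blast
qed

lemma join_chart_dense:
  assumes t: "\<And>j i. j < b \<Longrightarrow> j \<noteq> 1 \<Longrightarrow> i \<in> T \<Longrightarrow> t (j, i, 0) \<noteq> 0" and slope: "slope_sum t \<noteq> 0"
  shows "\<exists>c t'. join_map n T b t = fun_scale c (join_map n T b (join_chart t'))"
proof -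
  define P where "P = (\<lambda>j. \<Prod>i\<in>T. t (j, i, 0))"
  define S where "S = (\<Sum>i\<in>T. t (1, i, 0) / t (0, i, 0))"
  \<comment> \<open>The coordinate of the tangent vector at \<open>base_index T\<close>; it becomes
    the projective scale.\<close>
  define c where "c = P 0 * S"
  have t0: "t (0, i, 0) \<noteq> 0" if "i \<in> T" for i using t[of 0 i] that b2 by simp
  have c: "c \<noteq> 0" using slope slope_sum_eq[where t = t, OF t0] by (simp add: c_def P_def S_def)
  then have S0: "S \<noteq> 0" and P0: "P 0 \<noteq> 0" by (auto simp: c_def)
  define u where "u = (\<lambda>i k. t (0, i, k) / t (0, i, 0))"
  \<comment> \<open>In block 1 the slopes are removed, the rest is divided by \<open>S\<close>, and
    slope 1 is put back in factor \<open>i0\<close>.\<close>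
  define t' where "t' = (\<lambda>(j, i, k). if j = 0 then u i k
     else if j = 1 then (t (1, i, k) / t (0, i, 0) - t (1, i, 0) / t (0, i, 0) * u i k) / S + (if i = i0 then u i k else 0)
     else (if i = i0 then P j / c else 1) * (t (j, i, k) / t (j, i, 0)))"
  have b0: "block (join_chart t') 0 i k = u i k" if "i \<in> T" for i k
    using t0[OF that] by (simp add: block_def join_chart_def t'_def u_def)
  have b1: "block (join_chart t') 1 i k = 1 / S * (t (1, i, k) / t (0, i, 0))
      + 1 * ((if i = i0 then 1 else 0) - t (1, i, 0) / t (0, i, 0) / S) * u i k" if "i \<in> T" for i k
    using t0[OF that] S0 by (auto simp: block_def join_chart_def t'_def u_def field_simps)
  have "c * tv n T (block (join_chart t') 0) (block (join_chart t') 1) m = tv n T (block t 0) (block t 1) m" for m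
  proof -
    have "tv n T (block (join_chart t') 0) (block (join_chart t') 1) m = tv n T u (block (join_chart t') 1) m"
    proof -
      have "sv n T ((block (join_chart t') 0)(i := block (join_chart t') 1 i)) = sv n T (u(i := block (join_chart t') 1 i))" for i
        by (rule sv_cong) (simp add: b0)
      then show ?thesis by (simp add: tv_def)
    qed
    also have "\<dots> = 1 / S * tv n T u (\<lambda>i k. t (1, i, k) / t (0, i, 0)) m
        + 1 * tv n T u (\<lambda>i k. ((if i = i0 then 1 else 0) - t (1, i, 0) / t (0, i, 0) / S) * u i k) m"
      by (rule tv_linear) (simp_all only: b1 finite_atLeastAtMost mult_1)
    \<comment> \<open>The corrections to the slopes have total weight \<open>1 - S / S\<close>, so
      the tangent vector does not feel them.\<close>
    also have "tv n T u (\<lambda>i k. ((if i = i0 then 1 else 0) - t (1, i, 0) / t (0, i, 0) / S) * u i k) m = 0"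
    proof -
      have "(\<Sum>i\<in>T. (if i = i0 then 1 else 0) - t (1, i, 0) / t (0, i, 0) / S) = 1 - S / S"
        unfolding sum_subtractf sum_divide_distrib[symmetric] S_def[symmetric] using i0(3) by simp
      then show ?thesis using S0 by (simp add: tv_scaled_base)
    qed
    also have "tv n T u (\<lambda>i k. t (1, i, k) / t (0, i, 0)) m = tv n T (block t 0) (block t 1) m / P 0"
      unfolding u_def P_def using tv_divide[of T n "block t 0" "\<lambda>i. t (0, i, 0)" "block t 1" m] by (simp add: block_def)
    finally show ?thesis using S0 P0 by (simp add: c_def)
  qed
  moreover have "c * sv n T (block (join_chart t') j) m = sv n T (block t j) m" if j: "j \<in> {2..<b}" for j m
  proof -
    have tj: "t (j, i, 0) \<noteq> 0" if "i \<in> T" for i using t[of j i] j that by auto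
    have Pj: "P j \<noteq> 0" using tj by (simp add: P_def)
    have "sv n T (block (join_chart t') j) m = P j / c * (sv n T (block t j) m / (\<Prod>i\<in>T. block t j i 0))"
      by (rule sv_normalised) (use tj j in \<open>auto simp: block_def join_chart_def t'_def\<close>)
    then show ?thesis using Pj c by (simp add: P_def block_def)
  qed
  ultimately have "join_map n T b t = fun_scale c (join_map n T b (join_chart t'))"
    unfolding join_map_def fun_scale_def by (simp add: distrib_left sum_distrib_left)
  then show ?thesis by blast
qed

lemma vanishes_on_variety:
  assumes Y: "Y \<subseteq> proj_space I" and f: "f \<in> homogeneous_polys I" "eval_mpoly f 0 = 0"
    and iff: "\<And>v. v \<in> coord_space I \<Longrightarrow> v \<noteq> 0 \<Longrightarrow> fun_vec.span {v} \<in> Y \<Longrightarrow> eval_mpoly f v = 0"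
    and p: "p \<in> Y" "v \<in> p"
  shows "eval_mpoly f v = (0::'k)"
proof (cases "v = 0")
  case False
  have "p \<in> proj_space I" using p(1) Y by blast
  from proj_space_span_eq[OF this p(2) False] show ?thesis using iff p(1) False by metis
qed (simp add: f)

lemma secant_dim_le: "zariski_dim I (secant_variety I b X) \<le> enat (b * (\<Sum>i\<in>T. n i) + (b - 1))"
proof (rule zariski_dim_le[where \<phi> = "\<lambda>t. secant_map n T b (secant_chart t)" and J = "free 1"])
  show "(\<lambda>t. secant_map n T b (secant_chart t) m) \<in> polyfun (free 1)" for m
    by (rule polyfun_compose[OF polyfun_secant_map]) (rule polyfun_charts)
  fix f :: "(nat \<Rightarrow> nat, 'k) mpoly" and p v
  assume f: "f \<in> homogeneous_polys I" "\<And>t. eval_mpoly f (secant_map n T b (secant_chart t)) = 0"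
    and p: "p \<in> secant_variety I b X" "v \<in> p"
  have "eval_mpoly f (secant_map n T b t) = 0" for t
  proof (rule polyfun_zero_if_generic[where f = "\<lambda>t. eval_mpoly f (secant_map n T b t)"
        and g = "\<lambda>t. \<Prod>j<b. \<Prod>i\<in>T. t (j, i, 0)" and J = "params n T b"])
    show "(\<lambda>t. eval_mpoly f (secant_map n T b t)) \<in> polyfun (params n T b)"
      by (intro eval_homogeneous_polyfun[OF f(1)] polyfun_secant_map)
    show "(\<lambda>t. \<Prod>j<b. \<Prod>i\<in>T. t (j, i, 0)) \<in> polyfun (params n T b)"
      by (intro polyfun_prod polyfun_coord) (auto simp: params_def)
    show "(\<Prod>j<b. \<Prod>i\<in>T. (\<lambda>_. 1) (j, i, 0)) \<noteq> (0::'k)" by simp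
    fix t :: "nat \<times> nat \<times> nat \<Rightarrow> 'k" assume "(\<Prod>j<b. \<Prod>i\<in>T. t (j, i, 0)) \<noteq> 0"
    then have "t (j, i, 0) \<noteq> 0" if "j < b" "i \<in> T" for j i using that by auto
    from secant_chart_dense[where t = t, OF this] obtain c t'
      where c: "secant_map n T b t = fun_scale c (secant_map n T b (secant_chart t'))" by blast
    obtain d where "f \<in> forms I d" using f(1) by (auto simp: homogeneous_polys_def)
    then show "eval_mpoly f (secant_map n T b t) = 0" unfolding c using f(2)[of t'] by (simp add: eval_mpoly_scale)
  qed
  note f0 = this
  have "secant_map n T b (\<lambda>_. 0) = (0 :: _ \<Rightarrow> 'k)"
    unfolding secant_map_def block_def sv_zero by (simp add: fun_eq_iff)
  then have "eval_mpoly f 0 = 0" using f0[of "\<lambda>_. 0"] by simp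
  then show "eval_mpoly f v = 0"
    by (rule vanishes_on_variety[OF secant_proj f(1) _ _ p]) (use secant_iff[of b] b2 f(1) f0 in auto)
qed (simp_all add: finite_free card_free)

lemma join_dim_le: "zariski_dim I (tangential_join I X b) \<le> enat (b * (\<Sum>i\<in>T. n i) + (b - 2))"
proof (rule zariski_dim_le[where \<phi> = "\<lambda>t. join_map n T b (join_chart t)" and J = "free 2"])
  show "(\<lambda>t. join_map n T b (join_chart t) m) \<in> polyfun (free 2)" for m
    by (rule polyfun_compose[OF polyfun_join_map[OF b2]]) (rule polyfun_charts)
  fix f :: "(nat \<Rightarrow> nat, 'k) mpoly" and p v
  assume f: "f \<in> homogeneous_polys I" "\<And>t. eval_mpoly f (join_map n T b (join_chart t)) = 0"
    and p: "p \<in> tangential_join I X b" "v \<in> p"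
  have "eval_mpoly f (join_map n T b t) = 0" for t
  proof (rule polyfun_zero_if_generic[where f = "\<lambda>t. eval_mpoly f (join_map n T b t)"
        and g = "\<lambda>t. (\<Prod>j<b. \<Prod>i\<in>T. t (j, i, 0)) * slope_sum t" and J = "params n T b"])
    show "(\<lambda>t. eval_mpoly f (join_map n T b t)) \<in> polyfun (params n T b)"
      by (intro eval_homogeneous_polyfun[OF f(1)] polyfun_join_map b2)
    show "(\<lambda>t. (\<Prod>j<b. \<Prod>i\<in>T. t (j, i, 0)) * slope_sum t) \<in> polyfun (params n T b)"
      by (intro polyfun_mult polyfun_slope_sum polyfun_prod polyfun_coord) (auto simp: params_def)
    show "(\<Prod>j<b. \<Prod>i\<in>T. (\<lambda>_. 1) (j, i, 0)) * slope_sum (\<lambda>_. 1) \<noteq> (0::'k)" using slope_sum_ones by simp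
    fix t :: "nat \<times> nat \<times> nat \<Rightarrow> 'k" assume g: "(\<Prod>j<b. \<Prod>i\<in>T. t (j, i, 0)) * slope_sum t \<noteq> 0"
    then have "t (j, i, 0) \<noteq> 0" if "j < b" "j \<noteq> 1" "i \<in> T" for j i using that by auto
    from join_chart_dense[where t = t, OF this] g obtain c t'
      where c: "join_map n T b t = fun_scale c (join_map n T b (join_chart t'))" by auto
    obtain d where "f \<in> forms I d" using f(1) by (auto simp: homogeneous_polys_def)
    then show "eval_mpoly f (join_map n T b t) = 0" unfolding c using f(2)[of t'] by (simp add: eval_mpoly_scale)
  qed
  note f0 = this
  have "join_map n T b (\<lambda>_. 0) = (0 :: _ \<Rightarrow> 'k)"
  proof
    fix m
    show "join_map n T b (\<lambda>_. 0) m = (0 :: _ \<Rightarrow> 'k) m"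
      unfolding join_map_def block_def sv_zero using tv_scale[of T n "\<lambda>_ _. 0" "0::'k" "\<lambda>_ _. 0" m] by simp
  qed
  then have "eval_mpoly f 0 = 0" using f0[of "\<lambda>_. 0"] by simp
  then show "eval_mpoly f v = 0"
    by (rule vanishes_on_variety[OF join_proj f(1) _ _ p]) (use join_iff[OF b2] f(1) f0 in auto)
qed (simp_all add: finite_free card_free)

end

section \<open>The rank of a general point of the tangential join\<close>

lemma sum_in_span_image:
  assumes "\<And>m. w m = (\<Sum>a\<in>A. c a * v a m)" shows "w \<in> fun_vec.span (v ` A :: ('i \<Rightarrow> 'k::field) set)"
proof -
  have "w = (\<Sum>a\<in>A. fun_scale (c a) (v a))" using assms by (auto simp: sum_fun_apply fun_scale_apply)
  then show ?thesis by (simp only:) (intro fun_vec.span_sum fun_vec.span_scale fun_vec.span_base imageI)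
qed

lemma span_image_sum:
  assumes "w \<in> fun_vec.span (v ` A :: ('i \<Rightarrow> 'k::field) set)" "finite A" "inj_on v A"
  shows "\<exists>c. \<forall>m. w m = (\<Sum>a\<in>A. c a * v a m)"
proof -
  obtain u where u: "w = (\<Sum>x\<in>v ` A. fun_scale (u x) x)"
    using assms(1) unfolding fun_vec.span_finite[OF finite_imageI[OF assms(2)]] by blast
  have "w m = (\<Sum>a\<in>A. u (v a) * v a m)" for m
    unfolding u sum.reindex[OF assms(3)] by (simp add: sum_fun_apply fun_scale_apply)
  then show ?thesis by (intro exI[of _ "\<lambda>a. u (v a)"]) blast
qed

lemma tv_zero: "finite B \<Longrightarrow> tv n B u (\<lambda>i k. 0 :: 'k::comm_ring_1) m = 0"
  using tv_scale[of B n u 0 "\<lambda>i k. 0" m] by simp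

lemma sec_zero: "finite B \<Longrightarrow> sec n B u v (\<lambda>i k. 0 :: 'k::comm_ring_1) m = 0"
  using sec_linear[of B "\<lambda>i k. 0" 0 "\<lambda>i k. 0" 0 "\<lambda>i k. 0" n u v m] by simp

lemma join_deriv_cong:
  assumes "\<And>q. q \<in> params n B b \<Longrightarrow> w q = w' q" "k < b"
  shows "join_deriv n B t w k m = join_deriv n B t w' k m"
proof -
  have "block w j i l = block w' j i l" if "j < b" "i \<in> B" "l \<le> n i" for j i l
    using that assms(1)[of "(j, i, l)"] by (simp add: params_def block_def)
  then have "sv n B (u(i := block w j i)) = sv n B (u(i := block w' j i))" if "j < b" "i \<in> B" for u i j
    using that by (intro sv_cong) auto
  then show ?thesis using assms(2) by (auto simp: join_deriv_def tv_def sec_def)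
qed

text \<open>The span of the tuple contains a decomposable tensor that involves the tangent vector;
  its coefficient there is scaled to 1.\<close>

definition meets_segre :: "(nat \<Rightarrow> nat) \<Rightarrow> nat set \<Rightarrow> nat \<Rightarrow> (nat \<times> nat \<times> nat \<Rightarrow> 'k::field) \<Rightarrow> bool" where
  "meets_segre n B b t \<longleftrightarrow> (\<exists>v z. \<forall>m. sv n B v m =
     join_tuple n B t 1 m + (\<Sum>k\<in>{..<b} - {1}. z k * join_tuple n B t k m))"

lemma generically_not_meets_segre:
  assumes "big_factors n B b"
  shows "generically (params n B b) (\<lambda>t :: nat \<times> nat \<times> nat \<Rightarrow> 'k::{field_char_0, alg_closed_field}. \<not> meets_segre n B b t)"
proof (rule ccontr)
  assume not: "\<not> ?thesis"
  interpret big_factors n B b "TYPE('k)" by fact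
  define K where "K = {..<b} - {1::nat}"
  have K: "0 \<in> K" "finite K" "\<And>k. k \<in> K \<Longrightarrow> k < b" "\<And>k. k \<in> K \<Longrightarrow> k \<noteq> 1" "card K = b - 1" "{..<b} = insert 1 K" "1 \<notin> K"
    using b by (auto simp: K_def)
  have b01: "0 < b" "1 < b" using b by auto
  obtain d where "generically (params n B b) (\<lambda>t :: nat \<times> nat \<times> nat \<Rightarrow> 'k.
      indep_mod_tangent n B (block t 0) {..<b} (second_order d t))"
    using generically_second_order by blast
  from generically_conj[OF generically_join_tuple this] obtain g t1 where g: "g \<in> polyfun (params n B b)" "g t1 \<noteq> 0"
    "\<And>t. g t \<noteq> 0 \<Longrightarrow> indep_fam {..<b} (join_tuple n B t)"
    "\<And>t. g t \<noteq> 0 \<Longrightarrow> indep_mod_tangent n B (block t 0) {..<b} (second_order d t)"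
    unfolding generically_def by blast
  \<comment> \<open>the additional parameters: \<open>v\<close> in block \<open>b\<close>, \<open>z\<close> in block \<open>b + 1\<close>\<close>
  define L where "L = {b} \<times> (SIGMA i:B. {0..n i}) \<union> (\<lambda>k. (Suc b, 0, k)) ` K"
  define eqn where "eqn = (\<lambda>m (x :: nat \<times> nat \<times> nat \<Rightarrow> 'k). sv n B (block x b) m - join_tuple n B x 1 m
      - (\<Sum>k\<in>K. x (Suc b, 0, k) * join_tuple n B x k m))"
  have "\<exists>x. g x \<noteq> 0 \<and> (\<forall>e\<in>range eqn. e x = 0) \<and>
    (\<forall>w. \<exists>w'. (\<forall>j\<in>params n B b. w' j = w j) \<and> (\<forall>e\<in>range eqn. has_dd e x w' 0))"
  proof (rule generic_smoothness[where L = L])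
    show "finite L" using B K(2) by (simp add: L_def)
    have "eqn m \<in> polyfun (params n B b \<union> L)" for m
    proof -
      have sv: "(\<lambda>x :: nat \<times> nat \<times> nat \<Rightarrow> 'k. sv n B (block x b) m) \<in> polyfun (params n B b \<union> L)"
        unfolding block_def by (intro polyfun_sv polyfun_coord) (auto simp: L_def)
      have J: "(\<lambda>x :: nat \<times> nat \<times> nat \<Rightarrow> 'k. join_tuple n B x k m) \<in> polyfun (params n B b \<union> L)" if "k < b" for k
        by (rule polyfun_mono[OF polyfun_join_tuple[OF b that]]) simp
      have "(\<lambda>x :: nat \<times> nat \<times> nat \<Rightarrow> 'k. \<Sum>k\<in>K. x (Suc b, 0, k) * join_tuple n B x k m) \<in> polyfun (params n B b \<union> L)"
      proof (rule polyfun_sum)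
        fix k assume k: "k \<in> K"
        show "(\<lambda>x :: nat \<times> nat \<times> nat \<Rightarrow> 'k. x (Suc b, 0, k) * join_tuple n B x k m) \<in> polyfun (params n B b \<union> L)"
          by (rule polyfun_mult[OF polyfun_coord J[OF K(3)[OF k]]]) (use k in \<open>simp add: L_def\<close>)
      qed
      then show ?thesis unfolding eqn_def by (rule polyfun_diff[OF polyfun_diff[OF sv J[OF b01(2)]]])
    qed
    then show "range eqn \<subseteq> polyfun (params n B b \<union> L)" by blast
    show "g \<in> polyfun (params n B b)" "g t1 \<noteq> 0" by fact+
    fix f u assume f: "f \<in> polyfun (params n B b)" and vanish: "\<And>x. (\<And>e. e \<in> range eqn \<Longrightarrow> e x = 0) \<Longrightarrow> f x = 0"
    \<comment> \<open>A nonzero polynomial in the parameters that vanishes on all solutions would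
      witness genericity; so the failure of genericity is the density that
      \<open>generic_smoothness\<close> asks for.\<close>
    have "\<not> meets_segre n B b t" if "f t \<noteq> 0" for t
    proof
      assume "meets_segre n B b t"
      then obtain v z where vz: "\<And>m. sv n B v m = join_tuple n B t 1 m + (\<Sum>k\<in>K. z k * join_tuple n B t k m)"
        unfolding meets_segre_def K_def by blast
      define x where "x = (\<lambda>(j, i, k). if j < b then t (j, i, k) else if j = b then v i k else z k)"
      have blk: "block x j = block t j" if "j < b" for j using that by (simp add: x_def block_def)
      have tup: "join_tuple n B x k = join_tuple n B t k" if "k < b" for k
        unfolding join_tuple_def using blk b01 that by simp
      have "eqn m x = 0" for m
      proof -
        have "(\<Sum>k\<in>K. x (Suc b, 0, k) * join_tuple n B x k m) = (\<Sum>k\<in>K. z k * join_tuple n B t k m)"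
        proof (rule sum.cong)
          fix k assume "k \<in> K"
          show "x (Suc b, 0, k) * join_tuple n B x k m = z k * join_tuple n B t k m"
            unfolding tup[OF K(3)[OF \<open>k \<in> K\<close>]] by (simp add: x_def)
        qed simp
        moreover have "block x b = v" by (simp add: x_def block_def)
        ultimately show ?thesis by (simp add: eqn_def tup[OF b01(2), unfolded One_nat_def] vz)
      qed
      then have "f x = 0" by (intro vanish) auto
      moreover have "f x = f t" by (rule polyfun_cong[OF f]) (auto simp: x_def params_def)
      ultimately show False using that by simp
    qed
    then show "f u = 0" using not f unfolding generically_def by blast
  qed
  then obtain x where x: "g x \<noteq> 0" "\<And>m. eqn m x = 0"
    and lift: "\<And>w. \<exists>w'. (\<forall>j\<in>params n B b. w' j = w j) \<and> (\<forall>m. has_dd (eqn m) x w' 0)"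
    by auto
  note ind = g(3,4)[OF x(1)]
  define y where "y = block x b"
  define z where "z = (\<lambda>k. x (Suc b, 0, k))"
  have y: "sv n B y m = join_tuple n B x 1 m + (\<Sum>k\<in>K. z k * join_tuple n B x k m)" for m
    using x(2)[of m] unfolding eqn_def y_def z_def by (simp add: algebra_simps)
  \<comment> \<open>The coefficient 1 at the tangent vector keeps the tensor nonzero, so
    \<open>tb\<close> provides vectors spanning its tangent space in the expected number.\<close>
  have "\<exists>m0. sv n B y m0 \<noteq> 0"
  proof (rule ccontr)
    assume "\<nexists>m0. sv n B y m0 \<noteq> 0"
    then have "(\<Sum>k<b. (if k = 1 then 1 else z k) * join_tuple n B x k m) = 0" for m
    proof -
      have "(\<Sum>k\<in>K. (if k = 1 then 1 else z k) * join_tuple n B x k m) = (\<Sum>k\<in>K. z k * join_tuple n B x k m)"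
        by (rule sum.cong) (use K(4) in auto)
      then show ?thesis unfolding K(6) using y[of m] K(2,7) \<open>\<nexists>m0. sv n B y m0 \<noteq> 0\<close> by simp
    qed
    from indep_famD[OF ind(1) this, of 1] b01 show False by simp
  qed
  then obtain m0 where m0: "sv n B y m0 \<noteq> 0" by blast
  then have m0_in: "m0 \<in> tensor_index n B" using sv_outside by metis
  have ym0: "y i (m0 i) \<noteq> 0" if "i \<in> B" for i using m0 m0_in B that by (auto simp: sv_def)
  define H where "H = tb n B y ` tb_index n B m0 \<union> join_tuple n B x ` K"
  have tvH: "tv n B y w \<in> fun_vec.span H" for w
  proof -
    have "tv n B y w \<in> fun_vec.span (tb n B y ` tb_index n B m0)"
      by (rule sum_in_span_image) (rule tv_expand[where u = y and ?m0.0 = m0, OF B ym0])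
    then show ?thesis using fun_vec.span_mono[of "tb n B y ` tb_index n B m0" H] by (auto simp: H_def)
  qed
  have jH: "join_tuple n B x k \<in> fun_vec.span H" if "k \<in> K" for k
    using that by (intro fun_vec.span_base) (simp add: H_def)
  \<comment> \<open>Differentiate the equation along a lifted direction: the contributions of the
    auxiliary unknowns lie in the span of \<open>H\<close>, hence so does the variation of the
    tuple.\<close>
  have derH: "(\<lambda>m. join_deriv n B x w 1 m + (\<Sum>k\<in>K. z k * join_deriv n B x w k m)) \<in> fun_vec.span H" for w
  proof -
    obtain w' where w': "\<And>j. j \<in> params n B b \<Longrightarrow> w' j = w j" "\<And>m. has_dd (eqn m) x w' 0"
      using lift[of w] by blast
    have cong: "join_deriv n B x w' k m = join_deriv n B x w k m" if "k < b" for k m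
      by (rule join_deriv_cong[OF _ that]) (rule w'(1))
    have "has_dd (eqn m) x w' (tv n B y (block w' b) m - join_deriv n B x w' 1 m
        - (\<Sum>k\<in>K. z k * join_deriv n B x w' k m + w' (Suc b, 0, k) * join_tuple n B x k m))" for m
      unfolding eqn_def y_def z_def
      by (intro has_dd_diff has_dd_sum has_dd_mult has_dd_coord has_dd_join_tuple has_dd_sv B) (simp add: block_def has_dd_coord)
    from has_dd_unique[OF this w'(2)]
    have rel: "tv n B y (block w' b) m - join_deriv n B x w' 1 m
        - (\<Sum>k\<in>K. z k * join_deriv n B x w' k m + w' (Suc b, 0, k) * join_tuple n B x k m) = 0" for m .
    have "(\<Sum>k\<in>K. z k * join_deriv n B x w' k m + w' (Suc b, 0, k) * join_tuple n B x k m) =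
        (\<Sum>k\<in>K. z k * join_deriv n B x w k m) + (\<Sum>k\<in>K. w' (Suc b, 0, k) * join_tuple n B x k m)" for m
      unfolding sum.distrib[symmetric] by (rule sum.cong) (simp_all only: cong[OF K(3)])
    from rel[unfolded this cong[OF b01(2)]]
    have "join_deriv n B x w 1 m + (\<Sum>k\<in>K. z k * join_deriv n B x w k m) =
        tv n B y (block w' b) m - (\<Sum>k\<in>K. w' (Suc b, 0, k) * join_tuple n B x k m)" for m
      by (simp add: algebra_simps)
    then have "(\<lambda>m. join_deriv n B x w 1 m + (\<Sum>k\<in>K. z k * join_deriv n B x w k m)) =
        tv n B y (block w' b) - (\<Sum>k\<in>K. fun_scale (w' (Suc b, 0, k)) (join_tuple n B x k))"
      by (auto simp: sum_fun_apply fun_scale_apply)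
    then show ?thesis
      by (simp only:) (intro fun_vec.span_diff fun_vec.span_sum fun_vec.span_scale tvH jH)
  qed
  \<comment> \<open>Vary block 1 only: the tangent vector changes by a tangent vector at block 0,
    and the other members stay fixed.\<close>
  have tangent: "tv n B (block x 0) a \<in> fun_vec.span H" for a
  proof -
    define w where "w = (\<lambda>(j::nat, i, k). if j = 1 then a i k else 0)"
    have w: "block w 1 = a" "\<And>j. j \<noteq> 1 \<Longrightarrow> block w j = (\<lambda>i k. 0)" by (auto simp: block_def w_def)
    have "join_deriv n B x w 1 m = tv n B (block x 0) a m" for m
      unfolding join_deriv_def using w(1) w(2)[of 0] by (simp add: sec_zero[OF B])
    moreover have "join_deriv n B x w k m = 0" if "k \<in> K" for k m
      unfolding join_deriv_def w(2)[OF K(4)[OF that]] using K(4)[OF that] by (simp add: tv_zero[OF B])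
    ultimately show ?thesis using derH[of w] by simp
  qed
  \<comment> \<open>Vary block 0 only: besides the second derivative this moves member 0, by a
    tangent vector that is already known to lie in the span.\<close>
  have second: "sec n B (block x 0) (block x 1) a \<in> fun_vec.span H" for a
  proof -
    define w where "w = (\<lambda>(j::nat, i, k). if j = 0 then a i k else 0)"
    have w: "block w 0 = a" "\<And>j. j \<noteq> 0 \<Longrightarrow> block w j = (\<lambda>i k. 0)" by (auto simp: block_def w_def)
    have d1: "join_deriv n B x w 1 m = sec n B (block x 0) (block x 1) a m" for m
      unfolding join_deriv_def using w(1) w(2)[of 1] by (simp add: tv_zero[OF B])
    have "join_deriv n B x w k m = (if k = 0 then tv n B (block x 0) a m else 0)" if "k \<in> K" for k m
      unfolding join_deriv_def using K(4)[OF that] w(1) w(2)[of k] by (simp add: tv_zero[OF B])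
    then have "(\<Sum>k\<in>K. z k * join_deriv n B x w k m) = (\<Sum>k\<in>K. if k = 0 then z 0 * tv n B (block x 0) a m else 0)" for m
      by (intro sum.cong) auto
    then have d2: "(\<Sum>k\<in>K. z k * join_deriv n B x w k m) = z 0 * tv n B (block x 0) a m" for m
      using K(1,2) by simp
    have "sec n B (block x 0) (block x 1) a = (\<lambda>m. join_deriv n B x w 1 m + (\<Sum>k\<in>K. z k * join_deriv n B x w k m))
        - fun_scale (z 0) (tv n B (block x 0) a)"
      unfolding d1 d2 by (auto simp: fun_scale_apply)
    then show ?thesis by (simp only:) (intro fun_vec.span_diff fun_vec.span_scale derH tangent)
  qed
  define A where "A = Inl ` tan_index n B \<union> Inr ` {..<b}"
  have "case_sum (tb n B (block x 0)) (second_order d x) c \<in> fun_vec.span H" if "c \<in> A" for c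
  proof -
    have "tb n B (block x 0) a \<in> fun_vec.span H" if ain: "a \<in> tan_index n B" for a
    proof (cases a)
      case None
      then show ?thesis using jH[OF K(1)] by (simp add: tb_def join_tuple_def)
    next
      case (Some ik)
      then obtain i k where ik: "a = Some (i, k)" "i \<in> B" using ain by (auto simp: tb_index_def)
      have "tv n B (block x 0) (\<lambda>j. if j = i then unit_vec k else (\<lambda>_. 0)) = sv n B ((block x 0)(i := unit_vec k))"
        using tv_single_direction[OF ik(2), of "\<lambda>j. if j = i then unit_vec k else (\<lambda>_. 0)" "block x 0"] by auto
      then show ?thesis using tangent[of "\<lambda>j. if j = i then unit_vec k else (\<lambda>_. 0)"] by (simp add: ik tb_def)
    qed
    moreover have "second_order d x l \<in> fun_vec.span H" if "l < b" for l
      using second jH[of l] that by (auto simp: second_order_def[abs_def] join_tuple_def[abs_def] K_def)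
    ultimately show ?thesis using that by (auto simp: A_def)
  qed
  moreover have "finite A" "finite H" using B K(2) by (auto simp: A_def H_def finite_tb_index)
  ultimately have "card A \<le> card H" using ind(2) unfolding indep_mod_tangent_def A_def[symmetric] by (intro indep_fam_card_le)
  moreover have "card A = Suc (\<Sum>i\<in>B. n i) + b"
    unfolding A_def using B
    by (subst card_Un_disjoint) (auto simp: card_image finite_tb_index card_tb_index[OF B] base_index_apply)
  moreover have "card H \<le> Suc (\<Sum>i\<in>B. n i) + (b - 1)"
  proof -
    have "card (tb n B y ` tb_index n B m0) \<le> Suc (\<Sum>i\<in>B. n i)"
      using card_image_le[OF finite_tb_index[OF B], of "tb n B y" n m0] card_tb_index[OF B, of m0 n] tensor_index_le[OF m0_in] by simp
    moreover have "card (join_tuple n B x ` K) \<le> b - 1" using card_image_le[OF K(2), of "join_tuple n B x"] K(5) by simp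
    ultimately show ?thesis unfolding H_def using card_Un_le[of "tb n B y ` tb_index n B m0" "join_tuple n B x ` K"] by linarith
  qed
  ultimately show False using b by linarith
qed

section \<open>Decompositions of a point of the join into at most b points\<close>

context split_segre
begin

text \<open>Contracting the flattening with functionals dual to the F side expresses the
  \<open>b\<close> independent members on the E side through the E parts of at most \<open>b\<close>
  points. So both span the same space, and some E part involves the tangent vector.\<close>

lemma span_needs_more_points:
  assumes ind: "indep_fam {..<b} (join_tuple n E t)" "indep_fam {..<b} (join_tuple n F t)"
    and bad: "\<not> meets_segre n E b t"
    and S: "finite S" "S \<subseteq> X" "join_map n T b t \<in> fun_vec.span (\<Union>S)"
  shows "b < card S"
proof (rule ccontr)
  assume "\<not> b < card S"
  define c where "c = card S"
  have cb: "c \<le> b" using \<open>\<not> b < card S\<close> by (simp add: c_def)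
  obtain V where V: "join_map n T b t = (\<lambda>m. \<Sum>j<c. sv n T (V j) m)"
    using span_points[OF S, of "{..<c}"] by (auto simp: c_def)
  let ?x = "\<lambda>j. sv n E (V j)"
  have split: "(\<Sum>k<b. join_tuple n E t k e * join_tuple n F t (swap01 k) f) = (\<Sum>j<c. ?x j e * sv n F (V j) f)"
    if ef: "e \<in> tensor_index n E" "f \<in> tensor_index n F" for e f
  proof -
    obtain m where m: "m \<in> tensor_index n T" "restrict m E = e" "restrict m F = f" using T_merge[OF ef] by blast
    have "(\<Sum>j<c. sv n T (V j) m) = (\<Sum>j<c. ?x j e * sv n F (V j) f)"
      by (rule sum.cong) (simp_all only: T_split(1)[OF m(1)] m(2,3))
    then show ?thesis using fun_cong[OF V, of m] unfolding join_map_split[OF m(1)] m(2,3) by simp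
  qed
  have indF: "indep_fam {..<b} (\<lambda>k. join_tuple n F t (swap01 k))" by (rule indep_fam_reindex[OF swap01_bij[OF b2] ind(2)])
  have out: "join_tuple n B' t k y = 0" if "y \<notin> tensor_index n B'" for B' k y
    using that by (auto simp: join_tuple_def sv_outside tv_outside)
  obtain \<mu> where \<mu>: "\<forall>k\<in>{..<b}. \<forall>l\<in>{..<b}. (\<Sum>f\<in>tensor_index n F. \<mu> k f * join_tuple n F t (swap01 l) f) = (if k = l then 1 else 0)"
    using indep_fam_dual[OF finite_lessThan indF finite_tensor_index[OF finF]] out by blast
  define a where "a = (\<lambda>k j. \<Sum>f\<in>tensor_index n F. \<mu> k f * sv n F (V j) f)"
  have xE: "join_tuple n E t k e = (\<Sum>j<c. a k j * ?x j e)" if k: "k < b" for k e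
  proof (cases "e \<in> tensor_index n E")
    case True
    have "join_tuple n E t k e = (\<Sum>l<b. if k = l then join_tuple n E t l e else 0)" using k by simp
    also have "\<dots> = (\<Sum>l<b. join_tuple n E t l e * (\<Sum>f\<in>tensor_index n F. \<mu> k f * join_tuple n F t (swap01 l) f))"
      by (rule sum.cong) (use \<mu> k in auto)
    also have "\<dots> = (\<Sum>f\<in>tensor_index n F. \<mu> k f * (\<Sum>l<b. join_tuple n E t l e * join_tuple n F t (swap01 l) f))"
      unfolding sum_distrib_left by (subst sum.swap) (simp add: ac_simps)
    also have "\<dots> = (\<Sum>f\<in>tensor_index n F. \<mu> k f * (\<Sum>j<c. ?x j e * sv n F (V j) f))"
      by (rule sum.cong) (simp_all only: split[OF True])
    also have "\<dots> = (\<Sum>j<c. a k j * ?x j e)"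
      unfolding a_def sum_distrib_left sum_distrib_right by (subst sum.swap) (simp add: ac_simps)
    finally show ?thesis .
  qed (simp add: out sv_outside)
  have tE: "join_tuple n E t k \<in> fun_vec.span (?x ` {..<c})" if "k < b" for k
    by (rule sum_in_span_image) (rule xE[OF that])
  have indep: "fun_vec.independent (join_tuple n E t ` {..<b})" by (rule indep_fam_independent[OF ind(1)]) simp
  have inj: "inj_on (join_tuple n E t) {..<b}" by (rule indep_fam_inj[OF ind(1)]) simp
  \<comment> \<open>An E part outside this span would give \<open>b + 1\<close> independent vectors
    in the span of at most \<open>b\<close>.\<close>
  have "?x j \<in> fun_vec.span (join_tuple n E t ` {..<b})" if j: "j < c" for j
  proof (rule ccontr)
    assume nin: "?x j \<notin> fun_vec.span (join_tuple n E t ` {..<b})"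
    then have nin': "?x j \<notin> join_tuple n E t ` {..<b}" using fun_vec.span_base[of "?x j" "join_tuple n E t ` {..<b}"] by blast
    have "fun_vec.independent (insert (?x j) (join_tuple n E t ` {..<b}))"
      using nin nin' indep by (simp add: fun_vec.independent_insert)
    moreover have "insert (?x j) (join_tuple n E t ` {..<b}) \<subseteq> fun_vec.span (?x ` {..<c})"
      using tE fun_vec.span_base[of "?x j" "?x ` {..<c}"] j by auto
    ultimately have "card (insert (?x j) (join_tuple n E t ` {..<b})) \<le> card (?x ` {..<c})"
      using fun_vec.independent_span_bound[of "?x ` {..<c}"] by blast
    moreover have "card (?x ` {..<c}) \<le> c" using card_image_le[of "{..<c}" ?x] by simp
    moreover have "card (insert (?x j) (join_tuple n E t ` {..<b})) = Suc b" using nin' card_image[OF inj] by simp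
    ultimately show False using cb by linarith
  qed
  from span_image_sum[OF this _ inj] have "\<forall>j\<in>{..<c}. \<exists>r. \<forall>m. ?x j m = (\<Sum>k<b. r k * join_tuple n E t k m)" by simp
  then obtain M where M: "\<And>j m. j < c \<Longrightarrow> ?x j m = (\<Sum>k<b. M j k * join_tuple n E t k m)"
    unfolding bchoice_iff by auto
  have "\<exists>j<c. M j 1 \<noteq> 0"
  proof (rule ccontr)
    assume no: "\<not> (\<exists>j<c. M j 1 \<noteq> 0)"
    have "(\<Sum>k<b. ((\<Sum>j<c. a 1 j * M j k) - (if k = 1 then 1 else 0)) * join_tuple n E t k m) = 0" for m
    proof -
      have "(\<Sum>k<b. (\<Sum>j<c. a 1 j * M j k) * join_tuple n E t k m) = (\<Sum>j<c. a 1 j * (\<Sum>k<b. M j k * join_tuple n E t k m))"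
        unfolding sum_distrib_left sum_distrib_right by (subst sum.swap) (simp add: ac_simps)
      also have "\<dots> = (\<Sum>j<c. a 1 j * ?x j m)" by (rule sum.cong) (simp_all add: M)
      also have "\<dots> = join_tuple n E t 1 m" using xE[of 1 m] b2 by simp
      also have "\<dots> = (\<Sum>k<b. (if k = 1 then 1 else 0) * join_tuple n E t k m)"
        using b2 by (simp add: if_distrib[of "\<lambda>r. r * _"] cong: if_cong)
      finally show ?thesis by (simp add: left_diff_distrib sum_subtractf)
    qed
    from indep_famD[OF ind(1) this, of 1] b2 have "(\<Sum>j<c. a 1 j * M j 1) = 1" by simp
    moreover have "(\<Sum>j<c. a 1 j * M j 1) = 0" by (rule sum.neutral) (use no in auto)
    ultimately show False by simp
  qed
  then obtain j where j: "j < c" "M j 1 \<noteq> 0" by blast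
  \<comment> \<open>Scaling factor \<open>i0\<close> divides the tensor by its coefficient at the
    tangent vector.\<close>
  have "sv n E ((V j)(i0 := (\<lambda>k. inverse (M j 1) * V j i0 k))) m =
      join_tuple n E t 1 m + (\<Sum>k\<in>{..<b} - {1}. inverse (M j 1) * M j k * join_tuple n E t k m)" for m
  proof -
    have "sv n E ((V j)(i0 := (\<lambda>k. inverse (M j 1) * V j i0 k))) m = inverse (M j 1) * (\<Sum>k<b. M j k * join_tuple n E t k m)"
      by (simp only: sv_scale[OF finE i0(1)] M[OF j(1)])
    also have "(\<Sum>k<b. M j k * join_tuple n E t k m) = M j 1 * join_tuple n E t 1 m + (\<Sum>k\<in>{..<b} - {1}. M j k * join_tuple n E t k m)"
      by (rule sum.remove) (use b2 in auto)
    also have "inverse (M j 1) * (M j 1 * join_tuple n E t 1 m + (\<Sum>k\<in>{..<b} - {1}. M j k * join_tuple n E t k m)) =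
        join_tuple n E t 1 m + (\<Sum>k\<in>{..<b} - {1}. inverse (M j 1) * M j k * join_tuple n E t k m)"
      using j(2) by (simp add: distrib_left sum_distrib_left mult.assoc[symmetric])
    finally show ?thesis .
  qed
  then show False
    using bad unfolding meets_segre_def by (metis (no_types))
qed

text \<open>Makes the image of \<open>join_map\<close> a cone, as
  \<open>polyfun_zero_at_cone\<close> requires: the tangent part is linear in block 1, and every
  further summand is scaled in one factor.\<close>

lemma scaled_join_map: "\<exists>t'. join_map n T b t' = fun_scale c (join_map n T b t)"
proof -
  define t' where "t' = (\<lambda>(j, i, k). if j = 1 \<or> 2 \<le> j \<and> i = i0 then c * t (j, i, k) else t (j, i, k))"
  have "block t' 0 = block t 0" "block t' 1 = (\<lambda>i k. c * block t 1 i k)"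
    "\<And>j. 2 \<le> j \<Longrightarrow> block t' j = (block t j)(i0 := (\<lambda>k. c * block t j i0 k))"
    by (auto simp: block_def t'_def)
  note blk = this
  have "join_map n T b t' m = fun_scale c (join_map n T b t) m" for m
  proof -
    have "(\<Sum>j\<in>{2..<b}. sv n T (block t' j) m) = (\<Sum>j\<in>{2..<b}. c * sv n T (block t j) m)"
    proof (rule sum.cong)
      fix j assume "j \<in> {2..<b}"
      then have "2 \<le> j" by simp
      show "sv n T (block t' j) m = c * sv n T (block t j) m"
        unfolding blk(3)[OF \<open>2 \<le> j\<close>] by (rule sv_scale[OF finite_atLeastAtMost i0(3)])
    qed simp
    then show ?thesis
      unfolding join_map_def blk(1,2) fun_scale_apply tv_scale[OF finite_atLeastAtMost] by (simp add: distrib_left sum_distrib_left)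
  qed
  then show ?thesis by blast
qed

end

text \<open>\<open>image_contains_open\<close> yields a polynomial function \<open>P\<close>, while
  an open subset of the projective variety needs a form. One homogeneous component that does not
  vanish on the image is taken; where it is nonzero, some multiple of the representative has nonzero
  \<open>P\<close>.\<close>

lemma general_rank:
  fixes X :: "((nat \<Rightarrow> nat) \<Rightarrow> 'k::{field_char_0, alg_closed_field}) set set"
  assumes "split_segre s b n E F I X"
  shows "for_general I (tangential_join I X b) (\<lambda>q. X_rank I X q > enat b)"
proof -
  interpret split_segre s b n E F I X by fact
  let ?\<Phi> = "join_map n {1..s} b :: (nat \<times> nat \<times> nat \<Rightarrow> 'k) \<Rightarrow> _" and ?Y = "tangential_join I X b"
  have "generically (params n E b) (\<lambda>t :: nat \<times> nat \<times> nat \<Rightarrow> 'k. \<not> meets_segre n E b t)"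
    by (rule generically_not_meets_segre) (rule E.big_factors_axioms)
  from generically_mono[OF this params_E]
  have not_meets: "generically (params n {1..s} b) (\<lambda>t :: nat \<times> nat \<times> nat \<Rightarrow> 'k. \<not> meets_segre n E b t)" .
  have "generically (params n {1..s} b) (\<lambda>t :: nat \<times> nat \<times> nat \<Rightarrow> 'k. (indep_fam {..<b} (join_tuple n E t) \<and>
      indep_fam {..<b} (join_tuple n F t)) \<and> \<not> meets_segre n E b t)"
    by (intro generically_conj not_meets generically_mono[OF E.generically_join_tuple params_E]
        generically_mono[OF F.generically_join_tuple params_F])
  then obtain g and t0 :: "nat \<times> nat \<times> nat \<Rightarrow> 'k" where g: "g \<in> polyfun (params n {1..s} b)" "g t0 \<noteq> 0"
    and generic: "\<forall>t. g t \<noteq> 0 \<longrightarrow> (indep_fam {..<b} (join_tuple n E t) \<and>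
      indep_fam {..<b} (join_tuple n F t)) \<and> \<not> meets_segre n E b t"
    unfolding generically_def by blast
  have poly\<Phi>: "(\<lambda>t. ?\<Phi> t m) \<in> polyfun (params n {1..s} b)" for m by (rule polyfun_join_map[OF b2])
  have "\<exists>P\<in>polyfun I. (\<exists>u. P (?\<Phi> u) \<noteq> 0) \<and>
    (\<forall>v. (\<forall>f\<in>polyfun I. (\<forall>u. f (?\<Phi> u) = 0) \<longrightarrow> f v = 0) \<longrightarrow> P v \<noteq> 0 \<longrightarrow> (\<exists>u. (\<forall>i\<in>I. ?\<Phi> u i = v i) \<and> g u \<noteq> 0))"
    by (rule image_contains_open[OF finite_params poly\<Phi> g(1,2)]) simp
  then obtain P where P: "P \<in> polyfun I" "\<exists>u. P (?\<Phi> u) \<noteq> 0"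
    and image: "\<forall>v. (\<forall>f\<in>polyfun I. (\<forall>u. f (?\<Phi> u) = 0) \<longrightarrow> f v = 0) \<longrightarrow> P v \<noteq> 0 \<longrightarrow>
      (\<exists>u. (\<forall>i\<in>I. ?\<Phi> u i = v i) \<and> g u \<noteq> 0)"
    by (rule bexE) (elim conjE, rule that)
  then obtain u0 where u0: "P (?\<Phi> u0) \<noteq> 0" by (elim exE)
  obtain D h where h: "\<And>d. h d \<in> forms I d" "\<And>v. P v = (\<Sum>d\<le>D. eval_mpoly (h d) v)"
    using polyfun_homogeneous_components[OF P(1)] by blast
  have "\<exists>d\<le>D. eval_mpoly (h d) (?\<Phi> u0) \<noteq> 0"
  proof (rule ccontr)
    assume "\<not> ?thesis"
    then have "(\<Sum>d\<le>D. eval_mpoly (h d) (?\<Phi> u0)) = 0" by (intro sum.neutral) auto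
    then show False using u0 unfolding h(2) by simp
  qed
  then obtain d where d: "d \<le> D" "eval_mpoly (h d) (?\<Phi> u0) \<noteq> 0" by blast
  have hom: "{h d} \<subseteq> homogeneous_polys I" using h(1) by (auto simp: homogeneous_polys_def)
  define U where "U = (proj_space I - zero_locus I {h d}) \<inter> ?Y"
  have "openin (subtopology (zariski I) ?Y) U"
    unfolding openin_subtopology openin_zariski U_def using hom by blast
  moreover have "U \<noteq> {}"
  proof -
    obtain t' :: "nat \<times> nat \<times> nat \<Rightarrow> 'k" where "?\<Phi> t' \<noteq> 0" using join_nonzero by blast
    then obtain m where m: "?\<Phi> t' m \<noteq> 0" by (auto simp: fun_eq_iff)
    have "(\<lambda>t. eval_mpoly (h d) (?\<Phi> t)) \<in> polyfun (params n {1..s} b)"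
      by (rule eval_homogeneous_polyfun[OF _ poly\<Phi>]) (use hom in simp)
    from polyfun_mult_nonzero[OF this d(2) poly\<Phi> m] obtain t
      where t: "eval_mpoly (h d) (?\<Phi> t) \<noteq> 0" "?\<Phi> t m \<noteq> 0" by auto
    then have nz: "?\<Phi> t \<noteq> 0" by (metis zero_fun_apply)
    have "fun_vec.span {?\<Phi> t} \<in> ?Y" using join_iff[OF b2 join_coord nz] by blast
    moreover have "fun_vec.span {?\<Phi> t} \<notin> zero_locus I {h d}"
      using mem_zero_locus_span[OF hom join_coord nz] t(1) by simp
    ultimately show ?thesis using span_in_proj_space[OF join_coord nz] unfolding U_def by blast
  qed
  moreover have "X_rank I X q > enat b" if q: "q \<in> U" for q
  proof -
    have "q \<in> proj_space I" using q by (simp add: U_def)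
    then obtain v where v: "q = fun_vec.span {v}" "v \<in> coord_space I" "v \<noteq> 0" by (rule proj_spaceE)
    have "eval_mpoly (h d) v \<noteq> 0" using q mem_zero_locus_span[OF hom v(2,3)] unfolding U_def v(1) by auto
    then obtain c where c: "P (fun_scale c v) \<noteq> 0"
      using component_vanishes[of h I v D d] h d(1) by auto
    have "\<exists>u. (\<forall>i\<in>I. ?\<Phi> u i = fun_scale c v i) \<and> g u \<noteq> 0"
    proof (rule image[rule_format, OF _ c])
      fix f assume f: "f \<in> polyfun I" "\<And>u. f (?\<Phi> u) = 0"
      show "f (fun_scale c v) = 0"
      proof (rule polyfun_zero_at_cone[OF f(1), where C = "range ?\<Phi>" and C' = "{fun_scale c v}"])
        show "fun_scale a w \<in> range ?\<Phi>" if wr: "w \<in> range ?\<Phi>" for w a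
        proof -
          obtain t where t: "w = ?\<Phi> t" using wr by blast
          obtain t' where "?\<Phi> t' = fun_scale a (?\<Phi> t)" using scaled_join_map[of a t] by blast
          then show ?thesis unfolding t by (metis rangeI)
        qed
        show "eval_mpoly f w = 0"
          if f: "f \<in> homogeneous_polys I" "\<And>w. w \<in> range ?\<Phi> \<Longrightarrow> eval_mpoly f w = 0" and w: "w \<in> {fun_scale c v}" for f w
        proof -
          have "fun_vec.span {v} \<in> ?Y" using q v(1) by (simp add: U_def)
          then have "eval_mpoly f v = 0" using join_iff[OF b2 v(2,3)] f by blast
          moreover obtain e where "f \<in> forms I e" using f(1) by (auto simp: homogeneous_polys_def)
          ultimately show ?thesis using w by (simp add: eval_mpoly_scale)
        qed
      qed (use f(2) in auto)
    qed
    then obtain u where u: "\<And>i. i \<in> I \<Longrightarrow> ?\<Phi> u i = fun_scale c v i" "g u \<noteq> 0" by blast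
    have "?\<Phi> u i = fun_scale c v i" for i
      using u(1)[of i] v(2) join_coord[of b u] by (cases "i \<in> I") (auto simp: coord_space_def fun_scale_apply)
    then have "?\<Phi> u = fun_scale c v" by blast
    then have uq: "?\<Phi> u \<in> q" unfolding v(1) using fun_vec.span_scale[OF fun_vec.span_base[of v "{v}"]] by simp
    \<comment> \<open>The strict inequality is reached through the bound \<open>Suc b\<close>, which
      also covers points without any decomposition, whose rank is infinite.\<close>
    have "enat (Suc b) \<le> X_rank I X q"
      unfolding X_rank_def
    proof (rule Inf_greatest)
      fix r assume "r \<in> {enat (card S) | S. finite S \<and> S \<subseteq> X \<and> q \<in> proj_span I S}"
      then obtain S where S: "r = enat (card S)" "finite S" "S \<subseteq> X" "q \<subseteq> fun_vec.span (\<Union>S)"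
        by (auto simp: proj_span_def)
      have "b < card S"
        by (rule span_needs_more_points[of u]) (use generic u(2) uq S(2-4) in blast)+
      then show "enat (Suc b) \<le> r" by (simp add: S(1))
    qed
    then show ?thesis by (metis enat_ord_simps(2) lessI less_le_trans)
  qed
  ultimately show ?thesis unfolding for_general_def by blast
qed

theorem theorem1p3:
  fixes s b N :: nat
    and n :: "nat \<Rightarrow> nat"
    and E F :: "nat set"
    and I :: "(nat \<Rightarrow> nat) set"
    and X :: "((nat \<Rightarrow> nat) \<Rightarrow> 'k::{field_char_0, alg_closed_field}) set set"
  assumes n_pos: "\<forall>i\<in>{1..s}. n i > 0"
    and N: "N = (\<Sum>i\<in>{1..s}. n i)"
    and I: "I = multi_index s n"
    and X: "X = segre_variety s n"
    and b: "b \<ge> 2"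
    and EF: "E \<union> F = {1..s}" "E \<inter> F = {}"
    and E: "(\<Prod>i\<in>E. (n i + 1)) > b + 3 + (\<Sum>i\<in>E. n i)"
    and F: "(\<Prod>i\<in>F. (n i + 1)) > b + 3 + (\<Sum>i\<in>F. n i)"
  shows "zariski_dim I (secant_variety I b X) = enat (b * (N + 1) - 1)
       \<and> zariski_dim I (tangential_join I X b) = enat (b * (N + 1) - 2)
       \<and> for_general I (tangential_join I X b) (\<lambda>q. X_rank I X q > enat b)"
proof -
  interpret split_segre s b n E F I X
    by (rule split_segre.intro) (use n_pos I X b EF E F in simp_all)
  have "b * (N + 1) - 1 = b * N + (b - 1)" "b * (N + 1) - 2 = b * N + (b - 2)" using b by auto
  then show ?thesis
    using antisym[OF secant_dim_le secant_dim_ge] antisym[OF join_dim_le join_dim_ge]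
      general_rank[OF split_segre_axioms] by (simp add: N)
qed

end
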